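(* Suppose that $G$ is a compact abelian group. Let $(T_t)_{t \geq 0}$ be a $w^*$-continuous semigroup of selfadjoint contractive Fourier multipliers on $L^\infty(G)$. Let $X$ be a K-convex Banach space isomorphic to a Banach space $E$ which admits an OK-convex operator space structure. Consider $1<p<\infty$. Then $(T_t)_{t\geq 0}$ induces a strongly continuous bounded analytic semigroup $(T_t \otimes Id_X)_{t \geq 0}$ of contractions on the Bochner space $L^p(G,X)$.
   Context: All Banach spaces are complex. K-convexity: let $\Omega$ be a probability space and $\varepsilon_1,\varepsilon_2,\ldots$ a sequence of independent random variables on $\Omega$ with $P(\varepsilon_k=1)=P(\varepsilon_k=-1)=\frac12$. The Rademacher projection is $P\colon L^2(\Omega)\to L^2(\Omega)$, $f\mapsto \sum_{k=1}^\infty\big(\int_\Omega f\varepsilon_k\big)\varepsilon_k$. A Banach space $X$ is K-convex if $P\otimes Id_X$ induces a bounded operator on the Bochner space $L^2(\Omega,X)$. OK-convexity: for an operator space $E$ and $1\le p<\infty$, the vector valued Schatten space $S^p(E)$ is Pisier's space $S^p(E)=\big(B(\ell^2)\otimes_{\min}E,\ S^1\widehat{\otimes}E\big)_{1/p}$ (complex interpolation), where $\otimes_{\min}$ and $\widehat{\otimes}$ are the injective and projective tensor products of operator spaces and $S^1$ is the trace class on $\ell^2$. An operator space $E$ is OK-convex if the Banach space $S^p(E)$ is K-convex for some (equivalently all) $1<p<\infty$. A Banach space $E$ admits an OK-convex operator space structure if there is an operator space structure on $E$ (compatible with its norm) which makes it an OK-convex operator space. Fourier multipliers: the compact abelian group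 $G$ is equipped with its normalized Haar measure, and $\hat G$ denotes its (discrete) dual group. A Fourier multiplier on $L^\infty(G)$ is a normal (i.e. $w^*$-continuous) linear map $T\colon L^\infty(G)\to L^\infty(G)$ such that there is a function $\varphi\colon\hat G\to\mathbb{C}$ with $T(\gamma)=\varphi(\gamma)\gamma$ for every character $\gamma\in\hat G$. A normal contraction $T\colon L^\infty(G)\to L^\infty(G)$ is selfadjoint if $\int_G T(f)\,\overline{g}=\int_G f\,\overline{T(g)}$ for all $f,g\in L^\infty(G)$; such a $T$ extends to a contraction on $L^p(G)$ for all $1\le p<\infty$, still denoted $T$. A $w^*$-continuous semigroup $(T_t)_{t\ge0}$ on $L^\infty(G)$ satisfies $T_0=Id$, $T_{s+t}=T_sT_t$, and $t\mapsto T_t f$ is continuous for the weak* topology for each $f$. "Induces" means that each operator $T_t\otimes Id_X$, defined on the algebraic tensor product $L^p(G)\otimes X$, extends to a bounded operator on $L^p(G,X)$, and that the resulting family has the stated properties. A strongly continuous semigroup $(S_t)_{t\ge0}$ on a Banach space $Y$ is called bounded analytic if there exist $0<\theta<\frac{\pi}{2}$ and a bounded holomorphic extension $\Sigma_\theta\to B(Y)$, $z\mapsto S_z$, of $t\mapsto S_t$ ($t>0$), where $\Sigma_\theta=\{z\in\mathbb{C}^*:|\mathrm{Arg}(z)|<\theta\}$. *)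

theory Defs
  imports "HOL-Probability.Probability" "HOL-Library.Function_Algebras"
begin

section \<open>Complex vector spaces and complex Banach spaces\<close>

class scaleC =
  fixes scaleC :: "complex \<Rightarrow> 'a \<Rightarrow> 'a" (infixr "*\<^sub>C" 75)

class complex_vector = scaleC + ab_group_add +
  assumes scaleC_add_right: "a *\<^sub>C (x + y) = a *\<^sub>C x + a *\<^sub>C y"
    and scaleC_add_left: "(a + b) *\<^sub>C x = a *\<^sub>C x + b *\<^sub>C x"
    and scaleC_scaleC: "a *\<^sub>C b *\<^sub>C x = (a * b) *\<^sub>C x"
    and scaleC_one: "1 *\<^sub>C x = x"

class complex_banach = complex_vector + banach +
  assumes scaleR_scaleC: "r *\<^sub>R x = complex_of_real r *\<^sub>C x"
    and norm_scaleC: "norm (c *\<^sub>C x) = cmod c * norm x"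

instantiation complex :: complex_banach
begin

definition scaleC_complex :: "complex \<Rightarrow> complex \<Rightarrow> complex"
  where "scaleC_complex c x = c * x"

instance
  by standard (auto simp: scaleC_complex_def algebra_simps norm_mult scaleR_conv_of_real)

end

instantiation "fun" :: (type, complex_vector) complex_vector
begin

definition scaleC_fun :: "complex \<Rightarrow> ('a \<Rightarrow> 'b) \<Rightarrow> 'a \<Rightarrow> 'b"
  where "scaleC_fun c f = (\<lambda>x. c *\<^sub>C f x)"

instance
  by standard
    (auto simp: scaleC_fun_def fun_eq_iff scaleC_add_right scaleC_add_left scaleC_scaleC scaleC_one)

end

definition complex_isomorphism :: "('a::complex_banach \<Rightarrow> 'b::complex_banach) \<Rightarrow> bool"
  where "complex_isomorphism u \<longleftrightarrow>
    bij u \<and> bounded_linear u \<and> bounded_linear (inv u) \<and> (\<forall>c x. u (c *\<^sub>C x) = c *\<^sub>C u x)"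


section \<open>Seminormed spaces given by a carrier and operators on them\<close>

text \<open>
  A space is given by a carrier \<open>V\<close> (a subspace of a complex vector space) and a function \<open>N\<close> that
  is a norm or a seminorm on \<open>V\<close>. In the second case the space meant is the quotient by the null
  space (for \<open>L\<^sup>p\<close>: functions modulo equality almost everywhere); accordingly all identities between
  vectors are required only up to a difference of seminorm zero.
\<close>

definition linear_op ::
    "'v::complex_vector set \<Rightarrow> ('v \<Rightarrow> real) \<Rightarrow> ('v \<Rightarrow> 'v) \<Rightarrow> bool"
  where "linear_op V N S \<longleftrightarrow>
    (\<forall>x\<in>V. S x \<in> V) \<and>
    (\<forall>x\<in>V. \<forall>y\<in>V. N (S (x + y) - (S x + S y)) = 0) \<and>
    (\<forall>c. \<forall>x\<in>V. N (S (c *\<^sub>C x) - c *\<^sub>C S x) = 0)"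

definition bounded_ops :: "'v::complex_vector set \<Rightarrow> ('v \<Rightarrow> real) \<Rightarrow> ('v \<Rightarrow> 'v) set"
  where "bounded_ops V N = {S. linear_op V N S \<and> (\<exists>C. \<forall>x\<in>V. N (S x) \<le> C * N x)}"

definition bounded_ops_norm ::
    "'v::complex_vector set \<Rightarrow> ('v \<Rightarrow> real) \<Rightarrow> ('v \<Rightarrow> 'v) \<Rightarrow> real"
  where "bounded_ops_norm V N S = Sup {N (S x) | x. x \<in> V \<and> N x \<le> 1}"

definition contraction_op ::
    "'v::complex_vector set \<Rightarrow> ('v \<Rightarrow> real) \<Rightarrow> ('v \<Rightarrow> 'v) \<Rightarrow> bool"
  where "contraction_op V N S \<longleftrightarrow> linear_op V N S \<and> (\<forall>x\<in>V. N (S x) \<le> N x)"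

definition norm_continuous_on ::
    "('v::complex_vector \<Rightarrow> real) \<Rightarrow> 's::topological_space set \<Rightarrow> ('s \<Rightarrow> 'v) \<Rightarrow> bool"
  where "norm_continuous_on N A F \<longleftrightarrow>
    (\<forall>z\<in>A. ((\<lambda>w. N (F w - F z)) \<longlongrightarrow> 0) (at z within A))"

definition norm_holomorphic_on ::
    "'v::complex_vector set \<Rightarrow> ('v \<Rightarrow> real) \<Rightarrow> complex set \<Rightarrow> (complex \<Rightarrow> 'v) \<Rightarrow> bool"
  where "norm_holomorphic_on V N A F \<longleftrightarrow>
    (\<forall>z\<in>A. F z \<in> V) \<and>
    (\<forall>z\<in>A. \<exists>D\<in>V. ((\<lambda>w. N (inverse (w - z) *\<^sub>C (F w - F z) - D)) \<longlongrightarrow> 0) (at z within A))"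

definition operator_semigroup ::
    "'v::complex_vector set \<Rightarrow> ('v \<Rightarrow> real) \<Rightarrow> (real \<Rightarrow> 'v \<Rightarrow> 'v) \<Rightarrow> bool"
  where "operator_semigroup V N S \<longleftrightarrow>
    (\<forall>t\<ge>0. S t \<in> bounded_ops V N) \<and>
    (\<forall>x\<in>V. N (S 0 x - x) = 0) \<and>
    (\<forall>s\<ge>0. \<forall>t\<ge>0. \<forall>x\<in>V. N (S (s + t) x - S s (S t x)) = 0)"

definition strongly_continuous_semigroup ::
    "'v::complex_vector set \<Rightarrow> ('v \<Rightarrow> real) \<Rightarrow> (real \<Rightarrow> 'v \<Rightarrow> 'v) \<Rightarrow> bool"
  where "strongly_continuous_semigroup V N S \<longleftrightarrow>
    operator_semigroup V N S \<and> (\<forall>x\<in>V. norm_continuous_on N {0..} (\<lambda>t. S t x))"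

definition sector :: "real \<Rightarrow> complex set"
  where "sector \<theta> = {z. z \<noteq> 0 \<and> \<bar>Arg z\<bar> < \<theta>}"

definition bounded_analytic ::
    "'v::complex_vector set \<Rightarrow> ('v \<Rightarrow> real) \<Rightarrow> (real \<Rightarrow> 'v \<Rightarrow> 'v) \<Rightarrow> bool"
  where "bounded_analytic V N S \<longleftrightarrow>
    (\<exists>\<theta> R. 0 < \<theta> \<and> \<theta> < pi / 2 \<and>
      norm_holomorphic_on (bounded_ops V N) (bounded_ops_norm V N) (sector \<theta>) R \<and>
      (\<exists>C. \<forall>z\<in>sector \<theta>. bounded_ops_norm V N (R z) \<le> C) \<and>
      (\<forall>t>0. \<forall>x\<in>V. N (R (complex_of_real t) x - S t x) = 0))"


section \<open>Bochner spaces\<close>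

text \<open>
  In a nonseparable Banach space Borel measurability is too weak; the elements of the Bochner space
  are the pointwise limits of simple functions (every class contains such a representative).
\<close>

definition strongly_measurable :: "'a measure \<Rightarrow> ('a \<Rightarrow> 'b::real_normed_vector) \<Rightarrow> bool"
  where "strongly_measurable M f \<longleftrightarrow>
    (\<exists>s. (\<forall>n. simple_function M (s n)) \<and> (\<forall>x\<in>space M. (\<lambda>n. s n x) \<longlonglongrightarrow> f x))"

definition Lp :: "'a measure \<Rightarrow> real \<Rightarrow> ('a \<Rightarrow> 'b::real_normed_vector) set"
  where "Lp M p = {f. strongly_measurable M f \<and> integrable M (\<lambda>x. norm (f x) powr p)}"

definition Lp_norm :: "'a measure \<Rightarrow> real \<Rightarrow> ('a \<Rightarrow> 'b::real_normed_vector) \<Rightarrow> real"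
  where "Lp_norm M p f = (\<integral>x. norm (f x) powr p \<partial>M) powr (1 / p)"

definition Linf :: "'a measure \<Rightarrow> ('a \<Rightarrow> complex) set"
  where "Linf M = {f \<in> borel_measurable M. \<exists>C. AE x in M. cmod (f x) \<le> C}"

definition Linf_norm :: "'a measure \<Rightarrow> ('a \<Rightarrow> complex) \<Rightarrow> real"
  where "Linf_norm M f = Inf {C. 0 \<le> C \<and> (AE x in M. cmod (f x) \<le> C)}"


section \<open>K-convexity\<close>

definition rademacher_sequence :: "'w measure \<Rightarrow> (nat \<Rightarrow> 'w \<Rightarrow> real) \<Rightarrow> bool"
  where "rademacher_sequence \<Omega> \<epsilon> \<longleftrightarrow>
    prob_space \<Omega> \<and> prob_space.indep_vars \<Omega> (\<lambda>_. borel) \<epsilon> UNIV \<and>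
    (\<forall>k. measure \<Omega> {\<omega> \<in> space \<Omega>. \<epsilon> k \<omega> = 1} = 1/2 \<and>
         measure \<Omega> {\<omega> \<in> space \<Omega>. \<epsilon> k \<omega> = -1} = 1/2)"

text \<open>\<open>g\<close> represents \<open>P f\<close>, the series defining \<open>P f\<close> being convergent in \<open>L\<^sup>2\<close>.\<close>

definition rademacher_projection ::
    "'w measure \<Rightarrow> (nat \<Rightarrow> 'w \<Rightarrow> real) \<Rightarrow> ('w \<Rightarrow> complex) \<Rightarrow> ('w \<Rightarrow> complex) \<Rightarrow> bool"
  where "rademacher_projection \<Omega> \<epsilon> f g \<longleftrightarrow> g \<in> Lp \<Omega> 2 \<and>
    (\<lambda>n. Lp_norm \<Omega> 2 (\<lambda>\<omega>. g \<omega> -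
        (\<Sum>k<n. (\<integral>\<omega>'. f \<omega>' * complex_of_real (\<epsilon> k \<omega>') \<partial>\<Omega>) * complex_of_real (\<epsilon> k \<omega>)))) \<longlonglongrightarrow> 0"

text \<open>
  \<open>P \<otimes> Id\<close> extends to a bounded operator on \<open>L\<^sup>2(\<Omega>, V)\<close> iff it is bounded for the Bochner norm on the
  dense subspace \<open>L\<^sup>2(\<Omega>) \<otimes> V\<close>, whose elements are the functions \<open>\<Sum>\<^sub>k f\<^sub>k v\<^sub>k\<close>.
\<close>

definition K_convex ::
    "'w measure \<Rightarrow> (nat \<Rightarrow> 'w \<Rightarrow> real) \<Rightarrow> 'v::complex_vector set \<Rightarrow> ('v \<Rightarrow> real) \<Rightarrow> bool"
  where "K_convex \<Omega> \<epsilon> V N \<longleftrightarrow>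
    (\<exists>C. \<forall>(n::nat) f g v.
      (\<forall>k<n. f k \<in> Lp \<Omega> 2 \<and> rademacher_projection \<Omega> \<epsilon> (f k) (g k) \<and> v k \<in> V) \<longrightarrow>
      sqrt (\<integral>\<omega>. (N (\<Sum>k<n. g k \<omega> *\<^sub>C v k))\<^sup>2 \<partial>\<Omega>)
        \<le> C * sqrt (\<integral>\<omega>. (N (\<Sum>k<n. f k \<omega> *\<^sub>C v k))\<^sup>2 \<partial>\<Omega>))"


section \<open>Matrices over index sets as operators between Hilbert spaces\<close>

definition ell2 :: "'i set \<Rightarrow> ('i \<Rightarrow> complex) set"
  where "ell2 I = {v. (\<lambda>i. (cmod (v i))\<^sup>2) summable_on I}"

definition ell2_norm :: "'i set \<Rightarrow> ('i \<Rightarrow> complex) \<Rightarrow> real"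
  where "ell2_norm I v = sqrt (\<Sum>\<^sub>\<infinity>i\<in>I. (cmod (v i))\<^sup>2)"

definition mat_vec ::
    "'j set \<Rightarrow> ('i \<Rightarrow> 'j \<Rightarrow> complex) \<Rightarrow> ('j \<Rightarrow> complex) \<Rightarrow> 'i \<Rightarrow> complex"
  where "mat_vec J a v = (\<lambda>i. \<Sum>\<^sub>\<infinity>j\<in>J. a i j * v j)"

definition opnorm :: "'i set \<Rightarrow> 'j set \<Rightarrow> ('i \<Rightarrow> 'j \<Rightarrow> complex) \<Rightarrow> real"
  where "opnorm I J a = Sup {ell2_norm I (mat_vec J a v) | v. v \<in> ell2 J \<and> ell2_norm J v \<le> 1}"

type_synonym cmat = "nat \<Rightarrow> nat \<Rightarrow> complex"

text \<open>\<open>B(\<ell>\<^sup>2)\<close>: a bounded operator is identified with its matrix in the canonical basis.\<close>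

definition B_ell2 :: "cmat set"
  where "B_ell2 = {a. \<exists>C. \<forall>v\<in>ell2 UNIV.
    (\<forall>i. (\<lambda>j. a i j * v j) summable_on UNIV) \<and>
    mat_vec UNIV a v \<in> ell2 UNIV \<and> ell2_norm UNIV (mat_vec UNIV a v) \<le> C * ell2_norm UNIV v}"


section \<open>Operator spaces\<close>

text \<open>
  An operator space is a space \<open>V\<close> with a norm \<open>N n\<close> on \<open>M\<^sub>n(V)\<close> for each \<open>n\<close>. Elements of \<open>M\<^sub>n(V)\<close> are
  functions \<open>nat \<Rightarrow> nat \<Rightarrow> 'v\<close> of which only the entries with both indices below \<open>n\<close> matter.
\<close>

type_synonym 'v matrix_norms = "nat \<Rightarrow> (nat \<Rightarrow> nat \<Rightarrow> 'v) \<Rightarrow> real"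

definition mat_sum :: "nat \<Rightarrow> nat \<Rightarrow> (nat \<Rightarrow> nat \<Rightarrow> 'v::zero) \<Rightarrow> (nat \<Rightarrow> nat \<Rightarrow> 'v) \<Rightarrow> nat \<Rightarrow> nat \<Rightarrow> 'v"
  where "mat_sum n m x y = (\<lambda>i j.
    if i < n \<and> j < n then x i j
    else if n \<le> i \<and> i < n + m \<and> n \<le> j \<and> j < n + m then y (i - n) (j - n)
    else 0)"

definition mat_conj ::
    "nat \<Rightarrow> cmat \<Rightarrow> (nat \<Rightarrow> nat \<Rightarrow> 'v::complex_vector) \<Rightarrow> cmat \<Rightarrow> nat \<Rightarrow> nat \<Rightarrow> 'v"
  where "mat_conj m \<alpha> x \<beta> = (\<lambda>i j. \<Sum>k<m. \<Sum>l<m. (\<alpha> i k * \<beta> l j) *\<^sub>C x k l)"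

text \<open>Ruan's axioms, for matrix norms compatible with the given norm of the Banach space.\<close>

definition operator_space_structure :: "'e::complex_banach matrix_norms \<Rightarrow> bool"
  where "operator_space_structure N \<longleftrightarrow>
    (\<forall>n x y. (\<forall>i<n. \<forall>j<n. x i j = y i j) \<longrightarrow> N n x = N n y) \<and>
    (\<forall>n x y. N n (x + y) \<le> N n x + N n y) \<and>
    (\<forall>n c x. N n (c *\<^sub>C x) = cmod c * N n x) \<and>
    (\<forall>n x. N n x = 0 \<longrightarrow> (\<forall>i<n. \<forall>j<n. x i j = 0)) \<and>
    (\<forall>x. N 1 x = norm (x 0 0)) \<and>
    (\<forall>n m x y. N (n + m) (mat_sum n m x y) = max (N n x) (N m y)) \<and>
    (\<forall>n m \<alpha> x \<beta>. N n (mat_conj m \<alpha> x \<beta>)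
        \<le> opnorm {..<n} {..<m} \<alpha> * N m x * opnorm {..<m} {..<n} \<beta>)"

text \<open>\<open>M\<^sub>n(B(\<ell>\<^sup>2)) = B(\<ell>\<^sup>2 \<oplus> \<dots> \<oplus> \<ell>\<^sup>2)\<close>\<close>

definition B_ell2_norms :: "cmat matrix_norms"
  where "B_ell2_norms n x =
    opnorm ({..<n} \<times> UNIV) ({..<n} \<times> UNIV) (\<lambda>(i, r) (j, s). x i j r s)"

text \<open>
  The trace class: operators \<open>a\<close> such that \<open>b = \<bar>a\<bar>\<close>, the positive operator with \<open>b\<^sup>2 = a\<^sup>*a\<close>, has finite
  trace.
\<close>

definition trace_class :: "cmat set"
  where "trace_class = {a \<in> B_ell2. \<exists>b\<in>B_ell2.
    (\<forall>v\<in>ell2 UNIV. (\<Sum>\<^sub>\<infinity>i. mat_vec UNIV b v i * cnj (v i)) \<in> \<real>\<^sub>\<ge>\<^sub>0) \<and>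
    (\<forall>i j. (\<Sum>\<^sub>\<infinity>k. b i k * b k j) = (\<Sum>\<^sub>\<infinity>k. cnj (a k i) * a k j)) \<and>
    (\<lambda>i. b i i) summable_on UNIV}"

text \<open>
  The operator space structure of \<open>S\<^sup>1\<close> as the predual of \<open>B(\<ell>\<^sup>2)\<close>, i.e. \<open>M\<^sub>n(S\<^sup>1) \<subseteq> CB(B(\<ell>\<^sup>2), M\<^sub>n)\<close>. The
  pairing is the parallel one, \<open>\<langle>a, b\<rangle> = \<Sum> a\<^sub>r\<^sub>s b\<^sub>r\<^sub>s = tr (a b\<^sup>T)\<close>, and not \<open>tr (a b)\<close>: this is Pisier's
  convention, needed for the pair \<open>(B(\<ell>\<^sup>2), S\<^sup>1)\<close> to be compatible as operator spaces when the
  interpolation is done along the identity inclusion. The transposition is not completely isometric.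
\<close>

definition parallel_pairing :: "cmat \<Rightarrow> cmat \<Rightarrow> complex"
  where "parallel_pairing a b = (\<Sum>\<^sub>\<infinity>r. \<Sum>\<^sub>\<infinity>s. a r s * b r s)"

definition trace_class_norms :: "cmat matrix_norms"
  where "trace_class_norms n x =
    Sup {opnorm ({..<n} \<times> {..<m}) ({..<n} \<times> {..<m}) (\<lambda>(i, k) (j, l). parallel_pairing (x i j) (b k l))
      | m b. (\<forall>k<m. \<forall>l<m. b k l \<in> B_ell2) \<and> B_ell2_norms m b \<le> 1}"

definition complete_contractions ::
    "'v::complex_vector set \<Rightarrow> 'v matrix_norms \<Rightarrow> nat \<Rightarrow> ('v \<Rightarrow> cmat) set"
  where "complete_contractions V N q = {f.
    (\<forall>x\<in>V. \<forall>y\<in>V. f (x + y) = f x + f y) \<and>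
    (\<forall>c. \<forall>x\<in>V. f (c *\<^sub>C x) = c *\<^sub>C f x) \<and>
    (\<forall>n x. (\<forall>i<n. \<forall>j<n. x i j \<in> V) \<longrightarrow>
      opnorm ({..<n} \<times> {..<q}) ({..<n} \<times> {..<q}) (\<lambda>(i, k) (j, l). f (x i j) k l) \<le> N n x)}"


section \<open>Tensor products of operator spaces of matrices with an operator space\<close>

type_synonym 'e emat = "nat \<Rightarrow> nat \<Rightarrow> 'e"

text \<open>
  For a space \<open>V\<close> of scalar matrices, \<open>V \<otimes> E\<close> embeds into the \<open>E\<close>-valued matrices by
  \<open>a \<otimes> e \<mapsto> (a\<^sub>r\<^sub>s e)\<^sub>r\<^sub>s\<close>, and is identified with its image.
\<close>

definition tensor_mat :: "(cmat \<times> 'e::complex_vector) list \<Rightarrow> 'e emat"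
  where "tensor_mat us = (\<lambda>r s. \<Sum>(a, e)\<leftarrow>us. a r s *\<^sub>C e)"

definition tensor :: "cmat set \<Rightarrow> 'e::complex_vector emat set"
  where "tensor V = {tensor_mat us | us. \<forall>(a, e)\<in>set us. a \<in> V}"

text \<open>
  The injective norm: the supremum of the norms in \<open>M\<^sub>p \<otimes> M\<^sub>q = M\<^sub>p\<^sub>q\<close> of \<open>(f \<otimes> g)(u)\<close> over all complete
  contractions \<open>f: V \<rightarrow> M\<^sub>p\<close> and \<open>g: E \<rightarrow> M\<^sub>q\<close>.
\<close>

definition min_tensor_norm ::
    "cmat set \<Rightarrow> cmat matrix_norms \<Rightarrow> 'e::complex_vector matrix_norms \<Rightarrow> 'e emat \<Rightarrow> real"
  where "min_tensor_norm V NV NE u =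
    Sup {opnorm ({..<p} \<times> {..<q}) ({..<p} \<times> {..<q})
          (\<lambda>(i, k) (j, l). \<Sum>(a, e)\<leftarrow>us. f a i j * g e k l)
      | p q f g us. f \<in> complete_contractions V NV p \<and> g \<in> complete_contractions UNIV NE q \<and>
          (\<forall>(a, e)\<in>set us. a \<in> V) \<and> u = tensor_mat us}"

text \<open>
  The operator space projective norm: the infimum of \<open>\<parallel>\<alpha>\<parallel> \<parallel>v\<parallel> \<parallel>w\<parallel> \<parallel>\<beta>\<parallel>\<close> over all factorizations
  \<open>u = \<alpha> (v \<otimes> w) \<beta>\<close> with \<open>v \<in> M\<^sub>p(V)\<close>, \<open>w \<in> M\<^sub>q(E)\<close>, a row \<open>\<alpha>\<close> and a column \<open>\<beta>\<close> of length \<open>pq\<close>.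
\<close>

definition proj_tensor_norm ::
    "cmat set \<Rightarrow> cmat matrix_norms \<Rightarrow> 'e::complex_vector matrix_norms \<Rightarrow> 'e emat \<Rightarrow> real"
  where "proj_tensor_norm V NV NE u =
    Inf {ell2_norm ({..<p} \<times> {..<q}) \<alpha> * NV p v * NE q w * ell2_norm ({..<p} \<times> {..<q}) \<beta>
      | p q \<alpha> v w \<beta>. (\<forall>i<p. \<forall>j<p. v i j \<in> V) \<and>
          u = (\<lambda>r s. \<Sum>i<p. \<Sum>k<q. \<Sum>j<p. \<Sum>l<q. (\<alpha> (i, k) * v i j r s * \<beta> (j, l)) *\<^sub>C w k l)}"

text \<open>
  Completion of a space \<open>A\<close> of matrices under a norm \<open>N\<close> that dominates the norms of the entries. It is
  realized again by matrices, through the extension of the entry maps to the completion; for the two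
  tensor norms used below this extension is injective.
\<close>

definition completes_to ::
    "'e::complex_banach emat set \<Rightarrow> ('e emat \<Rightarrow> real) \<Rightarrow> (nat \<Rightarrow> 'e emat) \<Rightarrow> 'e emat \<Rightarrow> bool"
  where "completes_to A N u x \<longleftrightarrow>
    (\<forall>n. u n \<in> A) \<and> (\<forall>\<epsilon>>0. \<exists>K. \<forall>m\<ge>K. \<forall>n\<ge>K. N (u m - u n) < \<epsilon>) \<and>
    (\<forall>r s. (\<lambda>n. u n r s) \<longlonglongrightarrow> x r s)"

definition completion :: "'e::complex_banach emat set \<Rightarrow> ('e emat \<Rightarrow> real) \<Rightarrow> 'e emat set"
  where "completion A N = {x. \<exists>u. completes_to A N u x}"

definition completion_norm ::
    "'e::complex_banach emat set \<Rightarrow> ('e emat \<Rightarrow> real) \<Rightarrow> 'e emat \<Rightarrow> real"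
  where "completion_norm A N x = (THE L. \<exists>u. completes_to A N u x \<and> (\<lambda>n. N (u n)) \<longlonglongrightarrow> L)"


section \<open>Complex interpolation\<close>

definition sum_space :: "'v::complex_vector set \<Rightarrow> 'v set \<Rightarrow> 'v set"
  where "sum_space A0 A1 = {a + b | a b. a \<in> A0 \<and> b \<in> A1}"

definition sum_space_norm ::
    "'v::complex_vector set \<Rightarrow> ('v \<Rightarrow> real) \<Rightarrow> 'v set \<Rightarrow> ('v \<Rightarrow> real) \<Rightarrow> 'v \<Rightarrow> real"
  where "sum_space_norm A0 N0 A1 N1 x = Inf {N0 a + N1 b | a b. a \<in> A0 \<and> b \<in> A1 \<and> x = a + b}"

text \<open>
  Requiring decay at infinity on the two boundary lines (as Bergh and Loefstroem do) or only boundedness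
  gives the same interpolation spaces with the same norms.
\<close>

definition calderon ::
    "'v::complex_vector set \<Rightarrow> ('v \<Rightarrow> real) \<Rightarrow> 'v set \<Rightarrow> ('v \<Rightarrow> real) \<Rightarrow> (complex \<Rightarrow> 'v) set"
  where "calderon A0 N0 A1 N1 = {F.
    (\<forall>z. 0 \<le> Re z \<and> Re z \<le> 1 \<longrightarrow> F z \<in> sum_space A0 A1) \<and>
    (\<exists>C. \<forall>z. 0 \<le> Re z \<and> Re z \<le> 1 \<longrightarrow> sum_space_norm A0 N0 A1 N1 (F z) \<le> C) \<and>
    norm_continuous_on (sum_space_norm A0 N0 A1 N1) {z. 0 \<le> Re z \<and> Re z \<le> 1} F \<and>
    norm_holomorphic_on (sum_space A0 A1) (sum_space_norm A0 N0 A1 N1) {z. 0 < Re z \<and> Re z < 1} F \<and>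
    (\<forall>t. F (Complex 0 t) \<in> A0) \<and> norm_continuous_on N0 UNIV (\<lambda>t. F (Complex 0 t)) \<and>
    ((\<lambda>t. N0 (F (Complex 0 t))) \<longlongrightarrow> 0) at_infinity \<and>
    (\<forall>t. F (Complex 1 t) \<in> A1) \<and> norm_continuous_on N1 UNIV (\<lambda>t. F (Complex 1 t)) \<and>
    ((\<lambda>t. N1 (F (Complex 1 t))) \<longlongrightarrow> 0) at_infinity}"

definition calderon_norm ::
    "('v \<Rightarrow> real) \<Rightarrow> ('v \<Rightarrow> real) \<Rightarrow> (complex \<Rightarrow> 'v) \<Rightarrow> real"
  where "calderon_norm N0 N1 F =
    max (SUP t. N0 (F (Complex 0 t))) (SUP t. N1 (F (Complex 1 t)))"

definition interpolation_space ::
    "'v::complex_vector set \<Rightarrow> ('v \<Rightarrow> real) \<Rightarrow> 'v set \<Rightarrow> ('v \<Rightarrow> real) \<Rightarrow> real \<Rightarrow> 'v set"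
  where "interpolation_space A0 N0 A1 N1 \<theta> =
    {F (complex_of_real \<theta>) | F. F \<in> calderon A0 N0 A1 N1}"

definition interpolation_norm ::
    "'v::complex_vector set \<Rightarrow> ('v \<Rightarrow> real) \<Rightarrow> 'v set \<Rightarrow> ('v \<Rightarrow> real) \<Rightarrow> real \<Rightarrow> 'v \<Rightarrow> real"
  where "interpolation_norm A0 N0 A1 N1 \<theta> x =
    Inf {calderon_norm N0 N1 F | F. F \<in> calderon A0 N0 A1 N1 \<and> F (complex_of_real \<theta>) = x}"


section \<open>Vector valued Schatten spaces and OK-convexity\<close>

definition B_min :: "'e::complex_banach matrix_norms \<Rightarrow> 'e emat set"
  where "B_min N = completion (tensor B_ell2) (min_tensor_norm B_ell2 B_ell2_norms N)"

definition B_min_norm :: "'e::complex_banach matrix_norms \<Rightarrow> 'e emat \<Rightarrow> real"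
  where "B_min_norm N = completion_norm (tensor B_ell2) (min_tensor_norm B_ell2 B_ell2_norms N)"

definition S1_proj :: "'e::complex_banach matrix_norms \<Rightarrow> 'e emat set"
  where "S1_proj N =
    completion (tensor trace_class) (proj_tensor_norm trace_class trace_class_norms N)"

definition S1_proj_norm :: "'e::complex_banach matrix_norms \<Rightarrow> 'e emat \<Rightarrow> real"
  where "S1_proj_norm N =
    completion_norm (tensor trace_class) (proj_tensor_norm trace_class trace_class_norms N)"

definition schatten :: "'e::complex_banach matrix_norms \<Rightarrow> real \<Rightarrow> 'e emat set"
  where "schatten N p =
    interpolation_space (B_min N) (B_min_norm N) (S1_proj N) (S1_proj_norm N) (1 / p)"

definition schatten_norm :: "'e::complex_banach matrix_norms \<Rightarrow> real \<Rightarrow> 'e emat \<Rightarrow> real"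
  where "schatten_norm N p =
    interpolation_norm (B_min N) (B_min_norm N) (S1_proj N) (S1_proj_norm N) (1 / p)"

definition OK_convex ::
    "'w measure \<Rightarrow> (nat \<Rightarrow> 'w \<Rightarrow> real) \<Rightarrow> 'e::complex_banach matrix_norms \<Rightarrow> bool"
  where "OK_convex \<Omega> \<epsilon> N \<longleftrightarrow> (\<exists>p>1. K_convex \<Omega> \<epsilon> (schatten N p) (schatten_norm N p))"


section \<open>Fourier multipliers on compact abelian groups\<close>

text \<open>Regularity is part of the definition: it is not automatic for nonmetrizable groups.\<close>

definition normalized_haar_measure ::
    "'g::{topological_ab_group_add, t2_space} measure \<Rightarrow> bool"
  where "normalized_haar_measure \<mu> \<longleftrightarrow>
    sets \<mu> = sets borel \<and> emeasure \<mu> UNIV = 1 \<and>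
    (\<forall>a. \<forall>A\<in>sets borel. emeasure \<mu> ((\<lambda>x. a + x) ` A) = emeasure \<mu> A) \<and>
    (\<forall>A\<in>sets borel. emeasure \<mu> A = (SUP K\<in>{K. compact K \<and> K \<subseteq> A}. emeasure \<mu> K) \<and>
                    emeasure \<mu> A = (INF U\<in>{U. open U \<and> A \<subseteq> U}. emeasure \<mu> U))"

definition characters :: "('g::{topological_ab_group_add, t2_space} \<Rightarrow> complex) set"
  where "characters = {\<gamma>. continuous_on UNIV \<gamma> \<and>
    (\<forall>x y. \<gamma> (x + y) = \<gamma> x * \<gamma> y) \<and> (\<forall>x. cmod (\<gamma> x) = 1)}"

definition weak_star :: "'a measure \<Rightarrow> ('a \<Rightarrow> complex) topology"
  where "weak_star M = topology_generated_by
    {{f \<in> Linf M. (\<integral>x. f x * h x \<partial>M) \<in> U} | h U. integrable M h \<and> open U}"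

definition fourier_multiplier ::
    "'g::{topological_ab_group_add, t2_space} measure \<Rightarrow> (('g \<Rightarrow> complex) \<Rightarrow> ('g \<Rightarrow> complex)) \<Rightarrow> bool"
  where "fourier_multiplier \<mu> T \<longleftrightarrow>
    linear_op (Linf \<mu>) (Linf_norm \<mu>) T \<and>
    continuous_map (weak_star \<mu>) (weak_star \<mu>) T \<and>
    (\<exists>\<phi>. \<forall>\<gamma>\<in>characters. AE x in \<mu>. T \<gamma> x = \<phi> \<gamma> * \<gamma> x)"

definition selfadjoint :: "'a measure \<Rightarrow> (('a \<Rightarrow> complex) \<Rightarrow> ('a \<Rightarrow> complex)) \<Rightarrow> bool"
  where "selfadjoint M T \<longleftrightarrow>
    (\<forall>f\<in>Linf M. \<forall>g\<in>Linf M. (\<integral>x. T f x * cnj (g x) \<partial>M) = (\<integral>x. f x * cnj (T g x) \<partial>M))"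

definition weak_star_semigroup ::
    "'a measure \<Rightarrow> (real \<Rightarrow> ('a \<Rightarrow> complex) \<Rightarrow> ('a \<Rightarrow> complex)) \<Rightarrow> bool"
  where "weak_star_semigroup M T \<longleftrightarrow>
    operator_semigroup (Linf M) (Linf_norm M) T \<and>
    (\<forall>f\<in>Linf M. continuous_map (top_of_set {0..}) (weak_star M) (\<lambda>t. T t f))"

definition Lp_extension ::
    "'a measure \<Rightarrow> real \<Rightarrow> (('a \<Rightarrow> complex) \<Rightarrow> ('a \<Rightarrow> complex)) \<Rightarrow>
      (('a \<Rightarrow> complex) \<Rightarrow> ('a \<Rightarrow> complex)) \<Rightarrow> bool"
  where "Lp_extension M p T U \<longleftrightarrow>
    contraction_op (Lp M p) (Lp_norm M p) U \<and> (\<forall>f\<in>Linf M. AE x in M. U f x = T f x)"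

text \<open>\<open>S\<close> is a bounded operator on \<open>L\<^sup>p(M, X)\<close> that extends \<open>T \<otimes> Id\<^sub>X\<close> from \<open>L\<^sup>p(M) \<otimes> X\<close>.\<close>

definition induced_operator ::
    "'a measure \<Rightarrow> real \<Rightarrow> (('a \<Rightarrow> complex) \<Rightarrow> ('a \<Rightarrow> complex)) \<Rightarrow>
      (('a \<Rightarrow> 'x::complex_banach) \<Rightarrow> ('a \<Rightarrow> 'x)) \<Rightarrow> bool"
  where "induced_operator M p T S \<longleftrightarrow>
    S \<in> bounded_ops (Lp M p) (Lp_norm M p) \<and>
    (\<exists>U. Lp_extension M p T U \<and>
      (\<forall>(n::nat) f v. (\<forall>k<n. f k \<in> Lp M p) \<longrightarrow>
        (AE x in M. S (\<lambda>y. \<Sum>k<n. f k y *\<^sub>C v k) x = (\<Sum>k<n. U (f k) x *\<^sub>C v k))))"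

end

theory Submission
  imports Defs
begin

text \<open>
  Translations act isometrically on \<open>L\<^sup>p(G, X)\<close> for every Banach space \<open>X\<close>. If \<open>T\<close> is a contractive
  Fourier multiplier on \<open>L\<^sup>\<infinity>(G)\<close> with symbol \<open>\<phi>\<close>, then \<open>\<bar>\<Sum> a\<^sub>\<xi> \<phi>(\<xi>)\<bar> \<le> sup \<bar>\<Sum> a\<^sub>\<xi> \<xi>\<bar>\<close> for all finitely supported
  coefficients, and so \<open>\<phi>\<close> is a pointwise limit of transforms of discrete measures of total variation one
  (\<open>sup_dominated_approx\<close>): on trigonometric polynomials \<open>T\<close> is a limit of averages of unimodular
  multiples of translations. Hence \<open>T\<close> extends to a contraction of \<open>L\<^sup>p(G, X)\<close>. Selfadjointness makes
  \<open>\<phi>\<close> real, and a \<open>w\<^sup>*\<close>-continuous semigroup of such multipliers has the symbols \<open>exp (- t a)\<close> with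
  \<open>a \<ge> 0\<close> (\<open>semigroup_symbol\<close>).

  Analyticity comes from Beurling's criterion: a contraction semigroup is bounded analytic as soon as
  \<open>\<parallel>(1 - T\<^sub>s)\<^sup>n\<parallel> \<le> \<rho> < 2\<^sup>n\<close> for one \<open>n\<close> and all \<open>s\<close>. Indeed \<open>e + T\<^sub>s\<close> is then invertible for \<open>e \<ge> 1\<close>, Kato's
  argument turns this into the resolvent bound of order \<open>1 / \<bar>z\<bar>\<close> on the right half plane, the resolvent
  bound gives \<open>\<parallel>t A T\<^sub>t\<parallel> \<le> K\<close>, and the Taylor series of \<open>T\<close> then converges in a sector
  (\<open>analytic_multipliers\<close>). All operators here are multipliers, so that every limit can be taken
  frequency by frequency and no operator-valued integral is needed.

  The bound on \<open>(1 - T\<^sub>s)\<^sup>n\<close> is Pisier's argument. A K-convex space does not contain the spaces \<open>\<ell>\<^sub>1\<^sup>n\<close>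
  uniformly (\<open>K_convex_sign_bound\<close>), and this passes to \<open>L\<^sup>p(G, X)\<close>: for a suitable \<open>n\<close>, the average over the
  signs of \<open>\<parallel>\<Sum> \<eta>\<^sub>k x\<^sub>k\<parallel>\<close>, for \<open>n\<close> vectors in the unit ball, is at most \<open>n - \<epsilon>\<close>. Now
  \<open>T\<^sub>s = T T\<^sup>*\<close> with \<open>T = T\<^sub>s\<^sub>/\<^sub>2\<close> an average of isometries \<open>U\<^sub>i\<close>. The gain for the vectors \<open>U\<^sub>i\<^sub>k T\<^sup>* v\<close>, averaged
  over the indices \<open>i\<^sub>1, \<dots>, i\<^sub>n\<close> with suitable isometries in front, is a gain for a combination of two consecutive
  powers of \<open>T\<^sub>s\<close> (\<open>dilation_estimate\<close>), and these are two terms of the binomial expansion of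
  \<open>(1 - T\<^sub>s)\<^sup>n\<close> (\<open>power_of_difference_bound\<close>).

  Trigonometric polynomials are dense in \<open>L\<^sup>p(G, X)\<close> because characters separate points. The characters
  are found as minimal idempotents of the convolution algebra of continuous functions; an idempotent below a
  given positive function arises as a limit of its convolution powers (\<open>top_idempotent\<close>).
\<close>

section \<open>Multipliers acting on finitely supported vector functions\<close>

lemma scaleC_zero_left [simp]: "0 *\<^sub>C (x::'a::complex_vector) = 0"
  by (metis add_cancel_right_right scaleC_add_left)

lemma scaleC_zero_right [simp]: "c *\<^sub>C (0::'a::complex_vector) = 0"
  by (metis add_cancel_right_right scaleC_add_right)

lemma scaleC_minus_left: "(- c) *\<^sub>C (x::'a::complex_vector) = - (c *\<^sub>C x)"
  by (metis add.left_inverse add_eq_0_iff2 scaleC_add_left scaleC_zero_left)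

lemma scaleC_minus_right: "c *\<^sub>C (- x::'a::complex_vector) = - (c *\<^sub>C x)"
  by (metis add.left_inverse add_eq_0_iff2 scaleC_add_right scaleC_zero_right)

lemma scaleC_diff_left: "(c - d) *\<^sub>C (x::'a::complex_vector) = c *\<^sub>C x - d *\<^sub>C x"
  by (metis add_uminus_conv_diff scaleC_add_left scaleC_minus_left)

lemma scaleC_diff_right: "c *\<^sub>C (x - y::'a::complex_vector) = c *\<^sub>C x - c *\<^sub>C y"
  by (metis add_uminus_conv_diff scaleC_add_right scaleC_minus_right)

lemma scaleC_sum_right: "c *\<^sub>C (\<Sum>i\<in>I. (x i::'a::complex_vector)) = (\<Sum>i\<in>I. c *\<^sub>C x i)"
  by (induction I rule: infinite_finite_induct) (auto simp: scaleC_add_right)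

lemma scaleC_sum_left: "(\<Sum>i\<in>I. c i) *\<^sub>C (x::'a::complex_vector) = (\<Sum>i\<in>I. c i *\<^sub>C x)"
  by (induction I rule: infinite_finite_induct) (auto simp: scaleC_add_left)

lemma bounded_bilinear_scaleC: "bounded_bilinear (scaleC :: complex \<Rightarrow> 'a::complex_banach \<Rightarrow> 'a)"
proof (rule bounded_bilinear.intro)
  fix r :: real and c :: complex and x :: 'a
  show "(r *\<^sub>R c) *\<^sub>C x = r *\<^sub>R c *\<^sub>C x"
    by (simp only: scaleR_conv_of_real scaleR_scaleC[where ?'a='a] scaleC_scaleC)
  show "c *\<^sub>C (r *\<^sub>R x) = r *\<^sub>R c *\<^sub>C x"
    by (simp add: scaleR_scaleC scaleC_scaleC mult.commute)
  show "\<exists>K. \<forall>(c::complex) x::'a. norm (c *\<^sub>C x) \<le> norm c * norm x * K"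
    by (rule exI[of _ 1]) (simp add: norm_scaleC)
qed (simp_all add: scaleC_add_left scaleC_add_right)

text \<open>
  The norms of the trigonometric polynomials with frequencies in \<open>F\<close> and coefficients \<open>v\<close> in a Bochner
  space. An operator is represented by a function on the frequencies, and its norm by what it does to
  these polynomials; completeness enters only when the multipliers are extended to the whole space.
\<close>

locale multiplier_seminorm =
  fixes \<Gamma> :: "'c set" and nu :: "'c set \<Rightarrow> ('c \<Rightarrow> 'x::complex_banach) \<Rightarrow> real"
  assumes nu_nonneg: "nu F v \<ge> 0"
    and nu_add: "finite F \<Longrightarrow> F \<subseteq> \<Gamma> \<Longrightarrow> nu F (\<lambda>\<xi>. v \<xi> + w \<xi>) \<le> nu F v + nu F w"
    and nu_scale: "finite F \<Longrightarrow> F \<subseteq> \<Gamma> \<Longrightarrow> nu F (\<lambda>\<xi>. c *\<^sub>C v \<xi>) = cmod c * nu F v"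
    and nu_coord: "finite F \<Longrightarrow> F \<subseteq> \<Gamma> \<Longrightarrow> nu F v \<le> (\<Sum>\<xi>\<in>F. norm (v \<xi>))"
begin

lemma nu_cong:
  assumes "finite F" "F \<subseteq> \<Gamma>" "\<And>\<xi>. \<xi> \<in> F \<Longrightarrow> v \<xi> = w \<xi>"
  shows "nu F v = nu F w"
proof -
  have *: "nu F v \<le> nu F w" if "\<And>\<xi>. \<xi> \<in> F \<Longrightarrow> v \<xi> = w \<xi>" for v w
  proof -
    have "nu F (\<lambda>\<xi>. w \<xi> + (v \<xi> - w \<xi>)) \<le> nu F w + nu F (\<lambda>\<xi>. v \<xi> - w \<xi>)"
      by (rule nu_add[OF assms(1,2)])
    moreover have "nu F (\<lambda>\<xi>. v \<xi> - w \<xi>) \<le> (\<Sum>\<xi>\<in>F. norm (v \<xi> - w \<xi>))"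
      by (rule nu_coord[OF assms(1,2)])
    moreover have "(\<Sum>\<xi>\<in>F. norm (v \<xi> - w \<xi>)) = 0" using that by simp
    ultimately show ?thesis by simp
  qed
  show ?thesis using *[of v w] *[of w v] assms(3) by force
qed

lemma nu_diff:
  assumes "finite F" "F \<subseteq> \<Gamma>"
  shows "nu F (\<lambda>\<xi>. v \<xi> - w \<xi>) \<le> nu F v + nu F w"
  using nu_add[OF assms, of v "\<lambda>\<xi>. (-1) *\<^sub>C w \<xi>"] nu_scale[OF assms, of "-1" w]
  by (simp add: scaleC_minus_left scaleC_one)

lemma nu_zero: assumes "finite F" "F \<subseteq> \<Gamma>" shows "nu F (\<lambda>\<xi>. 0) = 0"
  using nu_scale[OF assms, of 0 "\<lambda>_. 0"] by simp

lemma nu_sum: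
  assumes "finite F" "F \<subseteq> \<Gamma>"
  shows "nu F (\<lambda>\<xi>. \<Sum>i\<in>I. v i \<xi>) \<le> (\<Sum>i\<in>I. nu F (v i))"
proof (induction I rule: infinite_finite_induct)
  case (insert i I)
  then show ?case using nu_add[OF assms, of "v i" "\<lambda>\<xi>. \<Sum>i\<in>I. v i \<xi>"] by simp
qed (use nu_zero[OF assms] in auto)

lemma nu_tendsto:
  assumes "finite F" "F \<subseteq> \<Gamma>" "\<And>\<xi>. \<xi> \<in> F \<Longrightarrow> ((\<lambda>K. v K \<xi>) \<longlongrightarrow> w \<xi>) \<F>"
  shows "((\<lambda>K. nu F (v K)) \<longlongrightarrow> nu F w) \<F>"
proof -
  have "((\<lambda>K. \<Sum>\<xi>\<in>F. norm (v K \<xi> - w \<xi>)) \<longlongrightarrow> (\<Sum>\<xi>\<in>F. 0)) \<F>"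
    by (rule tendsto_sum) (use assms(3) LIM_zero tendsto_norm_zero in blast)
  then have lim: "((\<lambda>K. \<Sum>\<xi>\<in>F. norm (v K \<xi> - w \<xi>)) \<longlongrightarrow> 0) \<F>" by simp
  have bd: "norm (nu F (v K) - nu F w) \<le> (\<Sum>\<xi>\<in>F. norm (v K \<xi> - w \<xi>))" for K
  proof -
    have "nu F (v K) \<le> nu F w + nu F (\<lambda>\<xi>. v K \<xi> - w \<xi>)"
      using nu_add[OF assms(1,2), of w "\<lambda>\<xi>. v K \<xi> - w \<xi>"] by simp
    moreover have "nu F w \<le> nu F (v K) + nu F (\<lambda>\<xi>. v K \<xi> - w \<xi>)"
      using nu_diff[OF assms(1,2), of "v K" "\<lambda>\<xi>. v K \<xi> - w \<xi>"] by simp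
    moreover have "nu F (\<lambda>\<xi>. v K \<xi> - w \<xi>) \<le> (\<Sum>\<xi>\<in>F. norm (v K \<xi> - w \<xi>))"
      by (rule nu_coord[OF assms(1,2)])
    ultimately show ?thesis by (simp add: abs_le_iff)
  qed
  have "((\<lambda>K. nu F (v K) - nu F w) \<longlongrightarrow> 0) \<F>"
    by (rule Lim_null_comparison[OF _ lim]) (use bd in auto)
  then show ?thesis by (simp add: LIM_zero_iff)
qed

definition mb :: "('c \<Rightarrow> complex) \<Rightarrow> real \<Rightarrow> bool" where
  "mb \<psi> B \<longleftrightarrow> (\<forall>F v. finite F \<longrightarrow> F \<subseteq> \<Gamma> \<longrightarrow> nu F (\<lambda>\<xi>. \<psi> \<xi> *\<^sub>C v \<xi>) \<le> B * nu F v)"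

lemma mbI: "(\<And>F v. finite F \<Longrightarrow> F \<subseteq> \<Gamma> \<Longrightarrow> nu F (\<lambda>\<xi>. \<psi> \<xi> *\<^sub>C v \<xi>) \<le> B * nu F v) \<Longrightarrow> mb \<psi> B"
  unfolding mb_def by blast

lemma mbD: "mb \<psi> B \<Longrightarrow> finite F \<Longrightarrow> F \<subseteq> \<Gamma> \<Longrightarrow> nu F (\<lambda>\<xi>. \<psi> \<xi> *\<^sub>C v \<xi>) \<le> B * nu F v"
  unfolding mb_def by blast

lemma mb_mono: "mb \<psi> B \<Longrightarrow> B \<le> B' \<Longrightarrow> mb \<psi> B'"
  unfolding mb_def by (meson mult_right_mono nu_nonneg order_trans)

lemma mb_cong:
  assumes "mb \<psi> B" "\<And>\<xi>. \<xi> \<in> \<Gamma> \<Longrightarrow> \<psi> \<xi> = \<psi>' \<xi>"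
  shows "mb \<psi>' B"
proof (rule mbI)
  fix F v assume F: "finite F" "F \<subseteq> \<Gamma>"
  have "nu F (\<lambda>\<xi>. \<psi>' \<xi> *\<^sub>C v \<xi>) = nu F (\<lambda>\<xi>. \<psi> \<xi> *\<^sub>C v \<xi>)"
    by (rule nu_cong[OF F]) (use assms(2) F in auto)
  then show "nu F (\<lambda>\<xi>. \<psi>' \<xi> *\<^sub>C v \<xi>) \<le> B * nu F v" using mbD[OF assms(1) F] by simp
qed

lemma mb_const: "mb (\<lambda>\<xi>. c) (cmod c)"
  by (rule mbI) (simp add: nu_scale)

lemma mb_one: "mb (\<lambda>\<xi>. 1) 1"
  using mb_const[of 1] by simp

lemma mb_add:
  assumes "mb \<psi> B" "mb \<psi>' B'" shows "mb (\<lambda>\<xi>. \<psi> \<xi> + \<psi>' \<xi>) (B + B')"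
proof (rule mbI)
  fix F v assume F: "finite F" "F \<subseteq> \<Gamma>"
  show "nu F (\<lambda>\<xi>. (\<psi> \<xi> + \<psi>' \<xi>) *\<^sub>C v \<xi>) \<le> (B + B') * nu F v"
    using nu_add[OF F, of "\<lambda>\<xi>. \<psi> \<xi> *\<^sub>C v \<xi>" "\<lambda>\<xi>. \<psi>' \<xi> *\<^sub>C v \<xi>"] mbD[OF assms(1) F, of v] mbD[OF assms(2) F, of v]
    unfolding scaleC_add_left distrib_right by linarith
qed

lemma mb_mult:
  assumes "mb \<psi> B" "mb \<psi>' B'" "B \<ge> 0" shows "mb (\<lambda>\<xi>. \<psi> \<xi> * \<psi>' \<xi>) (B * B')"
proof (rule mbI)
  fix F v assume F: "finite F" "F \<subseteq> \<Gamma>"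
  have "nu F (\<lambda>\<xi>. \<psi> \<xi> *\<^sub>C \<psi>' \<xi> *\<^sub>C v \<xi>) \<le> B * nu F (\<lambda>\<xi>. \<psi>' \<xi> *\<^sub>C v \<xi>)"
    by (rule mbD[OF assms(1) F])
  also have "\<dots> \<le> B * (B' * nu F v)"
    by (rule mult_left_mono[OF mbD[OF assms(2) F] assms(3)])
  finally show "nu F (\<lambda>\<xi>. (\<psi> \<xi> * \<psi>' \<xi>) *\<^sub>C v \<xi>) \<le> B * B' * nu F v"
    by (simp add: scaleC_scaleC mult.assoc)
qed

lemma mb_cmult:
  assumes "mb \<psi> B" shows "mb (\<lambda>\<xi>. c * \<psi> \<xi>) (cmod c * B)"
  by (rule mb_mult[OF mb_const assms]) simp

lemma mb_diff:
  assumes "mb \<psi> B" "mb \<psi>' B'" shows "mb (\<lambda>\<xi>. \<psi> \<xi> - \<psi>' \<xi>) (B + B')"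
  using mb_add[OF assms(1) mb_cmult[OF assms(2), of "-1"]] by simp

lemma mb_power:
  assumes "mb \<psi> B" "B \<ge> 0" shows "mb (\<lambda>\<xi>. \<psi> \<xi> ^ k) (B ^ k)"
  by (induction k) (use mb_mult[OF assms(1) _ assms(2)] mb_one in auto)

lemma mb_sum:
  assumes "\<And>i. i \<in> I \<Longrightarrow> mb (\<psi> i) (B i)"
  shows "mb (\<lambda>\<xi>. \<Sum>i\<in>I. \<psi> i \<xi>) (\<Sum>i\<in>I. B i)"
  using assms
proof (induction I rule: infinite_finite_induct)
  case (insert i I)
  then show ?case using mb_add[of "\<psi> i" "B i"] by simp
qed (use mb_const[of 0] in auto)

lemma mb_prod:
  assumes "\<And>i. i \<in> I \<Longrightarrow> mb (\<psi> i) 1"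
  shows "mb (\<lambda>\<xi>. \<Prod>i\<in>I. \<psi> i \<xi>) 1"
  using assms
proof (induction I rule: infinite_finite_induct)
  case (insert i I)
  then show ?case using mb_mult[of "\<psi> i" 1 "\<lambda>\<xi>. \<Prod>i\<in>I. \<psi> i \<xi>" 1] by simp
qed (use mb_one in auto)

text \<open>
  A polynomial has finitely many frequencies, so pointwise convergence of the symbols is enough. This
  is what replaces operator-valued integrals and strong limits in the whole analytic part.
\<close>

lemma mb_tendsto:
  assumes "\<forall>\<^sub>F K in \<F>. mb (\<psi> K) (B K)" "\<And>\<xi>. \<xi> \<in> \<Gamma> \<Longrightarrow> ((\<lambda>K. \<psi> K \<xi>) \<longlongrightarrow> \<phi> \<xi>) \<F>"
    "(B \<longlongrightarrow> B') \<F>" "\<F> \<noteq> bot"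
  shows "mb \<phi> B'"
proof (rule mbI)
  fix F v assume F: "finite F" "F \<subseteq> \<Gamma>"
  have 1: "((\<lambda>K. nu F (\<lambda>\<xi>. \<psi> K \<xi> *\<^sub>C v \<xi>)) \<longlongrightarrow> nu F (\<lambda>\<xi>. \<phi> \<xi> *\<^sub>C v \<xi>)) \<F>"
    by (rule nu_tendsto[OF F], rule bounded_bilinear.tendsto[OF bounded_bilinear_scaleC])
       (use assms(2) F in auto)
  have 2: "((\<lambda>K. B K * nu F v) \<longlongrightarrow> B' * nu F v) \<F>"
    by (intro tendsto_intros assms)
  show "nu F (\<lambda>\<xi>. \<phi> \<xi> *\<^sub>C v \<xi>) \<le> B' * nu F v"
    by (rule tendsto_le[OF assms(4) 2 1]) (use assms(1) in eventually_elim, use mbD F in blast)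
qed

lemma mb_neumann:
  assumes "mb \<psi> q" "q < 1" "\<And>\<xi>. \<xi> \<in> \<Gamma> \<Longrightarrow> \<psi> \<xi> \<noteq> 1"
  shows "mb (\<lambda>\<xi>. 1 / (1 - \<psi> \<xi>)) (1 / (1 - q))"
proof (rule mbI)
  fix F and v :: "'c \<Rightarrow> 'x" assume F: "finite F" "F \<subseteq> \<Gamma>"
  let ?w = "\<lambda>\<xi>. (1 / (1 - \<psi> \<xi>)) *\<^sub>C v \<xi>"
  have "nu F ?w = nu F (\<lambda>\<xi>. v \<xi> + \<psi> \<xi> *\<^sub>C ?w \<xi>)"
  proof (rule nu_cong[OF F])
    fix \<xi> assume "\<xi> \<in> F"
    then have "1 - \<psi> \<xi> \<noteq> 0" using assms(3) F by auto
    then have "1 / (1 - \<psi> \<xi>) = 1 + \<psi> \<xi> * (1 / (1 - \<psi> \<xi>))" by (simp add: field_simps)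
    then have "?w \<xi> = (1 + \<psi> \<xi> * (1 / (1 - \<psi> \<xi>))) *\<^sub>C v \<xi>" by (rule arg_cong)
    also have "\<dots> = v \<xi> + \<psi> \<xi> *\<^sub>C ?w \<xi>" by (simp only: scaleC_add_left scaleC_scaleC scaleC_one)
    finally show "?w \<xi> = v \<xi> + \<psi> \<xi> *\<^sub>C ?w \<xi>" .
  qed
  also have "\<dots> \<le> nu F v + q * nu F ?w"
    using nu_add[OF F, of v "\<lambda>\<xi>. \<psi> \<xi> *\<^sub>C ?w \<xi>"] mbD[OF assms(1) F, of ?w] by linarith
  finally have "(1 - q) * nu F ?w \<le> nu F v" by (simp add: algebra_simps)
  then show "nu F ?w \<le> 1 / (1 - q) * nu F v" using assms(2) by (simp add: field_simps)
qed

end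


section \<open>Averages over roots of unity\<close>

definition circle_point :: "real \<Rightarrow> nat \<Rightarrow> nat \<Rightarrow> complex" where
  "circle_point r M j = of_real r * cis (2 * pi * real j / real M)"

lemma norm_circle_point: "r > 0 \<Longrightarrow> cmod (circle_point r M j) = r"
  by (simp add: circle_point_def norm_mult)

lemma circle_point_powers_average:
  assumes "r > 0" "l < M" "m < M"
  shows "(\<Sum>j<M. circle_point r M j ^ m * inverse (circle_point r M j) ^ l) / of_nat M = (if l = m then 1 else 0)"
proof -
  define z where "z = cis (2 * pi * (real m - real l) / real M)"
  have M: "M > 0" using assms by simp
  have eq: "circle_point r M j ^ m * inverse (circle_point r M j) ^ l = of_real (r ^ m / r ^ l) * z ^ j" for j
  proof -
    have "circle_point r M j ^ m = of_real (r ^ m) * cis (real m * (2 * pi * real j / real M))"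
      by (simp add: circle_point_def power_mult_distrib Complex.DeMoivre)
    moreover have "inverse (circle_point r M j) ^ l = of_real (1 / r ^ l) * cis (- (real l * (2 * pi * real j / real M)))"
      by (simp add: circle_point_def power_mult_distrib Complex.DeMoivre divide_inverse power_inverse cis_inverse flip: of_real_power)
    moreover have "z ^ j = cis (real m * (2 * pi * real j / real M)) * cis (- (real l * (2 * pi * real j / real M)))"
      by (simp add: z_def Complex.DeMoivre cis_mult algebra_simps diff_divide_distrib)
    ultimately show ?thesis by simp
  qed
  have sum: "(\<Sum>j<M. circle_point r M j ^ m * inverse (circle_point r M j) ^ l) = of_real (r ^ m / r ^ l) * (\<Sum>j<M. z ^ j)"
    by (simp add: eq sum_distrib_left)
  show ?thesis
  proof (cases "l = m")
    case True
    then show ?thesis using sum M assms(1) by (simp add: z_def)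
  next
    case False
    have "z \<noteq> 1"
    proof
      assume "z = 1"
      then have "cos (2 * pi * (real m - real l) / real M) = 1"
        by (simp add: z_def complex_eq_iff)
      then obtain k :: int where "2 * pi * (real m - real l) / real M = of_int k * 2 * pi"
        using cos_one_2pi_int by blast
      then have "2 * pi * (real m - real l) = 2 * pi * (of_int k * real M)" using M by (simp add: divide_eq_eq)
      then have "real m - real l = of_int k * real M" by (metis mult_cancel_left pi_neq_zero mult_eq_0_iff zero_neq_numeral)
      then have e: "int m - int l = k * int M"
        by (metis of_int_eq_iff of_int_diff of_int_mult of_int_of_nat_eq)
      have "\<bar>int m - int l\<bar> < int M" using assms by linarith
      moreover have "k \<noteq> 0" using e False by auto
      then have "\<bar>k * int M\<bar> \<ge> int M" using M by (simp add: abs_mult)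
      ultimately show False using e by linarith
    qed
    have "z ^ M = cis (2 * pi * of_int (int m - int l))"
      using M by (simp add: z_def Complex.DeMoivre)
    then have "z ^ M = 1" by (metis cis_multiple_2pi Ints_of_int)
    then have "(\<Sum>j<M. z ^ j) = 0" using \<open>z \<noteq> 1\<close> by (simp add: geometric_sum)
    then show ?thesis using sum False by simp
  qed
qed

text \<open>
  The coefficient formula for Laurent series, discretised: the mean over the \<open>M\<close>-th roots of unity
  sees the exponents modulo \<open>M\<close> only. A finite mean of multipliers inherits their bounds, and the
  bound survives the limit.
\<close>

lemma coefficient_as_circle_average:
  fixes c :: "nat \<Rightarrow> complex"
  assumes r: "r > 0" and summ: "summable (\<lambda>l. norm (c l) / r ^ l)"
  shows "(\<lambda>M. (\<Sum>j<M. circle_point r M j ^ m * (\<Sum>l. c l * inverse (circle_point r M j) ^ l)) / of_nat M) \<longlonglongrightarrow> c m"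
proof -
  define A where "A l M = (\<Sum>j<M. circle_point r M j ^ m * inverse (circle_point r M j) ^ l) / of_nat M" for l M
  have bd: "norm (A l M) \<le> r ^ m / r ^ l" for l M
  proof (cases "M = 0")
    case False
    have "norm (\<Sum>j<M. circle_point r M j ^ m * inverse (circle_point r M j) ^ l) \<le> (\<Sum>j<M. r ^ m / r ^ l)"
      by (rule sum_norm_le) (use r in \<open>simp add: norm_mult norm_power norm_inverse norm_circle_point divide_inverse power_inverse\<close>)
    then show ?thesis using False by (simp add: A_def norm_divide field_simps)
  qed (use r in \<open>simp add: A_def\<close>)
  have "(\<lambda>M. \<Sum>l. c l * A l M) \<longlonglongrightarrow> (\<Sum>l. c l * (if l = m then 1 else 0))"
  proof (rule conjunct2[OF conjunct2[OF tannerys_theorem[where M = "\<lambda>l. r ^ m * (norm (c l) / r ^ l)"]]])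
    fix l
    have "\<forall>\<^sub>F M in sequentially. A l M = (if l = m then 1 else 0)"
      using eventually_gt_at_top[of "max l m"]
      by eventually_elim (use r in \<open>simp add: A_def circle_point_powers_average\<close>)
    then show "(\<lambda>M. c l * A l M) \<longlonglongrightarrow> c l * (if l = m then 1 else 0)"
      by (intro tendsto_mult tendsto_const) (rule tendsto_eventually)
  next
    show "\<forall>\<^sub>F (k, n) in sequentially \<times>\<^sub>F sequentially. norm (c k * A k n) \<le> r ^ m * (norm (c k) / r ^ k)"
    proof (rule always_eventually, clarify)
      fix k n
      show "norm (c k * A k n) \<le> r ^ m * (norm (c k) / r ^ k)"
        using mult_left_mono[OF bd[of k n] norm_ge_zero[of "c k"]] by (simp add: norm_mult mult.commute)
    qed
  next
    show "summable (\<lambda>l. r ^ m * (norm (c l) / r ^ l))" by (rule summable_mult[OF summ])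
  qed simp
  moreover have "(\<Sum>l. c l * (if l = m then 1 else 0)) = c m"
    using suminf_finite[of "{m}" "\<lambda>l. c l * (if l = m then 1 else 0)"] by simp
  moreover have "(\<Sum>l. c l * A l M) = (\<Sum>j<M. circle_point r M j ^ m * (\<Sum>l. c l * inverse (circle_point r M j) ^ l)) / of_nat M" for M
  proof -
    have s: "summable (\<lambda>l. c l * inverse (circle_point r M j) ^ l)" for j
      by (rule summable_norm_cancel)
         (use summ r in \<open>simp add: norm_mult norm_power norm_inverse norm_circle_point divide_inverse power_inverse\<close>)
    have "(\<Sum>j<M. circle_point r M j ^ m * (\<Sum>l. c l * inverse (circle_point r M j) ^ l))
       = (\<Sum>j<M. (\<Sum>l. circle_point r M j ^ m * (c l * inverse (circle_point r M j) ^ l)))"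
      by (simp add: suminf_mult[OF s])
    also have "\<dots> = (\<Sum>l. \<Sum>j<M. circle_point r M j ^ m * (c l * inverse (circle_point r M j) ^ l))"
      by (rule suminf_sum[symmetric]) (rule summable_mult[OF s])
    also have "\<dots> / of_nat M = (\<Sum>l. (\<Sum>j<M. circle_point r M j ^ m * (c l * inverse (circle_point r M j) ^ l)) / of_nat M)"
      by (rule suminf_divide[symmetric], rule summable_sum, rule summable_mult[OF s])
    also have "\<dots> = (\<Sum>l. c l * A l M)"
      by (simp add: A_def sum_distrib_left mult_ac)
    finally show ?thesis by simp
  qed
  ultimately show ?thesis by simp
qed

lemma cubed_geometric_sums:
  fixes x :: complex
  assumes "norm x < 1"
  shows "(\<lambda>l. of_real ((real l + 1) * (real l + 2) / 2) * x ^ l) sums (1 / (1 - x) ^ 3)"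
    and "summable (\<lambda>l. norm (of_real ((real l + 1) * (real l + 2) / 2) * x ^ l))"
proof -
  have g: "(\<lambda>n. x ^ n) sums (1 / (1 - x))" by (rule geometric_sums[OF assms])
  have d: "(\<lambda>n. of_nat (Suc n) * x ^ n) sums (1 / (1 - x)^2)" by (rule geometric_deriv_sums[OF assms])
  have gn: "summable (\<lambda>n. norm (x ^ n))" using assms by (simp add: norm_power)
  have dn: "summable (\<lambda>n. norm (of_nat (Suc n) * x ^ n))"
    using geometric_deriv_sums[of "norm x"] assms sums_summable
    by (force simp: norm_mult norm_power simp del: of_nat_Suc)
  have eq: "(\<Sum>i\<le>k. x ^ i * (of_nat (Suc (k - i)) * x ^ (k - i))) = of_real ((real k + 1) * (real k + 2) / 2) * x ^ k" for k
  proof -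
    have "(\<Sum>i\<le>k. x ^ i * (of_nat (Suc (k - i)) * x ^ (k - i))) = (\<Sum>i\<le>k. of_nat (Suc (k - i)) * x ^ k)"
      by (rule sum.cong) (auto simp: algebra_simps simp flip: power_add)
    also have "\<dots> = (\<Sum>i\<le>k. of_nat (Suc (k - i))) * x ^ k" by (simp add: sum_distrib_right)
    also have "(\<Sum>i\<le>k. of_nat (Suc (k - i)) :: complex) = (\<Sum>i\<le>k. of_nat (Suc i))"
      using sum.nat_diff_reindex[of "\<lambda>i. of_nat (Suc i) :: complex" "Suc k"]
      by (simp only: lessThan_Suc_atMost diff_Suc_Suc)
    also have "(\<Sum>i\<le>k. of_nat (Suc i)) = (of_real ((real k + 1) * (real k + 2) / 2) :: complex)"
      by (induction k) (auto simp: field_simps)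
    finally show ?thesis .
  qed
  have "1 / (1 - x) * (1 / (1 - x)^2) = 1 / (1 - x) ^ 3" by (simp add: power3_eq_cube power2_eq_square)
  then show "(\<lambda>l. of_real ((real l + 1) * (real l + 2) / 2) * x ^ l) sums (1 / (1 - x) ^ 3)"
    using Cauchy_product_sums[OF gn dn] g d unfolding eq by (simp add: sums_iff)
  have "summable (\<lambda>k. \<Sum>i\<le>k. norm (x ^ i) * norm (of_nat (Suc (k - i)) * x ^ (k - i)))"
    using summable_Cauchy_product[of "\<lambda>n. norm (x ^ n)" "\<lambda>n. norm (of_nat (Suc n) * x ^ n)"] gn dn by simp
  moreover have "(\<Sum>i\<le>k. norm (x ^ i) * norm (of_nat (Suc (k - i)) * x ^ (k - i))) =
    norm (of_real ((real k + 1) * (real k + 2) / 2) * x ^ k)" for k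
  proof -
    have "(\<Sum>i\<le>k. norm (x ^ i) * norm (of_nat (Suc (k - i)) * x ^ (k - i))) = (\<Sum>i\<le>k. real (Suc (k - i)) * norm x ^ k)"
      by (rule sum.cong) (auto simp: algebra_simps norm_mult norm_power simp flip: power_add simp del: of_nat_Suc)
    also have "\<dots> = (\<Sum>i\<le>k. real (Suc (k - i))) * norm x ^ k" by (simp add: sum_distrib_right)
    also have "(\<Sum>i\<le>k. real (Suc (k - i))) = (\<Sum>i\<le>k. real (Suc i))"
      using sum.nat_diff_reindex[of "\<lambda>i. real (Suc i)" "Suc k"]
      by (simp only: lessThan_Suc_atMost diff_Suc_Suc)
    also have "(\<Sum>i\<le>k. real (Suc i)) = (real k + 1) * (real k + 2) / 2"
      by (induction k) (auto simp: field_simps)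
    also have "(real k + 1) * (real k + 2) / 2 * norm x ^ k = norm (of_real ((real k + 1) * (real k + 2) / 2) * x ^ k)"
      by (subst norm_mult) (simp only: norm_of_real norm_power, simp)
    finally show ?thesis .
  qed
  ultimately show "summable (\<lambda>l. norm (of_real ((real l + 1) * (real l + 2) / 2) * x ^ l))" by (simp only:)
qed

text \<open>
  Cauchy's formula with a pole of order three. For \<open>r = 1 + 1/m\<close> the coefficient on the right is of
  order \<open>m\<^sup>2\<close>, while the mean of \<open>\<bar>w - 1\<bar>\<^sup>-\<^sup>2\<close> is of order \<open>m\<close>; their quotient is the decay \<open>1/m\<close> that
  is needed.
\<close>

lemma circle_average_inverse_cube:
  fixes y :: complex
  assumes "norm y < r"
  shows "(\<lambda>M. (\<Sum>j<M. circle_point r M j ^ (m + 3) / (circle_point r M j - y) ^ 3) / of_nat M)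
    \<longlonglongrightarrow> of_real ((real m + 1) * (real m + 2) / 2) * y ^ m"
proof -
  define c where "c l = of_real ((real l + 1) * (real l + 2) / 2) * y ^ l" for l
  have r: "r > 0" using assms norm_ge_zero[of y] by linarith
  have "(\<lambda>l. norm (c l) / r ^ l) = (\<lambda>l. norm (of_real ((real l + 1) * (real l + 2) / 2) * (y / of_real r) ^ l))"
    using r by (intro ext) (simp add: c_def norm_mult norm_power norm_divide power_divide)
  moreover have "norm (y / of_real r) < 1" using assms r by (simp add: norm_divide)
  ultimately have "summable (\<lambda>l. norm (c l) / r ^ l)"
    using cubed_geometric_sums(2)[of "y / of_real r"] by (simp only:)
  from coefficient_as_circle_average[OF r this, of m]
  have lim: "(\<lambda>M. (\<Sum>j<M. circle_point r M j ^ m * (\<Sum>l. c l * inverse (circle_point r M j) ^ l)) / of_nat M) \<longlonglongrightarrow> c m" .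
  have "circle_point r M j ^ m * (\<Sum>l. c l * inverse (circle_point r M j) ^ l) =
     circle_point r M j ^ (m + 3) / (circle_point r M j - y) ^ 3" for M j
  proof -
    define w where "w = circle_point r M j"
    have w: "norm w = r" using r by (simp add: w_def norm_circle_point)
    then have w0: "w \<noteq> 0" "w \<noteq> y" using r assms by auto
    have "norm (y / w) < 1" using w r assms by (simp add: norm_divide)
    then have "(\<Sum>l. of_real ((real l + 1) * (real l + 2) / 2) * (y / w) ^ l) = 1 / (1 - y / w) ^ 3"
      by (rule sums_unique[OF cubed_geometric_sums(1), symmetric])
    moreover have "of_real ((real l + 1) * (real l + 2) / 2) * (y / w) ^ l = c l * inverse w ^ l" for l
      by (simp only: c_def divide_inverse[of y] power_mult_distrib mult.assoc)
    moreover have "w ^ m * (1 / (1 - y / w) ^ 3) = w ^ (m + 3) / (w - y) ^ 3"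
    proof -
      have "1 - y / w = (w - y) / w" using w0 by (simp add: field_simps)
      then show ?thesis by (simp add: power_divide power_add)
    qed
    ultimately show ?thesis unfolding w_def[symmetric] by (simp only:)
  qed
  then show ?thesis using lim by (simp add: c_def)
qed

text \<open>
  Up to a factor, \<open>\<bar>w - 1\<bar>\<^sup>-\<^sup>2\<close> is the Poisson kernel, the real part of a power series in \<open>1/w\<close> with
  mean one.
\<close>

lemma circle_average_poisson:
  assumes "r > 1"
  shows "(\<lambda>M. (\<Sum>j<M. 1 / (cmod (circle_point r M j - 1))\<^sup>2) / real M) \<longlonglongrightarrow> 1 / (r\<^sup>2 - 1)"
proof -
  have r: "r > 0" using assms by simp
  have "summable (\<lambda>l. norm (1::complex) / r ^ l)"
    using summable_geometric[of "1 / r"] assms by (simp add: power_divide)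
  from coefficient_as_circle_average[OF r this, of 0]
  have "(\<lambda>M. (\<Sum>j<M. (\<Sum>l. inverse (circle_point r M j) ^ l)) / of_nat M) \<longlonglongrightarrow> 1" by simp
  then have lim: "(\<lambda>M. Re ((\<Sum>j<M. (\<Sum>l. inverse (circle_point r M j) ^ l)) / of_nat M)) \<longlonglongrightarrow> Re 1"
    by (rule tendsto_Re)
  have pt: "1 / (cmod (circle_point r M j - 1))\<^sup>2 = (2 * Re (\<Sum>l. inverse (circle_point r M j) ^ l) - 1) / (r\<^sup>2 - 1)" for M j
  proof -
    define w where "w = circle_point r M j"
    have w: "norm w = r" using r by (simp add: w_def norm_circle_point)
    have w1: "w \<noteq> 1" "w \<noteq> 0" using w assms by auto
    have "norm (inverse w) < 1" using w assms by (simp add: norm_inverse inverse_less_1_iff)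
    then have "(\<Sum>l. inverse w ^ l) = 1 / (1 - inverse w)" by (simp add: suminf_geometric)
    also have "\<dots> = w / (w - 1)" using w1 by (simp add: field_simps)
    finally have "Re (\<Sum>l. inverse w ^ l) = Re (w * cnj (w - 1)) / (cmod (w - 1))\<^sup>2"
      by (simp add: complex_div_cnj[of w] del: complex_cnj_diff flip: of_real_power)
    also have "Re (w * cnj (w - 1)) = r\<^sup>2 - Re w"
    proof -
      have "w * cnj (w - 1) = of_real (r\<^sup>2) - w"
        using complex_norm_square[of w] w by (simp add: right_diff_distrib)
      then show ?thesis by simp
    qed
    finally have "2 * Re (\<Sum>l. inverse w ^ l) - 1 = (2 * (r\<^sup>2 - Re w) - (cmod (w - 1))\<^sup>2) / (cmod (w - 1))\<^sup>2"
      using w1 by (simp add: field_simps)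
    also have "(cmod (w - 1))\<^sup>2 = r\<^sup>2 - 2 * Re w + 1"
      using w cmod_power2[of w] cmod_power2[of "w - 1"] by (simp add: power2_eq_square algebra_simps)
    also have "(2 * (r\<^sup>2 - Re w) - (r\<^sup>2 - 2 * Re w + 1)) = r\<^sup>2 - 1" by simp
    finally have "2 * Re (\<Sum>l. inverse w ^ l) - 1 = (r\<^sup>2 - 1) / (r\<^sup>2 - 2 * Re w + 1)" .
    moreover have "(cmod (w - 1))\<^sup>2 = r\<^sup>2 - 2 * Re w + 1"
      using w cmod_power2[of w] cmod_power2[of "w - 1"] by (simp add: power2_eq_square algebra_simps)
    moreover have "r\<^sup>2 - 1 \<noteq> 0" using assms by (simp add: power2_eq_1_iff)
    ultimately show ?thesis unfolding w_def[symmetric] by simp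
  qed
  have ev: "\<forall>\<^sub>F M in sequentially. (2 * Re ((\<Sum>j<M. (\<Sum>l. inverse (circle_point r M j) ^ l)) / of_nat M) - 1) / (r\<^sup>2 - 1)
    = (\<Sum>j<M. 1 / (cmod (circle_point r M j - 1))\<^sup>2) / real M"
    using eventually_gt_at_top[of 0]
  proof eventually_elim
    case (elim M)
    have "(\<Sum>j<M. 1 / (cmod (circle_point r M j - 1))\<^sup>2) = (2 * (\<Sum>j<M. Re (\<Sum>l. inverse (circle_point r M j) ^ l)) - real M) / (r\<^sup>2 - 1)"
      unfolding pt by (simp add: sum_subtractf sum_distrib_left flip: sum_divide_distrib)
    moreover have "(2 * (X / real M) - 1) / D = (2 * X - real M) / D / real M" for X D :: real
    proof -
      have "2 * (X / real M) - 1 = (2 * X - real M) / real M" using elim by (simp add: field_simps)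
      then show ?thesis by (simp only: divide_divide_eq_left mult.commute)
    qed
    ultimately show ?case by (simp only: Re_divide_of_nat Re_sum)
  qed
  have "r\<^sup>2 - 1 \<noteq> 0" using one_less_power[OF assms, of 2] by simp
  from tendsto_divide[OF tendsto_diff[OF tendsto_mult[OF tendsto_const[of 2] lim] tendsto_const[of 1]] tendsto_const this]
  show ?thesis by (rule Lim_transform_eventually[THEN back_subst[of "\<lambda>x. _ \<longlonglongrightarrow> x"], OF _ ev]) simp
qed


section \<open>Analyticity from Beurling's condition\<close>

locale beurling_semigroup = multiplier_seminorm +
  fixes a :: "'a \<Rightarrow> real" and n :: nat and \<rho> :: real
  assumes a_nonneg: "\<And>\<xi>. \<xi> \<in> \<Gamma> \<Longrightarrow> a \<xi> \<ge> 0"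
    and contr: "\<And>s. s \<ge> 0 \<Longrightarrow> mb (\<lambda>\<xi>. exp (- of_real (s * a \<xi>))) 1"
    and beurling: "\<And>s. s \<ge> 0 \<Longrightarrow> mb (\<lambda>\<xi>. (1 - exp (- of_real (s * a \<xi>))) ^ n) \<rho>"
    and n: "n > 0" and \<rho>: "0 \<le> \<rho>" "\<rho> < 2 ^ n"
begin

definition C0 where "C0 = real n / (1 - \<rho> / 2 ^ n)"

lemma C0_nonneg: "C0 \<ge> 0"
  unfolding C0_def using \<rho> by simp

text \<open>
  Put \<open>y = 1 - T\<^sub>s\<close> and \<open>\<zeta> = 1 + e \<ge> 2\<close>. Then \<open>e + T\<^sub>s = \<zeta> - y\<close>, and
  \<open>1 / (\<zeta> - y) = (\<Sum>i<n. y\<^sup>i / \<zeta>\<^sup>i\<^sup>+\<^sup>1) / (1 - (y / \<zeta>)\<^sup>n)\<close>, where the denominator is inverted by a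
  Neumann series because \<open>\<parallel>y\<^sup>n\<parallel> \<le> \<rho> < 2\<^sup>n \<le> \<zeta>\<^sup>n\<close>.
\<close>

lemma one_plus_semigroup_inverse:
  assumes s: "s \<ge> 0" and e: "e \<ge> (1::real)"
  shows "mb (\<lambda>\<xi>. 1 / (of_real e + exp (- of_real (s * a \<xi>)))) (C0 / e)"
proof -
  define y where "y \<xi> = 1 - exp (- of_real (s * a \<xi>) :: complex)" for \<xi>
  define yr where "yr \<xi> = 1 - exp (- (s * a \<xi>))" for \<xi>
  have y_yr: "y \<xi> = of_real (yr \<xi>)" for \<xi> by (simp add: y_def yr_def flip: exp_of_real)
  have yr: "0 \<le> yr \<xi>" "yr \<xi> < 1" if "\<xi> \<in> \<Gamma>" for \<xi>
    using a_nonneg[OF that] s by (auto simp: yr_def)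
  define \<zeta> where "\<zeta> = 1 + e"
  have \<zeta>: "\<zeta> \<ge> 2" using e by (simp add: \<zeta>_def)
  have \<zeta>n: "2 ^ n \<le> \<zeta> ^ n" using \<zeta> by (intro power_mono) auto
  have y2: "mb y 2"
    using mb_diff[OF mb_one contr[OF s]] by (simp add: y_def[abs_def])
  have yn: "mb (\<lambda>\<xi>. y \<xi> ^ n) \<rho>" using beurling[OF s] by (simp add: y_def)
  have q: "mb (\<lambda>\<xi>. of_real (1 / \<zeta> ^ n) * y \<xi> ^ n) (\<rho> / 2 ^ n)"
  proof (rule mb_mono[OF mb_cmult[OF yn]])
    have "cmod (of_real (1 / \<zeta> ^ n)) = 1 / \<zeta> ^ n" using \<zeta> by (simp only: norm_of_real) simp
    moreover have "1 / \<zeta> ^ n \<le> 1 / 2 ^ n" using \<zeta>n \<zeta> by (intro divide_left_mono mult_pos_pos zero_less_power) auto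
    ultimately show "cmod (of_real (1 / \<zeta> ^ n)) * \<rho> \<le> \<rho> / 2 ^ n"
      using mult_right_mono[of "1 / \<zeta> ^ n" "1 / 2 ^ n" \<rho>] \<rho>(1) by simp
  qed
  have lt: "yr \<xi> ^ n < \<zeta> ^ n" if "\<xi> \<in> \<Gamma>" for \<xi>
    using yr[OF that] \<zeta> n by (intro power_strict_mono) auto
  have N: "mb (\<lambda>\<xi>. 1 / (1 - of_real (1 / \<zeta> ^ n) * y \<xi> ^ n)) (1 / (1 - \<rho> / 2 ^ n))"
  proof (rule mb_neumann[OF q])
    show "\<rho> / 2 ^ n < 1" using \<rho> by simp
    fix \<xi> assume "\<xi> \<in> \<Gamma>"
    from lt[OF this] have "1 / \<zeta> ^ n * yr \<xi> ^ n \<noteq> 1" using \<zeta> by (auto simp: field_simps)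
    then show "of_real (1 / \<zeta> ^ n) * y \<xi> ^ n \<noteq> 1"
      by (metis y_yr of_real_eq_1_iff of_real_mult of_real_power)
  qed
  have G: "mb (\<lambda>\<xi>. \<Sum>i<n. of_real (1 / \<zeta> ^ Suc i) * y \<xi> ^ i) (\<Sum>i<n. 1 / \<zeta>)"
  proof (rule mb_sum)
    fix i
    show "mb (\<lambda>\<xi>. of_real (1 / \<zeta> ^ Suc i) * y \<xi> ^ i) (1 / \<zeta>)"
    proof (rule mb_mono[OF mb_cmult[OF mb_power[OF y2]]])
      have "cmod (of_real (1 / \<zeta> ^ Suc i)) = 1 / \<zeta> ^ Suc i" using \<zeta> by (simp only: norm_of_real) simp
      moreover have "2 ^ i \<le> \<zeta> ^ i" using \<zeta> by (intro power_mono) auto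
      then have "1 / \<zeta> ^ Suc i * 2 ^ i \<le> 1 / \<zeta>" using \<zeta> by (simp add: field_simps)
      ultimately show "cmod (of_real (1 / \<zeta> ^ Suc i)) * 2 ^ i \<le> 1 / \<zeta>" by metis
    qed simp
  qed
  have "mb (\<lambda>\<xi>. (\<Sum>i<n. of_real (1 / \<zeta> ^ Suc i) * y \<xi> ^ i) * (1 / (1 - of_real (1 / \<zeta> ^ n) * y \<xi> ^ n)))
     ((\<Sum>i<n. 1 / \<zeta>) * (1 / (1 - \<rho> / 2 ^ n)))"
    by (rule mb_mult[OF G N]) (use \<zeta> in \<open>simp add: sum_nonneg\<close>)
  then have "mb (\<lambda>\<xi>. 1 / (of_real e + exp (- of_real (s * a \<xi>))))
     ((\<Sum>i<n. 1 / \<zeta>) * (1 / (1 - \<rho> / 2 ^ n)))"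
  proof (rule mb_cong)
    fix \<xi> assume g: "\<xi> \<in> \<Gamma>"
    have 1: "(\<Sum>i<n. 1 / \<zeta> ^ Suc i * yr \<xi> ^ i) = (1 - 1 / \<zeta> ^ n * yr \<xi> ^ n) / (\<zeta> - yr \<xi>)"
    proof -
      have ne: "yr \<xi> / \<zeta> \<noteq> 1" "\<zeta> \<noteq> 0" "\<zeta> - yr \<xi> \<noteq> 0" using yr[OF g] \<zeta> by auto
      have "(\<Sum>i<n. 1 / \<zeta> ^ Suc i * yr \<xi> ^ i) = (\<Sum>i<n. (yr \<xi> / \<zeta>) ^ i) / \<zeta>"
        by (simp add: power_divide sum_divide_distrib mult.commute)
      also have "(\<Sum>i<n. (yr \<xi> / \<zeta>) ^ i) = ((yr \<xi> / \<zeta>) ^ n - 1) / (yr \<xi> / \<zeta> - 1)"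
        by (rule geometric_sum[OF ne(1)])
      also have "\<dots> / \<zeta> = ((yr \<xi> / \<zeta>) ^ n - 1) / (yr \<xi> - \<zeta>)" using ne by (simp add: field_simps)
      also have "\<dots> = (1 - (yr \<xi> / \<zeta>) ^ n) / (\<zeta> - yr \<xi>)"
        by (metis minus_diff_eq minus_divide_divide)
      finally show ?thesis by (simp add: power_divide)
    qed
    have "1 - 1 / \<zeta> ^ n * yr \<xi> ^ n \<noteq> 0" using lt[OF g] \<zeta> by (auto simp: field_simps)
    then have 2: "(\<Sum>i<n. 1 / \<zeta> ^ Suc i * yr \<xi> ^ i) * (1 / (1 - 1 / \<zeta> ^ n * yr \<xi> ^ n)) = 1 / (\<zeta> - yr \<xi>)"
      unfolding 1 by simp
    have "(\<Sum>i<n. of_real (1 / \<zeta> ^ Suc i) * y \<xi> ^ i) * (1 / (1 - of_real (1 / \<zeta> ^ n) * y \<xi> ^ n)) =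
      of_real ((\<Sum>i<n. 1 / \<zeta> ^ Suc i * yr \<xi> ^ i) * (1 / (1 - 1 / \<zeta> ^ n * yr \<xi> ^ n)))"
      unfolding y_yr by simp
    also have "\<dots> = 1 / (of_real (\<zeta> - yr \<xi>))" unfolding 2 by simp
    also have "of_real (\<zeta> - yr \<xi>) = of_real e + exp (- of_real (s * a \<xi>) :: complex)"
      by (simp add: \<zeta>_def yr_def flip: exp_of_real)
    finally show "(\<Sum>i<n. of_real (1 / \<zeta> ^ Suc i) * y \<xi> ^ i) * (1 / (1 - of_real (1 / \<zeta> ^ n) * y \<xi> ^ n)) =
      1 / (of_real e + exp (- of_real (s * a \<xi>)))" .
  qed
  then show ?thesis
  proof (rule mb_mono)
    have "(\<Sum>i<n. 1 / \<zeta>) * (1 / (1 - \<rho> / 2 ^ n)) = C0 / \<zeta>" by (simp add: C0_def)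
    also have "\<dots> \<le> C0 / e" using e by (intro divide_left_mono C0_nonneg) (auto simp: \<zeta>_def)
    finally show "(\<Sum>i<n. 1 / \<zeta>) * (1 / (1 - \<rho> / 2 ^ n)) \<le> C0 / e" .
  qed
qed

end


lemma exp_quotient_tendsto:
  fixes w :: complex
  shows "((\<lambda>h. (exp (w * of_real h) - 1) / of_real h) \<longlongrightarrow> w) (at_right (0::real))"
proof -
  have "((\<lambda>h. exp (w * h)) has_field_derivative w) (at 0)"
    by (auto intro!: derivative_eq_intros)
  then have 1: "((\<lambda>h. (exp (w * h) - 1) / h) \<longlongrightarrow> w) (at 0)"
    by (simp add: DERIV_def)
  have 2: "filterlim (\<lambda>h. complex_of_real h) (at 0) (at_right 0)"
  proof (rule filterlim_atI)
    show "((\<lambda>h. complex_of_real h) \<longlongrightarrow> 0) (at_right 0)"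
      using tendsto_of_real[OF tendsto_ident_at[of "0::real" "{0<..}"], where ?'a=complex] by simp
    show "\<forall>\<^sub>F h in at_right 0. complex_of_real h \<noteq> 0"
      using eventually_at_right_less[of "0::real"] by eventually_elim auto
  qed
  show ?thesis using filterlim_compose[OF 1 2] by simp
qed

lemma scaled_difference_tendsto:
  fixes z :: complex and b :: real
  shows "((\<lambda>h. (exp (z * of_real h) - exp (- of_real (h * b))) / of_real h) \<longlongrightarrow> z + of_real b) (at_right (0::real))"
proof -
  have "((\<lambda>h. (exp (z * of_real h) - 1) / of_real h - (exp (- of_real b * of_real h) - 1) / of_real h) \<longlongrightarrow> z - (- of_real b)) (at_right (0::real))"
    by (intro tendsto_diff exp_quotient_tendsto)
  then show ?thesis by (simp add: mult.commute flip: diff_divide_distrib)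
qed

context beurling_semigroup
begin

text \<open>
  The resolvent of the generator as a limit of rescaled resolvents of \<open>T\<^sub>h\<close>, which avoids the Laplace
  integral.
\<close>

lemma resolvent_limit:
  assumes z: "Re z \<ge> 0" "z \<noteq> 0" and h: "filterlim h (at_right 0) \<F>" "\<F> \<noteq> bot"
    and b: "\<forall>\<^sub>F M in \<F>. mb (\<lambda>\<xi>. of_real (h M) / (exp (z * of_real (h M)) - exp (- of_real (h M * a \<xi>)))) B"
  shows "mb (\<lambda>\<xi>. 1 / (z + of_real (a \<xi>))) B"
proof (rule mb_tendsto[OF b _ tendsto_const h(2)])
  fix \<xi> assume g: "\<xi> \<in> \<Gamma>"
  have ne: "z + of_real (a \<xi>) \<noteq> 0"
    using z a_nonneg[OF g] by (auto simp: complex_eq_iff)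
  have "((\<lambda>M. (exp (z * of_real (h M)) - exp (- of_real (h M * a \<xi>))) / of_real (h M)) \<longlongrightarrow> z + of_real (a \<xi>)) \<F>"
    by (rule filterlim_compose[OF scaled_difference_tendsto h(1)])
  from tendsto_inverse[OF this ne]
  show "((\<lambda>M. of_real (h M) / (exp (z * of_real (h M)) - exp (- of_real (h M * a \<xi>)))) \<longlongrightarrow> 1 / (z + of_real (a \<xi>))) \<F>"
    by (simp add: inverse_eq_divide)
qed

text \<open>
  Kato's argument. For \<open>s = \<pi> / \<bar>Im z\<bar>\<close> the number \<open>exp (z s)\<close> is \<open>- E\<close> with \<open>E \<ge> 1\<close>, so
  \<open>exp (z s) - T\<^sub>s\<close> is invertible with inverse of norm at most \<open>C0 / E\<close>. With \<open>h = s / M\<close> this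
  operator is \<open>exp (z h) - T\<^sub>h\<close> times a sum of \<open>M\<close> terms of norm at most \<open>E\<close>; hence
  \<open>h / (exp (z h) - T\<^sub>h)\<close> is bounded by \<open>s C0\<close>.
\<close>

lemma resolvent_bound_imaginary:
  assumes z: "Re z \<ge> 0" "Im z \<noteq> 0"
  shows "mb (\<lambda>\<xi>. 1 / (z + of_real (a \<xi>))) (pi * C0 / \<bar>Im z\<bar>)"
proof -
  define s where "s = pi / \<bar>Im z\<bar>"
  have s: "s > 0" using z by (simp add: s_def)
  define E where "E = exp (Re z * s)"
  have E: "E \<ge> 1" using z s by (simp add: E_def)
  have ezs: "exp (z * of_real s) = - of_real E"
  proof -
    have "Im z * s = pi \<or> Im z * s = - pi" using z by (auto simp: s_def abs_if)
    then have "cis (Im z * s) = - 1" by (auto simp: complex_eq_iff)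
    moreover have "exp (z * of_real s) = of_real (exp (Re (z * of_real s))) * cis (Im (z * of_real s))"
      by (rule exp_eq_polar)
    ultimately show ?thesis by (simp add: E_def)
  qed
  have "mb (\<lambda>\<xi>. 1 / (z + of_real (a \<xi>))) (s * C0)"
  proof (rule resolvent_limit[where \<F> = sequentially and h = "\<lambda>M. s / real M"])
    show "filterlim (\<lambda>M. s / real M) (at_right 0) sequentially"
      unfolding filterlim_at
    proof (rule conjI)
      show "(\<lambda>M. s / real M) \<longlonglongrightarrow> 0" by (rule lim_const_over_n)
      show "\<forall>\<^sub>F M in sequentially. s / real M \<in> {0<..} \<and> s / real M \<noteq> 0"
        using eventually_gt_at_top[of 0] by eventually_elim (use s in auto)
    qed
    show "\<forall>\<^sub>F M in sequentially. mb (\<lambda>\<xi>. of_real (s / real M) / (exp (z * of_real (s / real M)) - exp (- of_real (s / real M * a \<xi>)))) (s * C0)"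
      using eventually_gt_at_top[of 0]
    proof eventually_elim
      case (elim M)
      define h where "h = s / real M"
      have h: "h > 0" "real M * h = s" using elim s by (auto simp: h_def)
      define e where "e = exp (z * of_real h)"
      define x where "x \<xi> = exp (- of_real (h * a \<xi>) :: complex)" for \<xi>
      have eM: "e ^ M = - of_real E"
        using h(2) unfolding e_def exp_of_nat_mult[symmetric] ezs[symmetric]
        by (metis mult.left_commute of_real_mult of_real_of_nat_eq)
      have xM: "x \<xi> ^ M = exp (- of_real (s * a \<xi>))" for \<xi>
        unfolding x_def exp_of_nat_mult[symmetric] h(2)[symmetric] by (simp add: mult.assoc)
      have x1: "mb x 1" using contr[of h] h by (simp add: x_def[abs_def])
      have S: "mb (\<lambda>\<xi>. \<Sum>i<M. x \<xi> ^ (M - Suc i) * e ^ i) (\<Sum>i<M. E)"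
      proof (rule mb_sum)
        fix i assume i: "i \<in> {..<M}"
        have "cmod (e ^ i) = exp (real i * (Re z * h))"
          by (simp add: e_def norm_power exp_of_nat_mult)
        also have "\<dots> \<le> exp (real M * (Re z * h))"
          using i z h by (intro exp_le_cancel_iff[THEN iffD2] mult_right_mono) auto
        also have "real M * (Re z * h) = Re z * s" using h(2) by (simp flip: h(2))
        finally have "cmod (e ^ i) \<le> E" by (simp add: E_def)
        then show "mb (\<lambda>\<xi>. x \<xi> ^ (M - Suc i) * e ^ i) E"
          using mb_mono[OF mb_cmult[OF mb_power[OF x1], of "e ^ i" "M - Suc i"]] by (simp add: mult.commute)
      qed
      have P: "mb (\<lambda>\<xi>. (\<Sum>i<M. x \<xi> ^ (M - Suc i) * e ^ i) * (of_real (- h) * (1 / (of_real E + exp (- of_real (s * a \<xi>))))))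
         ((\<Sum>i<M. E) * (cmod (of_real (- h)) * (C0 / E)))"
        by (rule mb_mult[OF S mb_cmult[OF one_plus_semigroup_inverse]]) (use s E in auto)
      have B: "(\<Sum>i<M. E) * (cmod (of_real (- h)) * (C0 / E)) = s * C0"
        using h E by (simp flip: h(2))
      show ?case unfolding h_def[symmetric]
      proof (rule mb_cong[OF P[unfolded B]])
        fix \<xi> assume g: "\<xi> \<in> \<Gamma>"
        have pos: "of_real E + exp (- of_real (s * a \<xi>)) \<noteq> (0::complex)"
        proof -
          have "E + exp (- (s * a \<xi>)) > 0" using E by (simp add: add_pos_pos)
          moreover have "of_real E + exp (- of_real (s * a \<xi>)) = (of_real (E + exp (- (s * a \<xi>))) :: complex)"
            by (simp flip: exp_of_real)
          ultimately show ?thesis by (metis less_irrefl of_real_eq_0_iff)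
        qed
        have key: "(e - x \<xi>) * (\<Sum>i<M. x \<xi> ^ (M - Suc i) * e ^ i) = - (of_real E + exp (- of_real (s * a \<xi>)))"
          using power_diff_sumr2[of e M "x \<xi>"] unfolding eM xM by simp
        then have "e - x \<xi> \<noteq> 0" using pos by (metis mult_zero_left neg_equal_0_iff_equal)
        then have "(\<Sum>i<M. x \<xi> ^ (M - Suc i) * e ^ i) = - (of_real E + exp (- of_real (s * a \<xi>))) / (e - x \<xi>)"
          using key by (metis nonzero_mult_div_cancel_left)
        moreover have "S * (of_real (- h) * (1 / D)) = of_real h / d" if "S = - D / d" "D \<noteq> 0" for S D d :: complex
          using that by simp
        ultimately show "(\<Sum>i<M. x \<xi> ^ (M - Suc i) * e ^ i) * (of_real (- h) * (1 / (of_real E + exp (- of_real (s * a \<xi>))))) =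
          of_real h / (exp (z * of_real h) - exp (- of_real (h * a \<xi>)))"
          using pos unfolding e_def[symmetric] x_def[symmetric] by blast
      qed
    qed
  qed (use z in auto)
  then show ?thesis by (simp add: s_def)
qed

text \<open>
  The Hille--Yosida bound of a contraction semigroup; it covers the directions close to the positive
  axis, where \<open>Im z\<close> is too small for Kato's argument.
\<close>

lemma resolvent_bound_real:
  assumes z: "Re z > 0"
  shows "mb (\<lambda>\<xi>. 1 / (z + of_real (a \<xi>))) (1 / Re z)"
proof (rule resolvent_limit[where \<F> = "at_right 0" and h = "\<lambda>h. h"])
  show "filterlim (\<lambda>h::real. h) (at_right 0) (at_right 0)" by (rule filterlim_ident)
  show "\<forall>\<^sub>F h in at_right 0. mb (\<lambda>\<xi>. of_real h / (exp (z * of_real h) - exp (- of_real (h * a \<xi>)))) (1 / Re z)"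
    using eventually_at_right_less[of "0::real"]
  proof eventually_elim
    case (elim h)
    define e where "e = exp (- z * of_real h)"
    have ne: "cmod e = exp (- (Re z * h))" by (simp add: e_def)
    have e1: "cmod e < 1" using z elim by (simp add: ne)
    define x where "x \<xi> = exp (- of_real (h * a \<xi>) :: complex)" for \<xi>
    have x1: "mb x 1" using contr[of h] elim by (simp add: x_def[abs_def])
    have nx: "cmod (x \<xi>) \<le> 1" if "\<xi> \<in> \<Gamma>" for \<xi> using a_nonneg[OF that] elim by (simp add: x_def)
    have "mb (\<lambda>\<xi>. 1 / (1 - e * x \<xi>)) (1 / (1 - cmod e))"
    proof (rule mb_neumann)
      show "mb (\<lambda>\<xi>. e * x \<xi>) (cmod e)" using mb_cmult[OF x1, of e] by simp
      fix \<xi> assume "\<xi> \<in> \<Gamma>"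
      then have "cmod (e * x \<xi>) < 1" using nx[of \<xi>] e1 mult_left_le[of "cmod (x \<xi>)" "cmod e"] by (simp add: norm_mult)
      then show "e * x \<xi> \<noteq> 1" by auto
    qed (rule e1)
    from mb_cmult[OF this, of "of_real h * e"]
    have "mb (\<lambda>\<xi>. of_real h / (exp (z * of_real h) - exp (- of_real (h * a \<xi>)))) (cmod (of_real h * e) * (1 / (1 - cmod e)))"
    proof (rule mb_cong)
      fix \<xi>
      have "exp (z * of_real h) - x \<xi> = (1 - e * x \<xi>) / e"
        by (simp add: e_def exp_minus field_simps)
      then show "of_real h * e * (1 / (1 - e * x \<xi>)) = of_real h / (exp (z * of_real h) - exp (- of_real (h * a \<xi>)))"
        unfolding x_def[symmetric] by simp
    qed
    then show ?case
    proof (rule mb_mono)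
      have "1 + Re z * h \<le> exp (Re z * h)" by simp
      then have "Re z * h * exp (- (Re z * h)) \<le> 1 - exp (- (Re z * h))"
        by (simp add: exp_minus field_simps)
      then show "cmod (of_real h * e) * (1 / (1 - cmod e)) \<le> 1 / Re z"
        using elim z e1 unfolding norm_mult ne by (simp add: field_simps)
    qed
  qed
qed (use z in auto)

definition C1 where "C1 = 2 * max 1 (pi * C0)"

lemma C1_pos: "C1 > 0" unfolding C1_def by simp

lemma resolvent_bound:
  assumes z: "Re z \<ge> 0" "z \<noteq> 0"
  shows "mb (\<lambda>\<xi>. 1 / (z + of_real (a \<xi>))) (C1 / cmod z)"
proof (cases "\<bar>Im z\<bar> \<ge> cmod z / 2")
  case True
  then have "Im z \<noteq> 0" using z by auto
  show ?thesis
  proof (rule mb_mono[OF resolvent_bound_imaginary[OF z(1) \<open>Im z \<noteq> 0\<close>]])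
    have "pi * C0 / \<bar>Im z\<bar> \<le> pi * C0 / (cmod z / 2)"
      using True C0_nonneg z by (intro divide_left_mono mult_pos_pos) (auto intro!: mult_nonneg_nonneg)
    also have "\<dots> \<le> C1 / cmod z" by (auto simp: C1_def intro!: divide_right_mono)
    finally show "pi * C0 / \<bar>Im z\<bar> \<le> C1 / cmod z" .
  qed
next
  case False
  then have r: "Re z \<ge> cmod z / 2" using z cmod_le[of z] by auto
  have cz: "cmod z > 0" using z by simp
  then have "Re z > 0" using r by linarith
  show ?thesis
  proof (rule mb_mono[OF resolvent_bound_real[OF \<open>Re z > 0\<close>]])
    have "1 / Re z \<le> 1 / (cmod z / 2)"
      using r cz \<open>Re z > 0\<close> by (intro divide_left_mono mult_pos_pos) auto
    also have "\<dots> \<le> C1 / cmod z" by (auto simp: C1_def intro!: divide_right_mono)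
    finally show "1 / Re z \<le> C1 / cmod z" .
  qed
qed

end


context beurling_semigroup
begin

text \<open>
  A step of length \<open>t / m\<close> of the implicit Euler scheme; its \<open>m\<close>-th power approximates \<open>T\<^sub>t\<close>.
\<close>

definition euler :: "real \<Rightarrow> nat \<Rightarrow> 'a \<Rightarrow> complex" where
  "euler t m \<xi> = 1 / (1 + of_real (t * a \<xi> / real m))"

definition C2 where "C2 = 3 + C1"

lemma euler_real: "euler t m \<xi> = of_real (1 / (1 + t * a \<xi> / real m))"
  by (simp add: euler_def)

lemma norm_euler_le:
  assumes "t \<ge> 0" "\<xi> \<in> \<Gamma>"
  shows "cmod (euler t m \<xi>) \<le> 1"
proof -
  have "t * a \<xi> / real m \<ge> 0" using assms a_nonneg[of \<xi>] by simp
  then have "\<bar>1 / (1 + t * a \<xi> / real m)\<bar> \<le> 1" by (metis abs_of_nonneg add_increasing2 divide_le_eq_1_pos le_add_same_cancel1 less_add_same_cancel1 add_pos_nonneg zero_less_one zero_le_divide_1_iff zero_le_one)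
  then show ?thesis by (simp only: euler_real norm_of_real)
qed

text \<open>
  The resolvent of an Euler step is a Moebius transform of the resolvent of the generator, so the half
  plane bound becomes Ritt's condition outside the unit disc.
\<close>

lemma euler_resolvent_bound:
  assumes t: "t > 0" and m: "m > 0" and w: "cmod w > 1" "cmod w \<le> 2"
  shows "mb (\<lambda>\<xi>. 1 / (w - euler t m \<xi>)) (C2 / cmod (w - 1))"
proof -
  define l where "l = 1 - 1 / w"
  have w0: "w \<noteq> 0" "w \<noteq> 1" using w by auto
  have lw: "l = (w - 1) / w" using w0 by (simp add: l_def field_simps)
  have l0: "l \<noteq> 0" using w0 by (simp add: lw)
  have "1 / cmod w \<le> 1" using w by (simp add: divide_le_eq_1)
  then have "Re (1 / w) \<le> 1"
    using complex_Re_le_cmod[of "1 / w"] unfolding norm_divide norm_one by linarith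
  then have Rl: "Re l \<ge> 0" by (simp add: l_def)
  define c where "c = real m / t"
  have c: "c > 0" using t m by (simp add: c_def)
  have "mb (\<lambda>\<xi>. 1 / (of_real c * l + of_real (a \<xi>))) (C1 / cmod (of_real c * l))"
    by (rule resolvent_bound) (use Rl l0 c in auto)
  from mb_cmult[OF this, of "of_real c / w"]
  have "mb (\<lambda>\<xi>. of_real c / w * (1 / (of_real c * l + of_real (a \<xi>)))) (cmod (of_real c / w) * (C1 / cmod (of_real c * l)))" .
  moreover have "cmod (of_real c / w) * (C1 / cmod (of_real c * l)) = C1 / cmod (w - 1)"
    using c w0 by (simp add: norm_mult norm_divide lw)
  ultimately have "mb (\<lambda>\<xi>. of_real c / w * (1 / (of_real c * l + of_real (a \<xi>)))) (C1 / cmod (w - 1))" by simp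
  from mb_cmult[OF mb_add[OF mb_one this], of "1 / w"]
  have "mb (\<lambda>\<xi>. 1 / (w - euler t m \<xi>)) (cmod (1 / w) * (1 + C1 / cmod (w - 1)))"
  proof (rule mb_cong)
    fix \<xi> assume g: "\<xi> \<in> \<Gamma>"
    define X where "X = complex_of_real (t * a \<xi> / real m)"
    have aX: "of_real (a \<xi>) = of_real c * X" using t m by (simp add: X_def c_def)
    have Re0: "Re X \<ge> 0" "Im X = 0" using a_nonneg[OF g] t by (simp_all add: X_def)
    then have X1: "1 + X \<noteq> 0" by (auto simp: complex_eq_iff)
    have lX: "l + X \<noteq> 0"
    proof
      assume "l + X = 0"
      then have "Re l = 0" "Im l = 0" using Rl Re0 by (auto simp: complex_eq_iff)
      then show False using l0 by (simp add: complex_eq_iff)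
    qed
    have "w - euler t m \<xi> = w * (l + X) / (1 + X)"
    proof -
      have "w * l = w - 1" using w0 by (simp add: lw)
      then have num: "w * (l + X) = w * (1 + X) - 1" by (simp add: distrib_left)
      show ?thesis using X1 unfolding euler_def X_def[symmetric] num by (simp add: diff_divide_distrib)
    qed
    then have "1 / (w - euler t m \<xi>) = 1 / w * ((1 + X) / (l + X))" by simp
    also have "(1 + X) / (l + X) = 1 + (1 - l) / (l + X)" using lX by (simp add: field_simps)
    also have "(1 - l) / (l + X) = of_real c / w * (1 / (of_real c * l + of_real c * X))"
    proof -
      have "1 - l = 1 / w" by (simp add: l_def)
      then show ?thesis using c by (simp flip: distrib_left)
    qed
    finally show "1 / w * (1 + of_real c / w * (1 / (of_real c * l + of_real (a \<xi>)))) = 1 / (w - euler t m \<xi>)"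
      unfolding aX by simp
  qed
  then show ?thesis
  proof (rule mb_mono)
    have pos: "cmod (w - 1) > 0" using w0 by simp
    have "cmod (1 / w) \<le> 1" using w by (simp add: norm_divide divide_le_eq_1)
    then have "cmod (1 / w) * (1 + C1 / cmod (w - 1)) \<le> 1 + C1 / cmod (w - 1)"
      using C1_pos pos by (intro mult_left_le_one_le) auto
    moreover have "1 \<le> 3 / cmod (w - 1)"
      using norm_triangle_ineq4[of w 1] w pos by (simp add: field_simps)
    ultimately show "cmod (1 / w) * (1 + C1 / cmod (w - 1)) \<le> C2 / cmod (w - 1)"
      unfolding C2_def add_divide_distrib by linarith
  qed
qed

definition K0 where "K0 = 8 * exp 1 * (1 + C2) * C2\<^sup>2"

lemma C2_pos: "C2 > 0" using C1_pos by (simp add: C2_def)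

lemma K0_pos: "K0 > 0" unfolding K0_def using C2_pos by simp

text \<open>
  Ritt's condition implies \<open>\<parallel>R\<^sup>m (1 - R)\<parallel> = O(1/m)\<close>. The power \<open>R\<^sup>m\<close> is recovered from the cube of the
  resolvent on the circle of radius \<open>1 + 1/m\<close>. One of the three factors is absorbed by \<open>1 - R\<close>, the
  other two contribute \<open>\<bar>w - 1\<bar>\<^sup>-\<^sup>2\<close>, whose mean is known.
\<close>

lemma ritt_bound:
  assumes t: "t > 0" and m: "m > 0"
  shows "mb (\<lambda>\<xi>. of_nat m * euler t m \<xi> ^ m * (1 - euler t m \<xi>)) K0"
proof -
  define r where "r = 1 + 1 / real m"
  have r: "r > 1" "r \<le> 2" using m by (auto simp: r_def)
  define R where "R = euler t m"
  define cp where "cp = circle_point r"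
  have ncp: "cmod (cp M j) = r" for M j using r by (simp add: cp_def norm_circle_point)
  have cp1: "cp M j \<noteq> 1" for M j using ncp[of M j] r by auto
  have res: "mb (\<lambda>\<xi>. 1 / (cp M j - R \<xi>)) (C2 / cmod (cp M j - 1))" for M j
    unfolding R_def by (rule euler_resolvent_bound[OF t m]) (use ncp r in auto)
  have neR: "cp M j - R \<xi> \<noteq> 0" if "\<xi> \<in> \<Gamma>" for M j \<xi>
    using norm_euler_le[of t \<xi> m] that t ncp[of M j] r by (auto simp: R_def)
  have num: "mb (\<lambda>\<xi>. (1 - R \<xi>) / (cp M j - R \<xi>)) (1 + C2)" for M j
  proof -
    have "mb (\<lambda>\<xi>. 1 + (1 - cp M j) * (1 / (cp M j - R \<xi>))) (1 + cmod (1 - cp M j) * (C2 / cmod (cp M j - 1)))"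
      by (rule mb_add[OF mb_one mb_cmult[OF res]])
    moreover have "1 + cmod (1 - cp M j) * (C2 / cmod (cp M j - 1)) = 1 + C2"
      using cp1[of M j] by (simp add: norm_minus_commute)
    ultimately have "mb (\<lambda>\<xi>. 1 + (1 - cp M j) * (1 / (cp M j - R \<xi>))) (1 + C2)" by simp
    then show ?thesis
      by (rule mb_cong) (use neR[of _ M j] in \<open>simp add: field_simps\<close>)
  qed
  define A where "A = r ^ (m + 3) * (1 + C2) * C2\<^sup>2"
  have A0: "A \<ge> 0" using r C2_pos by (simp add: A_def)
  have cube: "mb (\<lambda>\<xi>. cp M j ^ (m + 3) / (cp M j - R \<xi>) ^ 3 * (1 - R \<xi>)) (A * (1 / (cmod (cp M j - 1))\<^sup>2))" for M j
  proof -
    have "mb (\<lambda>\<xi>. (1 - R \<xi>) / (cp M j - R \<xi>) * (1 / (cp M j - R \<xi>)) ^ 2) ((1 + C2) * (C2 / cmod (cp M j - 1)) ^ 2)"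
      by (rule mb_mult[OF num mb_power[OF res]]) (use C2_pos in auto)
    from mb_cmult[OF this, of "cp M j ^ (m + 3)"]
    have "mb (\<lambda>\<xi>. cp M j ^ (m + 3) / (cp M j - R \<xi>) ^ 3 * (1 - R \<xi>)) (cmod (cp M j ^ (m + 3)) * ((1 + C2) * (C2 / cmod (cp M j - 1)) ^ 2))"
      by (rule mb_cong) (simp add: power2_eq_square power3_eq_cube)
    moreover have "cmod (cp M j ^ (m + 3)) * ((1 + C2) * (C2 / cmod (cp M j - 1)) ^ 2) = A * (1 / (cmod (cp M j - 1))\<^sup>2)"
      by (simp only: norm_power ncp A_def power_divide) simp
    ultimately show ?thesis by simp
  qed
  have avg: "mb (\<lambda>\<xi>. (1 / of_nat M) * (\<Sum>j<M. cp M j ^ (m + 3) / (cp M j - R \<xi>) ^ 3 * (1 - R \<xi>)))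
     (cmod (1 / of_nat M) * (\<Sum>j<M. A * (1 / (cmod (cp M j - 1))\<^sup>2)))" for M
    by (rule mb_cmult[OF mb_sum[OF cube]])
  have "mb (\<lambda>\<xi>. of_real ((real m + 1) * (real m + 2) / 2) * R \<xi> ^ m * (1 - R \<xi>)) (A * (1 / (r\<^sup>2 - 1)))"
  proof (rule mb_tendsto[where \<F> = sequentially])
    show "\<forall>\<^sub>F M in sequentially. mb (\<lambda>\<xi>. (1 / of_nat M) * (\<Sum>j<M. cp M j ^ (m + 3) / (cp M j - R \<xi>) ^ 3 * (1 - R \<xi>)))
       (cmod (1 / of_nat M) * (\<Sum>j<M. A * (1 / (cmod (cp M j - 1))\<^sup>2)))"
      using avg by simp
    have "(\<lambda>M. A * ((\<Sum>j<M. 1 / (cmod (cp M j - 1))\<^sup>2) / real M)) \<longlonglongrightarrow> A * (1 / (r\<^sup>2 - 1))"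
      unfolding cp_def by (rule tendsto_mult[OF tendsto_const circle_average_poisson[OF r(1)]])
    moreover have "A * ((\<Sum>j<M. 1 / (cmod (cp M j - 1))\<^sup>2) / real M) = cmod (1 / of_nat M) * (\<Sum>j<M. A * (1 / (cmod (cp M j - 1))\<^sup>2))" for M
      by (simp only: sum_distrib_left[symmetric] norm_divide norm_one norm_of_nat) simp
    ultimately show "(\<lambda>M. cmod (1 / of_nat M) * (\<Sum>j<M. A * (1 / (cmod (cp M j - 1))\<^sup>2))) \<longlonglongrightarrow> A * (1 / (r\<^sup>2 - 1))"
      by (simp only:)
    fix \<xi> assume g: "\<xi> \<in> \<Gamma>"
    have "cmod (R \<xi>) < r" using norm_euler_le[of t \<xi> m] g t r by (simp add: R_def)
    from tendsto_mult[OF circle_average_inverse_cube[OF this] tendsto_const]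
    have "(\<lambda>M. (\<Sum>j<M. cp M j ^ (m + 3) / (cp M j - R \<xi>) ^ 3) / of_nat M * (1 - R \<xi>)) \<longlonglongrightarrow> of_real ((real m + 1) * (real m + 2) / 2) * R \<xi> ^ m * (1 - R \<xi>)"
      unfolding cp_def .
    moreover have "(\<Sum>j<M. cp M j ^ (m + 3) / (cp M j - R \<xi>) ^ 3) / of_nat M * (1 - R \<xi>) =
      (1 / of_nat M) * (\<Sum>j<M. cp M j ^ (m + 3) / (cp M j - R \<xi>) ^ 3 * (1 - R \<xi>))" for M
      by (simp only: sum_distrib_right[symmetric]) simp
    ultimately show "(\<lambda>M. (1 / of_nat M) * (\<Sum>j<M. cp M j ^ (m + 3) / (cp M j - R \<xi>) ^ 3 * (1 - R \<xi>)))
      \<longlonglongrightarrow> of_real ((real m + 1) * (real m + 2) / 2) * R \<xi> ^ m * (1 - R \<xi>)"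
      by (simp only:)
  qed simp
  from mb_cmult[OF this, of "of_real (real m / ((real m + 1) * (real m + 2) / 2))"]
  have "mb (\<lambda>\<xi>. of_nat m * R \<xi> ^ m * (1 - R \<xi>))
     (cmod (of_real (real m / ((real m + 1) * (real m + 2) / 2))) * (A * (1 / (r\<^sup>2 - 1))))"
  proof (rule mb_cong)
    fix \<xi>
    define q where "q = (real m + 1) * (real m + 2) / 2"
    have q: "q \<noteq> 0" using m by (simp add: q_def add_eq_0_iff)
    have "of_real (real m / q) * (of_real q * R \<xi> ^ m * (1 - R \<xi>)) = of_real (real m / q * q) * R \<xi> ^ m * (1 - R \<xi>)"
      by (simp only: of_real_mult mult.assoc)
    also have "real m / q * q = real m" using q by simp
    finally show "of_real (real m / ((real m + 1) * (real m + 2) / 2)) * (of_real ((real m + 1) * (real m + 2) / 2) * R \<xi> ^ m * (1 - R \<xi>)) = of_nat m * R \<xi> ^ m * (1 - R \<xi>)"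
      unfolding q_def by simp
  qed
  then show ?thesis unfolding R_def
  proof (rule mb_mono)
    have "cmod (of_real (real m / ((real m + 1) * (real m + 2) / 2))) = real m / ((real m + 1) * (real m + 2) / 2)"
      by (simp only: norm_of_real) simp
    also have "\<dots> \<le> 2 / real m"
    proof -
      define q where "q = (real m + 1) * (real m + 2) / 2"
      have "q > 0" by (simp add: q_def add_pos_nonneg)
      moreover have "real m * real m \<le> 2 * q" by (simp add: q_def algebra_simps)
      ultimately show ?thesis unfolding q_def[symmetric] using m by (simp add: field_simps)
    qed
    finally have 1: "cmod (of_real (real m / ((real m + 1) * (real m + 2) / 2))) \<le> 2 / real m" .
    have "r\<^sup>2 - 1 = 2 * (1 / real m) + (1 / real m)\<^sup>2" unfolding r_def power2_eq_square by algebra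
    then have "r\<^sup>2 - 1 \<ge> 2 / real m" by simp
    then have "1 / (r\<^sup>2 - 1) \<le> 1 / (2 / real m)" using m
      by (intro divide_left_mono mult_pos_pos) (use one_less_power[OF r(1), of 2] in auto)
    then have 2: "1 / (r\<^sup>2 - 1) \<le> real m / 2" by simp
    have "r ^ m \<le> exp 1" using exp_ge_one_plus_x_over_n_power_n[of m 1] m by (simp add: r_def)
    moreover have "r ^ 3 \<le> 2 ^ 3" using r by (intro power_mono) auto
    ultimately have "r ^ m * r ^ 3 \<le> exp 1 * 2 ^ 3" using r by (intro mult_mono) auto
    then have "A \<le> K0" unfolding A_def K0_def power_add using C2_pos by (intro mult_right_mono) auto
    have "cmod (of_real (real m / ((real m + 1) * (real m + 2) / 2))) * (A * (1 / (r\<^sup>2 - 1))) \<le> 2 / real m * (K0 * (real m / 2))"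
      by (intro mult_mono 1 2 \<open>A \<le> K0\<close>) (use A0 K0_pos r one_less_power[OF r(1), of 2] in auto)
    also have "\<dots> = K0" using m by simp
    finally show "cmod (of_real (real m / ((real m + 1) * (real m + 2) / 2))) * (A * (1 / (r\<^sup>2 - 1))) \<le> K0" .
  qed
qed

text \<open>
  The limit \<open>m \<rightarrow> \<infinity>\<close> of the bound for the Euler scheme. This estimate characterizes bounded analytic
  semigroups among the contraction semigroups.
\<close>

lemma generator_semigroup_bound:
  assumes t: "t > 0"
  shows "mb (\<lambda>\<xi>. of_real (t * a \<xi>) * exp (- of_real (t * a \<xi>))) K0"
proof (rule mb_tendsto[where \<F> = sequentially, OF _ _ tendsto_const])
  show "\<forall>\<^sub>F m in sequentially. mb (\<lambda>\<xi>. of_nat m * euler t m \<xi> ^ m * (1 - euler t m \<xi>)) K0"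
    using eventually_gt_at_top[of 0] by eventually_elim (rule ritt_bound[OF t])
  fix \<xi> assume g: "\<xi> \<in> \<Gamma>"
  define x where "x = t * a \<xi>"
  have x: "x \<ge> 0" using a_nonneg[OF g] t by (simp add: x_def)
  have e: "(\<lambda>m. inverse ((1 + x / real m) ^ m)) \<longlonglongrightarrow> inverse (exp x)"
    by (rule tendsto_inverse[OF tendsto_exp_limit_sequentially]) simp
  have "(\<lambda>m. inverse (1 + x / real m)) \<longlonglongrightarrow> inverse (1 + 0)"
    by (intro tendsto_inverse tendsto_add tendsto_const lim_const_over_n) simp
  then have "(\<lambda>m. inverse ((1 + x / real m) ^ m) * (x * inverse (1 + x / real m))) \<longlonglongrightarrow> inverse (exp x) * (x * inverse (1 + 0))"
    by (intro tendsto_mult e tendsto_const)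
  then have "(\<lambda>m. inverse ((1 + x / real m) ^ m) * (x * inverse (1 + x / real m))) \<longlonglongrightarrow> x * exp (- x)"
    by (simp add: exp_minus mult.commute)
  from tendsto_of_real[OF this, where ?'a=complex]
  have lim: "(\<lambda>m. complex_of_real (inverse ((1 + x / real m) ^ m) * (x * inverse (1 + x / real m)))) \<longlonglongrightarrow> of_real (x * exp (- x))" .
  have "\<forall>\<^sub>F m in sequentially. complex_of_real (inverse ((1 + x / real m) ^ m) * (x * inverse (1 + x / real m))) = of_nat m * euler t m \<xi> ^ m * (1 - euler t m \<xi>)"
    using eventually_gt_at_top[of 0]
  proof eventually_elim
    case (elim m)
    define y where "y = 1 + x / real m"
    have y: "y > 0" using x elim by (simp add: y_def add_pos_nonneg)
    have "euler t m \<xi> = of_real (1 / y)" by (simp add: euler_real y_def x_def)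
    then have "of_nat m * euler t m \<xi> ^ m * (1 - euler t m \<xi>) = complex_of_real (real m * (1 / y) ^ m * (1 - 1 / y))"
      by simp
    also have "real m * (1 / y) ^ m * (1 - 1 / y) = inverse (y ^ m) * (real m * (1 - 1 / y))"
      by (simp add: power_one_over inverse_eq_divide)
    also have "real m * (1 - 1 / y) = x * inverse y"
    proof -
      have "1 - 1 / y = (y - 1) / y" using y by (simp add: field_simps)
      then show ?thesis using elim by (simp add: y_def divide_inverse)
    qed
    finally show ?case unfolding y_def by simp
  qed
  from Lim_transform_eventually[OF lim this]
  show "(\<lambda>m. of_nat m * euler t m \<xi> ^ m * (1 - euler t m \<xi>)) \<longlonglongrightarrow> of_real (t * a \<xi>) * exp (- of_real (t * a \<xi>))"
    unfolding x_def[symmetric] by (simp flip: exp_of_real)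
qed simp

end


lemma power_self_le_exp_fact: "real k ^ k / fact k \<le> exp 1 ^ k"
proof -
  have "(\<Sum>j\<in>{k}. real k ^ j /\<^sub>R fact j) \<le> (\<Sum>j. real k ^ j /\<^sub>R fact j)"
    by (rule sum_le_suminf) (use exp_converges[of "real k"] in \<open>auto simp: sums_iff\<close>)
  also have "\<dots> = exp (real k)" by (simp add: exp_def)
  also have "\<dots> = exp 1 ^ k" using exp_of_nat_mult[of k "1::real"] by simp
  finally show ?thesis by (simp add: divide_inverse mult.commute)
qed

lemma sector_arctan:
  assumes z: "z \<in> sector (arctan c)" and c: "c > 0"
  shows "Re z > 0" "\<bar>Im z\<bar> \<le> Re z * c"
proof -
  have z0: "z \<noteq> 0" and A: "\<bar>Arg z\<bar> < arctan c" using z by (auto simp: sector_def)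
  have lt: "\<bar>Arg z\<bar> < pi / 2" using A arctan_ubound[of c] by linarith
  then have cos: "cos (Arg z) > 0" by (intro cos_gt_zero_pi) auto
  have zc: "z = of_real (cmod z) * cis (Arg z)"
    using z0 by (metis cis_Arg mult.commute nonzero_mult_div_cancel_left norm_eq_zero of_real_eq_0_iff
        rcis_cmod_Arg rcis_def)
  have Re: "Re z = cmod z * cos (Arg z)" and Im: "Im z = cmod z * sin (Arg z)"
    by (subst zc, simp)+
  show "Re z > 0" using Re cos z0 by simp
  have "\<bar>tan (Arg z)\<bar> \<le> c"
  proof -
    have "tan (Arg z) < tan (arctan c)" "tan (- Arg z) < tan (arctan c)"
      by (rule tan_monotone; use A lt arctan_ubound[of c] in linarith)+
    then show ?thesis by (simp add: tan_arctan)
  qed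
  then have "\<bar>sin (Arg z)\<bar> \<le> c * cos (Arg z)"
    using cos by (simp add: tan_def abs_divide field_simps)
  then have "cmod z * \<bar>sin (Arg z)\<bar> \<le> cmod z * (c * cos (Arg z))"
    by (intro mult_left_mono) auto
  then show "\<bar>Im z\<bar> \<le> Re z * c" unfolding Re Im by (simp add: abs_mult mult_ac)
qed

context beurling_semigroup
begin

definition K where "K = exp 1 * K0"

lemma K_pos: "K > 0" using K0_pos by (simp add: K_def)

text \<open>
  \<open>A\<^sup>k T\<^sub>t\<close> is the \<open>k\<close>-th power of \<open>A T\<^sub>t\<^sub>/\<^sub>k\<close>, and \<open>k\<^sup>k \<le> e\<^sup>k k!\<close>.
\<close>

lemma taylor_term_bound:
  assumes t: "t > 0"
  shows "mb (\<lambda>\<xi>. of_real (a \<xi>) ^ k / fact k * exp (- of_real (t * a \<xi>))) ((K / t) ^ k)"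
proof (cases "k = 0")
  case True
  then show ?thesis using contr[of t] t by simp
next
  case False
  define u where "u = t / real k"
  have u: "u > 0" "real k * u = t" using t False by (auto simp: u_def)
  define c :: complex where "c = of_real (1 / (u ^ k * fact k))"
  have "mb (\<lambda>\<xi>. c * (of_real (u * a \<xi>) * exp (- of_real (u * a \<xi>))) ^ k) (cmod c * K0 ^ k)"
    by (rule mb_cmult[OF mb_power[OF generator_semigroup_bound[OF u(1)]]]) (use K0_pos in simp)
  then have "mb (\<lambda>\<xi>. of_real (a \<xi>) ^ k / fact k * exp (- of_real (t * a \<xi>))) (cmod c * K0 ^ k)"
  proof (rule mb_cong)
    fix \<xi>
    have "exp (- of_real (u * a \<xi>) :: complex) ^ k = exp (- of_real (t * a \<xi>))"
      unfolding exp_of_nat_mult[symmetric] u(2)[symmetric] by (simp add: mult.assoc)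
    then show "c * (of_real (u * a \<xi>) * exp (- of_real (u * a \<xi>))) ^ k = of_real (a \<xi>) ^ k / fact k * exp (- of_real (t * a \<xi>))"
      using u by (simp only: power_mult_distrib) (simp add: c_def power_mult_distrib)
  qed
  then show ?thesis
  proof (rule mb_mono)
    have "cmod c = 1 / (u ^ k * fact k)" using u unfolding c_def norm_of_real by simp
    also have "\<dots> = (real k ^ k / fact k) / t ^ k" by (simp add: u_def power_divide)
    also have "\<dots> \<le> exp 1 ^ k / t ^ k" using t by (intro divide_right_mono power_self_le_exp_fact) auto
    finally have "cmod c * K0 ^ k \<le> exp 1 ^ k / t ^ k * K0 ^ k" using K0_pos by (intro mult_right_mono) auto
    then show "cmod c * K0 ^ k \<le> (K / t) ^ k" by (simp add: K_def power_divide power_mult_distrib)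
  qed
qed

lemma geometric_half_sum_le: "0 \<le> x \<Longrightarrow> x \<le> 1 / 2 \<Longrightarrow> (\<Sum>k<L. x ^ k) \<le> (2::real)"
proof -
  assume x: "0 \<le> x" "x \<le> 1/2"
  have "(\<Sum>k<L. x ^ k) = (1 - x ^ L) / (1 - x)" using x by (simp add: sum_gp_strict)
  also have "\<dots> \<le> 1 / (1 - x)" using x by (intro divide_right_mono) auto
  also have "\<dots> \<le> 2" using x by (simp add: field_simps)
  finally show ?thesis .
qed

text \<open>
  The Taylor series of \<open>exp (- z a)\<close> around \<open>Re z\<close>; the aperture is chosen so that its terms are
  dominated by a geometric series of ratio at most one half.
\<close>

lemma sector_bound:
  assumes t: "Re z > 0" and I: "\<bar>Im z\<bar> \<le> Re z / (2 * K)"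
  shows "mb (\<lambda>\<xi>. exp (- z * of_real (a \<xi>))) 2"
proof -
  define b where "b = - (\<i> * of_real (Im z))"
  have nb: "cmod b = \<bar>Im z\<bar>" by (simp add: b_def norm_mult)
  define T where "T k \<xi> = complex_of_real (a \<xi>) ^ k / fact k * exp (- of_real (Re z * a \<xi>))" for k \<xi>
  have T: "mb (T k) ((K / Re z) ^ k)" for k unfolding T_def[abs_def] by (rule taylor_term_bound[OF t])
  have x: "\<bar>Im z\<bar> * (K / Re z) \<le> 1 / 2" using I t K_pos by (simp add: field_simps)
  have x0: "0 \<le> \<bar>Im z\<bar> * (K / Re z)" using t K_pos by simp
  show ?thesis
  proof (rule mb_tendsto[where \<F> = sequentially, OF _ _ tendsto_const])
    show "\<forall>\<^sub>F L in sequentially. mb (\<lambda>\<xi>. \<Sum>k<L. b ^ k * T k \<xi>) 2"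
    proof (rule always_eventually, rule allI)
      fix L
      have "mb (\<lambda>\<xi>. \<Sum>k<L. b ^ k * T k \<xi>) (\<Sum>k<L. cmod (b ^ k) * (K / Re z) ^ k)"
        by (rule mb_sum[OF mb_cmult[OF T]])
      then show "mb (\<lambda>\<xi>. \<Sum>k<L. b ^ k * T k \<xi>) 2"
        by (rule mb_mono) (use geometric_half_sum_le[OF x0 x] in \<open>simp only: norm_power nb power_mult_distrib\<close>)
    qed
    fix \<xi>
    have "(\<lambda>k. (b * of_real (a \<xi>)) ^ k /\<^sub>R fact k) sums exp (b * of_real (a \<xi>))" by (rule exp_converges)
    then have "(\<lambda>k. (b * of_real (a \<xi>)) ^ k /\<^sub>R fact k * exp (- of_real (Re z * a \<xi>))) sums (exp (b * of_real (a \<xi>)) * exp (- of_real (Re z * a \<xi>)))"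
      by (rule sums_mult2)
    moreover have "(b * of_real (a \<xi>)) ^ k /\<^sub>R fact k * exp (- of_real (Re z * a \<xi>)) = b ^ k * T k \<xi>" for k
      by (simp add: T_def power_mult_distrib scaleR_conv_of_real divide_inverse mult_ac)
    moreover have "exp (b * of_real (a \<xi>)) * exp (- of_real (Re z * a \<xi>)) = exp (- z * of_real (a \<xi>))"
      unfolding exp_add[symmetric] by (rule arg_cong[of _ _ exp]) (simp add: b_def complex_eq_iff)
    ultimately show "(\<lambda>L. \<Sum>k<L. b ^ k * T k \<xi>) \<longlonglongrightarrow> exp (- z * of_real (a \<xi>))"
      by (simp add: sums_def)
  qed simp
qed

text \<open>
  One half of \<open>Re z\<close> is spent on the derivatives, the other half on the bound in the larger sector.
\<close>

lemma sector_taylor_term_bound: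
  assumes t: "Re z > 0" and I: "\<bar>Im z\<bar> \<le> Re z / (4 * K)"
  shows "mb (\<lambda>\<xi>. of_real (a \<xi>) ^ k / fact k * exp (- z * of_real (a \<xi>))) ((2 * K / Re z) ^ k * 2)"
proof -
  define u where "u = Re z / 2"
  have u: "u > 0" using t by (simp add: u_def)
  have "mb (\<lambda>\<xi>. of_real (a \<xi>) ^ k / fact k * exp (- of_real (u * a \<xi>)) * exp (- (z - of_real u) * of_real (a \<xi>))) ((K / u) ^ k * 2)"
    by (rule mb_mult[OF taylor_term_bound[OF u] sector_bound]) (use u K_pos I in \<open>auto simp: u_def\<close>)
  then show ?thesis
    by (rule mb_cong[OF mb_mono]) (auto simp: u_def mult.assoc exp_add[symmetric] algebra_simps simp flip: exp_add)
qed

lemma sector_difference_quotient_bound: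
  assumes t: "Re z > 0" and I: "\<bar>Im z\<bar> \<le> Re z / (4 * K)" and h: "h \<noteq> 0" "cmod h \<le> Re z / (4 * K)"
  shows "mb (\<lambda>\<xi>. inverse h * (exp (- (z + h) * of_real (a \<xi>)) - exp (- z * of_real (a \<xi>))) + of_real (a \<xi>) * exp (- z * of_real (a \<xi>)))
     (4 * (2 * K / Re z)\<^sup>2 * cmod h)"
proof -
  define T where "T k \<xi> = complex_of_real (a \<xi>) ^ k / fact k * exp (- z * of_real (a \<xi>))" for k \<xi>
  define c where "c = 2 * K / Re z"
  have c: "c > 0" using t K_pos by (simp add: c_def)
  have T: "mb (T k) (c ^ k * 2)" for k unfolding T_def[abs_def] c_def by (rule sector_taylor_term_bound[OF t I])
  have x: "cmod h * c \<le> 1 / 2" using h(2) t K_pos by (simp add: c_def field_simps)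
  have x0: "0 \<le> cmod h * c" using c by simp
  define d where "d k = (- 1) ^ k * h ^ (k + 1)" for k
  show ?thesis
  proof (rule mb_tendsto[where \<F> = sequentially, OF _ _ tendsto_const])
    show "\<forall>\<^sub>F L in sequentially. mb (\<lambda>\<xi>. \<Sum>k<L. d k * T (k + 2) \<xi>) (4 * (2 * K / Re z)\<^sup>2 * cmod h)"
    proof (rule always_eventually, rule allI)
      fix L
      have "mb (\<lambda>\<xi>. \<Sum>k<L. d k * T (k + 2) \<xi>) (\<Sum>k<L. cmod (d k) * (c ^ (k + 2) * 2))"
        by (rule mb_sum[OF mb_cmult[OF T]])
      then show "mb (\<lambda>\<xi>. \<Sum>k<L. d k * T (k + 2) \<xi>) (4 * (2 * K / Re z)\<^sup>2 * cmod h)"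
      proof (rule mb_mono)
        have "(\<Sum>k<L. cmod (d k) * (c ^ (k + 2) * 2)) = 2 * c\<^sup>2 * cmod h * (\<Sum>k<L. (cmod h * c) ^ k)"
          by (simp add: d_def norm_mult norm_power power_mult_distrib sum_distrib_left power2_eq_square mult_ac)
        also have "\<dots> \<le> 2 * c\<^sup>2 * cmod h * 2"
          by (intro mult_left_mono geometric_half_sum_le[OF x0 x]) simp
        finally show "(\<Sum>k<L. cmod (d k) * (c ^ (k + 2) * 2)) \<le> 4 * (2 * K / Re z)\<^sup>2 * cmod h"
          by (simp add: c_def)
      qed
    qed
    fix \<xi>
    define A where "A = complex_of_real (a \<xi>)"
    define e where "e = exp (- z * A)"
    have "(\<lambda>k. (- h * A) ^ k /\<^sub>R fact k) sums exp (- h * A)" by (rule exp_converges)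
    then have "(\<lambda>k. (- h * A) ^ (k + 2) /\<^sub>R fact (k + 2)) sums (exp (- h * A) - (\<Sum>k<2. (- h * A) ^ k /\<^sub>R fact k))"
      by (rule sums_split_initial_segment)
    then have "(\<lambda>k. (- h * A) ^ (k + 2) /\<^sub>R fact (k + 2) * (e / h)) sums ((exp (- h * A) - (\<Sum>k<2. (- h * A) ^ k /\<^sub>R fact k)) * (e / h))"
      by (rule sums_mult2)
    moreover have "(- h * A) ^ (k + 2) /\<^sub>R fact (k + 2) * (e / h) = d k * T (k + 2) \<xi>" for k
    proof -
      have "(- h * A) ^ (k + 2) = (- 1) ^ k * h ^ (k + 1) * h * A ^ (k + 2)"
        by (simp only: mult_minus_left power_minus[of "h * A" "k + 2"]) (simp add: power_mult_distrib power2_eq_square)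
      then have "(- h * A) ^ (k + 2) * (e / h) = (- 1) ^ k * h ^ (k + 1) * h * A ^ (k + 2) * (e / h)"
        by (rule arg_cong)
      also have "\<dots> = (- 1) ^ k * h ^ (k + 1) * A ^ (k + 2) * e"
        using h(1) by simp
      finally have "(- h * A) ^ (k + 2) * (e / h) = (- 1) ^ k * h ^ (k + 1) * A ^ (k + 2) * e" .
      moreover have "(- h * A) ^ (k + 2) /\<^sub>R fact (k + 2) * (e / h) = ((- h * A) ^ (k + 2) * (e / h)) / of_real (fact (k + 2))"
        by (simp only: scaleR_conv_of_real of_real_inverse divide_inverse mult_ac)
      ultimately show ?thesis
        unfolding d_def T_def A_def[symmetric] e_def[symmetric] by (simp only: of_real_fact) simp
    qed
    moreover have "(exp (- h * A) - (\<Sum>k<2. (- h * A) ^ k /\<^sub>R fact k)) * (e / h) = inverse h * (exp (- (z + h) * A) - e) + A * e"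
    proof -
      have "(\<Sum>k<2. (- h * A) ^ k /\<^sub>R fact k) = 1 - h * A" by (simp add: numeral_2_eq_2)
      moreover have "exp (- (z + h) * A) = exp (- h * A) * e"
        unfolding e_def exp_add[symmetric] by (rule arg_cong[of _ _ exp]) (simp add: algebra_simps)
      moreover have "(E - (1 - h * A)) * (e / h) = inverse h * (E * e - e) + A * e" for E
        using h(1) by (simp add: field_simps)
      ultimately show ?thesis by (simp only:)
    qed
    ultimately have "(\<lambda>k. d k * T (k + 2) \<xi>) sums (inverse h * (exp (- (z + h) * A) - e) + A * e)"
      by (simp only:)
    then show "(\<lambda>L. \<Sum>k<L. d k * T (k + 2) \<xi>) \<longlonglongrightarrow> inverse h * (exp (- (z + h) * of_real (a \<xi>)) - exp (- z * of_real (a \<xi>))) + of_real (a \<xi>) * exp (- z * of_real (a \<xi>))"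
      unfolding sums_def A_def e_def .
  qed simp
qed

text \<open>
  The aperture \<open>arctan (1 / (4 K))\<close> leaves room for a disc around each point of the sector that lies
  in the larger sector of the bound, with the Taylor series converging in this disc.
\<close>

theorem analytic_multipliers:
  obtains \<theta> where "0 < \<theta>" "\<theta> < pi / 2"
    and "\<And>z. z \<in> sector \<theta> \<Longrightarrow> mb (\<lambda>\<xi>. exp (- z * of_real (a \<xi>))) 2"
    and "\<And>z. z \<in> sector \<theta> \<Longrightarrow> \<exists>B. mb (\<lambda>\<xi>. - of_real (a \<xi>) * exp (- z * of_real (a \<xi>))) B"
    and "\<And>z. z \<in> sector \<theta> \<Longrightarrow> \<exists>\<delta>>0. \<exists>B. \<forall>w. w \<noteq> z \<longrightarrow> cmod (w - z) < \<delta> \<longrightarrow>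
       mb (\<lambda>\<xi>. inverse (w - z) * (exp (- w * of_real (a \<xi>)) - exp (- z * of_real (a \<xi>))) - (- of_real (a \<xi>) * exp (- z * of_real (a \<xi>)))) (B * cmod (w - z))"
proof
  define c where "c = 1 / (4 * K)"
  have c: "c > 0" using K_pos by (simp add: c_def)
  show "0 < arctan c" "arctan c < pi / 2" using c arctan_ubound by auto
  fix z assume z: "z \<in> sector (arctan c)"
  have R: "Re z > 0" and I: "\<bar>Im z\<bar> \<le> Re z / (4 * K)"
    using sector_arctan[OF z c] by (auto simp: c_def)
  have I2: "\<bar>Im z\<bar> \<le> Re z / (2 * K)"
    using R K_pos by (intro order_trans[OF I] divide_left_mono) auto
  show "mb (\<lambda>\<xi>. exp (- z * of_real (a \<xi>))) 2" by (rule sector_bound[OF R I2])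
  show "\<exists>B. mb (\<lambda>\<xi>. - of_real (a \<xi>) * exp (- z * of_real (a \<xi>))) B"
    using mb_cmult[OF sector_taylor_term_bound[OF R I, of 1], of "-1"] by auto
  show "\<exists>\<delta>>0. \<exists>B. \<forall>w. w \<noteq> z \<longrightarrow> cmod (w - z) < \<delta> \<longrightarrow>
       mb (\<lambda>\<xi>. inverse (w - z) * (exp (- w * of_real (a \<xi>)) - exp (- z * of_real (a \<xi>))) - (- of_real (a \<xi>) * exp (- z * of_real (a \<xi>)))) (B * cmod (w - z))"
  proof (intro exI conjI allI impI)
    show "Re z / (4 * K) > 0" using R K_pos by simp
    fix w assume w: "w \<noteq> z" "cmod (w - z) < Re z / (4 * K)"
    show "mb (\<lambda>\<xi>. inverse (w - z) * (exp (- w * of_real (a \<xi>)) - exp (- z * of_real (a \<xi>))) - (- of_real (a \<xi>) * exp (- z * of_real (a \<xi>)))) (4 * (2 * K / Re z)\<^sup>2 * cmod (w - z))"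
      using sector_difference_quotient_bound[OF R I, of "w - z"] w by simp
  qed
qed

end


section \<open>Powers of differences of dilated contractions\<close>

abbreviation sign_choices :: "nat \<Rightarrow> (nat \<Rightarrow> real) set" where
  "sign_choices n \<equiv> PiE {..<n} (\<lambda>_. {-1, 1})"

lemma card_sign_choices: "card (sign_choices n) = 2 ^ n"
  by (simp add: card_PiE numeral_2_eq_2)

lemma finite_sign_choices: "finite (sign_choices n)"
  by (rule finite_PiE) auto

lemma minus_le_binomial_Suc: "b < n \<Longrightarrow> n - b \<le> n choose Suc b"
proof (induction n)
  case (Suc n)
  show ?case
  proof (cases "b < n")
    case True
    moreover have "n choose b \<ge> 1" using True by (simp add: Suc_le_eq)
    ultimately show ?thesis using Suc.IH[OF True] by simp
  next
    case False
    then have "b = n" using Suc.prems by simp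
    then show ?thesis by simp
  qed
qed simp

lemma scaleR_as_scaleC: "r *\<^sub>R (x::'a::complex_banach) = of_real r *\<^sub>C x"
  by (rule scaleR_scaleC)

context multiplier_seminorm
begin

text \<open>
  A quantitative form of the absence of almost isometric copies of \<open>\<ell>\<^sub>1\<^sup>n\<close>: for vectors in the unit
  ball the trivial bound for the sum over the signs is \<open>2\<^sup>n n\<close>.
\<close>

definition sign_gap :: "nat \<Rightarrow> real \<Rightarrow> bool" where
  "sign_gap n \<epsilon> \<longleftrightarrow> (\<forall>F v. finite F \<longrightarrow> F \<subseteq> \<Gamma> \<longrightarrow> (\<forall>k<n. nu F (v k) \<le> 1) \<longrightarrow>
     (\<Sum>\<eta>\<in>sign_choices n. nu F (\<lambda>\<xi>. \<Sum>k<n. \<eta> k *\<^sub>R v k \<xi>)) \<le> 2 ^ n * real n - \<epsilon>)"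

lemma isometry_combination:
  fixes c :: "'i \<Rightarrow> complex" and u :: "'i \<Rightarrow> 'c \<Rightarrow> complex"
  assumes "\<And>i. i \<in> I \<Longrightarrow> mb (u i) 1" and "(\<Sum>i\<in>I. cmod (c i)) = 1"
  shows "mb (\<lambda>\<xi>. \<Sum>i\<in>I. c i * u i \<xi>) 1"
  using mb_sum[of I "\<lambda>i \<xi>. c i * u i \<xi>" "\<lambda>i. cmod (c i) * 1"] mb_cmult[OF assms(1)] assms(2) by simp

text \<open>
  Here \<open>T = \<Sum> \<bar>c\<^sub>i\<bar> s\<^sub>i u\<^sub>i\<close> with \<open>s\<^sub>i = sgn c\<^sub>i\<close>. For each tuple \<open>i\<close> of indices the gap applies to
  the vectors \<open>s\<^sub>i\<^sub>k u\<^sub>i\<^sub>k T\<^sup>* v\<close> of the unit ball, and averaging with the weights \<open>W i = \<Prod> \<bar>c\<^sub>i\<^sub>k\<bar>\<close>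
  leaves one sign pattern \<open>\<eta>\<close> that gains for the mean over the tuples. Let \<open>B\<close> be the set of its plus
  signs. Multiplying by the contraction \<open>\<Prod>\<^sub>j\<^sub>\<in>\<^sub>B (s\<^sub>i\<^sub>j u\<^sub>i\<^sub>j)\<^sup>*\<close> before averaging, the mean over the
  tuples factors: for \<open>k \<in> B\<close> the isometry number \<open>k\<close> cancels and \<open>b - 1\<close> factors \<open>T\<^sup>*\<close> remain, for
  \<open>k \<notin> B\<close> there are \<open>b\<close> factors \<open>T\<^sup>*\<close> and one factor \<open>T\<close>. After a multiplication by \<open>T\<^sup>b\<close> everything
  is a power of \<open>P = T T\<^sup>*\<close>.
\<close>

lemma dilation_estimate:
  fixes c :: "'i \<Rightarrow> complex" and u :: "'i \<Rightarrow> 'c \<Rightarrow> complex"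
  assumes gap: "sign_gap n \<epsilon>"
    and I: "finite I" "(\<Sum>i\<in>I. cmod (c i)) = 1"
    and u: "\<And>i. i \<in> I \<Longrightarrow> mb (u i) 1" "\<And>i. i \<in> I \<Longrightarrow> mb (\<lambda>\<xi>. cnj (u i \<xi>)) 1"
      "\<And>i \<xi>. i \<in> I \<Longrightarrow> \<xi> \<in> \<Gamma> \<Longrightarrow> cmod (u i \<xi>) = 1"
    and F: "finite F" "F \<subseteq> \<Gamma>" and v: "nu F v \<le> 1"
  defines "T \<equiv> \<lambda>\<xi>. \<Sum>i\<in>I. c i * u i \<xi>"
  defines "P \<equiv> \<lambda>\<xi>. T \<xi> * cnj (T \<xi>)"
  shows "\<exists>b\<le>n. nu F (\<lambda>\<xi>. (of_nat b * P \<xi> ^ b - of_nat (n - b) * P \<xi> ^ Suc b) *\<^sub>C v \<xi>) \<le> real n - \<epsilon> / 2 ^ n"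
proof -
  define s where "s i = sgn (c i)" for i
  have sc: "of_real (cmod (c i)) * s i = c i" for i by (simp add: s_def sgn_eq)
  have ns: "cmod (s i) \<le> 1" for i by (simp add: s_def norm_sgn)
  have ss: "of_real (cmod (c i)) * (cnj (s i) * s i) = of_real (cmod (c i))" for i
  proof (cases "c i = 0")
    case False
    then have "s i * cnj (s i) = 1" by (simp add: s_def complex_norm_square[symmetric] norm_sgn)
    then show ?thesis by (simp add: mult.commute)
  qed simp
  have T1: "mb T 1" unfolding T_def by (rule isometry_combination[OF u(1) I(2)])
  have T'eq: "cnj (T \<xi>) = (\<Sum>i\<in>I. cnj (c i) * cnj (u i \<xi>))" for \<xi> by (simp add: T_def)
  have T'1: "mb (\<lambda>\<xi>. cnj (T \<xi>)) 1" unfolding T'eq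
    by (rule isometry_combination) (use u(2) I(2) in auto)
  define J where "J = PiE {..<n} (\<lambda>_. I)"
  have finJ: "finite J" unfolding J_def by (rule finite_PiE) (use I in auto)
  define W where "W i = (\<Prod>k<n. cmod (c (i k)))" for i :: "nat \<Rightarrow> 'i"
  have W0: "W i \<ge> 0" for i unfolding W_def by (intro prod_nonneg) auto
  have W1: "(\<Sum>i\<in>J. W i) = 1"
  proof -
    have "(\<Sum>i\<in>J. W i) = (\<Prod>k<n. \<Sum>i\<in>I. cmod (c i))"
      unfolding J_def W_def by (rule prod_sum_PiE[symmetric]) (use I in auto)
    then show ?thesis using I by simp
  qed
  define G where "G \<eta> i \<xi> = (\<Sum>k<n. of_real (\<eta> k) * (s (i k) * u (i k) \<xi> * cnj (T \<xi>)))" for \<eta> :: "nat \<Rightarrow> real" and i \<xi>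
  have avg: "(\<Sum>\<eta>\<in>sign_choices n. nu F (\<lambda>\<xi>. G \<eta> i \<xi> *\<^sub>C v \<xi>)) \<le> 2 ^ n * real n - \<epsilon>" if i: "i \<in> J" for i
  proof -
    have "nu F (\<lambda>\<xi>. (s (i k) * u (i k) \<xi> * cnj (T \<xi>)) *\<^sub>C v \<xi>) \<le> 1" if "k < n" for k
    proof -
      have ik: "i k \<in> I" using i that by (auto simp: J_def)
      have "mb (\<lambda>\<xi>. (s (i k) * u (i k) \<xi>) * cnj (T \<xi>)) (cmod (s (i k)) * 1 * 1)"
        by (rule mb_mult[OF mb_cmult[OF u(1)[OF ik]] T'1]) simp
      from mbD[OF this F, of v] have "nu F (\<lambda>\<xi>. (s (i k) * u (i k) \<xi> * cnj (T \<xi>)) *\<^sub>C v \<xi>) \<le> cmod (s (i k)) * nu F v"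
        by simp
      also have "\<dots> \<le> 1 * 1" by (intro mult_mono ns v nu_nonneg) simp
      finally show ?thesis by simp
    qed
    then have "(\<Sum>\<eta>\<in>sign_choices n. nu F (\<lambda>\<xi>. \<Sum>k<n. \<eta> k *\<^sub>R (s (i k) * u (i k) \<xi> * cnj (T \<xi>)) *\<^sub>C v \<xi>)) \<le> 2 ^ n * real n - \<epsilon>"
      by (intro gap[unfolded sign_gap_def, rule_format, OF F])
    moreover have "(\<Sum>k<n. \<eta> k *\<^sub>R (s (i k) * u (i k) \<xi> * cnj (T \<xi>)) *\<^sub>C v \<xi>) = G \<eta> i \<xi> *\<^sub>C v \<xi>" for \<eta> \<xi>
      unfolding G_def by (simp add: scaleC_sum_left scaleR_as_scaleC scaleC_scaleC)
    ultimately show ?thesis by simp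
  qed
  have "\<exists>\<eta>\<in>sign_choices n. (\<Sum>i\<in>J. W i * nu F (\<lambda>\<xi>. G \<eta> i \<xi> *\<^sub>C v \<xi>)) \<le> real n - \<epsilon> / 2 ^ n"
  proof (rule ccontr)
    assume "\<not> ?thesis"
    then have "real n - \<epsilon> / 2 ^ n < (\<Sum>i\<in>J. W i * nu F (\<lambda>\<xi>. G \<eta> i \<xi> *\<^sub>C v \<xi>))" if "\<eta> \<in> sign_choices n" for \<eta>
      using that by force
    then have "(\<Sum>\<eta>\<in>sign_choices n. real n - \<epsilon> / 2 ^ n) < (\<Sum>\<eta>\<in>sign_choices n. \<Sum>i\<in>J. W i * nu F (\<lambda>\<xi>. G \<eta> i \<xi> *\<^sub>C v \<xi>))"
      by (intro sum_strict_mono finite_sign_choices) (auto simp: PiE_eq_empty_iff)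
    also have "\<dots> = (\<Sum>i\<in>J. W i * (\<Sum>\<eta>\<in>sign_choices n. nu F (\<lambda>\<xi>. G \<eta> i \<xi> *\<^sub>C v \<xi>)))"
      by (subst sum.swap) (simp add: sum_distrib_left)
    also have "\<dots> \<le> (\<Sum>i\<in>J. W i * (2 ^ n * real n - \<epsilon>))"
      by (intro sum_mono mult_left_mono avg W0) auto
    also have "\<dots> = 2 ^ n * real n - \<epsilon>" using W1 by (simp flip: sum_distrib_right)
    also have "(\<Sum>\<eta>\<in>sign_choices n. real n - \<epsilon> / 2 ^ n) = 2 ^ n * (real n - \<epsilon> / 2 ^ n)"
      by (simp only: sum_constant card_sign_choices) simp
    also have "\<dots> = 2 ^ n * real n - \<epsilon>" by (simp add: right_diff_distrib)
    finally show False by simp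
  qed
  then obtain \<eta> where \<eta>: "\<eta> \<in> sign_choices n"
    and le: "(\<Sum>i\<in>J. W i * nu F (\<lambda>\<xi>. G \<eta> i \<xi> *\<^sub>C v \<xi>)) \<le> real n - \<epsilon> / 2 ^ n" by blast
  define B where "B = {k. k < n \<and> \<eta> k = 1}"
  have B: "B \<subseteq> {..<n}" "finite B" by (auto simp: B_def)
  define b where "b = card B"
  have bn: "b \<le> n" using card_mono[OF _ B(1)] by (simp add: b_def)
  define L where "L i \<xi> = (\<Prod>j\<in>B. cnj (s (i j)) * cnj (u (i j) \<xi>))" for i \<xi>
  have L1: "mb (L i) 1" if "i \<in> J" for i
    unfolding L_def[abs_def]
  proof (rule mb_prod)
    fix j assume "j \<in> B"
    then have "i j \<in> I" using that B by (auto simp: J_def)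
    from mb_cmult[OF u(2)[OF this], of "cnj (s (i j))"]
    show "mb (\<lambda>\<xi>. cnj (s (i j)) * cnj (u (i j) \<xi>)) 1"
      by (rule mb_mono) (use ns[of "i j"] in simp)
  qed
  have "mb (\<lambda>\<xi>. T \<xi> ^ b) (1 ^ b)" by (rule mb_power[OF T1]) simp
  from mbD[OF this F, of "\<lambda>\<xi>. \<Sum>i\<in>J. (of_real (W i) * L i \<xi> * G \<eta> i \<xi>) *\<^sub>C v \<xi>"]
  have "nu F (\<lambda>\<xi>. T \<xi> ^ b *\<^sub>C (\<Sum>i\<in>J. (of_real (W i) * L i \<xi> * G \<eta> i \<xi>) *\<^sub>C v \<xi>)) \<le>
    nu F (\<lambda>\<xi>. \<Sum>i\<in>J. (of_real (W i) * L i \<xi> * G \<eta> i \<xi>) *\<^sub>C v \<xi>)" by simp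
  also have "\<dots> \<le> (\<Sum>i\<in>J. nu F (\<lambda>\<xi>. (of_real (W i) * L i \<xi> * G \<eta> i \<xi>) *\<^sub>C v \<xi>))" by (rule nu_sum[OF F])
  also have "\<dots> \<le> (\<Sum>i\<in>J. W i * nu F (\<lambda>\<xi>. G \<eta> i \<xi> *\<^sub>C v \<xi>))"
  proof (rule sum_mono)
    fix i assume "i \<in> J"
    from mbD[OF mb_cmult[OF L1[OF this], of "of_real (W i)"] F, of "\<lambda>\<xi>. G \<eta> i \<xi> *\<^sub>C v \<xi>"]
    show "nu F (\<lambda>\<xi>. (of_real (W i) * L i \<xi> * G \<eta> i \<xi>) *\<^sub>C v \<xi>) \<le> W i * nu F (\<lambda>\<xi>. G \<eta> i \<xi> *\<^sub>C v \<xi>)"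
      using W0[of i] by (simp add: scaleC_scaleC)
  qed
  also note le
  finally have fin: "nu F (\<lambda>\<xi>. T \<xi> ^ b *\<^sub>C (\<Sum>i\<in>J. (of_real (W i) * L i \<xi> * G \<eta> i \<xi>) *\<^sub>C v \<xi>)) \<le> real n - \<epsilon> / 2 ^ n" .
  have eq: "T \<xi> ^ b * (\<Sum>i\<in>J. of_real (W i) * L i \<xi> * G \<eta> i \<xi>) = of_nat b * P \<xi> ^ b - of_nat (n - b) * P \<xi> ^ Suc b"
    if g: "\<xi> \<in> F" for \<xi>
  proof -
    have u1: "cnj (u i \<xi>) * u i \<xi> = 1" if "i \<in> I" for i
      using u(3)[OF that, of \<xi>] g F complex_norm_square[of "u i \<xi>"] by (auto simp: mult.commute)
    \<comment> \<open>Factor number \<open>j\<close> of the term of the tuple; the sum over tuples of a product is a product of sums.\<close>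
    define f where "f k j i = of_real (cmod (c i)) * (if j \<in> B then cnj (s i) * cnj (u i \<xi>) else 1) * (if j = k then s i * u i \<xi> else 1)" for k j :: nat and i
    have Sf: "(\<Sum>i\<in>I. f k j i) = (if j \<in> B then (if j = k then 1 else cnj (T \<xi>)) else (if j = k then T \<xi> else 1))" for k j
    proof -
      have 1: "(\<Sum>i\<in>I. complex_of_real (cmod (c i))) = 1" using I(2) by (metis of_real_1 of_real_sum)
      have 2: "(\<Sum>i\<in>I. of_real (cmod (c i)) * (s i * u i \<xi>)) = T \<xi>" unfolding T_def mult.assoc[symmetric] sc ..
      have 3: "(\<Sum>i\<in>I. of_real (cmod (c i)) * (cnj (s i) * cnj (u i \<xi>))) = cnj (T \<xi>)"
        unfolding 2[symmetric] by simp
      have 4: "(\<Sum>i\<in>I. of_real (cmod (c i)) * (cnj (s i) * cnj (u i \<xi>)) * (s i * u i \<xi>)) = 1"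
        unfolding 1[symmetric]
      proof (rule sum.cong[OF refl])
        fix i assume "i \<in> I"
        have "of_real (cmod (c i)) * (cnj (s i) * cnj (u i \<xi>)) * (s i * u i \<xi>) = of_real (cmod (c i)) * (cnj (s i) * s i) * (cnj (u i \<xi>) * u i \<xi>)"
          by (simp only: mult_ac)
        then show "of_real (cmod (c i)) * (cnj (s i) * cnj (u i \<xi>)) * (s i * u i \<xi>) = of_real (cmod (c i))"
          unfolding ss u1[OF \<open>i \<in> I\<close>] by simp
      qed
      show ?thesis using 1 2 3 4 by (auto simp: f_def)
    qed
    have prodf: "of_real (W i) * L i \<xi> * (s (i k) * u (i k) \<xi>) = (\<Prod>j<n. f k j (i j))" if "k < n" for i k
    proof -
      have "(\<Prod>j<n. f k j (i j)) = (\<Prod>j<n. of_real (cmod (c (i j)))) * (\<Prod>j<n. if j \<in> B then cnj (s (i j)) * cnj (u (i j) \<xi>) else 1) * (\<Prod>j<n. if j = k then s (i j) * u (i j) \<xi> else 1)"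
        unfolding f_def by (simp add: prod.distrib)
      also have "(\<Prod>j<n. if j \<in> B then cnj (s (i j)) * cnj (u (i j) \<xi>) else 1) = L i \<xi>"
        using B unfolding L_def by (subst prod.inter_restrict[symmetric]) (auto simp: Int_absorb1)
      also have "(\<Prod>j<n. if j = k then s (i j) * u (i j) \<xi> else 1) = s (i k) * u (i k) \<xi>"
        using that by simp
      finally show ?thesis by (simp add: W_def)
    qed
    have S: "(\<Sum>i\<in>J. of_real (W i) * L i \<xi> * (s (i k) * u (i k) \<xi>)) = (if k \<in> B then cnj (T \<xi>) ^ (b - 1) else cnj (T \<xi>) ^ b * T \<xi>)" if k: "k < n" for k
    proof -
      have "(\<Sum>i\<in>J. of_real (W i) * L i \<xi> * (s (i k) * u (i k) \<xi>)) = (\<Prod>j<n. \<Sum>i\<in>I. f k j i)"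
        unfolding prodf[OF k] J_def by (rule prod_sum_PiE[symmetric]) (use I in auto)
      also have "\<dots> = (\<Prod>j<n. (if j \<in> B - {k} then cnj (T \<xi>) else 1) * (if j = k \<and> k \<notin> B then T \<xi> else 1))"
        unfolding Sf by (rule prod.cong) auto
      also have "\<dots> = (\<Prod>j<n. (if j \<in> B - {k} then cnj (T \<xi>) else 1)) * (\<Prod>j<n. if j = k \<and> k \<notin> B then T \<xi> else 1)"
        by (rule prod.distrib)
      also have "(\<Prod>j<n. (if j \<in> B - {k} then cnj (T \<xi>) else 1)) = cnj (T \<xi>) ^ card (B - {k})"
        using B by (subst prod.inter_restrict[symmetric]) (auto simp: Int_absorb1 Diff_subset_conv subset_insertI2)
      also have "(\<Prod>j<n. if j = k \<and> k \<notin> B then T \<xi> else 1) = (if k \<in> B then 1 else T \<xi>)"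
        using k by auto
      finally show ?thesis using B by (auto simp: b_def card_Diff_singleton_if)
    qed
    have "(\<Sum>i\<in>J. of_real (W i) * L i \<xi> * G \<eta> i \<xi>) = (\<Sum>i\<in>J. \<Sum>k<n. of_real (\<eta> k) * cnj (T \<xi>) * (of_real (W i) * L i \<xi> * (s (i k) * u (i k) \<xi>)))"
      unfolding G_def by (simp only: sum_distrib_left mult_ac)
    also have "\<dots> = (\<Sum>k<n. of_real (\<eta> k) * cnj (T \<xi>) * (\<Sum>i\<in>J. of_real (W i) * L i \<xi> * (s (i k) * u (i k) \<xi>)))"
      by (subst sum.swap) (simp only: sum_distrib_left)
    also have "\<dots> = (\<Sum>k<n. if k \<in> B then cnj (T \<xi>) ^ b else - (cnj (T \<xi>) ^ Suc b * T \<xi>))"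
    proof (rule sum.cong[OF refl])
      fix k assume k: "k \<in> {..<n}"
      show "of_real (\<eta> k) * cnj (T \<xi>) * (\<Sum>i\<in>J. of_real (W i) * L i \<xi> * (s (i k) * u (i k) \<xi>)) = (if k \<in> B then cnj (T \<xi>) ^ b else - (cnj (T \<xi>) ^ Suc b * T \<xi>))"
      proof (cases "k \<in> B")
        case True
        then have "b > 0" using B by (auto simp: b_def card_gt_0_iff)
        then have "cnj (T \<xi>) * cnj (T \<xi>) ^ (b - 1) = cnj (T \<xi>) ^ b" by (metis power_eq_if not_gr_zero)
        then show ?thesis using True k S[of k] by (auto simp: B_def)
      next
        case False
        then have "\<eta> k = - 1" using k \<eta> by (auto simp: B_def PiE_iff)
        then show ?thesis using False k S[of k] by simp
      qed
    qed
    also have "\<dots> = of_nat b * cnj (T \<xi>) ^ b - of_nat (n - b) * (cnj (T \<xi>) ^ Suc b * T \<xi>)"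
    proof -
      have e: "{..<n} \<inter> B = B" "{..<n} \<inter> - B = {..<n} - B" using B by auto
      have "card ({..<n} - B) = n - b" using B by (simp add: card_Diff_subset b_def)
      then show ?thesis by (subst sum.If_cases) (simp_all add: e b_def)
    qed
    finally have SJ: "(\<Sum>i\<in>J. of_real (W i) * L i \<xi> * G \<eta> i \<xi>) = of_nat b * cnj (T \<xi>) ^ b - of_nat (n - b) * (cnj (T \<xi>) ^ Suc b * T \<xi>)" .
    show ?thesis unfolding SJ P_def by (simp add: power_mult_distrib algebra_simps)
  qed
  have "nu F (\<lambda>\<xi>. T \<xi> ^ b *\<^sub>C (\<Sum>i\<in>J. (of_real (W i) * L i \<xi> * G \<eta> i \<xi>) *\<^sub>C v \<xi>)) =
    nu F (\<lambda>\<xi>. (of_nat b * P \<xi> ^ b - of_nat (n - b) * P \<xi> ^ Suc b) *\<^sub>C v \<xi>)"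
    by (rule nu_cong[OF F]) (simp only: scaleC_sum_left[symmetric] scaleC_scaleC eq)
  with fin bn show ?thesis by auto
qed

text \<open>
  The terms of degree \<open>b\<close> and \<open>b + 1\<close> of the binomial expansion of \<open>(1 - P)\<^sup>n\<close> have opposite signs. A
  multiple of the combination of the previous lemma can therefore be split off; it is estimated by the
  gain and the other terms trivially, the sum of the binomial coefficients being \<open>2\<^sup>n\<close>.
\<close>

theorem power_of_difference_bound:
  fixes c :: "'i \<Rightarrow> complex" and u :: "'i \<Rightarrow> 'c \<Rightarrow> complex"
  assumes gap: "sign_gap n \<epsilon>" and n: "n > 0" and \<epsilon>: "\<epsilon> \<ge> 0"
    and I: "finite I" "(\<Sum>i\<in>I. cmod (c i)) = 1"
    and u: "\<And>i. i \<in> I \<Longrightarrow> mb (u i) 1" "\<And>i. i \<in> I \<Longrightarrow> mb (\<lambda>\<xi>. cnj (u i \<xi>)) 1"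
      "\<And>i \<xi>. i \<in> I \<Longrightarrow> \<xi> \<in> \<Gamma> \<Longrightarrow> cmod (u i \<xi>) = 1"
  defines "T \<equiv> \<lambda>\<xi>. \<Sum>i\<in>I. c i * u i \<xi>"
  shows "mb (\<lambda>\<xi>. (1 - T \<xi> * cnj (T \<xi>)) ^ n) (2 ^ n - \<epsilon> / 2 ^ n / real n)"
proof (rule mbI)
  define P where "P \<xi> = T \<xi> * cnj (T \<xi>)" for \<xi>
  define \<delta> where "\<delta> = \<epsilon> / 2 ^ n"
  have \<delta>: "\<delta> \<ge> 0" using \<epsilon> by (simp add: \<delta>_def)
  have T1: "mb T 1" unfolding T_def by (rule isometry_combination[OF u(1) I(2)])
  have T'eq: "cnj (T \<xi>) = (\<Sum>i\<in>I. cnj (c i) * cnj (u i \<xi>))" for \<xi> by (simp add: T_def)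
  have T'1: "mb (\<lambda>\<xi>. cnj (T \<xi>)) 1" unfolding T'eq
    by (rule isometry_combination) (use u(2) I(2) in auto)
  have P1: "mb P 1" unfolding P_def[abs_def] using mb_mult[OF T1 T'1] by simp
  have unit: "nu F (\<lambda>\<xi>. (1 - P \<xi>) ^ n *\<^sub>C v \<xi>) \<le> 2 ^ n - \<delta> / real n"
    if F: "finite F" "F \<subseteq> \<Gamma>" and v: "nu F v \<le> 1" for F v
  proof -
    have "\<exists>b\<le>n. nu F (\<lambda>\<xi>. (of_nat b * P \<xi> ^ b - of_nat (n - b) * P \<xi> ^ Suc b) *\<^sub>C v \<xi>) \<le> real n - \<delta>"
      unfolding P_def T_def \<delta>_def by (rule dilation_estimate[OF gap I u F v])
    then obtain b where b: "b \<le> n" and nb: "nu F (\<lambda>\<xi>. (of_nat b * P \<xi> ^ b - of_nat (n - b) * P \<xi> ^ Suc b) *\<^sub>C v \<xi>) \<le> real n - \<delta>"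
      by (elim exE conjE)
    \<comment> \<open>After division by \<open>\<kappa>\<close> both coefficients of the combination are at most the binomial ones. For \<open>b > 0\<close> this is
      division by \<open>b\<close>.\<close>
    define \<kappa> where "\<kappa> = real (max 1 b)"
    have \<kappa>: "\<kappa> \<ge> 1" "\<kappa> \<le> real n" "real b \<le> \<kappa>" using b n by (auto simp: \<kappa>_def)
    define d where "d j = (if j = b then real b / \<kappa> else if j = Suc b then real (n - b) / \<kappa> else 0)" for j
    have d_le: "d j \<le> real (n choose j)" for j
    proof -
      have "real b / \<kappa> \<le> real (n choose b)"
      proof -
        have "real b / \<kappa> \<le> 1" using \<kappa> by (simp add: divide_le_eq_1)
        moreover have "real (n choose b) \<ge> 1" using b by (simp add: Suc_le_eq)
        ultimately show ?thesis by linarith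
      qed
      moreover have "real (n - b) / \<kappa> \<le> real (n choose Suc b)"
      proof (cases "b < n")
        case True
        have "real (n - b) / \<kappa> \<le> real (n - b) / 1" using \<kappa> by (intro divide_left_mono) auto
        then show ?thesis using minus_le_binomial_Suc[OF True] by simp
      qed simp
      ultimately show ?thesis by (auto simp: d_def)
    qed
    have sum_d: "(\<Sum>j\<le>n. d j * f j) = real b / \<kappa> * f b + real (n - b) / \<kappa> * f (Suc b)" for f :: "nat \<Rightarrow> real"
    proof -
      have "(\<Sum>j\<le>n. d j * f j) = (\<Sum>j\<le>n. (if j = b then real b / \<kappa> * f b else 0) + (if j = Suc b then real (n - b) / \<kappa> * f (Suc b) else 0))"
        by (rule sum.cong) (auto simp: d_def)
      also have "\<dots> = real b / \<kappa> * f b + real (n - b) / \<kappa> * f (Suc b)"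
        using b by (cases "b < n") (auto simp: sum.distrib)
      finally show ?thesis .
    qed
    define p where "p \<xi> = (cmod (T \<xi>))\<^sup>2" for \<xi>
    have Pp: "P \<xi> = of_real (p \<xi>)" for \<xi> unfolding P_def p_def by (rule complex_norm_square[symmetric])
    \<comment> \<open>The coefficients that remain after the combination has been split off.\<close>
    define e where "e j = (- 1) ^ j * (real (n choose j) - d j)" for j
    have split: "(1 - P \<xi>) ^ n = of_real ((- 1) ^ b / \<kappa>) * (of_nat b * P \<xi> ^ b - of_nat (n - b) * P \<xi> ^ Suc b) + (\<Sum>j\<le>n. of_real (e j) * P \<xi> ^ j)" for \<xi>
    proof -
      have "(1 - p \<xi>) ^ n = (\<Sum>j\<le>n. real (n choose j) * (- p \<xi>) ^ j)"
        using binomial_ring[of "- p \<xi>" 1 n] by simp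
      also have "\<dots> = (\<Sum>j\<le>n. d j * ((- 1) ^ j * p \<xi> ^ j) + e j * p \<xi> ^ j)"
        by (rule sum.cong) (auto simp: e_def power_minus[of "p \<xi>"] algebra_simps)
      also have "\<dots> = (real b / \<kappa> * ((- 1) ^ b * p \<xi> ^ b) + real (n - b) / \<kappa> * ((- 1) ^ Suc b * p \<xi> ^ Suc b)) + (\<Sum>j\<le>n. e j * p \<xi> ^ j)"
        unfolding sum.distrib sum_d ..
      also have "\<dots> = ((- 1) ^ b / \<kappa>) * (real b * p \<xi> ^ b - real (n - b) * p \<xi> ^ Suc b) + (\<Sum>j\<le>n. e j * p \<xi> ^ j)"
        by (simp add: algebra_simps)
      finally have "complex_of_real ((1 - p \<xi>) ^ n) = of_real (((- 1) ^ b / \<kappa>) * (real b * p \<xi> ^ b - real (n - b) * p \<xi> ^ Suc b) + (\<Sum>j\<le>n. e j * p \<xi> ^ j))"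
        by (rule arg_cong)
      then show ?thesis unfolding Pp by (simp del: of_nat_diff)
    qed
    have "mb (\<lambda>\<xi>. \<Sum>j\<le>n. of_real (e j) * P \<xi> ^ j) (\<Sum>j\<le>n. cmod (of_real (e j)) * 1 ^ j)"
      by (rule mb_sum[OF mb_cmult[OF mb_power[OF P1]]]) simp
    from mbD[OF this F, of v] have rest: "nu F (\<lambda>\<xi>. (\<Sum>j\<le>n. of_real (e j) * P \<xi> ^ j) *\<^sub>C v \<xi>) \<le> (\<Sum>j\<le>n. \<bar>e j\<bar>) * nu F v"
      by simp
    have "(\<Sum>j\<le>n. \<bar>e j\<bar>) = (\<Sum>j\<le>n. real (n choose j)) - (\<Sum>j\<le>n. d j * 1)"
      using d_le by (simp add: e_def abs_mult sum_subtractf)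
    also have "\<dots> = 2 ^ n - real n / \<kappa>"
    proof -
      have "(\<Sum>j\<le>n. real (n choose j)) = 2 ^ n" using choose_row_sum[of n] by (metis of_nat_numeral of_nat_power of_nat_sum)
      moreover have "real b / \<kappa> + real (n - b) / \<kappa> = real n / \<kappa>" using b by (simp flip: add_divide_distrib)
      ultimately show ?thesis using sum_d[of "\<lambda>_. 1"] by simp
    qed
    finally have se: "(\<Sum>j\<le>n. \<bar>e j\<bar>) = 2 ^ n - real n / \<kappa>" .
    have "(\<Sum>j\<le>n. \<bar>e j\<bar>) * nu F v \<le> (\<Sum>j\<le>n. \<bar>e j\<bar>)"
      using v by (intro mult_left_le) (auto intro: sum_nonneg)
    with rest se have rest': "nu F (\<lambda>\<xi>. (\<Sum>j\<le>n. of_real (e j) * P \<xi> ^ j) *\<^sub>C v \<xi>) \<le> 2 ^ n - real n / \<kappa>" by linarith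
    let ?m = "\<lambda>\<xi>. of_nat b * P \<xi> ^ b - of_nat (n - b) * P \<xi> ^ Suc b"
    have "nu F (\<lambda>\<xi>. (1 - P \<xi>) ^ n *\<^sub>C v \<xi>) \<le> nu F (\<lambda>\<xi>. of_real ((- 1) ^ b / \<kappa>) *\<^sub>C (?m \<xi> *\<^sub>C v \<xi>)) + nu F (\<lambda>\<xi>. (\<Sum>j\<le>n. of_real (e j) * P \<xi> ^ j) *\<^sub>C v \<xi>)"
      unfolding split scaleC_add_left scaleC_scaleC[symmetric] by (rule nu_add[OF F])
    also have "nu F (\<lambda>\<xi>. of_real ((- 1) ^ b / \<kappa>) *\<^sub>C (?m \<xi> *\<^sub>C v \<xi>)) = cmod (of_real ((- 1) ^ b / \<kappa>)) * nu F (\<lambda>\<xi>. ?m \<xi> *\<^sub>C v \<xi>)"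
      by (rule nu_scale[OF F])
    also have "cmod (of_real ((- 1) ^ b / \<kappa>)) = 1 / \<kappa>" using \<kappa> by (simp only: norm_of_real) (simp add: abs_divide power_abs)
    also have "1 / \<kappa> * nu F (\<lambda>\<xi>. ?m \<xi> *\<^sub>C v \<xi>) \<le> 1 / \<kappa> * (real n - \<delta>)"
      using \<kappa> by (intro mult_left_mono nb) auto
    also have "1 / \<kappa> * (real n - \<delta>) = real n / \<kappa> - \<delta> / \<kappa>" by (simp add: diff_divide_distrib)
    finally have "nu F (\<lambda>\<xi>. (1 - P \<xi>) ^ n *\<^sub>C v \<xi>) \<le> 2 ^ n - \<delta> / \<kappa>" using rest' by linarith
    moreover have "\<delta> / real n \<le> \<delta> / \<kappa>" using \<kappa> \<delta> by (intro divide_left_mono) auto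
    ultimately show ?thesis by linarith
  qed
  fix F v assume F: "finite F" "F \<subseteq> \<Gamma>"
  let ?C = "2 ^ n - \<delta> / real n"
  have "nu F (\<lambda>\<xi>. (1 - P \<xi>) ^ n *\<^sub>C v \<xi>) \<le> ?C * nu F v"
  proof (cases "nu F v = 0")
    case True
    have "nu F (\<lambda>\<xi>. (1 - P \<xi>) ^ n *\<^sub>C v \<xi>) \<le> (1 + 1) ^ n * nu F v"
      by (rule mbD[OF mb_power[OF mb_diff[OF mb_one P1]] F]) simp
    then show ?thesis using True by simp
  next
    case False
    define r where "r = nu F v"
    have r: "r > 0" using False nu_nonneg[of F v] by (simp add: r_def)
    have "nu F (\<lambda>\<xi>. of_real (1 / r) *\<^sub>C v \<xi>) = 1"
      using r nu_scale[OF F, of "of_real (1 / r)" v] by (simp add: norm_divide flip: r_def)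
    from unit[OF F eq_refl[OF this]]
    have "?C \<ge> nu F (\<lambda>\<xi>. of_real (1 / r) *\<^sub>C ((1 - P \<xi>) ^ n *\<^sub>C v \<xi>))"
      by (simp add: scaleC_scaleC mult.commute)
    also have "nu F (\<lambda>\<xi>. of_real (1 / r) *\<^sub>C ((1 - P \<xi>) ^ n *\<^sub>C v \<xi>)) = 1 / r * nu F (\<lambda>\<xi>. (1 - P \<xi>) ^ n *\<^sub>C v \<xi>)"
      using r nu_scale[OF F, of "of_real (1 / r)" "\<lambda>\<xi>. (1 - P \<xi>) ^ n *\<^sub>C v \<xi>"] by (simp add: norm_divide)
    finally show ?thesis using r unfolding r_def[symmetric] by (simp add: pos_divide_le_eq)
  qed
  then show "nu F (\<lambda>\<xi>. (1 - T \<xi> * cnj (T \<xi>)) ^ n *\<^sub>C v \<xi>) \<le> (2 ^ n - \<epsilon> / 2 ^ n / real n) * nu F v"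
    by (simp add: P_def \<delta>_def)
qed

end


section \<open>Bochner spaces\<close>

lemma strongly_measurable_continuous2:
  assumes f: "strongly_measurable M f" and g: "strongly_measurable M g"
    and \<phi>: "continuous_on UNIV (\<lambda>z. \<phi> (fst z) (snd z))"
  shows "strongly_measurable M (\<lambda>x. \<phi> (f x) (g x))"
proof -
  obtain s where s: "\<And>n. simple_function M (s n)" "\<And>x. x \<in> space M \<Longrightarrow> (\<lambda>n. s n x) \<longlonglongrightarrow> f x"
    using f by (auto simp: strongly_measurable_def)
  obtain t where t: "\<And>n. simple_function M (t n)" "\<And>x. x \<in> space M \<Longrightarrow> (\<lambda>n. t n x) \<longlonglongrightarrow> g x"
    using g by (auto simp: strongly_measurable_def)
  show ?thesis unfolding strongly_measurable_def
  proof (intro exI[of _ "\<lambda>n x. \<phi> (s n x) (t n x)"] conjI allI ballI)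
    show "simple_function M (\<lambda>x. \<phi> (s n x) (t n x))" for n
      by (rule simple_function_compose2[OF s(1) t(1)])
    fix x assume "x \<in> space M"
    then have "(\<lambda>n. (s n x, t n x)) \<longlonglongrightarrow> (f x, g x)" by (intro tendsto_Pair s t)
    from continuous_on_tendsto_compose[OF \<phi> this]
    show "(\<lambda>n. \<phi> (s n x) (t n x)) \<longlonglongrightarrow> \<phi> (f x) (g x)" by simp
  qed
qed

lemma strongly_measurable_continuous:
  assumes f: "strongly_measurable M f" and \<phi>: "continuous_on UNIV \<phi>"
  shows "strongly_measurable M (\<lambda>x. \<phi> (f x))"
  by (rule strongly_measurable_continuous2[OF f f, of "\<lambda>a b. \<phi> a"])
     (intro continuous_on_compose2[OF \<phi>] continuous_intros, auto)

lemma strongly_measurable_simple: "simple_function M f \<Longrightarrow> strongly_measurable M f"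
  unfolding strongly_measurable_def by (intro exI[of _ "\<lambda>_. f"]) auto

lemma strongly_measurable_borel:
  fixes f :: "'a \<Rightarrow> 'b::{real_normed_vector, second_countable_topology}"
  assumes "f \<in> borel_measurable M" shows "strongly_measurable M f"
  using borel_measurable_implies_sequence_metric[OF assms, of 0] unfolding strongly_measurable_def by blast

lemma borel_measurable_norm_strongly:
  assumes "strongly_measurable M f" shows "(\<lambda>x. norm (f x)) \<in> borel_measurable M"
proof -
  obtain s where s: "\<And>n. simple_function M (s n)" "\<And>x. x \<in> space M \<Longrightarrow> (\<lambda>n. s n x) \<longlonglongrightarrow> f x"
    using assms by (auto simp: strongly_measurable_def)
  show ?thesis
  proof (rule borel_measurable_LIMSEQ_real)
    show "(\<lambda>x. norm (s n x)) \<in> borel_measurable M" for n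
      by (rule borel_measurable_simple_function) (rule simple_function_compose1[OF s(1)])
    show "(\<lambda>n. norm (s n x)) \<longlonglongrightarrow> norm (f x)" if "x \<in> space M" for x
      by (intro tendsto_norm s that)
  qed
qed

lemma strongly_measurable_add:
  "strongly_measurable M f \<Longrightarrow> strongly_measurable M g \<Longrightarrow> strongly_measurable M (\<lambda>x. f x + g x)"
  by (rule strongly_measurable_continuous2[where \<phi> = "(+)"]) (auto intro!: continuous_intros)

lemma strongly_measurable_diff:
  "strongly_measurable M f \<Longrightarrow> strongly_measurable M g \<Longrightarrow> strongly_measurable M (\<lambda>x. f x - g x)"
  by (rule strongly_measurable_continuous2[where \<phi> = "(-)"]) (auto intro!: continuous_intros)

lemma continuous_on_scaleC:
  fixes g :: "'t::topological_space \<Rightarrow> 'b::complex_banach"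
  shows "continuous_on S f \<Longrightarrow> continuous_on S g \<Longrightarrow> continuous_on S (\<lambda>x. f x *\<^sub>C g x)"
  using bounded_bilinear.continuous_on[OF bounded_bilinear_scaleC] .

lemma strongly_measurable_scaleC:
  fixes f :: "'a \<Rightarrow> 'b::complex_banach"
  assumes "strongly_measurable M f" shows "strongly_measurable M (\<lambda>x. c *\<^sub>C f x)"
  by (rule strongly_measurable_continuous[OF assms]) (intro continuous_on_scaleC continuous_intros)

lemma strongly_measurable_scaleC_vector:
  fixes v :: "'b::complex_banach"
  assumes "strongly_measurable M c" shows "strongly_measurable M (\<lambda>x. c x *\<^sub>C v)"
  by (rule strongly_measurable_continuous[OF assms]) (intro continuous_on_scaleC continuous_intros)

lemma strongly_measurable_sum:
  fixes f :: "'i \<Rightarrow> 'a \<Rightarrow> 'b::complex_banach"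
  assumes "\<And>i. i \<in> I \<Longrightarrow> strongly_measurable M (f i)"
  shows "strongly_measurable M (\<lambda>x. \<Sum>i\<in>I. f i x)"
  using assms
  by (induction I rule: infinite_finite_induct)
     (simp_all add: strongly_measurable_simple strongly_measurable_add)

lemma LpD: "f \<in> Lp M p \<Longrightarrow> strongly_measurable M f" "f \<in> Lp M p \<Longrightarrow> integrable M (\<lambda>x. norm (f x) powr p)"
  by (auto simp: Lp_def)

lemma LpI: "strongly_measurable M f \<Longrightarrow> integrable M (\<lambda>x. norm (f x) powr p) \<Longrightarrow> f \<in> Lp M p"
  by (auto simp: Lp_def)

lemma Lp_norm_nonneg: "Lp_norm M p f \<ge> 0"
  by (simp add: Lp_norm_def)

lemma Lp_norm_powr: "p > 0 \<Longrightarrow> Lp_norm M p f powr p = (\<integral>x. norm (f x) powr p \<partial>M)"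
  by (simp add: Lp_norm_def powr_powr)

lemma Lp_norm_leI:
  assumes "p > 0" "c \<ge> 0" "(\<integral>x. norm (f x) powr p \<partial>M) \<le> c powr p"
  shows "Lp_norm M p f \<le> c"
proof -
  have "Lp_norm M p f \<le> (c powr p) powr (1 / p)"
    unfolding Lp_norm_def by (rule powr_mono2) (use assms in auto)
  also have "\<dots> = c" using assms by (simp add: powr_powr)
  finally show ?thesis .
qed

lemma Lp_norm_mono:
  assumes "p > 0" "integrable M (\<lambda>x. norm (g x) powr p)" "strongly_measurable M f" "AE x in M. norm (f x) \<le> norm (g x)"
  shows "Lp_norm M p f \<le> Lp_norm M p g" and "f \<in> Lp M p"
proof -
  have m: "(\<lambda>x. norm (f x) powr p) \<in> borel_measurable M"
    using borel_measurable_norm_strongly[OF assms(3)] by measurable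
  have le: "AE x in M. norm (f x) powr p \<le> norm (g x) powr p"
    using assms(4) by eventually_elim (use assms(1) in \<open>auto intro: powr_mono2\<close>)
  have i: "integrable M (\<lambda>x. norm (f x) powr p)"
    by (rule Bochner_Integration.integrable_bound[OF assms(2) m]) (use le in auto)
  show "f \<in> Lp M p" using assms(3) i by (rule LpI)
  show "Lp_norm M p f \<le> Lp_norm M p g"
    unfolding Lp_norm_def
    by (rule powr_mono2) (use assms(1) in \<open>auto intro!: integral_mono_AE i assms(2) le\<close>)
qed

lemma Lp_scaleC:
  fixes f :: "'a \<Rightarrow> 'b::complex_banach"
  assumes "p > 0" "f \<in> Lp M p"
  shows "(\<lambda>x. c *\<^sub>C f x) \<in> Lp M p" "Lp_norm M p (\<lambda>x. c *\<^sub>C f x) = cmod c * Lp_norm M p f"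
proof -
  have eq: "norm (c *\<^sub>C f x) powr p = cmod c powr p * norm (f x) powr p" for x
    by (simp add: norm_scaleC powr_mult)
  show "(\<lambda>x. c *\<^sub>C f x) \<in> Lp M p"
    by (rule LpI) (use LpD[OF assms(2)] in \<open>auto simp: eq intro: strongly_measurable_scaleC\<close>)
  show "Lp_norm M p (\<lambda>x. c *\<^sub>C f x) = cmod c * Lp_norm M p f"
    unfolding Lp_norm_def eq using assms(1) by (simp add: powr_mult powr_powr)
qed

lemma powr_convex_combination:
  fixes x y t p :: real
  assumes "p \<ge> 1" "x \<ge> 0" "y \<ge> 0" "0 \<le> t" "t \<le> 1"
  shows "((1 - t) * x + t * y) powr p \<le> (1 - t) * x powr p + t * y powr p"
proof -
  have c: "convex_on {0<..} (\<lambda>x. x powr p)" by (rule powr_convex[OF assms(1)])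
  show ?thesis
  proof (cases "x = 0 \<or> y = 0")
    case False
    then show ?thesis using convex_onD[OF c, of t x y] assms by simp
  next
    case True
    have s: "s powr p \<le> s" if "0 \<le> s" "s \<le> 1" for s :: real
      using powr_le1 powr_mono'[of 1 p s] assms(1) that by (cases "s = 0") auto
    from True show ?thesis
    proof
      assume "x = 0"
      then show ?thesis using s[of t] assms by (auto simp: powr_mult intro!: mult_right_mono)
    next
      assume "y = 0"
      then show ?thesis using s[of "1 - t"] assms by (auto simp: powr_mult intro!: mult_right_mono)
    qed
  qed
qed

text \<open>
  Minkowski's inequality: for \<open>a\<close> and \<open>b\<close> above the two norms, \<open>f + g\<close> is \<open>a + b\<close> times a convex
  combination of \<open>f / a\<close> and \<open>g / b\<close>, and \<open>s \<mapsto> s\<^sup>p\<close> is convex.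
\<close>

lemma Lp_add:
  fixes f g :: "'a \<Rightarrow> 'b::complex_banach"
  assumes p: "p \<ge> 1" and f: "f \<in> Lp M p" and g: "g \<in> Lp M p"
  shows "(\<lambda>x. f x + g x) \<in> Lp M p"
    and "Lp_norm M p (\<lambda>x. f x + g x) \<le> Lp_norm M p f + Lp_norm M p g"
proof -
  have p0: "p > 0" using p by simp
  have sm: "strongly_measurable M (\<lambda>x. f x + g x)" using f g LpD by (auto intro: strongly_measurable_add)
  have m: "(\<lambda>x. norm (f x + g x) powr p) \<in> borel_measurable M"
    using borel_measurable_norm_strongly[OF sm] by measurable
  have pt: "norm (f x + g x) powr p \<le> (a + b) powr p * (a / (a + b) * (norm (f x) powr p / a powr p) + b / (a + b) * (norm (g x) powr p / b powr p))"
    if ab: "a > 0" "b > 0" for a b x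
  proof -
    define t where "t = b / (a + b)"
    have t: "1 - t = a / (a + b)" "0 \<le> t" "t \<le> 1" using ab by (auto simp: t_def field_simps)
    have "norm (f x + g x) powr p \<le> (norm (f x) + norm (g x)) powr p"
      using p by (intro powr_mono2 norm_triangle_ineq) auto
    also have "norm (f x) + norm (g x) = (a + b) * ((1 - t) * (norm (f x) / a) + t * (norm (g x) / b))"
      unfolding t(1) using ab by (simp add: t_def distrib_left)
    also have "\<dots> powr p = (a + b) powr p * ((1 - t) * (norm (f x) / a) + t * (norm (g x) / b)) powr p"
      using ab t by (intro powr_mult)
    also have "\<dots> \<le> (a + b) powr p * ((1 - t) * (norm (f x) / a) powr p + t * (norm (g x) / b) powr p)"
      by (intro mult_left_mono powr_convex_combination p t) (use ab in auto)
    finally show ?thesis using ab by (simp add: t(1) powr_divide) (simp add: t_def)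
  qed
  have int: "integrable M (\<lambda>x. (a + b) powr p * (a / (a + b) * (norm (f x) powr p / a powr p) + b / (a + b) * (norm (g x) powr p / b powr p)))" for a b
    using LpD(2)[OF f] LpD(2)[OF g] by (intro integrable_mult_right integrable_add integrable_divide_zero) auto
  have i: "integrable M (\<lambda>x. norm (f x + g x) powr p)"
    by (rule Bochner_Integration.integrable_bound[OF int[of 1 1] m]) (use pt[of 1 1] in auto)
  show "(\<lambda>x. f x + g x) \<in> Lp M p" using sm i by (rule LpI)
  have le: "Lp_norm M p (\<lambda>x. f x + g x) \<le> a + b" if ab: "a > Lp_norm M p f" "b > Lp_norm M p g" for a b
  proof (rule Lp_norm_leI[OF p0])
    have pos: "a > 0" "b > 0" using ab Lp_norm_nonneg order.strict_trans1 by blast+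
    then show "a + b \<ge> 0" by simp
    have "(\<integral>x. norm (f x + g x) powr p \<partial>M) \<le> (\<integral>x. (a + b) powr p * (a / (a + b) * (norm (f x) powr p / a powr p) + b / (a + b) * (norm (g x) powr p / b powr p)) \<partial>M)"
      by (intro integral_mono i int pt pos)
    also have "\<dots> = (a + b) powr p * (a / (a + b) * (Lp_norm M p f powr p / a powr p) + b / (a + b) * (Lp_norm M p g powr p / b powr p))"
      using LpD(2)[OF f] LpD(2)[OF g] p0 by (simp add: Lp_norm_powr)
    also have "\<dots> \<le> (a + b) powr p * (a / (a + b) * 1 + b / (a + b) * 1)"
    proof (intro mult_left_mono add_mono)
      show "Lp_norm M p f powr p / a powr p \<le> 1" "Lp_norm M p g powr p / b powr p \<le> 1"
        using ab pos p0 by (auto simp: Lp_norm_nonneg divide_le_eq_1 intro!: powr_mono2)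
    qed (use pos in auto)
    also have "a / (a + b) * 1 + b / (a + b) * 1 = 1" using pos by (simp flip: add_divide_distrib)
    finally show "(\<integral>x. norm (f x + g x) powr p \<partial>M) \<le> (a + b) powr p" by simp
  qed
  show "Lp_norm M p (\<lambda>x. f x + g x) \<le> Lp_norm M p f + Lp_norm M p g"
  proof (rule field_le_epsilon)
    fix e :: real assume "e > 0"
    then show "Lp_norm M p (\<lambda>x. f x + g x) \<le> Lp_norm M p f + Lp_norm M p g + e"
      using le[of "Lp_norm M p f + e / 2" "Lp_norm M p g + e / 2"] by simp
  qed
qed

lemma Lp_diff:
  fixes f g :: "'a \<Rightarrow> 'b::complex_banach"
  assumes p: "p \<ge> 1" and f: "f \<in> Lp M p" and g: "g \<in> Lp M p"
  shows "(\<lambda>x. f x - g x) \<in> Lp M p"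
    and "Lp_norm M p (\<lambda>x. f x - g x) \<le> Lp_norm M p f + Lp_norm M p g"
proof -
  have p0: "p > 0" using p by simp
  note n = Lp_scaleC[OF p0 g, of "-1"]
  have e: "(\<lambda>x. f x + (- 1) *\<^sub>C g x) = (\<lambda>x. f x - g x)" by (simp add: scaleC_minus_left scaleC_one)
  show "(\<lambda>x. f x - g x) \<in> Lp M p" using Lp_add(1)[OF p f n(1)] unfolding e .
  show "Lp_norm M p (\<lambda>x. f x - g x) \<le> Lp_norm M p f + Lp_norm M p g"
    using Lp_add(2)[OF p f n(1)] n(2) unfolding e by simp
qed

lemma Lp_norm_commute: "Lp_norm M p (\<lambda>x. f x - g x) = Lp_norm M p (\<lambda>x. g x - f x)"
  unfolding Lp_norm_def by (simp add: norm_minus_commute)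

lemma Lp_zero: "(\<lambda>x. 0) \<in> Lp M p" "p > 0 \<Longrightarrow> Lp_norm M p (\<lambda>x. 0) = 0"
  by (auto simp: Lp_def Lp_norm_def intro!: strongly_measurable_simple)

lemma Lp_sum:
  fixes f :: "'i \<Rightarrow> 'a \<Rightarrow> 'b::complex_banach"
  assumes "p \<ge> 1" "\<And>i. i \<in> I \<Longrightarrow> f i \<in> Lp M p"
  shows "(\<lambda>x. \<Sum>i\<in>I. f i x) \<in> Lp M p \<and> Lp_norm M p (\<lambda>x. \<Sum>i\<in>I. f i x) \<le> (\<Sum>i\<in>I. Lp_norm M p (f i))"
  using assms(2)
proof (induction I rule: infinite_finite_induct)
  case (insert i I)
  then show ?case using Lp_add[OF assms(1), of "f i" M "\<lambda>x. \<Sum>i\<in>I. f i x"] by fastforce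
qed (use assms(1) in \<open>auto simp: Lp_zero\<close>)

lemma Lp_bounded:
  fixes f :: "'a \<Rightarrow> 'b::complex_banach"
  assumes "prob_space M" "p \<ge> 1" "strongly_measurable M f" "AE x in M. norm (f x) \<le> B" "B \<ge> 0"
  shows "f \<in> Lp M p" "Lp_norm M p f \<le> B"
proof -
  interpret prob_space M by fact
  have p: "p > 0" using assms by simp
  have *: "norm (of_real B :: complex) = B" using assms by simp
  show "f \<in> Lp M p"
    by (rule Lp_norm_mono(2)[OF p, of M "\<lambda>x. of_real B :: complex"]) (use assms * in auto)
  have "Lp_norm M p f \<le> Lp_norm M p (\<lambda>x. of_real B :: complex)"
    by (rule Lp_norm_mono(1)[OF p]) (use assms * in auto)
  also have "\<dots> = B" unfolding Lp_norm_def * using assms p by (simp add: powr_powr prob_space)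
  finally show "Lp_norm M p f \<le> B" .
qed


lemma Lp_approx_simple:
  fixes f :: "'a \<Rightarrow> 'b::complex_banach"
  assumes M: "prob_space M" and p: "p \<ge> 1" and f: "f \<in> Lp M p" and e: "e > 0"
  obtains s where "simple_function M s" "s \<in> Lp M p" "Lp_norm M p (\<lambda>x. f x - s x) < e"
proof -
  interpret prob_space M by fact
  have p0: "p > 0" using p by simp
  obtain s where s: "\<And>n. simple_function M (s n)" "\<And>x. x \<in> space M \<Longrightarrow> (\<lambda>n. s n x) \<longlonglongrightarrow> f x"
    using LpD(1)[OF f] by (auto simp: strongly_measurable_def)
  define A where "A n = {x \<in> space M. norm (s n x) \<le> 2 * norm (f x)}" for n
  have A: "A n \<in> sets M" for n
  proof -
    have [measurable]: "(\<lambda>x. norm (s n x)) \<in> borel_measurable M" "(\<lambda>x. norm (f x)) \<in> borel_measurable M"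
      using s(1) LpD(1)[OF f] by (auto intro: borel_measurable_norm_strongly strongly_measurable_simple)
    show ?thesis unfolding A_def by measurable
  qed
  define t where "t n x = indicator (A n) x *\<^sub>R s n x" for n x
  have t: "simple_function M (t n)" for n
    unfolding t_def[abs_def] by (intro simple_function_compose2[where h = "scaleR"] s simple_function_indicator A)
  have tsm: "strongly_measurable M (t n)" for n using t by (rule strongly_measurable_simple)
  have tb: "norm (t n x) \<le> 2 * norm (f x)" for n x
    by (auto simp: t_def indicator_def A_def)
  have norm2: "norm (2 *\<^sub>C f x) = 2 * norm (f x)" for x by (simp add: norm_scaleC)
  have tLp: "t n \<in> Lp M p" for n
    by (rule Lp_norm_mono(2)[OF p0 LpD(2)[OF Lp_scaleC(1)[OF p0 f, of 2]] tsm]) (use tb norm2 in auto)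
  have lim: "(\<lambda>n. norm (f x - t n x) powr p) \<longlonglongrightarrow> 0" if x: "x \<in> space M" for x
  proof -
    have "t n x = s n x \<or> f x = 0" if "norm (s n x) \<le> 2 * norm (f x) \<or> f x = 0" for n
      using that x by (auto simp: t_def A_def indicator_def)
    have "(\<lambda>n. t n x) \<longlonglongrightarrow> f x"
    proof (cases "f x = 0")
      case True
      then have "t n x = 0" for n using tb[of n x] by simp
      then show ?thesis using True by simp
    next
      case False
      then have "norm (f x) < 2 * norm (f x)" by simp
      then have "\<forall>\<^sub>F n in sequentially. norm (s n x) < 2 * norm (f x)"
        using order_tendstoD(2)[OF tendsto_norm[OF s(2)[OF x]]] by blast
      then have "\<forall>\<^sub>F n in sequentially. s n x = t n x"
        by eventually_elim (use x in \<open>auto simp: t_def A_def indicator_def\<close>)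
      then show ?thesis by (rule Lim_transform_eventually[OF s(2)[OF x]])
    qed
    then have "(\<lambda>n. norm (f x - t n x)) \<longlonglongrightarrow> norm (f x - f x)" by (intro tendsto_intros)
    then have "(\<lambda>n. norm (f x - t n x)) \<longlonglongrightarrow> 0" by simp
    from tendsto_powr'[OF this tendsto_const[of p]] p0 show ?thesis by simp
  qed
  have "(\<lambda>n. \<integral>x. norm (f x - t n x) powr p \<partial>M) \<longlonglongrightarrow> (\<integral>x. 0 \<partial>M)"
  proof (rule integral_dominated_convergence[where w = "\<lambda>x. norm (3 *\<^sub>C f x) powr p"])
    show "integrable M (\<lambda>x. norm (3 *\<^sub>C f x) powr p)" by (rule LpD(2)[OF Lp_scaleC(1)[OF p0 f]])
    show "(\<lambda>x. norm (f x - t n x) powr p) \<in> borel_measurable M" for n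
      using LpD(2)[OF Lp_diff(1)[OF p f tLp]] by auto
    show "AE x in M. norm (norm (f x - t n x) powr p) \<le> norm (3 *\<^sub>C f x) powr p" for n
    proof (rule AE_I2)
      fix x
      have "norm (f x - t n x) \<le> norm (3 *\<^sub>C f x)"
        using norm_triangle_ineq4[of "f x" "t n x"] tb[of n x] by (simp add: norm_scaleC)
      then show "norm (norm (f x - t n x) powr p) \<le> norm (3 *\<^sub>C f x) powr p"
        using p0 by (auto intro!: powr_mono2)
    qed
  qed (use lim in auto)
  then have l: "(\<lambda>n. \<integral>x. norm (f x - t n x) powr p \<partial>M) \<longlonglongrightarrow> 0" by simp
  have "(\<lambda>n. Lp_norm M p (\<lambda>x. f x - t n x)) \<longlonglongrightarrow> 0"
    unfolding Lp_norm_def using tendsto_powr'[OF l tendsto_const[of "1 / p"]] p0 by simp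
  then have "\<forall>\<^sub>F n in sequentially. Lp_norm M p (\<lambda>x. f x - t n x) < e"
    using order_tendstoD(2) e by blast
  then obtain n where "Lp_norm M p (\<lambda>x. f x - t n x) < e" by (auto simp: eventually_sequentially)
  then show thesis using that t tLp by blast
qed

lemma integral_norm_le_Lp_norm:
  fixes f :: "'a \<Rightarrow> 'b::complex_banach"
  assumes M: "prob_space M" and p: "p \<ge> 1" and f: "f \<in> Lp M p"
  shows "integrable M (\<lambda>x. norm (f x))" "(\<integral>x. norm (f x) \<partial>M) \<le> Lp_norm M p f"
proof -
  interpret prob_space M by fact
  have p0: "p > 0" using p by simp
  have m: "(\<lambda>x. norm (f x)) \<in> borel_measurable M" by (rule borel_measurable_norm_strongly[OF LpD(1)[OF f]])
  have pt: "norm (f x) / a \<le> 1 / p * (norm (f x) powr p / a powr p) + (1 - 1 / p)" if a: "a > 0" for a x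
  proof -
    define y where "y = norm (f x) / a"
    have y: "y \<ge> 0" using a by (simp add: y_def)
    have "y \<le> 1 / p * y powr p + (1 - 1 / p)"
    proof (cases "y = 0")
      case True
      then show ?thesis using p by simp
    next
      case False
      then have "(y powr p) powr (1 / p) * 1 powr (1 - 1 / p) \<le> 1 / p * (y powr p) + (1 - 1 / p) * 1"
        using p y by (intro Youngs_inequality_0) auto
      then show ?thesis using p y by (simp add: powr_powr)
    qed
    then show ?thesis using a by (simp add: y_def powr_divide)
  qed
  have int: "integrable M (\<lambda>x. 1 / p * (norm (f x) powr p / a powr p) + (1 - 1 / p))" for a
    using LpD(2)[OF f] by simp
  have i1: "integrable M (\<lambda>x. norm (f x) / 1)"
    by (rule Bochner_Integration.integrable_bound[OF int[of 1]]) (use m pt[of 1] p in \<open>auto\<close>)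
  then show i: "integrable M (\<lambda>x. norm (f x))" by simp
  have le: "(\<integral>x. norm (f x) \<partial>M) \<le> a" if a: "a > Lp_norm M p f" for a
  proof -
    have a0: "a > 0" using a Lp_norm_nonneg order.strict_trans1 by blast
    have "(\<integral>x. norm (f x) / a \<partial>M) \<le> (\<integral>x. 1 / p * (norm (f x) powr p / a powr p) + (1 - 1 / p) \<partial>M)"
      by (intro integral_mono int pt a0) (use i in auto)
    also have "\<dots> = 1 / p * (Lp_norm M p f powr p / a powr p) + (1 - 1 / p)"
      using LpD(2)[OF f] p0 by (simp add: Lp_norm_powr prob_space)
    also have "\<dots> \<le> 1 / p * 1 + (1 - 1 / p)"
      using a a0 p0 by (intro add_mono mult_left_mono) (auto simp: divide_le_eq_1 Lp_norm_nonneg intro!: powr_mono2)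
    finally have "(\<integral>x. norm (f x) \<partial>M) / a \<le> 1" using p0 by simp
    then show ?thesis using a0 by (simp add: divide_le_eq_1)
  qed
  show "(\<integral>x. norm (f x) \<partial>M) \<le> Lp_norm M p f"
    by (rule field_le_epsilon) (use le in simp)
qed

text \<open>
  Simple functions come first because their pointwise limit is strongly measurable by definition; the
  limit exists almost everywhere since the norms of the increments have a finite sum in \<open>L\<^sup>1\<close>.
\<close>

lemma Lp_complete_simple:
  fixes s :: "nat \<Rightarrow> 'a \<Rightarrow> 'b::complex_banach"
  assumes M: "prob_space M" and p: "p \<ge> 1" and s: "\<And>n. simple_function M (s n)" "\<And>n. s n \<in> Lp M p"
    and fast: "\<And>n. Lp_norm M p (\<lambda>x. s (Suc n) x - s n x) \<le> (1 / 2) ^ n"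
  obtains g where "g \<in> Lp M p" "(\<lambda>n. Lp_norm M p (\<lambda>x. g x - s n x)) \<longlonglongrightarrow> 0"
proof -
  interpret prob_space M by fact
  have p0: "p > 0" using p by simp
  have d: "(\<lambda>x. s (Suc n) x - s n x) \<in> Lp M p" for n by (rule Lp_diff(1)[OF p s(2) s(2)])
  define D where "D n x = norm (s (Suc n) x - s n x)" for n x
  have D[measurable]: "D n \<in> borel_measurable M" for n
    unfolding D_def[abs_def] by (rule borel_measurable_norm_strongly[OF LpD(1)[OF d]])
  have iD: "integrable M (D n)" "(\<integral>x. D n x \<partial>M) \<le> (1 / 2) ^ n" for n
    using integral_norm_le_Lp_norm[OF M p d[of n]] fast[of n] unfolding D_def[abs_def] by auto
  have "(\<integral>\<^sup>+x. (\<Sum>n. ennreal (D n x)) \<partial>M) = (\<Sum>n. \<integral>\<^sup>+x. ennreal (D n x) \<partial>M)"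
    by (rule nn_integral_suminf) simp
  also have "\<dots> = (\<Sum>n. ennreal (\<integral>x. D n x \<partial>M))"
    by (intro suminf_cong nn_integral_eq_integral iD) (simp add: D_def)
  also have "\<dots> \<le> (\<Sum>n. ennreal ((1 / 2) ^ n))"
    by (intro suminf_le ennreal_leI iD) auto
  also have "\<dots> = ennreal (\<Sum>n. (1 / 2) ^ n)"
    by (intro suminf_ennreal2) (auto simp: summable_geometric)
  also have "\<dots> < \<infinity>" by simp
  finally have ne: "AE x in M. (\<Sum>n. ennreal (D n x)) \<noteq> \<infinity>"
    by (intro nn_integral_PInf_AE) auto
  define A where "A = {x \<in> space M. (\<Sum>n. ennreal (D n x)) \<noteq> \<infinity>}"
  have AE_A: "AE x in M. x \<in> A" using ne AE_space by eventually_elim (simp add: A_def)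
  have A: "A \<in> sets M" unfolding A_def by measurable
  have conv: "convergent (\<lambda>n. s n x)" if "x \<in> A" for x
  proof -
    have "summable (\<lambda>n. D n x)"
      by (rule summable_suminf_not_top) (use that in \<open>auto simp: A_def D_def\<close>)
    then have "summable (\<lambda>n. s (Suc n) x - s n x)" unfolding D_def by (rule summable_norm_cancel)
    then have "convergent (\<lambda>n. \<Sum>k<n. s (Suc k) x - s k x)" by (simp add: summable_iff_convergent)
    then have "convergent (\<lambda>n. s n x - s 0 x)" by (simp add: sum_lessThan_telescope[of "\<lambda>k. s k x"])
    then show ?thesis by (simp add: convergent_diff_const_right_iff)
  qed
  define g where "g x = (if x \<in> A then lim (\<lambda>n. s n x) else 0)" for x
  have gl: "(\<lambda>n. s n x) \<longlonglongrightarrow> g x" if "x \<in> A" for x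
    using conv[OF that] that by (simp add: g_def convergent_LIMSEQ_iff)
  have gsm: "strongly_measurable M g" unfolding strongly_measurable_def
  proof (intro exI[of _ "\<lambda>n x. indicator A x *\<^sub>R s n x"] conjI allI ballI)
    show "simple_function M (\<lambda>x. indicator A x *\<^sub>R s n x)" for n
      by (intro simple_function_compose2[where h = "scaleR"] s simple_function_indicator A)
    fix x show "(\<lambda>n. indicator A x *\<^sub>R s n x) \<longlonglongrightarrow> g x"
      using gl by (cases "x \<in> A") (auto simp: g_def)
  qed
  have tail: "Lp_norm M p (\<lambda>x. s (n + m) x - s n x) \<le> 2 * (1 / 2) ^ n" for n m
  proof -
    have "(\<lambda>x. s (n + m) x - s n x) = (\<lambda>x. \<Sum>k<m. s (Suc (n + k)) x - s (n + k) x)"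
      using sum_lessThan_telescope[of "\<lambda>k. s (n + k) x" m for x] by (intro ext) simp
    then have "Lp_norm M p (\<lambda>x. s (n + m) x - s n x) \<le> (\<Sum>k<m. Lp_norm M p (\<lambda>x. s (Suc (n + k)) x - s (n + k) x))"
      using Lp_sum[OF p, of "{..<m}" "\<lambda>k x. s (Suc (n + k)) x - s (n + k) x" M] d by simp
    also have "\<dots> \<le> (\<Sum>k<m. (1 / 2) ^ (n + k))" by (intro sum_mono fast)
    also have "\<dots> = (1 / 2) ^ n * (\<Sum>k<m. (1 / 2) ^ k)" by (simp add: power_add sum_distrib_left)
    also have "(\<Sum>k<m. (1 / 2 :: real) ^ k) \<le> 2" by (simp add: sum_gp_strict)
    finally show ?thesis by (simp add: mult.commute)
  qed
  have gs: "integrable M (\<lambda>x. norm (g x - s n x) powr p) \<and> (\<integral>x. norm (g x - s n x) powr p \<partial>M) \<le> (2 * (1 / 2) ^ n) powr p" for n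
  proof -
    have gn: "strongly_measurable M (\<lambda>x. g x - s n x)"
      by (rule strongly_measurable_diff[OF gsm strongly_measurable_simple[OF s(1)]])
    have [measurable]: "(\<lambda>x. norm (g x - s n x)) \<in> borel_measurable M" by (rule borel_measurable_norm_strongly[OF gn])
    have dm: "(\<lambda>x. s (n + m) x - s n x) \<in> Lp M p" for m by (rule Lp_diff(1)[OF p s(2) s(2)])
    have [measurable]: "(\<lambda>x. norm (s (n + m) x - s n x)) \<in> borel_measurable M" for m
      by (rule borel_measurable_norm_strongly[OF LpD(1)[OF dm]])
    have "(\<integral>\<^sup>+x. ennreal (norm (g x - s n x) powr p) \<partial>M) = (\<integral>\<^sup>+x. liminf (\<lambda>m. ennreal (norm (s (n + m) x - s n x) powr p)) \<partial>M)"
    proof (rule nn_integral_cong_AE)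
      show "AE x in M. ennreal (norm (g x - s n x) powr p) = liminf (\<lambda>m. ennreal (norm (s (n + m) x - s n x) powr p))"
        using AE_A
      proof eventually_elim
        case (elim x)
        have "(\<lambda>m. s (n + m) x) \<longlonglongrightarrow> g x" using LIMSEQ_ignore_initial_segment[OF gl[OF elim], of n] by (simp add: add.commute)
        then have "(\<lambda>m. norm (s (n + m) x - s n x)) \<longlonglongrightarrow> norm (g x - s n x)" by (intro tendsto_intros)
        from tendsto_powr'[OF this tendsto_const[of p]] p0
        have "(\<lambda>m. norm (s (n + m) x - s n x) powr p) \<longlonglongrightarrow> norm (g x - s n x) powr p" by simp
        then have "(\<lambda>m. ennreal (norm (s (n + m) x - s n x) powr p)) \<longlonglongrightarrow> ennreal (norm (g x - s n x) powr p)"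
          by (rule tendsto_ennrealI)
        then show ?case by (intro lim_imp_Liminf[symmetric]) auto
      qed
    qed
    also have "\<dots> \<le> liminf (\<lambda>m. \<integral>\<^sup>+x. ennreal (norm (s (n + m) x - s n x) powr p) \<partial>M)"
      by (rule nn_integral_liminf) measurable
    also have "\<dots> \<le> ennreal ((2 * (1 / 2) ^ n) powr p)"
    proof (rule Liminf_le)
      show "\<forall>\<^sub>F m in sequentially. (\<integral>\<^sup>+x. ennreal (norm (s (n + m) x - s n x) powr p) \<partial>M) \<le> ennreal ((2 * (1 / 2) ^ n) powr p)"
      proof (rule always_eventually, rule allI)
        fix m
        have "(\<integral>\<^sup>+x. ennreal (norm (s (n + m) x - s n x) powr p) \<partial>M) = ennreal (\<integral>x. norm (s (n + m) x - s n x) powr p \<partial>M)"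
          by (rule nn_integral_eq_integral[OF LpD(2)[OF dm]]) simp
        also have "\<dots> = ennreal (Lp_norm M p (\<lambda>x. s (n + m) x - s n x) powr p)" using p0 by (simp add: Lp_norm_powr)
        also have "\<dots> \<le> ennreal ((2 * (1 / 2) ^ n) powr p)"
          using tail[of n m] p0 by (intro ennreal_leI powr_mono2) (auto simp: Lp_norm_nonneg)
        finally show "(\<integral>\<^sup>+x. ennreal (norm (s (n + m) x - s n x) powr p) \<partial>M) \<le> ennreal ((2 * (1 / 2) ^ n) powr p)" .
      qed
    qed simp
    finally have fin: "(\<integral>\<^sup>+x. ennreal (norm (g x - s n x) powr p) \<partial>M) \<le> ennreal ((2 * (1 / 2) ^ n) powr p)" .
    have i: "integrable M (\<lambda>x. norm (g x - s n x) powr p)"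
      by (rule integrableI_bounded) (use fin order.strict_trans1 in \<open>auto simp: less_top[symmetric] top_unique\<close>)
    moreover have "(\<integral>x. norm (g x - s n x) powr p \<partial>M) \<le> (2 * (1 / 2) ^ n) powr p"
      using fin by (subst (asm) nn_integral_eq_integral[OF i]) auto
    ultimately show ?thesis by blast
  qed
  show thesis
  proof (rule that[of g])
    have "(\<lambda>x. g x - s 0 x) \<in> Lp M p"
      using gs[of 0] by (intro LpI strongly_measurable_diff gsm strongly_measurable_simple s) auto
    from Lp_add(1)[OF p this s(2)[of 0]] show "g \<in> Lp M p" by simp
    have "(\<lambda>n. 2 * (1 / 2 :: real) ^ n) \<longlonglongrightarrow> 2 * 0" by (intro tendsto_intros LIMSEQ_power_zero) auto
    then have l: "(\<lambda>n. 2 * (1 / 2 :: real) ^ n) \<longlonglongrightarrow> 0" by simp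
    have b: "Lp_norm M p (\<lambda>x. g x - s n x) \<le> 2 * (1 / 2) ^ n" for n
      by (rule Lp_norm_leI[OF p0]) (use gs in auto)
    show "(\<lambda>n. Lp_norm M p (\<lambda>x. g x - s n x)) \<longlonglongrightarrow> 0"
      by (rule tendsto_sandwich[OF _ _ tendsto_const l]) (use b in \<open>auto simp: Lp_norm_nonneg\<close>)
  qed
qed

lemma Lp_complete:
  fixes h :: "nat \<Rightarrow> 'a \<Rightarrow> 'b::complex_banach"
  assumes M: "prob_space M" and p: "p \<ge> 1" and h: "\<And>n. h n \<in> Lp M p"
    and fast: "\<And>n. Lp_norm M p (\<lambda>x. h (Suc n) x - h n x) \<le> (1 / 4) * (1 / 2) ^ n"
  obtains g where "g \<in> Lp M p" "(\<lambda>n. Lp_norm M p (\<lambda>x. g x - h n x)) \<longlonglongrightarrow> 0"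
proof -
  have "\<exists>s. simple_function M s \<and> s \<in> Lp M p \<and> Lp_norm M p (\<lambda>x. h n x - s x) < (1 / 4) * (1 / 2) ^ n" for n
    by (rule Lp_approx_simple[OF M p h[of n], of "(1 / 4) * (1 / 2) ^ n"]) auto
  then obtain s where s: "\<And>n. simple_function M (s n)" "\<And>n. s n \<in> Lp M p"
    "\<And>n. Lp_norm M p (\<lambda>x. h n x - s n x) < (1 / 4) * (1 / 2) ^ n" by metis
  have hs: "(\<lambda>x. h n x - s n x) \<in> Lp M p" "(\<lambda>x. h (Suc n) x - h n x) \<in> Lp M p" for n
    by (intro Lp_diff(1)[OF p] h s)+
  have "Lp_norm M p (\<lambda>x. s (Suc n) x - s n x) \<le> (1 / 2) ^ n" for n
  proof -
    have "Lp_norm M p (\<lambda>x. (h (Suc n) x - h n x) + (h n x - s n x) - (h (Suc n) x - s (Suc n) x)) \<le>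
      Lp_norm M p (\<lambda>x. (h (Suc n) x - h n x) + (h n x - s n x)) + Lp_norm M p (\<lambda>x. h (Suc n) x - s (Suc n) x)"
      by (intro Lp_diff(2)[OF p] Lp_add(1)[OF p] hs)
    also have "\<dots> \<le> Lp_norm M p (\<lambda>x. h (Suc n) x - h n x) + Lp_norm M p (\<lambda>x. h n x - s n x) + Lp_norm M p (\<lambda>x. h (Suc n) x - s (Suc n) x)"
      using Lp_add(2)[OF p hs(2) hs(1), of n n] by simp
    also have "\<dots> \<le> (1 / 4) * (1 / 2) ^ n + (1 / 4) * (1 / 2) ^ n + (1 / 4) * (1 / 2) ^ n"
    proof (intro add_mono fast)
      show "Lp_norm M p (\<lambda>x. h n x - s n x) \<le> (1 / 4) * (1 / 2) ^ n" using s(3)[of n] by simp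
      show "Lp_norm M p (\<lambda>x. h (Suc n) x - s (Suc n) x) \<le> (1 / 4) * (1 / 2) ^ n"
        by (rule order_trans[OF less_imp_le[OF s(3)]]) simp
    qed
    also have "\<dots> \<le> (1 / 2) ^ n" by simp
    finally show ?thesis by (simp add: algebra_simps)
  qed
  from Lp_complete_simple[OF M p s(1,2) this] obtain g where g: "g \<in> Lp M p" "(\<lambda>n. Lp_norm M p (\<lambda>x. g x - s n x)) \<longlonglongrightarrow> 0"
    by blast
  have "(\<lambda>n. (1 / 4) * (1 / 2 :: real) ^ n) \<longlonglongrightarrow> (1 / 4) * 0" by (intro tendsto_intros LIMSEQ_power_zero) auto
  then have l: "(\<lambda>n. Lp_norm M p (\<lambda>x. g x - s n x) + (1 / 4) * (1 / 2 :: real) ^ n) \<longlonglongrightarrow> 0"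
    using tendsto_add[OF g(2)] by fastforce
  have b: "Lp_norm M p (\<lambda>x. g x - h n x) \<le> Lp_norm M p (\<lambda>x. g x - s n x) + (1 / 4) * (1 / 2) ^ n" for n
    using Lp_diff(2)[OF p Lp_diff(1)[OF p g(1) s(2)] hs(1), of n n] s(3)[of n] by simp
  have "(\<lambda>n. Lp_norm M p (\<lambda>x. g x - h n x)) \<longlonglongrightarrow> 0"
    by (rule tendsto_sandwich[OF _ _ tendsto_const l]) (use b in \<open>auto simp: Lp_norm_nonneg\<close>)
  then show thesis using that g(1) by blast
qed


section \<open>K-convexity and sums with signs\<close>

lemma sum_sign_choices_Suc:
  fixes d :: "nat \<Rightarrow> real"
  shows "(\<Sum>h\<in>sign_choices (Suc N). \<phi> (\<Sum>j<Suc N. h j * d j))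
    = (\<Sum>h\<in>sign_choices N. \<phi> ((\<Sum>j<N. h j * d j) - d N) + \<phi> ((\<Sum>j<N. h j * d j) + d N :: real))"
proof -
  have eq: "(\<Sum>j<Suc N. (h(N := s)) j * d j) = (\<Sum>j<N. h j * d j) + s * d N" for h :: "nat \<Rightarrow> real" and s
  proof -
    have "(\<Sum>j<N. (h(N := s)) j * d j) = (\<Sum>j<N. h j * d j)" by (rule sum.cong) auto
    then show ?thesis by simp
  qed
  have "(\<Sum>h\<in>sign_choices (Suc N). \<phi> (\<Sum>j<Suc N. h j * d j))
    = (\<Sum>h\<in>(\<lambda>(y, g). g(N := y)) ` ({-1, 1} \<times> sign_choices N). \<phi> (\<Sum>j<Suc N. h j * d j))"
    by (simp only: lessThan_Suc[of N] PiE_insert_eq)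
  also have "\<dots> = (\<Sum>z\<in>{-1, 1} \<times> sign_choices N. \<phi> (\<Sum>j<Suc N. (case z of (y, g) \<Rightarrow> g(N := y)) j * d j))"
    by (rule sum.reindex[unfolded comp_def]) (rule inj_combinator, simp)
  also have "\<dots> = (\<Sum>s\<in>{-1, 1}. \<Sum>h\<in>sign_choices N. \<phi> (\<Sum>j<Suc N. (h(N := s)) j * d j))"
    by (simp add: sum.cartesian_product split_beta)
  also have "\<dots> = (\<Sum>h\<in>sign_choices N. \<phi> ((\<Sum>j<N. h j * d j) - d N) + \<phi> ((\<Sum>j<N. h j * d j) + d N))"
    unfolding eq by (simp add: sum.distrib)
  finally show ?thesis .
qed

lemma sign_sum_moments:
  fixes d :: "nat \<Rightarrow> real"
  assumes "\<And>j. j < N \<Longrightarrow> \<bar>d j\<bar> = 1"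
  shows "(\<Sum>h\<in>sign_choices N. (\<Sum>j<N. h j * d j)\<^sup>2) = 2 ^ N * real N"
    and "(\<Sum>h\<in>sign_choices N. (\<Sum>j<N. h j * d j) ^ 4) = 2 ^ N * (3 * (real N)\<^sup>2 - 2 * real N)"
proof -
  have "(\<Sum>h\<in>sign_choices N. (\<Sum>j<N. h j * d j)\<^sup>2) = 2 ^ N * real N \<and>
    (\<Sum>h\<in>sign_choices N. (\<Sum>j<N. h j * d j) ^ 4) = 2 ^ N * (3 * (real N)\<^sup>2 - 2 * real N)"
    using assms
  proof (induction N)
    case (Suc N)
    then have IH: "(\<Sum>h\<in>sign_choices N. (\<Sum>j<N. h j * d j)\<^sup>2) = 2 ^ N * real N"
      "(\<Sum>h\<in>sign_choices N. (\<Sum>j<N. h j * d j) ^ 4) = 2 ^ N * (3 * (real N)\<^sup>2 - 2 * real N)" by auto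
    have d: "(d N)\<^sup>2 = 1" using Suc.prems[of N] by (simp add: power2_eq_1_iff abs_eq_iff')
    have 2: "(s - d N)\<^sup>2 + (s + d N)\<^sup>2 = 2 * s\<^sup>2 + 2" for s
    proof -
      have "(s - d N)\<^sup>2 + (s + d N)\<^sup>2 = 2 * s\<^sup>2 + 2 * (d N)\<^sup>2" by (simp add: power2_eq_square algebra_simps)
      then show ?thesis using d by simp
    qed
    have 4: "(s - d N) ^ 4 + (s + d N) ^ 4 = 2 * s ^ 4 + 12 * s\<^sup>2 + 2" for s
    proof -
      have "(s - d N) ^ 4 + (s + d N) ^ 4 = 2 * s ^ 4 + 12 * s\<^sup>2 * (d N)\<^sup>2 + 2 * ((d N)\<^sup>2)\<^sup>2"
        by (simp add: power2_eq_square power4_eq_xxxx algebra_simps)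
      then show ?thesis using d by simp
    qed
    show ?case
      unfolding sum_sign_choices_Suc[of "\<lambda>s. s\<^sup>2"] sum_sign_choices_Suc[of "\<lambda>s. s ^ 4"] 2 4
      by (simp add: sum.distrib sum_distrib_left[symmetric] IH card_sign_choices)
        (simp add: power2_eq_square algebra_simps)
  qed simp
  then show "(\<Sum>h\<in>sign_choices N. (\<Sum>j<N. h j * d j)\<^sup>2) = 2 ^ N * real N"
    "(\<Sum>h\<in>sign_choices N. (\<Sum>j<N. h j * d j) ^ 4) = 2 ^ N * (3 * (real N)\<^sup>2 - 2 * real N)" by auto
qed

text \<open>
  Khintchine's inequality for the first absolute moment, obtained from the second and the fourth
  moment through \<open>\<bar>s\<bar> \<ge> (3 s\<^sup>2 / A - s\<^sup>4 / A\<^sup>3) / 2\<close> with \<open>A = \<surd>(3 N)\<close>.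
\<close>

lemma sign_sum_abs_lower_bound:
  fixes d :: "nat \<Rightarrow> real"
  assumes "\<And>j. j < N \<Longrightarrow> \<bar>d j\<bar> = 1" "N > 0"
  shows "(\<Sum>h\<in>sign_choices N. \<bar>\<Sum>j<N. h j * d j\<bar>) \<ge> 2 ^ N * (sqrt (3 * real N) / 3)"
proof -
  define A where "A = sqrt (3 * real N)"
  have A: "A > 0" "A\<^sup>2 = 3 * real N" using assms(2) by (auto simp: A_def)
  have pt: "\<bar>s\<bar> \<ge> (3 * s\<^sup>2 / A - s ^ 4 / A ^ 3) / 2" for s :: real
  proof -
    define u where "u = \<bar>s\<bar> / A"
    have u: "u \<ge> 0" using A by (simp add: u_def)
    have "u * ((u - 1)\<^sup>2 * (u + 2)) \<ge> 0" using u by (intro mult_nonneg_nonneg) auto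
    then have "u \<ge> (3 * u\<^sup>2 - u ^ 4) / 2" by (simp add: power2_eq_square power4_eq_xxxx algebra_simps)
    then have "A * ((3 * u\<^sup>2 - u ^ 4) / 2) \<le> A * u" using A by (intro mult_left_mono) auto
    moreover have "A * u = \<bar>s\<bar>" using A by (simp add: u_def)
    moreover have "A * ((3 * u\<^sup>2 - u ^ 4) / 2) = (3 * s\<^sup>2 / A - s ^ 4 / A ^ 3) / 2"
    proof -
      have "u\<^sup>2 = s\<^sup>2 / A\<^sup>2" "u ^ 4 = s ^ 4 / A ^ 4" by (simp_all add: u_def power_divide)
      then show ?thesis using A(1) by (simp add: power2_eq_square power3_eq_cube power4_eq_xxxx diff_divide_distrib right_diff_distrib)
    qed
    ultimately show ?thesis by linarith
  qed
  have f1: "(\<Sum>h\<in>sign_choices N. (3 * (\<Sum>j<N. h j * d j)\<^sup>2 / A - (\<Sum>j<N. h j * d j) ^ 4 / A ^ 3) / 2) \<le> (\<Sum>h\<in>sign_choices N. \<bar>\<Sum>j<N. h j * d j\<bar>)"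
    by (intro sum_mono pt)
  have f2: "(\<Sum>h\<in>sign_choices N. (3 * (\<Sum>j<N. h j * d j)\<^sup>2 / A - (\<Sum>j<N. h j * d j) ^ 4 / A ^ 3) / 2)
     = (3 * (2 ^ N * real N) / A - 2 ^ N * (3 * (real N)\<^sup>2 - 2 * real N) / A ^ 3) / 2"
    using sign_sum_moments[OF assms(1)]
    by (simp add: sum_subtractf sum_divide_distrib[symmetric] sum_distrib_left[symmetric])
  have f3: "(3 * (2 ^ N * real N) / A - 2 ^ N * (3 * (real N)\<^sup>2 - 2 * real N) / A ^ 3) / 2 \<ge> 2 ^ N * (A / 3)"
  proof -
    have "3 * (real N)\<^sup>2 - 2 * real N \<le> A ^ 4 / 3"
    proof -
      have "A ^ 4 = (3 * real N)\<^sup>2" using A(2) by (metis numeral_Bit0 power2_eq_square power_add)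
      then show ?thesis by (simp add: power2_eq_square)
    qed
    then have "(3 * (real N)\<^sup>2 - 2 * real N) / A ^ 3 \<le> (A ^ 4 / 3) / A ^ 3" using A by (intro divide_right_mono) auto
    also have "\<dots> = A / 3" using A by (simp add: power3_eq_cube power4_eq_xxxx)
    finally have "2 ^ N * ((3 * (real N)\<^sup>2 - 2 * real N) / A ^ 3) \<le> 2 ^ N * (A / 3)" by (intro mult_left_mono) auto
    moreover have "3 * (2 ^ N * real N) / A = 2 ^ N * A"
    proof -
      have "3 * real N / A = A" using A by (simp add: power2_eq_square flip: A(2))
      then show ?thesis by (metis mult.left_commute times_divide_eq_right)
    qed
    moreover have "a \<le> (x - y) / 2" if "y \<le> a" "x = 3 * a" for a x y :: real using that by simp
    ultimately show ?thesis by (simp only: times_divide_eq_right) (simp add: mult_ac)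
  qed
  show ?thesis using f3 f1 unfolding f2 A_def[symmetric] by (rule order_trans)
qed

text \<open>
  Vectors all of whose signed sums are almost extremal behave like the unit vectors of \<open>\<ell>\<^sub>1\<^sup>n\<close>: a
  combination with coefficients \<open>c\<^sub>k\<close> differs from the signed sum with the signs of the \<open>c\<^sub>k\<close> by at
  most \<open>\<Sum> (1 - \<bar>c\<^sub>k\<bar>)\<close>.
\<close>

lemma norm_combination_lower_bound:
  fixes x :: "nat \<Rightarrow> 'b::real_normed_vector"
  assumes x: "\<And>k. k < n \<Longrightarrow> norm (x k) \<le> 1"
    and signs: "\<And>\<eta>. \<eta> \<in> sign_choices n \<Longrightarrow> norm (\<Sum>k<n. \<eta> k *\<^sub>R x k) \<ge> real n - e"
    and c: "\<And>k. k < n \<Longrightarrow> \<bar>c k\<bar> \<le> 1"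
  shows "norm (\<Sum>k<n. c k *\<^sub>R x k) \<ge> (\<Sum>k<n. \<bar>c k\<bar>) - e"
proof -
  define \<eta> where "\<eta> = (\<lambda>k\<in>{..<n}. if c k \<ge> 0 then 1 else -1 :: real)"
  have \<eta>: "\<eta> \<in> sign_choices n" by (auto simp: \<eta>_def)
  have "norm ((\<Sum>k<n. \<eta> k *\<^sub>R x k) - (\<Sum>k<n. c k *\<^sub>R x k)) \<le> (\<Sum>k<n. 1 - \<bar>c k\<bar>)"
    unfolding sum_subtractf[symmetric] scaleR_diff_left[symmetric]
  proof (rule sum_norm_le)
    fix k assume "k \<in> {..<n}"
    then have k: "k < n" by simp
    have "norm ((\<eta> k - c k) *\<^sub>R x k) \<le> \<bar>\<eta> k - c k\<bar> * 1" using x[OF k] by (simp add: mult_left_le)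
    also have "\<dots> = 1 - \<bar>c k\<bar>" using c[OF k] k by (auto simp: \<eta>_def)
    finally show "norm ((\<eta> k - c k) *\<^sub>R x k) \<le> 1 - \<bar>c k\<bar>" .
  qed
  then have "norm (\<Sum>k<n. \<eta> k *\<^sub>R x k) \<le> norm (\<Sum>k<n. c k *\<^sub>R x k) + (real n - (\<Sum>k<n. \<bar>c k\<bar>))"
    using norm_triangle_ineq2[of "\<Sum>k<n. \<eta> k *\<^sub>R x k" "\<Sum>k<n. c k *\<^sub>R x k"] by (simp add: sum_subtractf)
  then show ?thesis using signs[OF \<eta>] by linarith
qed

lemma rademacher_half:
  assumes "rademacher_sequence \<Omega> \<epsilon>" "s \<in> {-1, 1::real}"
  shows "measure \<Omega> {\<omega> \<in> space \<Omega>. \<epsilon> k \<omega> = s} = 1 / 2"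
proof -
  have "measure \<Omega> {\<omega> \<in> space \<Omega>. \<epsilon> k \<omega> = 1} = 1 / 2 \<and> measure \<Omega> {\<omega> \<in> space \<Omega>. \<epsilon> k \<omega> = -1} = 1 / 2"
    using assms(1) unfolding rademacher_sequence_def by (elim conjE) (erule spec[where x = k])
  then show ?thesis using assms(2) by (elim insertE) (simp_all only: empty_iff)
qed

lemma integral_indicator_complex:
  assumes "prob_space M" "A \<in> sets M"
  shows "(\<integral>x. indicator A x \<partial>M) = complex_of_real (measure M A)" "integrable M (indicator A :: _ \<Rightarrow> complex)"
proof -
  interpret prob_space M by fact
  have e: "indicator A = (\<lambda>x. complex_of_real (indicator A x))" by (auto simp: indicator_def)
  show "(\<integral>x. indicator A x \<partial>M) = complex_of_real (measure M A)"
    unfolding e using assms(2) by (simp add: integral_complex_of_real)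
  show "integrable M (indicator A :: _ \<Rightarrow> complex)"
    unfolding e using assms(2) by (simp add: emeasure_eq_measure)
qed

lemma rademacher_cylinder_prob:
  assumes r: "rademacher_sequence \<Omega> \<epsilon>" and J: "finite J" and \<sigma>: "\<And>j. j \<in> J \<Longrightarrow> \<sigma> j \<in> {-1, 1::real}"
  shows "measure \<Omega> {\<omega> \<in> space \<Omega>. \<forall>j\<in>J. \<epsilon> j \<omega> = \<sigma> j} = (1 / 2) ^ card J"
proof (cases "J = {}")
  case True
  interpret prob_space \<Omega> using r by (simp add: rademacher_sequence_def)
  show ?thesis using True by (simp add: prob_space)
next
  case False
  interpret prob_space \<Omega> using r by (simp add: rademacher_sequence_def)
  have ind: "indep_vars (\<lambda>_. borel) \<epsilon> UNIV" using r by (simp add: rademacher_sequence_def)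
  have ind': "indep_sets (\<lambda>i. {\<epsilon> i -` A \<inter> space \<Omega> | A. A \<in> sets borel}) UNIV"
    using ind by (simp add: indep_vars_def2)
  have "prob (\<Inter>j\<in>J. {\<omega> \<in> space \<Omega>. \<epsilon> j \<omega> = \<sigma> j}) = (\<Prod>j\<in>J. prob {\<omega> \<in> space \<Omega>. \<epsilon> j \<omega> = \<sigma> j})"
  proof (rule indep_setsD[OF ind' _ False J])
    show "\<forall>j\<in>J. {\<omega> \<in> space \<Omega>. \<epsilon> j \<omega> = \<sigma> j} \<in> {\<epsilon> j -` A \<inter> space \<Omega> | A. A \<in> sets borel}"
      by (auto intro!: exI[of _ "{\<sigma> _}"])
  qed simp
  also have "(\<Inter>j\<in>J. {\<omega> \<in> space \<Omega>. \<epsilon> j \<omega> = \<sigma> j}) = {\<omega> \<in> space \<Omega>. \<forall>j\<in>J. \<epsilon> j \<omega> = \<sigma> j}" using False by auto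
  also have "(\<Prod>j\<in>J. prob {\<omega> \<in> space \<Omega>. \<epsilon> j \<omega> = \<sigma> j}) = (\<Prod>j\<in>J. 1 / 2)"
    by (rule prod.cong) (use rademacher_half[OF r] \<sigma> in auto)
  finally show ?thesis by simp
qed

lemma rademacher_AE_signs:
  assumes r: "rademacher_sequence \<Omega> \<epsilon>"
  shows "AE \<omega> in \<Omega>. \<epsilon> j \<omega> \<in> {-1, 1}"
proof -
  interpret prob_space \<Omega> using r by (simp add: rademacher_sequence_def)
  have [measurable]: "\<epsilon> j \<in> borel_measurable \<Omega>" using r by (simp add: rademacher_sequence_def indep_vars_def2)
  have "prob ({\<omega> \<in> space \<Omega>. \<epsilon> j \<omega> = 1} \<union> {\<omega> \<in> space \<Omega>. \<epsilon> j \<omega> = -1}) = prob {\<omega> \<in> space \<Omega>. \<epsilon> j \<omega> = 1} + prob {\<omega> \<in> space \<Omega>. \<epsilon> j \<omega> = -1}"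
    by (rule finite_measure_Union) auto
  also have "\<dots> = 1" using rademacher_half[OF r, of 1 j] rademacher_half[OF r, of "-1" j] by simp
  finally have "AE \<omega> in \<Omega>. \<omega> \<in> {\<omega> \<in> space \<Omega>. \<epsilon> j \<omega> = 1} \<union> {\<omega> \<in> space \<Omega>. \<epsilon> j \<omega> = -1}"
    by (subst prob_eq_1[symmetric]) auto
  then show ?thesis by eventually_elim auto
qed

text \<open>
  The indicator of a cylinder set has finitely many nonzero Rademacher coefficients, so its Rademacher
  projection is a finite sum.
\<close>

lemma rademacher_cylinder_coefficient:
  assumes r: "rademacher_sequence \<Omega> \<epsilon>" and \<sigma>: "\<sigma> \<in> sign_choices N"
  defines "D \<equiv> {\<omega> \<in> space \<Omega>. \<forall>j\<in>{..<N}. \<epsilon> j \<omega> = \<sigma> j}"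
  shows "(\<integral>\<omega>. indicator D \<omega> * complex_of_real (\<epsilon> m \<omega>) \<partial>\<Omega>) = (if m < N then of_real (\<sigma> m / 2 ^ N) else 0)"
proof -
  interpret prob_space \<Omega> using r by (simp add: rademacher_sequence_def)
  have m[measurable]: "\<epsilon> j \<in> borel_measurable \<Omega>" for j using r by (simp add: rademacher_sequence_def indep_vars_def2)
  have D[measurable]: "D \<in> sets \<Omega>" unfolding D_def by measurable
  show ?thesis
  proof (cases "m < N")
    case True
    have "(\<integral>\<omega>. indicator D \<omega> * complex_of_real (\<epsilon> m \<omega>) \<partial>\<Omega>) = (\<integral>\<omega>. of_real (\<sigma> m) * indicator D \<omega> \<partial>\<Omega>)"
      by (rule Bochner_Integration.integral_cong) (use True in \<open>auto simp: D_def indicator_def\<close>)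
    also have "\<dots> = of_real (\<sigma> m) * of_real (prob D)"
      using integral_indicator_complex(1)[OF prob_space_axioms D] by simp
    also have "prob D = (1 / 2) ^ N"
      unfolding D_def using rademacher_cylinder_prob[OF r finite_lessThan, of N \<sigma>] PiE_mem[OF \<sigma>] by simp
    finally show ?thesis using True by (simp add: power_one_over)
  next
    case False
    define E where "E s = {\<omega> \<in> space \<Omega>. \<forall>j\<in>insert m {..<N}. \<epsilon> j \<omega> = (\<sigma>(m := s)) j}" for s :: real
    have E[measurable]: "E s \<in> sets \<Omega>" for s unfolding E_def by measurable
    have pE: "prob (E s) = (1 / 2) ^ Suc N" if "s \<in> {-1, 1}" for s
    proof -
      have "(\<sigma>(m := s)) j \<in> {-1, 1}" if "j \<in> insert m {..<N}" for j
        using PiE_mem[OF \<sigma>, of j] that \<open>s \<in> {-1, 1}\<close> by (cases "j = m") simp_all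
      from rademacher_cylinder_prob[OF r _ this]
      have "prob (E s) = (1 / 2) ^ card (insert m {..<N})" unfolding E_def by (simp only: finite_insert finite_lessThan)
      also have "card (insert m {..<N}) = Suc N" using False by (simp add: card_insert_if)
      finally show ?thesis .
    qed
    have "(\<integral>\<omega>. indicator D \<omega> * complex_of_real (\<epsilon> m \<omega>) \<partial>\<Omega>) = (\<integral>\<omega>. indicator (E 1) \<omega> - indicator (E (-1)) \<omega> \<partial>\<Omega>)"
    proof (rule integral_cong_AE)
      show "AE \<omega> in \<Omega>. indicator D \<omega> * complex_of_real (\<epsilon> m \<omega>) = indicator (E 1) \<omega> - indicator (E (-1)) \<omega>"
        using rademacher_AE_signs[OF r, of m]
        by eventually_elim (use False in \<open>auto simp: D_def E_def indicator_def\<close>)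
    qed auto
    also have "\<dots> = of_real (prob (E 1)) - of_real (prob (E (-1)))"
      using integral_indicator_complex[OF prob_space_axioms E] by (simp add: Bochner_Integration.integral_diff)
    also have "\<dots> = 0" by (simp add: pE)
    finally show ?thesis using False by simp
  qed
qed


text \<open>
  The easy half of the Maurey--Pisier theorem. Let \<open>n = 2\<^sup>N\<close> and let \<open>D\<^sub>k\<close> be the cylinder sets of
  length \<open>N\<close>, with sign patterns \<open>h\<^sub>k\<close>. The function \<open>\<Sum> 1\<^sub>D\<^sub>k x\<^sub>k\<close> has norm at most one, and its
  projection has the coefficients \<open>S\<^sub>k / 2\<^sup>N\<close> with \<open>S\<^sub>k = \<Sum>\<^sub>j h\<^sub>k(j) \<epsilon>\<^sub>j\<close>. If the \<open>x\<^sub>k\<close> were almost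
  the unit vectors of \<open>\<ell>\<^sub>1\<^sup>n\<close>, the norm of the projection would be almost \<open>\<Sum> \<bar>S\<^sub>k\<bar> / 2\<^sup>N\<close>, which by
  Khintchine's inequality is of order \<open>\<surd>N\<close> at almost every point; for large \<open>N\<close> this contradicts the
  boundedness of the projection.
\<close>

lemma K_convex_sign_bound:
  fixes \<Omega> :: "'w measure" and \<epsilon> :: "nat \<Rightarrow> 'w \<Rightarrow> real"
  assumes r: "rademacher_sequence \<Omega> \<epsilon>" and K: "K_convex \<Omega> \<epsilon> (UNIV :: 'x::complex_banach set) norm"
  obtains n :: nat and e :: real where "n > 0" "e > 0"
    "\<And>x :: nat \<Rightarrow> 'x. (\<And>k. k < n \<Longrightarrow> norm (x k) \<le> 1) \<Longrightarrow> \<exists>\<eta>\<in>sign_choices n. norm (\<Sum>k<n. \<eta> k *\<^sub>R x k) < real n - e"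
proof -
  interpret prob_space \<Omega> using r by (simp add: rademacher_sequence_def)
  have [measurable]: "\<epsilon> j \<in> borel_measurable \<Omega>" for j using r by (simp add: rademacher_sequence_def indep_vars_def2)
  obtain C where C: "\<And>n f g (v :: nat \<Rightarrow> 'x). (\<forall>k<n. f k \<in> Lp \<Omega> 2 \<and> rademacher_projection \<Omega> \<epsilon> (f k) (g k) \<and> v k \<in> UNIV) \<Longrightarrow>
      sqrt (\<integral>\<omega>. (norm (\<Sum>k<n. g k \<omega> *\<^sub>C v k))\<^sup>2 \<partial>\<Omega>) \<le> C * sqrt (\<integral>\<omega>. (norm (\<Sum>k<n. f k \<omega> *\<^sub>C v k))\<^sup>2 \<partial>\<Omega>)"
    using K unfolding K_convex_def by blast
  define C' where "C' = \<bar>C\<bar>"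
  obtain N :: nat where N: "real N > 3 * (C' + 2)\<^sup>2" using reals_Archimedean2 by blast
  have N0: "N > 0"
  proof (rule ccontr)
    assume "\<not> N > 0"
    then have "3 * (C' + 2)\<^sup>2 < 0" using N by simp
    then show False by (metis not_less zero_le_mult_iff zero_le_numeral zero_le_power2)
  qed
  have sN: "sqrt (3 * real N) / 3 > C' + 1"
  proof -
    have "(3 * (C' + 2))\<^sup>2 = 3 * (3 * (C' + 2)\<^sup>2)" by (simp only: power_mult_distrib) simp
    then have "(3 * (C' + 2))\<^sup>2 < 3 * real N" using N by simp
    then have "3 * (C' + 2) < sqrt (3 * real N)" by (intro real_less_rsqrt)
    then show ?thesis by simp
  qed
  \<comment> \<open>The loss \<open>e\<close> is chosen such that \<open>e N / 2\<^sup>N < 1\<close>; the margin of \<open>N\<close> above absorbs it.\<close>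
  define n where "n = (2::nat) ^ N"
  define e where "e = 1 / (real N + 1)"
  have n: "n > 0" and e: "e > 0" by (auto simp: n_def e_def)
  have "card (sign_choices N) = n" by (simp only: card_sign_choices n_def)
  then obtain h where h: "bij_betw h {..<n} (sign_choices N)"
    using ex_bij_betw_nat_finite[OF finite_sign_choices[of N]] by (auto simp: atLeast0LessThan)
  have hs: "h k \<in> sign_choices N" if "k < n" for k using h that by (auto simp: bij_betw_def)
  define D where "D k = {\<omega> \<in> space \<Omega>. \<forall>j\<in>{..<N}. \<epsilon> j \<omega> = h k j}" for k
  have D[measurable]: "D k \<in> sets \<Omega>" for k unfolding D_def by measurable
  define f where "f k \<omega> = (indicator (D k) \<omega> :: complex)" for k \<omega>
  define S where "S k \<omega> = (\<Sum>j<N. h k j * \<epsilon> j \<omega>)" for k \<omega>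
  define g where "g k \<omega> = complex_of_real (S k \<omega> / 2 ^ N)" for k \<omega>
  have AEs: "AE \<omega> in \<Omega>. \<forall>j. \<epsilon> j \<omega> \<in> {-1, 1}"
    using rademacher_AE_signs[OF r] by (subst AE_all_countable) auto
  have S_le: "\<bar>S k \<omega>\<bar> \<le> real N" if "k < n" "\<forall>j. \<epsilon> j \<omega> \<in> {-1, 1}" for k \<omega>
  proof -
    have "\<bar>S k \<omega>\<bar> \<le> (\<Sum>j<N. \<bar>h k j * \<epsilon> j \<omega>\<bar>)" unfolding S_def by (rule sum_abs)
    also have "\<dots> \<le> (\<Sum>j<N. 1)"
    proof (rule sum_mono)
      fix j assume "j \<in> {..<N}"
      then have "h k j \<in> {-1, 1}" using PiE_mem[OF hs[OF that(1)]] by blast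
      moreover have "\<epsilon> j \<omega> \<in> {-1, 1}" using that(2) by blast
      ultimately show "\<bar>h k j * \<epsilon> j \<omega>\<bar> \<le> 1" by (auto simp: abs_mult)
    qed
    finally show ?thesis by simp
  qed
  have fL: "f k \<in> Lp \<Omega> 2" for k
    by (rule Lp_bounded(1)[OF prob_space_axioms, of 2 _ 1])
       (auto simp: f_def[abs_def] indicator_def intro!: strongly_measurable_borel)
  have gm: "strongly_measurable \<Omega> (g k)" for k
    by (rule strongly_measurable_borel) (simp add: g_def[abs_def] S_def)
  have gL: "g k \<in> Lp \<Omega> 2" if "k < n" for k
  proof (rule Lp_bounded(1)[OF prob_space_axioms _ gm, where B = "real N"])
    show "AE \<omega> in \<Omega>. norm (g k \<omega>) \<le> real N"
      using AEs
    proof eventually_elim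
      case (elim \<omega>)
      have "norm (g k \<omega>) = \<bar>S k \<omega>\<bar> / 2 ^ N" unfolding g_def norm_of_real by simp
      also have "\<dots> \<le> \<bar>S k \<omega>\<bar> / 1" by (intro divide_left_mono) auto
      finally show ?case using S_le[OF that elim] by simp
    qed
  qed auto
  have proj: "rademacher_projection \<Omega> \<epsilon> (f k) (g k)" if k: "k < n" for k
    unfolding rademacher_projection_def
  proof (intro conjI gL k)
    have "(\<Sum>m<M. (\<integral>\<omega>'. f k \<omega>' * complex_of_real (\<epsilon> m \<omega>') \<partial>\<Omega>) * complex_of_real (\<epsilon> m \<omega>)) = g k \<omega>" if M: "M \<ge> N" for M \<omega>
    proof -
      have "(\<Sum>m<M. (\<integral>\<omega>'. f k \<omega>' * complex_of_real (\<epsilon> m \<omega>') \<partial>\<Omega>) * complex_of_real (\<epsilon> m \<omega>))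
        = (\<Sum>m<M. (if m < N then of_real (h k m / 2 ^ N) else 0) * complex_of_real (\<epsilon> m \<omega>))"
        unfolding f_def D_def rademacher_cylinder_coefficient[OF r hs[OF k]] ..
      also have "\<dots> = (\<Sum>m<N. of_real (h k m / 2 ^ N) * complex_of_real (\<epsilon> m \<omega>))"
        by (rule sum.mono_neutral_cong_right) (use M in auto)
      also have "\<dots> = g k \<omega>"
        unfolding g_def S_def by (simp add: sum_divide_distrib)
      finally show ?thesis .
    qed
    then have "\<forall>\<^sub>F M in sequentially. 0 = Lp_norm \<Omega> 2 (\<lambda>\<omega>. g k \<omega> - (\<Sum>m<M. (\<integral>\<omega>'. f k \<omega>' * complex_of_real (\<epsilon> m \<omega>') \<partial>\<Omega>) * complex_of_real (\<epsilon> m \<omega>)))"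
      unfolding eventually_sequentially by (intro exI[of _ N]) (simp add: Lp_norm_def)
    then show "(\<lambda>M. Lp_norm \<Omega> 2 (\<lambda>\<omega>. g k \<omega> - (\<Sum>m<M. (\<integral>\<omega>'. f k \<omega>' * complex_of_real (\<epsilon> m \<omega>') \<partial>\<Omega>) * complex_of_real (\<epsilon> m \<omega>)))) \<longlonglongrightarrow> 0"
      by (rule Lim_transform_eventually[OF tendsto_const])
  qed
  show thesis
  proof (rule that[OF n e], rule ccontr)
    fix x :: "nat \<Rightarrow> 'x"
    assume x: "\<And>k. k < n \<Longrightarrow> norm (x k) \<le> 1"
      and "\<not> (\<exists>\<eta>\<in>sign_choices n. norm (\<Sum>k<n. \<eta> k *\<^sub>R x k) < real n - e)"
    then have signs: "norm (\<Sum>k<n. \<eta> k *\<^sub>R x k) \<ge> real n - e" if "\<eta> \<in> sign_choices n" for \<eta> using that by force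
    have f_le: "norm (\<Sum>k<n. f k \<omega> *\<^sub>C x k) \<le> 1" for \<omega>
    proof (cases "\<exists>k<n. \<omega> \<in> D k")
      case True
      then obtain k where k: "k < n" "\<omega> \<in> D k" by blast
      have uniq: "l = k" if "l < n" "\<omega> \<in> D l" for l
      proof -
        have "h l j = h k j" if "j \<in> {..<N}" for j using \<open>\<omega> \<in> D l\<close> k(2) that by (auto simp: D_def)
        then have "h l = h k" using hs[OF k(1)] hs[OF \<open>l < n\<close>] by (intro PiE_ext) auto
        then show ?thesis using inj_onD[OF bij_betw_imp_inj_on[OF h]] k(1) that(1) by simp
      qed
      have "(\<Sum>l<n. f l \<omega> *\<^sub>C x l) = (\<Sum>l<n. if l = k then x k else 0)"
      proof (rule sum.cong[OF refl])
        fix l assume l: "l \<in> {..<n}"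
        show "f l \<omega> *\<^sub>C x l = (if l = k then x k else 0)"
        proof (cases "l = k")
          case True
          then show ?thesis using k(2) by (simp add: f_def scaleC_one)
        next
          case False
          then have "\<omega> \<notin> D l" using uniq l by blast
          then show ?thesis using False by (simp add: f_def)
        qed
      qed
      also have "\<dots> = x k" using k by simp
      finally show ?thesis using x k by simp
    next
      case False
      then have "(\<Sum>l<n. f l \<omega> *\<^sub>C x l) = 0" by (intro sum.neutral) (auto simp: f_def)
      then show ?thesis by simp
    qed
    have Fsm: "strongly_measurable \<Omega> (\<lambda>\<omega>. \<Sum>k<n. f k \<omega> *\<^sub>C x k)"
      by (intro strongly_measurable_sum strongly_measurable_scaleC_vector LpD(1)[OF fL])
    have Gsm: "strongly_measurable \<Omega> (\<lambda>\<omega>. \<Sum>k<n. g k \<omega> *\<^sub>C x k)"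
      by (intro strongly_measurable_sum strongly_measurable_scaleC_vector gm)
    have [measurable]: "(\<lambda>\<omega>. norm (\<Sum>k<n. f k \<omega> *\<^sub>C x k)) \<in> borel_measurable \<Omega>" "(\<lambda>\<omega>. norm (\<Sum>k<n. g k \<omega> *\<^sub>C x k)) \<in> borel_measurable \<Omega>"
      by (rule borel_measurable_norm_strongly[OF Fsm], rule borel_measurable_norm_strongly[OF Gsm])
    have "(\<integral>\<omega>. (norm (\<Sum>k<n. f k \<omega> *\<^sub>C x k))\<^sup>2 \<partial>\<Omega>) \<le> (\<integral>\<omega>. 1 \<partial>\<Omega>)"
    proof (rule integral_mono)
      show "integrable \<Omega> (\<lambda>\<omega>. (norm (\<Sum>k<n. f k \<omega> *\<^sub>C x k))\<^sup>2)"
        by (rule integrable_const_bound[of _ 1]) (use f_le in \<open>auto simp: power_le_one\<close>)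
    qed (use f_le in \<open>auto simp: power_le_one\<close>)
    then have If: "sqrt (\<integral>\<omega>. (norm (\<Sum>k<n. f k \<omega> *\<^sub>C x k))\<^sup>2 \<partial>\<Omega>) \<le> 1" by (simp add: prob_space)
    have low: "norm (\<Sum>k<n. g k \<omega> *\<^sub>C x k) \<ge> C' + 1 - e * real N / 2 ^ N" if s: "\<forall>j. \<epsilon> j \<omega> \<in> {-1, 1}" for \<omega>
    proof -
      have c: "\<bar>S k \<omega> / real N\<bar> \<le> 1" if "k < n" for k using S_le[OF that s] N0 by simp
      have lo: "norm (\<Sum>k<n. (S k \<omega> / real N) *\<^sub>R x k) \<ge> (\<Sum>k<n. \<bar>S k \<omega> / real N\<bar>) - e"
        by (rule norm_combination_lower_bound[OF x signs c])
      have gx: "(\<Sum>k<n. g k \<omega> *\<^sub>C x k) = (real N / 2 ^ N) *\<^sub>R (\<Sum>k<n. (S k \<omega> / real N) *\<^sub>R x k)"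
        unfolding scaleR_sum_right
      proof (rule sum.cong[OF refl])
        fix k
        have "(real N / 2 ^ N) * (S k \<omega> / real N) = S k \<omega> / 2 ^ N" using N0 by simp
        then show "g k \<omega> *\<^sub>C x k = (real N / 2 ^ N) *\<^sub>R (S k \<omega> / real N) *\<^sub>R x k"
          unfolding scaleR_scaleR by (simp only: g_def scaleR_scaleC)
      qed
      have nS: "norm ((real N / 2 ^ N) *\<^sub>R Z) = (real N / 2 ^ N) * norm Z" for Z :: 'x by simp
      have 1: "norm (\<Sum>k<n. g k \<omega> *\<^sub>C x k) \<ge> (real N / 2 ^ N) * ((\<Sum>k<n. \<bar>S k \<omega> / real N\<bar>) - e)"
        unfolding gx nS by (rule mult_left_mono[OF lo]) simp
      have "(\<Sum>k<n. \<bar>S k \<omega>\<bar>) = (\<Sum>\<sigma>\<in>sign_choices N. \<bar>\<Sum>j<N. \<sigma> j * \<epsilon> j \<omega>\<bar>)"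
        unfolding S_def using sum.reindex_bij_betw[OF h, of "\<lambda>\<sigma>. \<bar>\<Sum>j<N. \<sigma> j * \<epsilon> j \<omega>\<bar>"] .
      also have "\<dots> \<ge> 2 ^ N * (sqrt (3 * real N) / 3)"
      proof (rule sign_sum_abs_lower_bound[OF _ N0])
        fix j show "\<bar>\<epsilon> j \<omega>\<bar> = 1" using s[rule_format, of j] by auto
      qed
      finally have "(\<Sum>k<n. \<bar>S k \<omega>\<bar>) / 2 ^ N \<ge> sqrt (3 * real N) / 3" by (simp add: pos_le_divide_eq mult.commute)
      then have "(\<Sum>k<n. \<bar>S k \<omega>\<bar>) / 2 ^ N \<ge> C' + 1" using sN by linarith
      moreover have "(real N / 2 ^ N) * ((\<Sum>k<n. \<bar>S k \<omega> / real N\<bar>) - e) = (\<Sum>k<n. \<bar>S k \<omega>\<bar>) / 2 ^ N - e * real N / 2 ^ N"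
        using N0 by (simp add: right_diff_distrib sum_divide_distrib[symmetric] abs_divide)
      ultimately show ?thesis using 1 by linarith
    qed
    have eN: "e * real N / 2 ^ N < 1"
    proof -
      have "e * real N < 1" by (simp add: e_def)
      also have "1 \<le> (2::real) ^ N" by simp
      finally show ?thesis by (simp add: pos_divide_less_eq)
    qed
    define q where "q = C' + 1 - e * real N / 2 ^ N"
    have q: "q > C'" using eN unfolding q_def by linarith
    moreover have "C' \<ge> 0" by (simp add: C'_def)
    ultimately have q0: "q \<ge> 0" by linarith
    have up: "norm (\<Sum>k<n. g k \<omega> *\<^sub>C x k) \<le> real n * real N" if s: "\<forall>j. \<epsilon> j \<omega> \<in> {-1, 1}" for \<omega>
    proof -
      have "norm (\<Sum>k<n. g k \<omega> *\<^sub>C x k) \<le> (\<Sum>k<n. real N)"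
      proof (rule sum_norm_le)
        fix k assume k: "k \<in> {..<n}"
        have "norm (g k \<omega>) = \<bar>S k \<omega>\<bar> / 2 ^ N" unfolding g_def norm_of_real by simp
        also have "\<dots> \<le> \<bar>S k \<omega>\<bar> / 1" by (intro divide_left_mono) auto
        finally have "norm (g k \<omega>) \<le> real N" using S_le[OF _ s, of k] k by simp
        then have "norm (g k \<omega>) * norm (x k) \<le> real N * 1" using x[of k] k by (intro mult_mono) auto
        then show "norm (g k \<omega> *\<^sub>C x k) \<le> real N" by (simp add: norm_scaleC)
      qed
      then show ?thesis by simp
    qed
    have "(\<integral>\<omega>. q\<^sup>2 \<partial>\<Omega>) \<le> (\<integral>\<omega>. (norm (\<Sum>k<n. g k \<omega> *\<^sub>C x k))\<^sup>2 \<partial>\<Omega>)"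
    proof (rule integral_mono_AE)
      show "integrable \<Omega> (\<lambda>\<omega>. (norm (\<Sum>k<n. g k \<omega> *\<^sub>C x k))\<^sup>2)"
        by (rule integrable_const_bound[of _ "(real n * real N)\<^sup>2"])
           (use AEs up in \<open>auto elim!: eventually_mono intro!: power_mono\<close>)
      show "AE \<omega> in \<Omega>. q\<^sup>2 \<le> (norm (\<Sum>k<n. g k \<omega> *\<^sub>C x k))\<^sup>2"
        using AEs by eventually_elim (use low q0 in \<open>auto simp: q_def intro!: power_mono\<close>)
    qed simp
    then have "q \<le> sqrt (\<integral>\<omega>. (norm (\<Sum>k<n. g k \<omega> *\<^sub>C x k))\<^sup>2 \<partial>\<Omega>)"
      by (intro real_le_rsqrt) (simp add: prob_space)
    also have "\<dots> \<le> C * sqrt (\<integral>\<omega>. (norm (\<Sum>k<n. f k \<omega> *\<^sub>C x k))\<^sup>2 \<partial>\<Omega>)"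
      by (rule C) (use fL proj in auto)
    also have "\<dots> \<le> C' * 1"
      unfolding C'_def by (intro mult_mono If) auto
    finally show False using q by simp
  qed
qed


text \<open>
  The distance of \<open>s\<^sup>p\<close> from its tangent at \<open>s = 1\<close>, that is, the defect in Bernoulli's inequality.
\<close>

definition power_gap :: "real \<Rightarrow> real \<Rightarrow> real" where
  "power_gap p s = s powr p - 1 - p * (s - 1)"

lemma power_gap_nonneg:
  assumes "p \<ge> 1" "s \<ge> 0" shows "power_gap p s \<ge> 0"
proof (cases "s = 0")
  case True
  then show ?thesis using assms by (simp add: power_gap_def)
next
  case False
  then have "(s powr p) powr (1 / p) * 1 powr (1 - 1 / p) \<le> 1 / p * (s powr p) + (1 - 1 / p) * 1"
    using assms by (intro Youngs_inequality_0) auto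
  then have "s \<le> 1 / p * (s powr p) + (1 - 1 / p)" using assms by (simp add: powr_powr)
  then have "p * s \<le> p * (1 / p * (s powr p) + (1 - 1 / p))" using assms by (intro mult_left_mono) auto
  then show ?thesis using assms by (simp add: power_gap_def right_diff_distrib distrib_left)
qed

lemma power_gap_pos:
  assumes "p > 1" "s \<ge> 0" "s \<noteq> 1" shows "power_gap p s > 0"
proof -
  define w where "w = sqrt s"
  have w: "w \<ge> 0" "s = w\<^sup>2" "w \<noteq> 1" using assms by (auto simp: w_def)
  have sp: "s powr p = (w powr p)\<^sup>2" using w by (simp add: power2_eq_square powr_mult)
  show ?thesis
  proof (cases "1 + p * (w - 1) \<ge> 0")
    case True
    have "1 + p * (w - 1) \<le> w powr p" using power_gap_nonneg[of p w] assms w by (simp add: power_gap_def)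
    then have "(1 + p * (w - 1))\<^sup>2 \<le> s powr p" unfolding sp using True by (intro power_mono) auto
    moreover have "(1 + p * (w - 1))\<^sup>2 - (1 + p * (s - 1)) = p * (p - 1) * (w - 1)\<^sup>2"
      unfolding w(2) by (simp add: power2_eq_square algebra_simps)
    moreover have "p * (p - 1) * (w - 1)\<^sup>2 > 0" using assms w by simp
    ultimately show ?thesis by (simp add: power_gap_def)
  next
    case False
    have "p * (s - 1) = p * (w - 1) * (w + 1)" unfolding w(2) by (simp add: power2_eq_square algebra_simps)
    also have "\<dots> \<le> p * (w - 1) * 1" using False w by (intro mult_left_mono_neg) auto
    also have "\<dots> < - 1" using False by simp
    finally have "1 + p * (s - 1) < 0" by simp
    then show ?thesis unfolding power_gap_def using powr_ge_zero[of s p] by linarith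
  qed
qed

lemma power_gap_uniform:
  assumes p: "p > 1" and \<tau>: "0 < \<tau>" "\<tau> < 1"
  obtains g where "g > 0" "\<And>s. s \<ge> 0 \<Longrightarrow> \<bar>s - 1\<bar> \<ge> \<tau> \<Longrightarrow> power_gap p s \<ge> g"
proof
  define g where "g = min (power_gap p (1 + \<tau>)) (power_gap p (1 - \<tau>))"
  show "g > 0" unfolding g_def using power_gap_pos[of p "1 + \<tau>"] power_gap_pos[of p "1 - \<tau>"] p \<tau> by auto
  fix s :: real assume s: "s \<ge> 0" "\<bar>s - 1\<bar> \<ge> \<tau>"
  have conv: "power_gap p (1 + t * (s - 1)) \<le> power_gap p s" if t: "0 \<le> t" "t \<le> 1" for t
  proof -
    have "((1 - t) * 1 + t * s) powr p \<le> (1 - t) * 1 powr p + t * s powr p"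
      using p s t by (intro powr_convex_combination) auto
    moreover have "(1 - t) * 1 + t * s = 1 + t * (s - 1)" by (simp add: algebra_simps)
    ultimately have "power_gap p (1 + t * (s - 1)) \<le> t * power_gap p s"
      by (simp add: power_gap_def algebra_simps)
    also have "\<dots> \<le> power_gap p s" using power_gap_nonneg[of p s] p s t by (intro mult_left_le_one_le) auto
    finally show ?thesis .
  qed
  show "power_gap p s \<ge> g"
  proof (cases "s \<ge> 1")
    case True
    then have "s - 1 > 0" "\<tau> \<le> s - 1" using s \<tau> by auto
    then have "power_gap p (1 + \<tau>) \<le> power_gap p s" using conv[of "\<tau> / (s - 1)"] \<tau> by (simp add: divide_le_eq_1)
    then show ?thesis by (simp add: g_def)
  next
    case False
    then have "1 - s > 0" "\<tau> \<le> 1 - s" using s \<tau> by auto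
    moreover have "\<tau> / (1 - s) * (s - 1) = - \<tau>" using \<open>1 - s > 0\<close> by (simp add: field_simps)
    ultimately have "power_gap p (1 - \<tau>) \<le> power_gap p s" using conv[of "\<tau> / (1 - s)"] \<tau> by (simp add: divide_le_eq_1)
    then show ?thesis by (simp add: g_def)
  qed
qed

text \<open>
  A gain for vectors of arbitrary norms, in the homogeneous form that can be integrated. If the norms
  are not almost equal, then the strict convexity of \<open>s \<mapsto> s\<^sup>p\<close> gives it. If they are almost equal,
  then after a normalization the hypothesis provides one choice of signs that gains, and the others
  are estimated trivially.
\<close>

lemma sign_average_powr_bound:
  fixes n :: nat and e p :: real
  assumes n: "n > 0" and e: "e > 0" and p: "p > 1"
    and bound: "\<And>x :: nat \<Rightarrow> 'x::complex_banach. (\<And>k. k < n \<Longrightarrow> norm (x k) \<le> 1) \<Longrightarrow> \<exists>\<eta>\<in>sign_choices n. norm (\<Sum>k<n. \<eta> k *\<^sub>R x k) < real n - e"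
  obtains \<delta> where "\<delta> > 0"
    "\<And>x :: nat \<Rightarrow> 'x. (\<Sum>\<eta>\<in>sign_choices n. norm (\<Sum>k<n. \<eta> k *\<^sub>R x k) powr p) \<le> (1 - \<delta>) * (2 ^ n * real n powr (p - 1) * (\<Sum>k<n. norm (x k) powr p))"
proof -
  \<comment> \<open>Norms within the factor \<open>1 + \<tau>\<close> of their mean cost at most half of the gain \<open>e\<close> in the normalization.\<close>
  define \<tau> where "\<tau> = min (1 / 2) (e / (2 * real n))"
  have \<tau>: "0 < \<tau>" "\<tau> < 1" "\<tau> * real n \<le> e / 2"
  proof -
    show "0 < \<tau>" "\<tau> < 1" using n e by (auto simp: \<tau>_def)
    have "\<tau> * real n \<le> e / (2 * real n) * real n" by (intro mult_right_mono) (auto simp: \<tau>_def)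
    then show "\<tau> * real n \<le> e / 2" using n by simp
  qed
  obtain g where g: "g > 0" "\<And>s. s \<ge> 0 \<Longrightarrow> \<bar>s - 1\<bar> \<ge> \<tau> \<Longrightarrow> power_gap p s \<ge> g"
    using power_gap_uniform[OF p \<tau>(1,2)] by blast
  define \<delta>1 where "\<delta>1 = g / (real n + g)"
  define q where "q = max 0 (1 - e / (2 * real n))"
  define \<delta>2 where "\<delta>2 = (1 - q powr p) / 2 ^ n"
  have q: "0 \<le> q" "q < 1" using e n by (auto simp: q_def)
  have qp: "q powr p < 1" using q p powr_less_mono2[of p q 1] by simp
  have \<delta>1: "\<delta>1 > 0" using g n by (simp add: \<delta>1_def)
  have \<delta>2: "\<delta>2 > 0" using qp by (simp add: \<delta>2_def)
  show thesis
  proof (rule that[of "min \<delta>1 \<delta>2"])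
    show "min \<delta>1 \<delta>2 > 0" using \<delta>1 \<delta>2 by simp
    fix x :: "nat \<Rightarrow> 'x"
    define a where "a = (\<Sum>k<n. norm (x k)) / real n"
    have a0: "a \<ge> 0" unfolding a_def by (intro divide_nonneg_nonneg sum_nonneg) auto
    have na: "(\<Sum>k<n. norm (x k)) = real n * a" using n by (simp add: a_def)
    define Q where "Q = 2 ^ n * real n powr (p - 1) * (\<Sum>k<n. norm (x k) powr p)"
    have Q0: "Q \<ge> 0" unfolding Q_def by (intro mult_nonneg_nonneg sum_nonneg) auto
    have triv: "norm (\<Sum>k<n. \<eta> k *\<^sub>R x k) \<le> real n * a" if "\<eta> \<in> sign_choices n" for \<eta>
      unfolding na[symmetric]
    proof (rule sum_norm_le)
      fix k assume "k \<in> {..<n}"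
      then have "\<eta> k \<in> {-1, 1}" using PiE_mem[OF that] by blast
      then show "norm (\<eta> k *\<^sub>R x k) \<le> norm (x k)" by auto
    qed
    have trivp: "norm (\<Sum>k<n. \<eta> k *\<^sub>R x k) powr p \<le> (real n * a) powr p" if "\<eta> \<in> sign_choices n" for \<eta>
      using triv[OF that] p by (intro powr_mono2) auto
    have "(\<Sum>\<eta>\<in>sign_choices n. norm (\<Sum>k<n. \<eta> k *\<^sub>R x k) powr p) \<le> (1 - min \<delta>1 \<delta>2) * Q"
    proof (cases "a = 0")
      case True
      then have "norm (\<Sum>k<n. \<eta> k *\<^sub>R x k) powr p = 0" if "\<eta> \<in> sign_choices n" for \<eta>
        using trivp[OF that] powr_ge_zero[of "norm (\<Sum>k<n. \<eta> k *\<^sub>R x k)" p] by simp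
      moreover have "norm (x k) = 0" if "k < n" for k
        using na True that sum_nonneg_eq_0_iff[of "{..<n}" "\<lambda>k. norm (x k)"] by simp
      ultimately show ?thesis by (simp add: Q_def)
    next
      case False
      then have a: "a > 0" using a0 by simp
      define r where "r k = norm (x k) / a" for k
      have r0: "r k \<ge> 0" for k using a by (simp add: r_def)
      have sr: "(\<Sum>k<n. r k) = real n" using a na by (simp add: r_def flip: sum_divide_distrib)
      have rp: "norm (x k) powr p = a powr p * r k powr p" for k
        using a by (simp add: r_def powr_divide)
      have Qr: "Q = 2 ^ n * (real n * a) powr p * ((\<Sum>k<n. r k powr p) / real n)"
      proof -
        have "real n powr (p - 1) = real n powr p / real n" using n by (simp add: powr_diff)
        then show ?thesis unfolding Q_def rp using a n by (simp add: powr_mult sum_distrib_left[symmetric])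
      qed
      have gapsum: "(\<Sum>k<n. r k powr p) = real n + (\<Sum>k<n. power_gap p (r k))"
      proof -
        have "(\<Sum>k<n. power_gap p (r k)) = (\<Sum>k<n. r k powr p) - real n - p * ((\<Sum>k<n. r k) - real n)"
          by (simp add: power_gap_def sum_subtractf sum_distrib_left[symmetric])
        then show ?thesis using sr by simp
      qed
      have gap0: "power_gap p (r k) \<ge> 0" for k using power_gap_nonneg[of p "r k"] p r0 by simp
      define H where "H = 2 ^ n * (real n * a) powr p"
      have H: "H > 0" using n a by (simp add: H_def)
      have HQ: "H \<le> Q"
      proof -
        have "(\<Sum>k<n. r k powr p) / real n \<ge> 1" using n gapsum sum_nonneg[of "{..<n}" "\<lambda>k. power_gap p (r k)"] gap0 by simp
        then have "H * 1 \<le> H * ((\<Sum>k<n. r k powr p) / real n)" using H by (intro mult_left_mono) auto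
        then show ?thesis unfolding Qr H_def[symmetric] by simp
      qed
      have "(\<Sum>\<eta>\<in>sign_choices n. norm (\<Sum>k<n. \<eta> k *\<^sub>R x k) powr p) \<le> (1 - \<delta>1) * Q \<or> (\<Sum>\<eta>\<in>sign_choices n. norm (\<Sum>k<n. \<eta> k *\<^sub>R x k) powr p) \<le> (1 - \<delta>2) * Q"
      proof (cases "\<exists>k<n. \<bar>r k - 1\<bar> \<ge> \<tau>")
        case True
        then obtain k where k: "k < n" "\<bar>r k - 1\<bar> \<ge> \<tau>" by blast
        have "g \<le> power_gap p (r k)" using g(2)[OF r0 k(2)] .
        also have "\<dots> \<le> (\<Sum>k<n. power_gap p (r k))" by (rule member_le_sum) (use k gap0 in auto)
        finally have "real n + g \<le> (\<Sum>k<n. r k powr p)" using gapsum by simp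
        then have "H * ((real n + g) / real n) \<le> Q" unfolding Qr H_def[symmetric]
          using H n by (intro mult_left_mono divide_right_mono) auto
        then have "(1 - \<delta>1) * (H * ((real n + g) / real n)) \<le> (1 - \<delta>1) * Q"
          using g n by (intro mult_left_mono) (auto simp: \<delta>1_def)
        moreover have "(1 - \<delta>1) * (H * ((real n + g) / real n)) = H"
        proof -
          have "1 - \<delta>1 = real n / (real n + g)" using g n by (simp add: \<delta>1_def field_simps)
          then show ?thesis using g n by simp
        qed
        moreover have "(\<Sum>\<eta>\<in>sign_choices n. norm (\<Sum>k<n. \<eta> k *\<^sub>R x k) powr p) \<le> H"
          using sum_bounded_above[of "sign_choices n" "\<lambda>\<eta>. norm (\<Sum>k<n. \<eta> k *\<^sub>R x k) powr p", OF trivp]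
          by (simp only: card_sign_choices H_def) simp
        ultimately show ?thesis by linarith
      next
        case False
        define y where "y k = (1 / (a * (1 + \<tau>))) *\<^sub>R x k" for k
        have "norm (y k) \<le> 1" if "k < n" for k
        proof -
          have "r k \<le> 1 + \<tau>" using False that by force
          then have "norm (x k) \<le> a * (1 + \<tau>)" using a by (simp add: r_def pos_divide_le_eq mult.commute)
          then show ?thesis using a \<tau> by (simp add: y_def divide_le_eq_1)
        qed
        then obtain \<eta>0 where \<eta>0: "\<eta>0 \<in> sign_choices n" "norm (\<Sum>k<n. \<eta>0 k *\<^sub>R y k) < real n - e"
          using bound[of y] by blast
        have ne: "real n - e > 0" using \<eta>0(2) norm_ge_zero[of "\<Sum>k<n. \<eta>0 k *\<^sub>R y k"] by linarith
        have "(\<Sum>k<n. \<eta>0 k *\<^sub>R x k) = (a * (1 + \<tau>)) *\<^sub>R (\<Sum>k<n. \<eta>0 k *\<^sub>R y k)"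
          unfolding scaleR_sum_right y_def using a \<tau> by (intro sum.cong) auto
        then have "norm (\<Sum>k<n. \<eta>0 k *\<^sub>R x k) = (a * (1 + \<tau>)) * norm (\<Sum>k<n. \<eta>0 k *\<^sub>R y k)" using a \<tau> by simp
        also have "\<dots> \<le> (a * (1 + \<tau>)) * (real n - e)" using \<eta>0 a \<tau> by (intro mult_left_mono) auto
        also have "\<dots> = a * ((real n - e) + \<tau> * (real n - e))" by (simp add: algebra_simps)
        also have "\<dots> \<le> a * (real n - e / 2)"
        proof (intro mult_left_mono)
          have "\<tau> * (real n - e) \<le> \<tau> * real n" using \<tau> e by (intro mult_left_mono) auto
          then show "(real n - e) + \<tau> * (real n - e) \<le> real n - e / 2" using \<tau>(3) by linarith
        qed (use a in simp)
        also have "real n - e / 2 = real n * q" using ne n e by (simp add: q_def max_def field_simps)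
        finally have "norm (\<Sum>k<n. \<eta>0 k *\<^sub>R x k) powr p \<le> (a * (real n * q)) powr p" using p by (intro powr_mono2) auto
        also have "\<dots> = (real n * a) powr p * q powr p" using a q by (simp add: powr_mult)
        finally have one: "norm (\<Sum>k<n. \<eta>0 k *\<^sub>R x k) powr p \<le> (real n * a) powr p * q powr p" .
        have "(\<Sum>\<eta>\<in>sign_choices n. norm (\<Sum>k<n. \<eta> k *\<^sub>R x k) powr p) = norm (\<Sum>k<n. \<eta>0 k *\<^sub>R x k) powr p + (\<Sum>\<eta>\<in>sign_choices n - {\<eta>0}. norm (\<Sum>k<n. \<eta> k *\<^sub>R x k) powr p)"
          by (rule sum.remove[OF finite_sign_choices \<eta>0(1)])
        also have "(\<Sum>\<eta>\<in>sign_choices n - {\<eta>0}. norm (\<Sum>k<n. \<eta> k *\<^sub>R x k) powr p) \<le> real (card (sign_choices n - {\<eta>0})) * (real n * a) powr p"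
          by (rule sum_bounded_above) (use trivp in auto)
        also have "card (sign_choices n - {\<eta>0}) = 2 ^ n - 1"
          using \<eta>0(1) finite_sign_choices by (simp only: card_Diff_singleton card_sign_choices)
        also have "real (2 ^ n - 1) = 2 ^ n - 1" by (simp add: of_nat_diff)
        also note one
        also have "(real n * a) powr p * q powr p + (2 ^ n - 1) * (real n * a) powr p = (1 - \<delta>2) * H"
          by (simp add: \<delta>2_def H_def algebra_simps diff_divide_distrib)
        also have "\<dots> \<le> (1 - \<delta>2) * Q"
        proof (rule mult_left_mono[OF HQ])
          have "(1 - q powr p) / 2 ^ n \<le> 1 / 1" by (intro frac_le) auto
          then show "0 \<le> 1 - \<delta>2" by (simp add: \<delta>2_def)
        qed
        finally show ?thesis by simp
      qed
      moreover have "(1 - \<delta>1) * Q \<le> (1 - min \<delta>1 \<delta>2) * Q" "(1 - \<delta>2) * Q \<le> (1 - min \<delta>1 \<delta>2) * Q"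
        using Q0 by (auto intro!: mult_right_mono)
      ultimately show ?thesis by linarith
    qed
    then show "(\<Sum>\<eta>\<in>sign_choices n. norm (\<Sum>k<n. \<eta> k *\<^sub>R x k) powr p) \<le> (1 - min \<delta>1 \<delta>2) * (2 ^ n * real n powr (p - 1) * (\<Sum>k<n. norm (x k) powr p))"
      by (simp add: Q_def)
  qed
qed

text \<open>
  The \<open>p\<close>-th powers are integrated first; the tangent of \<open>s \<mapsto> s\<^sup>p\<close> at \<open>s = n\<close> then leads back to the
  norms, which explains the factor \<open>1 / p\<close>.
\<close>

lemma Lp_sign_average_bound:
  fixes n :: nat and v :: "nat \<Rightarrow> 'a \<Rightarrow> 'x::complex_banach"
  assumes p: "p > 1" and n: "n > 0"
    and \<delta>: "\<And>x :: nat \<Rightarrow> 'x. (\<Sum>\<eta>\<in>sign_choices n. norm (\<Sum>k<n. \<eta> k *\<^sub>R x k) powr p) \<le> (1 - \<delta>) * (2 ^ n * real n powr (p - 1) * (\<Sum>k<n. norm (x k) powr p))"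
    and d1: "0 < \<delta>" "\<delta> \<le> 1"
    and v: "\<And>k. k < n \<Longrightarrow> v k \<in> Lp M p" "\<And>k. k < n \<Longrightarrow> Lp_norm M p (v k) \<le> 1"
  shows "(\<Sum>\<eta>\<in>sign_choices n. Lp_norm M p (\<lambda>y. \<Sum>k<n. \<eta> k *\<^sub>R v k y)) \<le> 2 ^ n * real n - \<delta> * (2 ^ n * real n / p)"
proof -
  have p0: "p > 0" "p \<ge> 1" using p by auto
  define L where "L \<eta> = Lp_norm M p (\<lambda>y. \<Sum>k<n. \<eta> k *\<^sub>R v k y)" for \<eta>
  have L0: "L \<eta> \<ge> 0" for \<eta> by (simp add: L_def Lp_norm_nonneg)
  have inL: "(\<lambda>y. \<Sum>k<n. \<eta> k *\<^sub>R v k y) \<in> Lp M p" for \<eta>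
  proof -
    have "(\<lambda>y. \<Sum>k<n. complex_of_real (\<eta> k) *\<^sub>C v k y) \<in> Lp M p"
      using Lp_sum[OF p0(2), of "{..<n}" "\<lambda>k y. complex_of_real (\<eta> k) *\<^sub>C v k y" M] Lp_scaleC(1)[OF p0(1) v(1)] by simp
    then show ?thesis by (simp add: scaleR_scaleC)
  qed
  have "(\<Sum>\<eta>\<in>sign_choices n. L \<eta> powr p) = (\<Sum>\<eta>\<in>sign_choices n. \<integral>y. norm (\<Sum>k<n. \<eta> k *\<^sub>R v k y) powr p \<partial>M)"
    unfolding L_def by (simp add: Lp_norm_powr[OF p0(1)])
  also have "\<dots> = (\<integral>y. (\<Sum>\<eta>\<in>sign_choices n. norm (\<Sum>k<n. \<eta> k *\<^sub>R v k y) powr p) \<partial>M)"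
    by (rule Bochner_Integration.integral_sum[symmetric]) (rule LpD(2)[OF inL])
  also have "\<dots> \<le> (\<integral>y. (1 - \<delta>) * (2 ^ n * real n powr (p - 1) * (\<Sum>k<n. norm (v k y) powr p)) \<partial>M)"
  proof (rule integral_mono)
    show "integrable M (\<lambda>y. \<Sum>\<eta>\<in>sign_choices n. norm (\<Sum>k<n. \<eta> k *\<^sub>R v k y) powr p)"
      by (rule Bochner_Integration.integrable_sum) (rule LpD(2)[OF inL])
    show "integrable M (\<lambda>y. (1 - \<delta>) * (2 ^ n * real n powr (p - 1) * (\<Sum>k<n. norm (v k y) powr p)))"
      by (intro integrable_mult_right Bochner_Integration.integrable_sum) (use LpD(2)[OF v(1)] in auto)
  qed (rule \<delta>)
  also have "\<dots> = (1 - \<delta>) * (2 ^ n * real n powr (p - 1) * (\<Sum>k<n. Lp_norm M p (v k) powr p))"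
    using LpD(2)[OF v(1)] by (simp add: Lp_norm_powr[OF p0(1)] Bochner_Integration.integral_sum)
  also have "\<dots> \<le> (1 - \<delta>) * (2 ^ n * real n powr (p - 1) * (\<Sum>k<n. 1))"
    using v(2) d1 p0 by (intro mult_left_mono sum_mono) (auto intro!: powr_le1 simp: Lp_norm_nonneg)
  also have "\<dots> = (1 - \<delta>) * (2 ^ n * real n powr p)"
    using n by (simp add: powr_diff)
  finally have 1: "(\<Sum>\<eta>\<in>sign_choices n. L \<eta> powr p) \<le> (1 - \<delta>) * (2 ^ n * real n powr p)" .
  have np: "real n powr p > 0" using n by simp
  have tangent: "real n powr p * (1 + p * (L \<eta> / real n - 1)) \<le> L \<eta> powr p" for \<eta>
  proof -
    have "1 + p * (L \<eta> / real n - 1) \<le> (L \<eta> / real n) powr p"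
      using power_gap_nonneg[OF p0(2), of "L \<eta> / real n"] L0[of \<eta>] by (simp add: power_gap_def)
    also have "\<dots> = L \<eta> powr p / real n powr p" using L0 by (simp add: powr_divide)
    finally show ?thesis using np by (simp add: pos_le_divide_eq mult.commute)
  qed
  have "real n powr p * (\<Sum>\<eta>\<in>sign_choices n. 1 + p * (L \<eta> / real n - 1)) \<le> (\<Sum>\<eta>\<in>sign_choices n. L \<eta> powr p)"
    unfolding sum_distrib_left by (intro sum_mono tangent)
  with 1 have "real n powr p * (\<Sum>\<eta>\<in>sign_choices n. 1 + p * (L \<eta> / real n - 1)) \<le> real n powr p * ((1 - \<delta>) * 2 ^ n)"
    by (simp add: mult_ac)
  then have "(\<Sum>\<eta>\<in>sign_choices n. 1 + p * (L \<eta> / real n - 1)) \<le> (1 - \<delta>) * 2 ^ n"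
    by (rule mult_left_le_imp_le[OF _ np])
  moreover have "(\<Sum>\<eta>\<in>sign_choices n. 1 + p * (L \<eta> / real n - 1)) = 2 ^ n + p * ((\<Sum>\<eta>\<in>sign_choices n. L \<eta>) / real n - 2 ^ n)"
    by (simp only: sum.distrib sum_distrib_left[symmetric] sum_subtractf sum_divide_distrib[symmetric] sum_constant card_sign_choices) simp
  ultimately have "p * ((\<Sum>\<eta>\<in>sign_choices n. L \<eta>) / real n - 2 ^ n) \<le> p * (- (\<delta> * 2 ^ n / p))"
    using p0 by (simp add: algebra_simps)
  then have "(\<Sum>\<eta>\<in>sign_choices n. L \<eta>) / real n - 2 ^ n \<le> - (\<delta> * 2 ^ n / p)"
    by (rule mult_left_le_imp_le[OF _ p0(1)])
  then have "(\<Sum>\<eta>\<in>sign_choices n. L \<eta>) / real n \<le> 2 ^ n - \<delta> * 2 ^ n / p" by linarith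
  then have "(\<Sum>\<eta>\<in>sign_choices n. L \<eta>) \<le> (2 ^ n - \<delta> * 2 ^ n / p) * real n" using n by (simp add: pos_divide_le_eq)
  then show ?thesis unfolding L_def by (simp add: algebra_simps)
qed


section \<open>Convolution on a compact abelian group\<close>

locale compact_haar_group =
  fixes \<mu> :: "'g::{topological_ab_group_add, t2_space} measure"
  assumes compact_group: "compact (UNIV :: 'g set)"
    and haar: "normalized_haar_measure \<mu>"
begin

lemma sets_haar [measurable_cong, simp]: "sets \<mu> = sets borel"
  using haar by (simp add: normalized_haar_measure_def)

lemma space_haar [simp]: "space \<mu> = UNIV"
  using sets_eq_imp_space_eq[OF sets_haar] by simp

lemma prob_space_haar: "prob_space \<mu>"
  using haar by (intro prob_spaceI) (simp add: normalized_haar_measure_def)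

sublocale prob_space \<mu> by (rule prob_space_haar)

lemma measure_UNIV [simp]: "measure \<mu> UNIV = 1" "emeasure \<mu> UNIV = 1"
  using prob_space emeasure_space_1 by simp_all

lemma translation_measurable [measurable]: "(\<lambda>x::'g. a + x) \<in> borel_measurable borel"
  by (intro borel_measurable_continuous_onI continuous_intros)

lemma translation_measurable_haar: "(\<lambda>x::'g. a + x) \<in> measurable \<mu> \<mu>"
  by measurable

lemma distr_translation: "distr \<mu> \<mu> (\<lambda>x. a + x) = \<mu>"
proof (rule measure_eqI)
  fix A assume "A \<in> sets (distr \<mu> \<mu> (\<lambda>x. a + x))"
  then have A: "A \<in> sets borel" by simp
  have "(\<lambda>x. a + x) -` A \<inter> space \<mu> = (\<lambda>x. - a + x) ` A"
  proof (intro equalityI subsetI)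
    fix x assume "x \<in> (\<lambda>x. a + x) -` A \<inter> space \<mu>"
    then show "x \<in> (\<lambda>x. - a + x) ` A" by (intro image_eqI[of _ _ "a + x"]) auto
  qed auto
  moreover have "emeasure \<mu> ((\<lambda>x. b + x) ` A) = emeasure \<mu> A" for b
    using haar A unfolding normalized_haar_measure_def by blast
  moreover have "emeasure (distr \<mu> \<mu> (\<lambda>x. a + x)) A = emeasure \<mu> ((\<lambda>x. a + x) -` A \<inter> space \<mu>)"
    by (rule emeasure_distr) (use A in auto)
  ultimately show "emeasure (distr \<mu> \<mu> (\<lambda>x. a + x)) A = emeasure \<mu> A" by (simp only:)
qed simp

lemma integral_translation:
  fixes f :: "'g \<Rightarrow> 'b::{banach, second_countable_topology}"
  assumes "f \<in> borel_measurable borel"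
  shows "(\<integral>x. f (a + x) \<partial>\<mu>) = (\<integral>x. f x \<partial>\<mu>)"
  using integral_distr[of "\<lambda>x. a + x" \<mu> \<mu> f] assms by (simp add: distr_translation)

lemma continuous_borel: "continuous_on UNIV f \<Longrightarrow> f \<in> borel_measurable borel"
  by (rule borel_measurable_continuous_onI)

lemma continuous_bounded:
  fixes f :: "'g \<Rightarrow> complex"
  assumes "continuous_on UNIV f"
  obtains B where "B \<ge> 0" "\<And>x. cmod (f x) \<le> B"
proof -
  have "bounded (range f)" by (rule compact_imp_bounded[OF compact_continuous_image[OF assms compact_group]])
  then obtain B where "\<And>x. cmod (f x) \<le> B" by (auto simp: bounded_iff)
  then show thesis using that[of "max B 0"] by (auto simp: le_max_iff_disj)
qed

lemma continuous_integrable: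
  fixes f :: "'g \<Rightarrow> complex"
  assumes "continuous_on UNIV f"
  shows "integrable \<mu> f"
proof -
  obtain B where "\<And>x. cmod (f x) \<le> B" using continuous_bounded[OF assms] by blast
  then show ?thesis using continuous_borel[OF assms] by (intro integrable_const_bound[of _ B]) auto
qed

lemma continuous_integrable_real:
  fixes f :: "'g \<Rightarrow> real"
  assumes "continuous_on UNIV f"
  shows "integrable \<mu> f"
proof -
  have "integrable \<mu> (\<lambda>x. complex_of_real (f x))"
    by (rule continuous_integrable) (intro continuous_intros assms)
  from integrable_Re[OF this] show ?thesis by simp
qed

lemma open_measure_pos:
  assumes U: "open U" "U \<noteq> ({} :: 'g set)"
  shows "emeasure \<mu> U > 0"
proof (rule ccontr)
  assume "\<not> emeasure \<mu> U > 0"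
  then have U0: "emeasure \<mu> U = 0" by simp
  obtain u where u: "u \<in> U" using U by blast
  define V where "V a = (\<lambda>x. (- a) + x) -` U" for a
  have oV: "open (V a)" for a unfolding V_def by (rule open_vimage[OF U(1)]) (intro continuous_intros)
  have "UNIV \<subseteq> (\<Union>a\<in>UNIV. V a)"
  proof
    fix x have "x \<in> V (x - u)" using u by (simp add: V_def)
    then show "x \<in> (\<Union>a\<in>UNIV. V a)" by blast
  qed
  then obtain C where C: "finite C" "UNIV \<subseteq> (\<Union>a\<in>C. V a)"
    using compactE_image[OF compact_group, of UNIV V] oV by metis
  have V0: "emeasure \<mu> (V a) = 0" for a
  proof -
    have "emeasure (distr \<mu> \<mu> (\<lambda>x. - a + x)) U = emeasure \<mu> ((\<lambda>x. - a + x) -` U \<inter> space \<mu>)"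
      by (rule emeasure_distr[OF translation_measurable_haar]) (simp add: U(1))
    then show ?thesis by (simp only: distr_translation U0 V_def space_haar Int_UNIV_right)
  qed
  have "emeasure \<mu> UNIV \<le> (\<Sum>a\<in>C. emeasure \<mu> (V a))"
    using C oV by (intro order_trans[OF emeasure_mono[OF C(2)] emeasure_subadditive_finite]) auto
  then show False using V0 emeasure_space_1 by simp
qed

lemma continuous_integral_zero:
  fixes f :: "'g \<Rightarrow> real"
  assumes f: "continuous_on UNIV f" "\<And>x. f x \<ge> 0" "(\<integral>x. f x \<partial>\<mu>) = 0"
  shows "f x = 0"
proof (rule ccontr)
  assume "f x \<noteq> 0"
  have "AE x in \<mu>. f x = 0"
    using integral_nonneg_eq_0_iff_AE[OF continuous_integrable_real[OF f(1)]] f by auto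
  moreover have o: "open {x. f x \<noteq> 0}"
    by (rule open_Collect_neq[OF f(1) continuous_on_const])
  ultimately have "emeasure \<mu> {x. f x \<noteq> 0} = 0"
    by (subst (asm) AE_iff_measurable[where N = "{x. f x \<noteq> 0}"]) auto
  then show False using open_measure_pos[OF o] \<open>f x \<noteq> 0\<close> by auto
qed

text \<open>
  For a nonmetrizable group the Borel sets of the product need not be generated by rectangles. By
  compactness \<open>F\<close> is a uniform limit of functions that take finitely many values as functions of the
  first variable, and these are measurable for the product of the \<open>\<sigma>\<close>-algebras.
\<close>

lemma continuous_pair_measurable:
  fixes F :: "'g \<times> 'g \<Rightarrow> complex"
  assumes F: "continuous_on UNIV F"
  shows "F \<in> borel_measurable (\<mu> \<Otimes>\<^sub>M \<mu>)"
proof -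
  have F2: "(\<lambda>z. F (x0, snd z)) \<in> borel_measurable (\<mu> \<Otimes>\<^sub>M \<mu>)" for x0
  proof -
    have "(\<lambda>y. F (x0, y)) \<in> borel_measurable borel"
      by (intro continuous_borel continuous_on_compose2[OF F] continuous_intros) auto
    then show ?thesis by measurable
  qed
  have "\<exists>G. G \<in> borel_measurable (\<mu> \<Otimes>\<^sub>M \<mu>) \<and> (\<forall>z. dist (F z) (G z) \<le> e)" if e: "e > 0" for e
  proof -
    have "\<exists>U. x0 \<in> U \<and> open U \<and> (\<forall>x\<in>U. \<forall>y. dist (F (x, y)) (F (x0, y)) \<le> e)" for x0
    proof -
      have "continuous_on (UNIV \<times> UNIV) F" using F by simp
      from continuous_on_prod_compactE[OF this compact_group UNIV_I[of x0] e]
      show ?thesis by (metis Int_UNIV_right UNIV_I)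
    qed
    then obtain U where U: "\<And>x0. x0 \<in> U x0" "\<And>x0. open (U x0)" "\<And>x0 x y. x \<in> U x0 \<Longrightarrow> dist (F (x, y)) (F (x0, y)) \<le> e"
      by metis
    have "UNIV \<subseteq> (\<Union>a\<in>UNIV. U a)" using U(1) by blast
    then obtain C where C: "finite C" "UNIV \<subseteq> (\<Union>a\<in>C. U a)"
      using compactE_image[OF compact_group, of UNIV U] U(2) by metis
    obtain xs where xs: "set xs = C" using finite_list[OF C(1)] by blast
    define G where "G xs z = foldr (\<lambda>x0 r. if fst z \<in> U x0 then F (x0, snd z) else r) xs 0" for xs and z :: "'g \<times> 'g"
    have [measurable]: "U a \<in> sets \<mu>" for a using U(2) by simp
    have Gm: "G xs \<in> borel_measurable (\<mu> \<Otimes>\<^sub>M \<mu>)" for xs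
    proof (induction xs)
      case Nil
      then show ?case by (simp add: G_def[abs_def])
    next
      case (Cons a xs)
      have "G (a # xs) = (\<lambda>z. if fst z \<in> U a then F (a, snd z) else G xs z)" by (rule ext) (simp add: G_def)
      moreover have "(\<lambda>z. if fst z \<in> U a then F (a, snd z) else G xs z) \<in> borel_measurable (\<mu> \<Otimes>\<^sub>M \<mu>)"
        using F2[of a] Cons by measurable
      ultimately show ?case by (simp only:)
    qed
    have "dist (F z) (G xs z) \<le> e" if "\<exists>a\<in>set xs. fst z \<in> U a" for z xs
      using that
    proof (induction xs)
      case (Cons a xs)
      then show ?case using U(3)[of "fst z" a "snd z"] by (auto simp: G_def)
    qed simp
    then show ?thesis using Gm[of xs] C(2) xs by (intro exI[of _ "G xs"]) blast
  qed
  then have "\<forall>n. \<exists>G. G \<in> borel_measurable (\<mu> \<Otimes>\<^sub>M \<mu>) \<and> (\<forall>z. dist (F z) (G z) \<le> 1 / real (Suc n))" by simp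
  then obtain G where G: "\<And>n. G n \<in> borel_measurable (\<mu> \<Otimes>\<^sub>M \<mu>)" "\<And>n z. dist (F z) (G n z) \<le> 1 / real (Suc n)" by metis
  show ?thesis
  proof (rule borel_measurable_LIMSEQ_metric[of G, OF G(1)])
    fix z
    have "(\<lambda>n. dist (G n z) (F z)) \<longlonglongrightarrow> 0"
    proof (rule tendsto_sandwich[where f = "\<lambda>_. 0" and h = "\<lambda>n. 1 / real (Suc n)"])
      show "(\<lambda>n. 1 / real (Suc n)) \<longlonglongrightarrow> 0" using LIMSEQ_inverse_real_of_nat by (simp add: inverse_eq_divide)
      show "\<forall>\<^sub>F n in sequentially. dist (G n z) (F z) \<le> 1 / real (Suc n)"
        by (intro always_eventually allI) (subst dist_commute, rule G(2))
    qed simp_all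
    then show "(\<lambda>n. G n z) \<longlonglongrightarrow> F z" by (rule tendsto_dist_iff[THEN iffD2])
  qed
qed

lemma fubini_continuous:
  fixes F :: "'g \<Rightarrow> 'g \<Rightarrow> complex"
  assumes F: "continuous_on UNIV (\<lambda>z. F (fst z) (snd z))"
  shows "(\<integral>x. \<integral>y. F x y \<partial>\<mu> \<partial>\<mu>) = (\<integral>y. \<integral>x. F x y \<partial>\<mu> \<partial>\<mu>)"
proof -
  interpret P: pair_prob_space \<mu> \<mu> ..
  have "compact (UNIV :: ('g \<times> 'g) set)" using compact_Times[OF compact_group compact_group] by simp
  then have "bounded (range (\<lambda>z. F (fst z) (snd z)))" by (intro compact_imp_bounded compact_continuous_image[OF F])
  then obtain B where B: "\<And>z. cmod (F (fst z) (snd z)) \<le> B" by (auto simp: bounded_iff)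
  have m: "(\<lambda>z. F (fst z) (snd z)) \<in> borel_measurable (\<mu> \<Otimes>\<^sub>M \<mu>)" by (rule continuous_pair_measurable[OF F])
  have "integrable (\<mu> \<Otimes>\<^sub>M \<mu>) (\<lambda>z. F (fst z) (snd z))"
    by (rule P.P.integrable_const_bound[of _ B]) (use B m in auto)
  then have "integrable (\<mu> \<Otimes>\<^sub>M \<mu>) (\<lambda>(x, y). F x y)" by (simp add: case_prod_beta')
  from P.Fubini_integral[OF this] show ?thesis by simp
qed

lemma continuous_parameter_integral:
  fixes F :: "'g \<Rightarrow> 'g \<Rightarrow> complex"
  assumes F: "continuous_on UNIV (\<lambda>z. F (fst z) (snd z))"
  shows "continuous_on UNIV (\<lambda>x. \<integral>y. F x y \<partial>\<mu>)"
  unfolding continuous_on_def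
proof (intro ballI)
  fix x0 :: 'g
  have cont: "continuous_on UNIV (\<lambda>y. F x y)" for x
    using continuous_on_compose2[OF F, of UNIV "\<lambda>y. (x, y)"] by (simp add: continuous_intros)
  show "((\<lambda>x. \<integral>y. F x y \<partial>\<mu>) \<longlongrightarrow> (\<integral>y. F x0 y \<partial>\<mu>)) (at x0 within UNIV)"
  proof (rule tendstoI)
    fix e :: real assume e: "e > 0"
    have cu: "continuous_on (UNIV \<times> UNIV) (\<lambda>z. F (fst z) (snd z))" using F by simp
    have e2: "e / 2 > 0" using e by simp
    obtain U where U: "x0 \<in> U" "open U" "\<forall>x\<in>U \<inter> UNIV. \<forall>y\<in>UNIV. dist (F (fst (x, y)) (snd (x, y))) (F (fst (x0, y)) (snd (x0, y))) \<le> e / 2"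
      by (rule continuous_on_prod_compactE[OF cu compact_group UNIV_I[of x0] e2])
    have "\<forall>\<^sub>F x in at x0 within UNIV. x \<in> U" using U by (auto simp: eventually_at_topological)
    then show "\<forall>\<^sub>F x in at x0 within UNIV. dist (\<integral>y. F x y \<partial>\<mu>) (\<integral>y. F x0 y \<partial>\<mu>) < e"
    proof eventually_elim
      case (elim x)
      have i: "integrable \<mu> (\<lambda>y. F x y - F x0 y)" by (intro Bochner_Integration.integrable_diff continuous_integrable cont)
      have "dist (\<integral>y. F x y \<partial>\<mu>) (\<integral>y. F x0 y \<partial>\<mu>) = cmod (\<integral>y. F x y - F x0 y \<partial>\<mu>)"
        by (simp add: dist_norm Bochner_Integration.integral_diff continuous_integrable cont)
      also have "\<dots> \<le> (\<integral>y. cmod (F x y - F x0 y) \<partial>\<mu>)" by (rule integral_norm_bound)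
      also have "\<dots> \<le> (\<integral>y. e / 2 \<partial>\<mu>)"
        by (rule integral_mono) (use i U(3) elim in \<open>auto simp: dist_norm\<close>)
      also have "\<dots> = e / 2" using prob_space by simp
      finally show ?case using e by simp
    qed
  qed
qed

lemma continuous_minus_arg: "continuous_on UNIV f \<Longrightarrow> continuous_on UNIV (\<lambda>x::'g. f (- x :: 'g))"
  by (rule continuous_on_compose2[of UNIV f]) (auto intro!: continuous_intros)

lemma continuous_diff_arg:
  assumes "continuous_on UNIV f" "continuous_on S a" "continuous_on S b"
  shows "continuous_on S (\<lambda>x. f (a x - b x :: 'g))"
  by (rule continuous_on_compose2[OF assms(1)]) (auto intro!: continuous_intros assms)

lemma integral_reflection:
  fixes f :: "'g \<Rightarrow> complex"
  assumes f: "continuous_on UNIV f"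
  shows "(\<integral>x. f (- x) \<partial>\<mu>) = (\<integral>x. f x \<partial>\<mu>)"
proof -
  have "(\<integral>x. \<integral>y. f (x - y) \<partial>\<mu> \<partial>\<mu>) = (\<integral>y. \<integral>x. f (x - y) \<partial>\<mu> \<partial>\<mu>)"
    by (rule fubini_continuous) (intro continuous_diff_arg[OF f] continuous_intros)
  moreover have "(\<integral>x. f (x - y) \<partial>\<mu>) = (\<integral>x. f x \<partial>\<mu>)" for y
    using integral_translation[OF continuous_borel[OF f], of "- y"] by simp
  moreover have "(\<integral>y. f (x - y) \<partial>\<mu>) = (\<integral>y. f (- y) \<partial>\<mu>)" for x
    using integral_translation[OF continuous_borel[OF continuous_minus_arg[OF f]], of "- x"] by simp
  ultimately show ?thesis by (simp add: prob_space)
qed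

lemma integral_reflected_translation:
  fixes f :: "'g \<Rightarrow> complex"
  assumes f: "continuous_on UNIV f"
  shows "(\<integral>y. f (a - y) \<partial>\<mu>) = (\<integral>y. f y \<partial>\<mu>)"
  using integral_translation[OF continuous_borel[OF continuous_minus_arg[OF f]], of "- a"] integral_reflection[OF f] by simp

end


context compact_haar_group
begin

definition conv :: "('g \<Rightarrow> complex) \<Rightarrow> ('g \<Rightarrow> complex) \<Rightarrow> 'g \<Rightarrow> complex" where
  "conv f g x = (\<integral>y. f (x - y) * g y \<partial>\<mu>)"

definition involution :: "('g \<Rightarrow> complex) \<Rightarrow> 'g \<Rightarrow> complex" where
  "involution f x = cnj (f (- x))"

definition energy :: "('g \<Rightarrow> complex) \<Rightarrow> real" where
  "energy f = (\<integral>x. (cmod (f x))\<^sup>2 \<partial>\<mu>)"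

lemma conv_continuous:
  fixes f g :: "'g \<Rightarrow> complex"
  assumes "continuous_on UNIV f" "continuous_on UNIV g"
  shows "continuous_on UNIV (conv f g)"
  unfolding conv_def[abs_def]
  by (rule continuous_parameter_integral)
     (intro continuous_intros continuous_diff_arg[OF assms(1)] continuous_on_compose2[OF assms(2)], auto intro!: continuous_intros)

lemma conv_integrand_continuous:
  fixes f g :: "'g \<Rightarrow> complex"
  assumes "continuous_on UNIV f" "continuous_on UNIV g"
  shows "continuous_on UNIV (\<lambda>y. f (x - y) * g y)"
  by (intro continuous_intros continuous_diff_arg[OF assms(1)] assms(2))

lemma conv_integrable:
  fixes f g :: "'g \<Rightarrow> complex"
  assumes "continuous_on UNIV f" "continuous_on UNIV g"
  shows "integrable \<mu> (\<lambda>y. f (x - y) * g y)"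
  by (intro continuous_integrable conv_integrand_continuous assms)

lemma involution_continuous: "continuous_on UNIV f \<Longrightarrow> continuous_on UNIV (involution f)"
  unfolding involution_def[abs_def] by (intro continuous_intros continuous_minus_arg)

lemma conv_commute:
  assumes f: "continuous_on UNIV f" and g: "continuous_on UNIV g"
  shows "conv f g = conv g f"
proof
  fix x
  have "continuous_on UNIV (\<lambda>y. f y * g (x - y))"
    by (intro continuous_intros continuous_diff_arg[OF g] f)
  from integral_reflected_translation[OF this, of x]
  show "conv f g x = conv g f x" by (simp add: conv_def mult.commute)
qed

lemma conv_assoc:
  assumes f: "continuous_on UNIV f" and g: "continuous_on UNIV g" and h: "continuous_on UNIV h"
  shows "conv (conv f g) h = conv f (conv g h)"
proof
  fix x
  have "conv f (conv g h) x = (\<integral>w. \<integral>z. f (x - w) * (g (w - z) * h z) \<partial>\<mu> \<partial>\<mu>)"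
    unfolding conv_def by simp
  also have "\<dots> = (\<integral>z. \<integral>w. f (x - w) * (g (w - z) * h z) \<partial>\<mu> \<partial>\<mu>)"
    by (rule fubini_continuous)
       (intro continuous_intros continuous_diff_arg[OF f] continuous_diff_arg[OF g] continuous_on_compose2[OF h], auto intro!: continuous_intros)
  also have "\<dots> = (\<integral>z. (\<integral>y. f (x - z - y) * g y \<partial>\<mu>) * h z \<partial>\<mu>)"
  proof (rule Bochner_Integration.integral_cong[OF refl])
    fix z
    have "continuous_on UNIV (\<lambda>w. f (x - w) * (g (w - z) * h z))"
      by (intro continuous_intros continuous_diff_arg[OF f] continuous_diff_arg[OF g])
    from integral_translation[OF continuous_borel[OF this], of z]
    have "(\<integral>w. f (x - w) * (g (w - z) * h z) \<partial>\<mu>) = (\<integral>y. f (x - z - y) * g y * h z \<partial>\<mu>)"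
      by (simp add: algebra_simps)
    then show "(\<integral>w. f (x - w) * (g (w - z) * h z) \<partial>\<mu>) = (\<integral>y. f (x - z - y) * g y \<partial>\<mu>) * h z" by simp
  qed
  finally show "conv (conv f g) h x = conv f (conv g h) x" unfolding conv_def by simp
qed

lemma conv_add_right:
  assumes "continuous_on UNIV f" "continuous_on UNIV g" "continuous_on UNIV h"
  shows "conv f (\<lambda>x. g x + h x) = (\<lambda>x. conv f g x + conv f h x)"
  using conv_integrable[OF assms(1,2)] conv_integrable[OF assms(1,3)]
  by (intro ext) (simp add: conv_def distrib_left)

lemma conv_scale_right: "conv f (\<lambda>x. c * g x) = (\<lambda>x. c * conv f g x)"
proof
  fix x
  have "(\<integral>y. f (x - y) * (c * g y) \<partial>\<mu>) = (\<integral>y. c * (f (x - y) * g y) \<partial>\<mu>)" by (simp only: mult.left_commute)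
  then show "conv f (\<lambda>x. c * g x) x = c * conv f g x" by (simp add: conv_def)
qed

lemma conv_scale_left: "conv (\<lambda>x. c * f x) g = (\<lambda>x. c * conv f g x)"
  by (intro ext) (simp add: conv_def mult.assoc)

lemma conv_diff_right:
  assumes "continuous_on UNIV f" "continuous_on UNIV g" "continuous_on UNIV h"
  shows "conv f (\<lambda>x. g x - h x) = (\<lambda>x. conv f g x - conv f h x)"
  using conv_integrable[OF assms(1,2)] conv_integrable[OF assms(1,3)]
  by (intro ext) (simp add: conv_def right_diff_distrib)

lemma conv_translate:
  "conv (\<lambda>x. f (x + a)) g = (\<lambda>x. conv f g (x + a))"
  by (intro ext) (simp add: conv_def algebra_simps)

lemma involution_conv:
  assumes "continuous_on UNIV f" "continuous_on UNIV g"
  shows "involution (conv f g) = conv (involution f) (involution g)"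
proof
  fix x
  have "involution (conv f g) x = (\<integral>y. cnj (f (- x - y)) * cnj (g y) \<partial>\<mu>)"
    unfolding involution_def conv_def using integral_bounded_linear[OF bounded_linear_cnj conv_integrable[OF assms, of "- x"]] by simp
  also have "\<dots> = (\<integral>y. cnj (f (- x - (- y))) * cnj (g (- y)) \<partial>\<mu>)"
    by (rule integral_reflection[symmetric]) (intro continuous_intros continuous_diff_arg[OF assms(1)] assms)
  also have "\<dots> = conv (involution f) (involution g) x"
    unfolding involution_def conv_def by (simp add: algebra_simps)
  finally show "involution (conv f g) x = conv (involution f) (involution g) x" .
qed

lemma conv_involution_0:
  assumes "continuous_on UNIV f"
  shows "conv f (involution f) 0 = of_real (energy f)"
proof -
  have "conv f (involution f) 0 = (\<integral>y. of_real ((cmod (f (- y)))\<^sup>2) \<partial>\<mu>)"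
    unfolding conv_def involution_def by (simp add: complex_norm_square del: of_real_power)
  also have "\<dots> = (\<integral>y. of_real ((cmod (f y))\<^sup>2) \<partial>\<mu>)"
    by (rule integral_reflection) (intro continuous_intros assms)
  also have "\<dots> = of_real (energy f)" unfolding energy_def by (rule integral_complex_of_real)
  finally show ?thesis .
qed

lemma energy_nonneg: "energy f \<ge> 0" by (simp add: energy_def)

lemma energy_pos:
  assumes "continuous_on UNIV f" "f x \<noteq> 0" shows "energy f > 0"
proof (rule ccontr)
  assume "\<not> energy f > 0"
  then have "energy f = 0" using energy_nonneg[of f] by simp
  then have "(cmod (f x))\<^sup>2 = 0" unfolding energy_def
    by (intro continuous_integral_zero[of "\<lambda>x. (cmod (f x))\<^sup>2"]) (auto intro!: continuous_intros assms)
  then show False using assms by simp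
qed

lemma energy_le:
  assumes "continuous_on UNIV f" "\<And>x. cmod (f x) \<le> B" shows "energy f \<le> B\<^sup>2"
proof -
  have "energy f \<le> (\<integral>x. B\<^sup>2 \<partial>\<mu>)" unfolding energy_def
    by (rule integral_mono) (auto intro!: continuous_integrable_real continuous_intros assms power_mono)
  then show ?thesis by simp
qed

lemma cauchy_schwarz:
  assumes f: "continuous_on UNIV f" and g: "continuous_on UNIV g"
  shows "(cmod (\<integral>x. f x * g x \<partial>\<mu>))\<^sup>2 \<le> energy f * energy g"
proof -
  define B where "B = (\<integral>x. cmod (f x) * cmod (g x) \<partial>\<mu>)"
  have B0: "B \<ge> 0" by (simp add: B_def)
  have le: "cmod (\<integral>x. f x * g x \<partial>\<mu>) \<le> B"
    unfolding B_def using integral_norm_bound[of \<mu> "\<lambda>x. f x * g x"] by (simp add: norm_mult)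
  have quad: "2 * t * B \<le> t\<^sup>2 * energy f + energy g" for t
  proof -
    have "2 * t * B = (\<integral>x. 2 * t * (cmod (f x) * cmod (g x)) \<partial>\<mu>)" by (simp add: B_def)
    also have "\<dots> \<le> (\<integral>x. t\<^sup>2 * (cmod (f x))\<^sup>2 + (cmod (g x))\<^sup>2 \<partial>\<mu>)"
    proof (rule integral_mono)
      show "2 * t * (cmod (f x) * cmod (g x)) \<le> t\<^sup>2 * (cmod (f x))\<^sup>2 + (cmod (g x))\<^sup>2" for x
        using sum_squares_bound[of "t * cmod (f x)" "cmod (g x)"] by (simp add: power_mult_distrib mult_ac)
    qed (auto intro!: continuous_integrable_real continuous_intros assms)
    also have "\<dots> = t\<^sup>2 * energy f + energy g"
      unfolding energy_def
      by (subst Bochner_Integration.integral_add) (auto intro!: continuous_integrable_real continuous_intros assms)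
    finally show ?thesis .
  qed
  have "B\<^sup>2 \<le> energy f * energy g"
  proof (cases "energy f = 0")
    case True
    have "B = 0"
    proof (rule ccontr)
      assume "B \<noteq> 0"
      then show False using quad[of "(energy g + 1) / B"] energy_nonneg[of g] True B0 by simp
    qed
    then show ?thesis using True by simp
  next
    case False
    then have e: "energy f > 0" using energy_nonneg[of f] by simp
    from quad[of "B / energy f"] have "2 * B\<^sup>2 / energy f \<le> B\<^sup>2 / energy f + energy g"
      using e by (simp add: power2_eq_square)
    then show ?thesis using e by (simp add: field_simps)
  qed
  moreover have "(cmod (\<integral>x. f x * g x \<partial>\<mu>))\<^sup>2 \<le> B\<^sup>2" using le by (intro power_mono) auto
  ultimately show ?thesis by linarith
qed

lemma energy_involution_translate:
  assumes "continuous_on UNIV f"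
  shows "energy (\<lambda>y. f (x - y)) = energy f"
proof -
  have "(\<integral>y. complex_of_real ((cmod (f (x - y)))\<^sup>2) \<partial>\<mu>) = (\<integral>y. complex_of_real ((cmod (f y))\<^sup>2) \<partial>\<mu>)"
    by (rule integral_reflected_translation[of "\<lambda>y. complex_of_real ((cmod (f y))\<^sup>2)"]) (intro continuous_intros assms)
  then have "complex_of_real (\<integral>y. (cmod (f (x - y)))\<^sup>2 \<partial>\<mu>) = of_real (\<integral>y. (cmod (f y))\<^sup>2 \<partial>\<mu>)"
    by (simp only: integral_complex_of_real)
  then show ?thesis unfolding energy_def using of_real_eq_iff by blast
qed

lemma conv_bound:
  assumes f: "continuous_on UNIV f" and g: "continuous_on UNIV g"
  shows "(cmod (conv f g x))\<^sup>2 \<le> energy f * energy g"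
proof -
  have "continuous_on UNIV (\<lambda>y. f (x - y))" by (intro continuous_diff_arg[OF f] continuous_intros)
  from cauchy_schwarz[OF this g] show ?thesis
    unfolding conv_def energy_involution_translate[OF f] .
qed

end


section \<open>Characters from convolution idempotents\<close>

context compact_haar_group
begin

lemma energy_conv_le:
  assumes "continuous_on UNIV f" "continuous_on UNIV g"
  shows "energy (conv f g) \<le> energy f * energy g"
proof -
  have "energy (conv f g) \<le> (\<integral>x. energy f * energy g \<partial>\<mu>)"
    unfolding energy_def[of "conv f g"]
    by (rule integral_mono)
       (use conv_bound[OF assms] conv_continuous[OF assms] in \<open>auto intro!: continuous_integrable_real continuous_intros\<close>)
  then show ?thesis by simp
qed

lemma conv_tendsto:
  assumes f: "continuous_on UNIV f" and g: "\<And>n. continuous_on UNIV (g n)" "continuous_on UNIV h"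
    and u: "uniform_limit UNIV g h sequentially"
  shows "(\<lambda>n. conv f (g n) x) \<longlonglongrightarrow> conv f h x"
proof (rule tendstoI)
  fix e :: real assume e: "e > 0"
  define E where "E = sqrt (energy f)"
  have E: "E \<ge> 0" "E\<^sup>2 = energy f" using energy_nonneg by (auto simp: E_def)
  define d where "d = e / (E + 1)"
  have d: "d > 0" "E * d < e"
  proof -
    show "d > 0" using e E by (simp add: d_def add_nonneg_pos)
    have "E * d = e * (E / (E + 1))" by (simp add: d_def)
    also have "\<dots> < e * 1" using e E by (intro mult_strict_left_mono) (auto simp: divide_less_eq_1 add_nonneg_pos)
    finally show "E * d < e" by simp
  qed
  have "\<forall>\<^sub>F n in sequentially. \<forall>x\<in>UNIV. dist (g n x) (h x) < d"
    using u d(1) by (rule uniform_limitD)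
  then show "\<forall>\<^sub>F n in sequentially. dist (conv f (g n) x) (conv f h x) < e"
  proof eventually_elim
    case (elim n)
    have c: "continuous_on UNIV (\<lambda>x. g n x - h x)" by (intro continuous_intros g)
    have "energy (\<lambda>x. g n x - h x) \<le> d\<^sup>2"
      by (rule energy_le[OF c]) (use elim in \<open>auto simp: dist_norm intro: less_imp_le\<close>)
    then have "energy f * energy (\<lambda>x. g n x - h x) \<le> E\<^sup>2 * d\<^sup>2" unfolding E(2) by (intro mult_left_mono energy_nonneg)
    then have "(cmod (conv f (\<lambda>x. g n x - h x) x))\<^sup>2 \<le> (E * d)\<^sup>2"
      using conv_bound[OF f c, of x] by (simp add: power_mult_distrib)
    then have "cmod (conv f (\<lambda>x. g n x - h x) x) \<le> E * d"
      by (rule power2_le_imp_le) (use E d in auto)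
    then show ?case using d(2) by (simp add: conv_diff_right[OF f g(1) g(2)] dist_norm)
  qed
qed

text \<open>By Peter--Weyl these are the nonempty finite sums of distinct characters.\<close>

definition idempotent :: "('g \<Rightarrow> complex) \<Rightarrow> bool" where
  "idempotent e \<longleftrightarrow> continuous_on UNIV e \<and> involution e = e \<and> conv e e = e \<and> (\<exists>x. e x \<noteq> 0)"

lemma selfadjoint_value_0:
  assumes "continuous_on UNIV f" "involution f = f"
  shows "conv f f 0 = of_real (energy f)"
  using conv_involution_0[OF assms(1)] assms(2) by simp

text \<open>
  The energy is the number of characters of which the idempotent is the sum. Its lower bound is what
  makes a descent on the energy end.
\<close>

lemma idempotent_energy:
  assumes "idempotent e"
  shows "e 0 = of_real (energy e)" "energy e \<ge> 1" "cmod (e x) \<le> energy e"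
proof -
  have c: "continuous_on UNIV e" and i: "involution e = e" and ee: "conv e e = e" and ne: "\<exists>x. e x \<noteq> 0"
    using assms by (auto simp: idempotent_def)
  show "e 0 = of_real (energy e)" using selfadjoint_value_0[OF c i] ee by simp
  have le: "cmod (e x) \<le> energy e" for x
    using conv_bound[OF c c, of x] energy_nonneg[of e] unfolding ee
    by (intro power2_le_imp_le[of "cmod (e x)"]) (auto simp: power2_eq_square)
  then show "cmod (e x) \<le> energy e" .
  have "energy e \<le> energy e * energy e" using energy_le[OF c le] by (simp add: power2_eq_square)
  moreover have "energy e > 0" using ne energy_pos[OF c] by blast
  ultimately show "energy e \<ge> 1" by simp
qed

text \<open>
  The orthogonal projection onto the eigenspace of the largest eigenvalue \<open>\<kappa>\<close> of the positive operator
  \<open>f \<mapsto> k * k * f\<close>, found by the power method. The energies \<open>a n\<close> of the convolution powers of \<open>k\<close> are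
  logarithmically convex, so their ratios increase to some \<open>\<kappa>\<close>, and \<open>b n = a n / \<kappa>\<^sup>n\<^sup>+\<^sup>1\<close> decreases.
  As \<open>b\<close> stays above 1, the normalized powers do not tend to zero; they form a Cauchy sequence in
  \<open>L\<^sup>2\<close>, and one further convolution makes the convergence uniform.
\<close>

lemma top_idempotent:
  assumes k: "continuous_on UNIV k" "involution k = k" "k x0 \<noteq> 0"
  obtains e and \<kappa> :: real where "idempotent e" "\<kappa> > 0" "conv (conv k k) e = (\<lambda>x. of_real \<kappa> * e x)"
proof -
  define kp where "kp n = ((conv k) ^^ n) k" for n
  have kp0: "kp 0 = k" and kpS: "kp (Suc n) = conv k (kp n)" for n by (simp_all add: kp_def)
  have ckp: "continuous_on UNIV (kp n)" for n
    by (induction n) (auto simp: kp0 kpS k intro: conv_continuous)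
  have kpadd: "conv (kp m) (kp n) = kp (Suc (m + n))" for m n
    by (induction m) (auto simp: kp0 kpS conv_assoc[OF k(1) ckp ckp])
  have ikp: "involution (kp n) = kp n" for n
    by (induction n) (auto simp: kp0 kpS k involution_conv[OF k(1) ckp])
  define a where "a n = energy (kp n)" for n
  have kp2: "kp (Suc (2 * n)) 0 = of_real (a n)" for n
    using selfadjoint_value_0[OF ckp ikp, of n] unfolding kpadd a_def by (simp add: mult_2)
  have logc: "(a (Suc n))\<^sup>2 \<le> a n * a (Suc (Suc n))" for n
  proof -
    have "conv (kp n) (kp (Suc (Suc n))) = kp (Suc (2 * Suc n))" unfolding kpadd by (simp add: mult_2)
    then have "conv (kp n) (kp (Suc (Suc n))) 0 = of_real (a (Suc n))" using kp2[of "Suc n"] by simp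
    with conv_bound[OF ckp ckp, of n "Suc (Suc n)" 0] show ?thesis by (simp add: a_def)
  qed
  have pos: "a n > 0 \<and> a (Suc n) > 0" for n
  proof (induction n)
    case 0
    have a0: "a 0 > 0" using energy_pos[OF k(1,3)] by (simp add: a_def kp0)
    then have "kp (Suc 0) 0 \<noteq> 0" using kp2[of 0] by simp
    then show ?case using a0 energy_pos[OF ckp] by (auto simp: a_def)
  next
    case (Suc n)
    then have "0 < (a (Suc n))\<^sup>2" by simp
    then have "0 < a n * a (Suc (Suc n))" using logc[of n] by linarith
    then show ?case using Suc zero_less_mult_pos by blast
  qed
  define \<rho> where "\<rho> n = a (Suc n) / a n" for n
  have inc: "incseq \<rho>"
  proof (rule incseq_SucI)
    fix n show "\<rho> n \<le> \<rho> (Suc n)"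
      using logc[of n] pos[of n] pos[of "Suc n"] by (simp add: \<rho>_def field_simps power2_eq_square)
  qed
  have bdd: "\<rho> n \<le> energy k" for n
    using energy_conv_le[OF k(1) ckp, of n] pos[of n] by (simp add: \<rho>_def a_def kpS pos_divide_le_eq)
  obtain \<kappa> where \<kappa>: "\<rho> \<longlonglongrightarrow> \<kappa>" "\<And>n. \<rho> n \<le> \<kappa>"
    using incseq_convergent[OF inc, of "energy k"] bdd by blast
  have \<rho>0: "\<rho> n > 0" for n using pos[of n] by (simp add: \<rho>_def)
  have l0: "\<kappa> > 0" using \<rho>0[of 0] \<kappa>(2)[of 0] by linarith
  define b where "b n = a n / \<kappa> ^ Suc n" for n
  have b0: "b n > 0" for n using pos[of n] l0 by (simp add: b_def)
  have bS: "b (Suc n) = \<rho> n / \<kappa> * b n" for n using pos[of n] l0 by (simp add: b_def \<rho>_def)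
  have dec: "decseq b"
  proof (rule decseq_SucI)
    fix n show "b (Suc n) \<le> b n"
      unfolding bS using \<kappa>(2)[of n] \<rho>0[of n] l0 b0[of n] by (intro mult_left_le_one_le) auto
  qed
  have sub: "b (Suc (2 * n)) \<le> (b n)\<^sup>2" for n
  proof -
    have "a (Suc (2 * n)) \<le> a n * a n"
      using energy_conv_le[OF ckp ckp, of n n] by (simp add: a_def kpadd mult_2)
    then have "b (Suc (2 * n)) \<le> a n * a n / \<kappa> ^ Suc (Suc (2 * n))"
      unfolding b_def using l0 by (intro divide_right_mono) auto
    also have "\<dots> = (b n)\<^sup>2" by (simp add: b_def power2_eq_square mult_2 power_add)
    finally show ?thesis .
  qed
  \<comment> \<open>By \<open>sub\<close>, a value \<open>b m < 1\<close> would force geometric decay of \<open>b\<close> along a subsequence, whereas the quotients of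
    consecutive values are \<open>\<rho> n / \<kappa>\<close> and tend to 1.\<close>
  have b1: "b m \<ge> 1" for m
  proof (rule ccontr)
    assume "\<not> b m \<ge> 1"
    define q where "q = b m"
    have q: "0 < q" "q < 1" using b0[of m] \<open>\<not> b m \<ge> 1\<close> by (auto simp: q_def)
    define r where "r = 1 - (1 - q) / (2 * real (Suc m))"
    have r: "0 < r" "r < 1"
    proof -
      show "r < 1" using q by (simp add: r_def)
      have "(1 - q) / (2 * real (Suc m)) \<le> (1 - q) / 1" using q by (intro divide_left_mono) auto
      then show "0 < r" using q by (simp add: r_def)
    qed
    define s where "s = r ^ Suc m"
    have "1 + real (Suc m) * (- ((1 - q) / (2 * real (Suc m)))) \<le> (1 + (- ((1 - q) / (2 * real (Suc m))))) ^ Suc m"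
      by (rule Bernoulli_inequality) (use r in \<open>simp add: r_def\<close>)
    then have "1 + real (Suc m) * (- ((1 - q) / (2 * real (Suc m)))) \<le> s" by (simp add: s_def r_def)
    moreover have "1 + real (Suc m) * (- ((1 - q) / (2 * real (Suc m)))) = (1 + q) / 2" by (simp add: field_simps)
    ultimately have "(1 + q) / 2 \<le> s" by (simp only:)
    then have "q < s" using q by simp
    have s0: "s > 0" using r by (simp add: s_def)
    have "(\<lambda>n. \<rho> n / \<kappa>) \<longlonglongrightarrow> \<kappa> / \<kappa>" by (intro tendsto_divide \<kappa>(1) tendsto_const) (use l0 in auto)
    then have "(\<lambda>n. \<rho> n / \<kappa>) \<longlonglongrightarrow> 1" using l0 by simp
    then have "\<forall>\<^sub>F n in sequentially. r < \<rho> n / \<kappa>" using r(2) by (rule order_tendstoD)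
    then obtain n0 where n0: "\<And>n. n \<ge> n0 \<Longrightarrow> r < \<rho> n / \<kappa>" by (auto simp: eventually_sequentially)
    have low: "b (n0 + j) \<ge> b n0 * r ^ j" for j
    proof (induction j)
      case (Suc j)
      have "b n0 * r ^ Suc j = r * (b n0 * r ^ j)" by simp
      also have "\<dots> \<le> (\<rho> (n0 + j) / \<kappa>) * b (n0 + j)"
        using Suc n0[of "n0 + j"] r b0 by (intro mult_mono) (auto intro: less_imp_le)
      finally show ?case by (simp add: bS)
    qed simp
    define c where "c = b n0"
    have c0: "c > 0" using b0 by (simp add: c_def)
    have low': "b n \<ge> c * r ^ Suc n" if "n \<ge> n0" for n
    proof -
      have "c * r ^ Suc n \<le> c * r ^ (n - n0)" using r c0 by (intro mult_left_mono power_decreasing) auto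
      also have "\<dots> \<le> b n" using low[of "n - n0"] that by (simp add: c_def)
      finally show ?thesis .
    qed
    define N where "N j = 2 ^ j * Suc m - 1" for j :: nat
    have N0: "Suc (N j) = 2 ^ j * Suc m" for j by (simp add: N_def)
    have NS: "N (Suc j) = Suc (2 * N j)" for j using N0[of j] N0[of "Suc j"] by simp
    have up: "b (N j) \<le> q ^ (2 ^ j)" for j
    proof (induction j)
      case 0 then show ?case by (simp add: N_def q_def)
    next
      case (Suc j)
      have "b (N (Suc j)) \<le> (b (N j))\<^sup>2" unfolding NS by (rule sub)
      also have "\<dots> \<le> (q ^ (2 ^ j))\<^sup>2" using Suc b0 by (intro power_mono) (auto intro: less_imp_le)
      also have "\<dots> = q ^ (2 ^ Suc j)" by (simp add: power_mult[symmetric] mult.commute)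
      finally show ?case .
    qed
    have "c \<le> (q / s) ^ j" if j: "j \<ge> n0" for j
    proof -
      have "j < 2 ^ j" by (rule less_exp)
      also have "2 ^ j \<le> 2 ^ j * Suc m" by simp
      finally have "N j \<ge> n0" using j by (simp add: N_def)
      then have "c * r ^ Suc (N j) \<le> q ^ (2 ^ j)" using low'[of "N j"] up[of j] by linarith
      also have "r ^ Suc (N j) = s ^ (2 ^ j)" unfolding N0 s_def by (simp only: power_mult[symmetric] mult.commute)
      finally have "c \<le> (q / s) ^ (2 ^ j)" using s0 by (simp add: power_divide pos_le_divide_eq)
      also have "\<dots> \<le> (q / s) ^ j" using \<open>j < 2 ^ j\<close> q s0 \<open>q < s\<close> by (intro power_decreasing) (auto intro: less_imp_le)
      finally show ?thesis .
    qed
    moreover have "(\<lambda>j. (q / s) ^ j) \<longlonglongrightarrow> 0" by (rule LIMSEQ_realpow_zero) (use q s0 \<open>q < s\<close> in auto)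
    ultimately have "c \<le> 0" by (intro LIMSEQ_le_const) auto
    then show False using c0 by simp
  qed
  have "convergent b" by (rule decseq_convergent[OF dec, of 0]) (use b0 in \<open>auto intro: less_imp_le simp: convergent_def\<close>)
  then obtain L where L: "b \<longlonglongrightarrow> L" by (auto simp: convergent_def)
  have L1: "L \<ge> 1" by (rule LIMSEQ_le_const[OF L]) (use b1 in auto)
  define K where "K = conv k k"
  have cK: "continuous_on UNIV K" unfolding K_def by (intro conv_continuous k)
  define e where "e n x = kp (Suc (2 * n)) x * of_real (1 / \<kappa> ^ Suc n)" for n x
  have ce: "continuous_on UNIV (e n)" for n unfolding e_def[abs_def] by (intro continuous_intros ckp)
  have e_alt: "e n = (\<lambda>x. of_real (1 / \<kappa> ^ Suc n) * kp (Suc (2 * n)) x)" for n by (auto simp: e_def)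
  have eadd: "conv (e m) (e n) = e (Suc (m + n))" for m n
    unfolding e_alt conv_scale_left conv_scale_right kpadd
    by (intro ext) (simp add: power_add mult_2 algebra_simps)
  have e0: "e n 0 = of_real (b n)" for n by (simp add: e_def kp2 b_def)
  have ie: "involution (e n) = e n" for n
    using ikp[of "Suc (2 * n)"] by (auto simp: involution_def e_def fun_eq_iff)
  have Ke: "conv K (e n) = (\<lambda>x. of_real \<kappa> * e (Suc n) x)" for n
  proof -
    have "K = kp (Suc 0)" by (simp add: K_def kpS kp0)
    then show ?thesis unfolding e_alt conv_scale_right using l0 by (simp add: kpadd)
  qed
  have en_diff: "energy (\<lambda>x. e m x - e n x) = b (Suc (2 * m)) - 2 * b (Suc (m + n)) + b (Suc (2 * n))" for m n
  proof -
    have c: "continuous_on UNIV (\<lambda>x. e m x - e n x)" by (intro continuous_intros ce)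
    have i: "involution (\<lambda>x. e m x - e n x) = (\<lambda>x. e m x - e n x)"
      using ie[of m] ie[of n] by (auto simp: involution_def fun_eq_iff)
    have "conv (\<lambda>x. e m x - e n x) (\<lambda>x. e m x - e n x) = (\<lambda>x. conv (\<lambda>x. e m x - e n x) (e m) x - conv (\<lambda>x. e m x - e n x) (e n) x)"
      by (rule conv_diff_right[OF c ce ce])
    also have "conv (\<lambda>x. e m x - e n x) (e m) = (\<lambda>x. conv (e m) (e m) x - conv (e m) (e n) x)"
      unfolding conv_commute[OF c ce] by (rule conv_diff_right[OF ce ce ce])
    also have "conv (\<lambda>x. e m x - e n x) (e n) = (\<lambda>x. conv (e n) (e m) x - conv (e n) (e n) x)"
      unfolding conv_commute[OF c ce] by (rule conv_diff_right[OF ce ce ce])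
    finally have D: "conv (\<lambda>x. e m x - e n x) (\<lambda>x. e m x - e n x) 0 = e (Suc (m + m)) 0 - e (Suc (m + n)) 0 - (e (Suc (n + m)) 0 - e (Suc (n + n)) 0)"
      unfolding eadd by (rule fun_cong)
    have "complex_of_real (energy (\<lambda>x. e m x - e n x)) = of_real (b (Suc (2 * m)) - 2 * b (Suc (m + n)) + b (Suc (2 * n)))"
      unfolding selfadjoint_value_0[OF c i, symmetric] D e0 add.commute[of n m] mult_2 by simp
    then show ?thesis by (simp only: of_real_eq_iff)
  qed
  have sup_diff: "(cmod (e (Suc m) x - e (Suc n) x))\<^sup>2 \<le> energy K * (b (Suc (2 * m)) - 2 * b (Suc (m + n)) + b (Suc (2 * n))) / \<kappa>\<^sup>2" for m n x
  proof -
    have c: "continuous_on UNIV (\<lambda>x. e m x - e n x)" by (intro continuous_intros ce)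
    have "conv K (\<lambda>x. e m x - e n x) x = of_real \<kappa> * (e (Suc m) x - e (Suc n) x)"
      unfolding conv_diff_right[OF cK ce ce] Ke by (simp add: right_diff_distrib)
    with conv_bound[OF cK c, of x] have "(\<kappa> * cmod (e (Suc m) x - e (Suc n) x))\<^sup>2 \<le> energy K * (b (Suc (2 * m)) - 2 * b (Suc (m + n)) + b (Suc (2 * n)))"
      using l0 by (simp add: norm_mult en_diff)
    then show ?thesis using l0 by (simp add: power_mult_distrib pos_le_divide_eq mult.commute)
  qed
  have "uniformly_Cauchy_on UNIV (\<lambda>n. e (Suc n))"
  proof (rule uniformly_Cauchy_onI)
    fix \<epsilon> :: real assume \<epsilon>: "\<epsilon> > 0"
    have EK: "energy K \<ge> 0" by (rule energy_nonneg)
    define E1 where "E1 = energy K + 1"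
    have E1: "E1 > 0" using EK by (simp add: E1_def)
    define \<delta> where "\<delta> = \<epsilon>\<^sup>2 * \<kappa>\<^sup>2 / (2 * E1)"
    have \<delta>: "\<delta> > 0" using \<epsilon> l0 E1 by (simp add: \<delta>_def)
    have "\<forall>\<^sub>F n in sequentially. b n < L + \<delta>" using L \<delta> by (intro order_tendstoD) auto
    then obtain M where M: "\<And>n. n \<ge> M \<Longrightarrow> b n < L + \<delta>" by (auto simp: eventually_sequentially)
    have bL: "b n \<ge> L" for n using decseq_ge[OF dec L] .
    have "dist (e (Suc m) x) (e (Suc n) x) < \<epsilon>" if "m \<ge> M" "n \<ge> M" for m n x
    proof -
      have "b (Suc (2 * m)) - 2 * b (Suc (m + n)) + b (Suc (2 * n)) < 2 * \<delta>"
        using M[of "Suc (2 * m)"] M[of "Suc (2 * n)"] bL[of "Suc (m + n)"] that by simp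
      then have "energy K * (b (Suc (2 * m)) - 2 * b (Suc (m + n)) + b (Suc (2 * n))) / \<kappa>\<^sup>2 \<le> energy K * (2 * \<delta>) / \<kappa>\<^sup>2"
        using EK l0 by (intro divide_right_mono mult_left_mono) auto
      also have "\<dots> = \<epsilon>\<^sup>2 * (energy K / E1)"
        using l0 E1 by (simp add: \<delta>_def)
      also have "\<dots> < \<epsilon>\<^sup>2 * 1" using \<epsilon> E1 by (intro mult_strict_left_mono) (auto simp: E1_def)
      finally have "(cmod (e (Suc m) x - e (Suc n) x))\<^sup>2 < \<epsilon>\<^sup>2" using sup_diff[of m x n] by simp
      then show ?thesis using \<epsilon> by (simp add: dist_norm power2_less_imp_less)
    qed
    then show "\<exists>M. \<forall>x\<in>UNIV. \<forall>m\<ge>M. \<forall>n\<ge>M. dist (e (Suc m) x) (e (Suc n) x) < \<epsilon>" by blast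
  qed
  then obtain E where "uniform_limit UNIV (\<lambda>n. e (Suc n)) E sequentially"
    using Cauchy_uniformly_convergent uniformly_convergent_on_def by blast
  then have E: "uniform_limit UNIV e E sequentially"
    using filterlim_sequentially_Suc[of e] by (simp add: filterlim_sequentially_Suc)
  have cE: "continuous_on UNIV E" by (rule uniform_limit_theorem[OF _ E]) (use ce in auto)
  have Ept: "(\<lambda>n. e n x) \<longlonglongrightarrow> E x" for x by (rule tendsto_uniform_limitI[OF E]) simp
  have E0: "E 0 = of_real L"
    using LIMSEQ_unique[OF Ept[of 0]] tendsto_of_real[OF L, where ?'a = complex] by (simp add: e0)
  have iE: "involution E = E"
  proof
    fix x
    have "(\<lambda>n. cnj (e n (- x))) \<longlonglongrightarrow> cnj (E (- x))" by (intro tendsto_cnj Ept)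
    moreover have "cnj (e n (- x)) = e n x" for n using fun_cong[OF ie[of n], of x] by (simp add: involution_def)
    ultimately have "(\<lambda>n. e n x) \<longlonglongrightarrow> cnj (E (- x))" by simp
    then show "involution E x = E x" using LIMSEQ_unique[OF Ept[of x]] by (simp add: involution_def)
  qed
  have KE: "conv K E = (\<lambda>x. of_real \<kappa> * E x)"
  proof
    fix x
    have "(\<lambda>n. conv K (e n) x) \<longlonglongrightarrow> conv K E x" by (rule conv_tendsto[OF cK ce cE E])
    moreover have "(\<lambda>n. of_real \<kappa> * e (Suc n) x) \<longlonglongrightarrow> of_real \<kappa> * E x"
      by (intro tendsto_intros LIMSEQ_Suc Ept)
    ultimately show "conv K E x = of_real \<kappa> * E x" unfolding Ke by (rule LIMSEQ_unique)
  qed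
  have eE: "conv (e m) E = E" for m
  proof
    fix x
    have "(\<lambda>n. conv (e m) (e n) x) \<longlonglongrightarrow> conv (e m) E x" by (rule conv_tendsto[OF ce ce cE E])
    moreover have "(\<lambda>n. e (n + Suc m) x) \<longlonglongrightarrow> E x" by (rule LIMSEQ_ignore_initial_segment[OF Ept])
    ultimately show "conv (e m) E x = E x" unfolding eadd by (intro LIMSEQ_unique) (auto simp: add.commute)
  qed
  have EE: "conv E E = E"
  proof
    fix x
    have "(\<lambda>n. conv E (e n) x) \<longlonglongrightarrow> conv E E x" by (rule conv_tendsto[OF cE ce cE E])
    then have "(\<lambda>n. E x) \<longlonglongrightarrow> conv E E x" by (simp add: conv_commute[OF cE ce] eE)
    then show "conv E E x = E x" by (simp add: LIMSEQ_const_iff)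
  qed
  have "E 0 \<noteq> 0" using E0 L1 by simp
  then have "idempotent E" using cE iE EE by (auto simp: idempotent_def)
  then show thesis using that[of E \<kappa>] l0 KE by (simp add: K_def)
qed

end


lemma characters_mult:
  assumes "\<xi> \<in> characters" "\<delta> \<in> characters" shows "(\<lambda>x. \<xi> x * \<delta> x) \<in> characters"
  using assms by (auto simp: characters_def norm_mult intro!: continuous_intros)

lemma characters_cnj:
  assumes "\<xi> \<in> characters" shows "(\<lambda>x. cnj (\<xi> x)) \<in> characters"
  using assms by (auto simp: characters_def intro!: continuous_intros)

lemma characters_one: "(\<lambda>x. 1) \<in> characters"
  by (auto simp: characters_def)

lemma characterD:
  assumes "\<xi> \<in> characters"
  shows "continuous_on UNIV \<xi>" "\<xi> (x + y) = \<xi> x * \<xi> y" "cmod (\<xi> x) = 1"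
  using assms by (auto simp: characters_def)

lemma character_0: "\<xi> \<in> characters \<Longrightarrow> \<xi> 0 = 1"
  using characterD(2)[of \<xi> 0 0] characterD(3)[of \<xi> 0] by auto

lemma character_minus:
  assumes "\<xi> \<in> characters" shows "\<xi> (- x) = cnj (\<xi> x)"
proof -
  have "\<xi> x * \<xi> (- x) = 1" using characterD(2)[OF assms, of x "- x"] character_0[OF assms] by simp
  moreover have "\<xi> x * cnj (\<xi> x) = 1" using characterD(3)[OF assms, of x] by (simp flip: complex_norm_square)
  moreover have "\<xi> x \<noteq> 0" using characterD(3)[OF assms, of x] by auto
  ultimately show ?thesis by (metis mult_left_cancel)
qed

context compact_haar_group
begin

lemma conv_zero_right: "conv f (\<lambda>x. 0) = (\<lambda>x. 0)"
  by (intro ext) (simp add: conv_def)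

text \<open>Splitting off a proper subidempotent lowers the energy by at least one.\<close>

lemma minimal_idempotent:
  assumes "idempotent e"
  shows "\<exists>e'. idempotent e' \<and> conv e e' = e' \<and> (\<forall>d. idempotent d \<longrightarrow> conv e' d = d \<longrightarrow> d = e')"
  using assms
proof (induction "nat \<lfloor>energy e\<rfloor>" arbitrary: e rule: less_induct)
  case less
  have ce: "continuous_on UNIV e" and ie: "involution e = e" and ee: "conv e e = e"
    using less.prems by (auto simp: idempotent_def)
  show ?case
  proof (cases "\<forall>d. idempotent d \<longrightarrow> conv e d = d \<longrightarrow> d = e")
    case True
    then show ?thesis using less.prems ee by blast
  next
    case False
    then obtain d where d: "idempotent d" "conv e d = d" "d \<noteq> e" by blast
    have cd: "continuous_on UNIV d" and id: "involution d = d" and dd: "conv d d = d"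
      using d by (auto simp: idempotent_def)
    define f where "f = (\<lambda>x. e x - d x)"
    have cf: "continuous_on UNIV f" unfolding f_def by (intro continuous_intros ce cd)
    have "idempotent f" unfolding idempotent_def
    proof (intro conjI cf)
      show "involution f = f" using ie id by (auto simp: f_def involution_def fun_eq_iff)
      have fe: "conv f e = f" unfolding conv_commute[OF cf ce] unfolding f_def conv_diff_right[OF ce ce cd] ee d(2) ..
      have fd: "conv f d = (\<lambda>x. 0)" unfolding conv_commute[OF cf cd] unfolding f_def conv_diff_right[OF cd ce cd] conv_commute[OF cd ce] dd d(2) by simp
      have "conv f (\<lambda>x. e x - d x) = (\<lambda>x. conv f e x - conv f d x)" by (rule conv_diff_right[OF cf ce cd])
      then show "conv f f = f" unfolding fe fd by (simp flip: f_def)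
      show "\<exists>x. f x \<noteq> 0" using d(3) unfolding f_def by (metis eq_iff_diff_eq_0 ext)
    qed
    from idempotent_energy(1,2)[OF this] idempotent_energy(1)[OF d(1)] idempotent_energy(1)[OF less.prems]
    have "complex_of_real (energy f) = of_real (energy e - energy d)" "energy f \<ge> 1" by (auto simp: f_def)
    then have "energy d \<le> energy e - 1" unfolding of_real_eq_iff by linarith
    moreover have "energy d \<ge> 1" by (rule idempotent_energy(2)[OF d(1)])
    ultimately have "nat \<lfloor>energy d\<rfloor> < nat \<lfloor>energy e\<rfloor>" by linarith
    from less.hyps[OF this d(1)] obtain e' where e': "idempotent e'" "conv d e' = e'" "\<forall>d. idempotent d \<longrightarrow> conv e' d = d \<longrightarrow> d = e'" by blast
    have "conv e e' = conv (conv e d) e'"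
      using conv_assoc[OF ce cd, of e'] e' by (simp add: idempotent_def)
    then have "conv e e' = e'" using d(2) e'(2) by simp
    then show ?thesis using e' by blast
  qed
qed

text \<open>
  For a selfadjoint \<open>g\<close> in the range, the top idempotent of \<open>g\<close> lies below \<open>e\<close>, so it is \<open>e\<close> and
  \<open>g * g = \<kappa> e\<close>. With \<open>s = \<surd>\<kappa>\<close> the functions \<open>g - s e\<close> and \<open>g + s e\<close> annihilate each other; if the
  first is nonzero, its square is a positive multiple of \<open>e\<close> and the second vanishes. A general \<open>g\<close> is
  split into two selfadjoint parts.
\<close>

lemma minimal_idempotent_range:
  assumes e: "idempotent e" and min: "\<And>d. idempotent d \<Longrightarrow> conv e d = d \<Longrightarrow> d = e"
    and g: "continuous_on UNIV g" "conv e g = g"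
  shows "\<exists>c. g = (\<lambda>x. c * e x)"
proof -
  have ce: "continuous_on UNIV e" and ie: "involution e = e" and ee: "conv e e = e"
    using e by (auto simp: idempotent_def)
  have square: "\<exists>\<kappa>>0. conv g g = (\<lambda>x. complex_of_real \<kappa> * e x)"
    if g: "continuous_on UNIV g" "conv e g = g" "involution g = g" "g x0 \<noteq> 0" for g x0
  proof -
    obtain d and \<kappa> :: real where d: "idempotent d" "\<kappa> > 0" "conv (conv g g) d = (\<lambda>x. of_real \<kappa> * d x)"
      using top_idempotent[OF g(1,3,4)] by blast
    have cd: "continuous_on UNIV d" using d by (simp add: idempotent_def)
    have cgg: "continuous_on UNIV (conv g g)" by (intro conv_continuous g)
    have egg: "conv e (conv g g) = conv g g" using conv_assoc[OF ce g(1) g(1)] g(2) by simp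
    have "conv e (conv (conv g g) d) = conv (conv g g) d" using conv_assoc[OF ce cgg cd] egg by simp
    then have "(\<lambda>x. of_real \<kappa> * conv e d x) = (\<lambda>x. of_real \<kappa> * d x)" unfolding d(3) conv_scale_right .
    then have "conv e d = d" using d(2) by (auto simp: fun_eq_iff)
    then have "d = e" using min d(1) by blast
    then have "conv g g = (\<lambda>x. complex_of_real \<kappa> * e x)"
      using d(3) conv_commute[OF cgg ce] egg by simp
    then show ?thesis using d(2) by blast
  qed
  have selfadj: "\<exists>c. g = (\<lambda>x. c * e x)" if g: "continuous_on UNIV g" "conv e g = g" "involution g = g" for g
  proof (cases "\<exists>x0. g x0 \<noteq> 0")
    case False
    then show ?thesis by (intro exI[of _ 0]) auto
  next
    case True
    then obtain \<kappa> where \<kappa>: "\<kappa> > 0" "conv g g = (\<lambda>x. complex_of_real \<kappa> * e x)" using square[OF g] by blast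
    define s where "s = complex_of_real (sqrt \<kappa>)"
    have s2: "s * s = of_real \<kappa>" using \<kappa> by (simp add: s_def flip: of_real_mult)
    have s: "cnj s = s" by (simp add: s_def)
    define h where "h = (\<lambda>x. g x - s * e x)"
    have cse: "continuous_on UNIV (\<lambda>x. s * e x)" by (intro continuous_intros ce)
    have ch: "continuous_on UNIV h" unfolding h_def by (intro continuous_intros g ce)
    have eh: "conv e h = h" unfolding h_def conv_diff_right[OF ce g(1) cse] conv_scale_right g(2) ee ..
    have ih: "involution h = h" using g(3) ie s by (auto simp: h_def involution_def fun_eq_iff)
    show ?thesis
    proof (cases "\<exists>x0. h x0 \<noteq> 0")
      case False
      then show ?thesis by (intro exI[of _ s]) (auto simp: h_def)
    next
      case True
      then obtain \<kappa>' where \<kappa>': "\<kappa>' > 0" "conv h h = (\<lambda>x. complex_of_real \<kappa>' * e x)" using square[OF ch eh ih] by blast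
      define p where "p = (\<lambda>x. g x + s * e x)"
      have cp: "continuous_on UNIV p" unfolding p_def by (intro continuous_intros g ce)
      have ep: "conv e p = p" unfolding p_def conv_add_right[OF ce g(1) cse] conv_scale_right g(2) ee ..
      have hg: "conv h g = (\<lambda>x. of_real \<kappa> * e x - s * g x)"
        unfolding conv_commute[OF ch g(1)] unfolding h_def conv_diff_right[OF g(1) g(1) cse] conv_scale_right \<kappa>(2) conv_commute[OF g(1) ce] g(2) ..
      have he: "conv h e = h" using conv_commute[OF ch ce] eh by simp
      have "conv h p = (\<lambda>x. conv h g x + s * conv h e x)"
        unfolding p_def conv_add_right[OF ch g(1) cse] conv_scale_right ..
      also have "\<dots> = (\<lambda>x. 0)" unfolding hg he unfolding h_def s2[symmetric] by (simp add: algebra_simps)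
      finally have "conv h (conv h p) = (\<lambda>x. 0)" by (simp add: conv_zero_right)
      then have "conv (conv h h) p = (\<lambda>x. 0)" using conv_assoc[OF ch ch cp] by simp
      then have "(\<lambda>x. of_real \<kappa>' * p x) = (\<lambda>x. 0)" unfolding \<kappa>'(2) conv_scale_left ep .
      then have "p x = 0" for x using \<kappa>'(1) by (auto simp: fun_eq_iff)
      then show ?thesis by (intro exI[of _ "- s"]) (auto simp: p_def fun_eq_iff eq_neg_iff_add_eq_0)
    qed
  qed
  have ci: "continuous_on UNIV (involution g)" by (rule involution_continuous[OF g(1)])
  have eig: "conv e (involution g) = involution g" using involution_conv[OF ce g(1)] ie g(2) by simp
  define u where "u = (\<lambda>x. g x + involution g x)"
  define w where "w = (\<lambda>x. \<i> * g x - \<i> * involution g x)"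
  have c2: "continuous_on UNIV (\<lambda>x. \<i> * g x)" "continuous_on UNIV (\<lambda>x. \<i> * involution g x)" by (intro continuous_intros g ci)+
  have cu: "continuous_on UNIV u" and cw: "continuous_on UNIV w" unfolding u_def w_def by (intro continuous_intros g ci)+
  have "conv e u = u" unfolding u_def conv_add_right[OF ce g(1) ci] g(2) eig ..
  moreover have "involution u = u" by (auto simp: u_def involution_def fun_eq_iff)
  ultimately obtain c1 where c1: "u = (\<lambda>x. c1 * e x)" using selfadj[OF cu] by blast
  have "conv e w = w" unfolding w_def conv_diff_right[OF ce c2] conv_scale_right g(2) eig ..
  moreover have "involution w = w" by (auto simp: w_def involution_def fun_eq_iff algebra_simps)
  ultimately obtain c2 where c2: "w = (\<lambda>x. c2 * e x)" using selfadj[OF cw] by blast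
  have "g x = (c1 - \<i> * c2) / 2 * e x" for x
  proof -
    have "2 * g x = u x - \<i> * w x" by (simp add: u_def w_def algebra_simps)
    also have "\<dots> = (c1 - \<i> * c2) * e x" unfolding c1 c2 by (simp add: algebra_simps)
    finally have "g x * 2 = (c1 - \<i> * c2) * e x" by (simp only: mult.commute)
    then show ?thesis by simp
  qed
  then show ?thesis by blast
qed

text \<open>
  The range of convolution by \<open>e\<close> is invariant under translations and one-dimensional, so the
  translates of \<open>e\<close> are multiples of \<open>e\<close>.
\<close>

lemma minimal_idempotent_character:
  assumes e: "idempotent e" and min: "\<And>d. idempotent d \<Longrightarrow> conv e d = d \<Longrightarrow> d = e"
  shows "(\<lambda>x. e x / e 0) \<in> characters"
proof -
  have ce: "continuous_on UNIV e" and ee: "conv e e = e"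
    using e by (auto simp: idempotent_def)
  have E: "energy e \<ge> 1" "e 0 = of_real (energy e)" using idempotent_energy[OF e] by auto
  then have e0: "e 0 \<noteq> 0" by auto
  define \<theta> where "\<theta> x = e x / e 0" for x
  have mult: "\<theta> (x + a) = \<theta> x * \<theta> a" for x a
  proof -
    define g where "g = (\<lambda>x. e (x + a))"
    have cg: "continuous_on UNIV g" unfolding g_def by (rule continuous_on_compose2[OF ce]) (auto intro!: continuous_intros)
    have "conv g e = (\<lambda>x. conv e e (x + a))" unfolding g_def by (rule conv_translate)
    then have "conv g e = g" unfolding ee g_def .
    then have "conv e g = g" using conv_commute[OF ce cg] by simp
    from minimal_idempotent_range[OF e min cg this] obtain c where c: "g = (\<lambda>x. c * e x)" by blast
    have "e a = c * e 0" using fun_cong[OF c, of 0] by (simp add: g_def)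
    moreover have "e (x + a) = c * e x" using fun_cong[OF c, of x] by (simp add: g_def)
    ultimately show ?thesis using e0 by (simp add: \<theta>_def)
  qed
  have le: "cmod (\<theta> x) \<le> 1" for x
    using idempotent_energy(3)[OF e, of x] E by (simp add: \<theta>_def norm_divide divide_le_eq_1)
  have "cmod (\<theta> x) = 1" for x
  proof -
    have "\<theta> x * \<theta> (- x) = 1" using mult[of x "- x"] e0 by (simp add: \<theta>_def)
    then have "cmod (\<theta> x) * cmod (\<theta> (- x)) = 1" by (metis norm_mult norm_one)
    moreover have "cmod (\<theta> x) * cmod (\<theta> (- x)) \<le> cmod (\<theta> x)" using le[of "- x"] by (intro mult_left_le) auto
    ultimately show ?thesis using le[of x] by linarith
  qed
  moreover have "continuous_on UNIV \<theta>" unfolding \<theta>_def using e0 by (intro continuous_intros ce) auto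
  ultimately show ?thesis using mult unfolding characters_def \<theta>_def by blast
qed

text \<open>
  A minimal idempotent below the top idempotent of \<open>f * f\<^sup>*\<close> is a multiple of a character. If this
  character were orthogonal to \<open>f\<close>, its convolution with \<open>f * f\<^sup>*\<close> would be zero, whereas a second
  convolution with this function has to give a positive multiple of it.
\<close>

theorem nonzero_fourier_coefficient:
  assumes f: "continuous_on UNIV f" "f x0 \<noteq> 0"
  shows "\<exists>\<xi>\<in>characters. (\<integral>x. f x * cnj (\<xi> x) \<partial>\<mu>) \<noteq> 0"
proof -
  have cif: "continuous_on UNIV (involution f)" by (rule involution_continuous[OF f(1)])
  define k where "k = conv f (involution f)"
  have ck: "continuous_on UNIV k" unfolding k_def by (intro conv_continuous f cif)
  have "involution (involution f) = f" by (auto simp: involution_def)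
  then have ik: "involution k = k" unfolding k_def involution_conv[OF f(1) cif] by (simp add: conv_commute[OF f(1) cif])
  have "k 0 \<noteq> 0" unfolding k_def conv_involution_0[OF f(1)] using energy_pos[OF f] by simp
  from top_idempotent[OF ck ik this] obtain e and \<kappa> :: real where e: "idempotent e" "\<kappa> > 0" "conv (conv k k) e = (\<lambda>x. of_real \<kappa> * e x)" by blast
  obtain d where d: "idempotent d" "conv e d = d" "\<And>d'. idempotent d' \<Longrightarrow> conv d d' = d' \<Longrightarrow> d' = d"
    using minimal_idempotent[OF e(1)] by blast
  have ce: "continuous_on UNIV e" and cd: "continuous_on UNIV d" using e d by (auto simp: idempotent_def)
  have ckk: "continuous_on UNIV (conv k k)" by (intro conv_continuous ck)
  define \<xi> where "\<xi> = (\<lambda>x. d x / d 0)"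
  have \<xi>: "\<xi> \<in> characters" unfolding \<xi>_def by (rule minimal_idempotent_character[OF d(1,3)])
  have d0: "d 0 \<noteq> 0" using idempotent_energy[OF d(1)] by auto
  have d\<xi>: "d = (\<lambda>x. d 0 * \<xi> x)" using d0 by (auto simp: \<xi>_def)
  have "(\<integral>x. f x * cnj (\<xi> x) \<partial>\<mu>) \<noteq> 0"
  proof
    assume z: "(\<integral>x. f x * cnj (\<xi> x) \<partial>\<mu>) = 0"
    have "conv \<xi> f x = 0" for x
    proof -
      have "conv \<xi> f x = (\<integral>y. \<xi> x * (f y * cnj (\<xi> y)) \<partial>\<mu>)"
        unfolding conv_def using characterD(2)[OF \<xi>, of x "- _"] by (simp add: character_minus[OF \<xi>] mult_ac)
      then show ?thesis using z by simp
    qed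
    then have "conv d f = (\<lambda>x. 0)" by (subst d\<xi>) (simp add: conv_scale_left)
    then have fd: "conv f d = (\<lambda>x. 0)" using conv_commute[OF f(1) cd] by simp
    have "conv k d = conv (involution f) (conv f d)"
      unfolding k_def conv_commute[OF f(1) cif] conv_assoc[OF cif f(1) cd] ..
    then have "conv k d = (\<lambda>x. 0)" by (simp add: fd conv_zero_right)
    then have "conv (conv k k) d = (\<lambda>x. 0)" by (simp add: conv_assoc[OF ck ck cd] conv_zero_right)
    moreover have "conv (conv k k) d = conv (conv (conv k k) e) d" using conv_assoc[OF ckk ce cd] d(2) by simp
    then have "conv (conv k k) d = (\<lambda>x. of_real \<kappa> * d x)" unfolding e(3) conv_scale_left d(2) .
    ultimately have "of_real \<kappa> * d 0 = 0" by (metis)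
    then show False using d0 e(2) by simp
  qed
  then show ?thesis using \<xi> by blast
qed

lemma normal_group: "normal_space (euclidean :: 'g topology)"
proof -
  have "Hausdorff_space (euclidean :: 'g topology)"
    unfolding Hausdorff_space_def by (simp add: disjnt_def) (metis hausdorff)
  moreover have "compact_space (euclidean :: 'g topology)" using compact_group by (simp add: compact_space_def)
  ultimately show ?thesis by (intro compact_Hausdorff_or_regular_imp_normal_space) auto
qed

lemma urysohn_group:
  assumes "closed S" "closed T" "S \<inter> T = ({} :: 'g set)"
  obtains h :: "'g \<Rightarrow> real" where "continuous_on UNIV h" "\<And>x. 0 \<le> h x \<and> h x \<le> 1" "\<And>x. x \<in> S \<Longrightarrow> h x = 0" "\<And>x. x \<in> T \<Longrightarrow> h x = 1"
proof -
  obtain h where h: "continuous_map euclidean (top_of_set {0..1::real}) h" "h ` S \<subseteq> {0}" "h ` T \<subseteq> {1}"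
    using Urysohn_lemma[OF normal_group, of S T 0 1] assms by (auto simp: disjnt_def)
  show thesis
  proof (rule that[of h])
    show "continuous_on UNIV h" using h(1) by (simp add: continuous_map_in_subtopology)
    show "0 \<le> h x \<and> h x \<le> 1" for x using h(1) by (auto simp: continuous_map_in_subtopology)
  qed (use h in auto)
qed

text \<open>
  A function \<open>H(a + z) - H(z)\<close> that is not zero has a nonzero coefficient, which is \<open>\<xi>(a) - 1\<close> times a
  coefficient of \<open>H\<close>.
\<close>

lemma characters_separate:
  assumes "x \<noteq> (y::'g)" shows "\<exists>\<xi>\<in>characters. \<xi> x \<noteq> \<xi> y"
proof -
  define a where "a = x - y"
  have a: "a \<noteq> 0" using assms by (simp add: a_def)
  obtain h :: "'g \<Rightarrow> real" where h: "continuous_on UNIV h" "h 0 = 0" "h a = 1"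
    using urysohn_group[of "{0}" "{a}"] a by auto
  define H where "H x = complex_of_real (h x)" for x
  have cH: "continuous_on UNIV H" unfolding H_def by (intro continuous_intros h)
  define f where "f z = H (a + z) - H z" for z
  have cHa: "continuous_on UNIV (\<lambda>z. H (a + z))" by (rule continuous_on_compose2[OF cH]) (auto intro!: continuous_intros)
  have cf: "continuous_on UNIV f" unfolding f_def by (intro continuous_intros cHa cH)
  have "f 0 \<noteq> 0" using h by (simp add: f_def H_def)
  from nonzero_fourier_coefficient[OF cf this] obtain \<xi> where \<xi>: "\<xi> \<in> characters" "(\<integral>x. f x * cnj (\<xi> x) \<partial>\<mu>) \<noteq> 0" by blast
  have c\<xi>: "continuous_on UNIV (\<lambda>z. cnj (\<xi> z))" by (intro continuous_intros characterD[OF \<xi>(1)])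
  have "(\<integral>z. H (a + z) * cnj (\<xi> z) \<partial>\<mu>) = (\<integral>z. H z * cnj (\<xi> (z - a)) \<partial>\<mu>)"
  proof -
    have "continuous_on UNIV (\<lambda>z. H z * cnj (\<xi> (z - a)))"
      by (intro continuous_intros cH continuous_diff_arg[OF characterD(1)[OF \<xi>(1)]])
    from integral_translation[OF continuous_borel[OF this], of a] show ?thesis by simp
  qed
  also have "\<dots> = (\<integral>z. \<xi> a * (H z * cnj (\<xi> z)) \<partial>\<mu>)"
    using characterD(2)[OF \<xi>(1), of _ "- a"] by (simp add: character_minus[OF \<xi>(1)] mult_ac)
  also have "\<dots> = \<xi> a * (\<integral>z. H z * cnj (\<xi> z) \<partial>\<mu>)" by simp
  finally have "(\<integral>x. f x * cnj (\<xi> x) \<partial>\<mu>) = (\<xi> a - 1) * (\<integral>z. H z * cnj (\<xi> z) \<partial>\<mu>)"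
    unfolding f_def left_diff_distrib
    by (subst Bochner_Integration.integral_diff) (auto intro!: continuous_integrable continuous_intros cHa cH c\<xi>)
  then have "\<xi> a \<noteq> 1" using \<xi>(2) by auto
  moreover have "\<xi> x = \<xi> a * \<xi> y" using characterD(2)[OF \<xi>(1), of a y] by (simp add: a_def)
  moreover have "\<xi> y \<noteq> 0" using characterD(3)[OF \<xi>(1), of y] by auto
  ultimately show ?thesis using \<xi>(1) by (intro bexI[of _ \<xi>]) auto
qed

end


section \<open>Trigonometric polynomials\<close>

definition trig :: "('g::{topological_ab_group_add, t2_space} \<Rightarrow> complex) set \<Rightarrow> (('g \<Rightarrow> complex) \<Rightarrow> 'x::complex_banach) \<Rightarrow> 'g \<Rightarrow> 'x" where
  "trig F v x = (\<Sum>\<xi>\<in>F. \<xi> x *\<^sub>C v \<xi>)"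

lemma trig_add:
  assumes "finite F" "finite G"
  shows "trig F v x + trig G w x = trig (F \<union> G) (\<lambda>\<xi>. (if \<xi> \<in> F then v \<xi> else 0) + (if \<xi> \<in> G then w \<xi> else 0)) x"
proof -
  have "trig F v x = (\<Sum>\<xi>\<in>F \<union> G. \<xi> x *\<^sub>C (if \<xi> \<in> F then v \<xi> else 0))"
    unfolding trig_def by (rule sum.mono_neutral_cong_left) (use assms in auto)
  moreover have "trig G w x = (\<Sum>\<xi>\<in>F \<union> G. \<xi> x *\<^sub>C (if \<xi> \<in> G then w \<xi> else 0))"
    unfolding trig_def by (rule sum.mono_neutral_cong_left) (use assms in auto)
  ultimately show ?thesis by (simp add: trig_def sum.distrib scaleC_add_right)
qed

lemma trig_scaleC: "c *\<^sub>C trig F v x = trig F (\<lambda>\<xi>. c *\<^sub>C v \<xi>) x"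
  unfolding trig_def by (simp add: scaleC_sum_right scaleC_scaleC mult.commute)

lemma trig_extend:
  assumes "finite G" "F \<subseteq> G"
  shows "trig F v x = trig G (\<lambda>\<xi>. if \<xi> \<in> F then v \<xi> else 0) x"
  unfolding trig_def by (rule sum.mono_neutral_cong_left) (use assms in auto)

lemma trig_scalar_times_vector: "trig F c x *\<^sub>C v = trig F (\<lambda>\<xi>. c \<xi> *\<^sub>C v) x"
  unfolding trig_def by (simp add: scaleC_sum_left scaleC_scaleC scaleC_complex_def)

definition trig_poly :: "('g::{topological_ab_group_add, t2_space} \<Rightarrow> complex) \<Rightarrow> bool" where
  "trig_poly f \<longleftrightarrow> (\<exists>F c. finite F \<and> F \<subseteq> characters \<and> f = trig F c)"

lemma trig_poly_add:
  assumes "trig_poly f" "trig_poly g" shows "trig_poly (\<lambda>x. f x + g x)"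
proof -
  obtain F c where F: "finite F" "F \<subseteq> characters" "f = trig F c" using assms(1) by (auto simp: trig_poly_def)
  obtain G d where G: "finite G" "G \<subseteq> characters" "g = trig G d" using assms(2) by (auto simp: trig_poly_def)
  show ?thesis unfolding trig_poly_def F(3) G(3) trig_add[OF F(1) G(1)]
    by (intro exI[of _ "F \<union> G"] exI conjI refl) (use F G in auto)
qed

lemma trig_poly_zero: "trig_poly (\<lambda>x. 0)"
  unfolding trig_poly_def by (intro exI[of _ "{}"]) (auto simp: trig_def fun_eq_iff)

lemma trig_poly_monomial: "\<xi> \<in> characters \<Longrightarrow> trig_poly (\<lambda>x. c * \<xi> x)"
  unfolding trig_poly_def by (intro exI[of _ "{\<xi>}"] exI[of _ "\<lambda>_. c"]) (auto simp: trig_def scaleC_complex_def fun_eq_iff)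

lemma trig_poly_sum: "(\<And>i. i \<in> I \<Longrightarrow> trig_poly (f i)) \<Longrightarrow> trig_poly (\<lambda>x. \<Sum>i\<in>I. f i x)"
  by (induction I rule: infinite_finite_induct) (auto intro: trig_poly_zero trig_poly_add)

lemma trig_poly_mult:
  assumes "trig_poly f" "trig_poly g" shows "trig_poly (\<lambda>x. f x * g x)"
proof -
  obtain F c where F: "finite F" "F \<subseteq> characters" "f = trig F c" using assms(1) by (auto simp: trig_poly_def)
  obtain G d where G: "finite G" "G \<subseteq> characters" "g = trig G d" using assms(2) by (auto simp: trig_poly_def)
  have "f x * g x = (\<Sum>\<xi>\<in>F. \<Sum>\<delta>\<in>G. (c \<xi> * d \<delta>) * (\<xi> x * \<delta> x))" for x
    unfolding F(3) G(3) trig_def scaleC_complex_def sum_product by (simp add: mult_ac)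
  moreover have "trig_poly (\<lambda>x. \<Sum>\<xi>\<in>F. \<Sum>\<delta>\<in>G. (c \<xi> * d \<delta>) * (\<xi> x * \<delta> x))"
    by (intro trig_poly_sum trig_poly_monomial[of "\<lambda>x. _ x * _ x"] characters_mult) (use F G in auto)
  ultimately show ?thesis by simp
qed

context compact_haar_group
begin

lemma trig_strongly_measurable:
  fixes v :: "('g \<Rightarrow> complex) \<Rightarrow> 'x::complex_banach"
  assumes "F \<subseteq> characters"
  shows "strongly_measurable \<mu> (trig F v)"
  unfolding trig_def[abs_def]
proof (intro strongly_measurable_sum strongly_measurable_scaleC_vector strongly_measurable_borel)
  fix \<xi> assume "\<xi> \<in> F"
  then have "\<xi> \<in> characters" using assms by blast
  from continuous_borel[OF characterD(1)[OF this]] show "\<xi> \<in> borel_measurable \<mu>" by simp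
qed

lemma norm_trig_le:
  assumes "F \<subseteq> characters" shows "norm (trig F v x) \<le> (\<Sum>\<xi>\<in>F. norm (v \<xi>))"
  unfolding trig_def
proof (rule sum_norm_le)
  fix \<xi> assume "\<xi> \<in> F"
  then have "\<xi> \<in> characters" using assms by blast
  from characterD(3)[OF this, of x] show "norm (\<xi> x *\<^sub>C v \<xi>) \<le> norm (v \<xi>)" by (simp add: norm_scaleC)
qed

lemma trig_Lp:
  assumes "F \<subseteq> characters" "p \<ge> 1"
  shows "trig F v \<in> Lp \<mu> p" "Lp_norm \<mu> p (trig F v) \<le> (\<Sum>\<xi>\<in>F. norm (v \<xi>))"
proof -
  have b: "AE x in \<mu>. norm (trig F v x) \<le> (\<Sum>\<xi>\<in>F. norm (v \<xi>))" by (intro AE_I2 norm_trig_le assms(1))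
  have n: "(\<Sum>\<xi>\<in>F. norm (v \<xi>)) \<ge> 0" by (intro sum_nonneg) auto
  note * = Lp_bounded[OF prob_space_haar assms(2) trig_strongly_measurable[OF assms(1)] b n]
  show "trig F v \<in> Lp \<mu> p" "Lp_norm \<mu> p (trig F v) \<le> (\<Sum>\<xi>\<in>F. norm (v \<xi>))" by (rule *)+
qed

theorem trig_poly_uniformly_dense:
  fixes h :: "'g \<Rightarrow> real"
  assumes h: "continuous_on UNIV h" and e: "e > 0"
  obtains q where "trig_poly q" "\<And>x. cmod (of_real (h x) - q x) < e"
proof -
  define R where "R = {f :: 'g \<Rightarrow> real. continuous_on UNIV f \<and> trig_poly (\<lambda>x. complex_of_real (f x))}"
  interpret function_ring_on R "UNIV :: 'g set"
  proof
    show "compact (UNIV :: 'g set)" by (rule compact_group)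
    show "f \<in> R \<Longrightarrow> continuous_on UNIV f" for f by (simp add: R_def)
    show "f \<in> R \<Longrightarrow> g \<in> R \<Longrightarrow> (\<lambda>x. f x + g x) \<in> R" for f g
      using trig_poly_add[of "\<lambda>x. complex_of_real (f x)" "\<lambda>x. complex_of_real (g x)"] by (auto simp: R_def intro!: continuous_intros)
    show "f \<in> R \<Longrightarrow> g \<in> R \<Longrightarrow> (\<lambda>x. f x * g x) \<in> R" for f g
      using trig_poly_mult[of "\<lambda>x. complex_of_real (f x)" "\<lambda>x. complex_of_real (g x)"] by (auto simp: R_def intro!: continuous_intros)
    show "(\<lambda>_. c) \<in> R" for c
      using trig_poly_monomial[OF characters_one, of "of_real c"] by (simp add: R_def)
    fix x y :: 'g assume "x \<noteq> y"
    then obtain \<xi> where \<xi>: "\<xi> \<in> characters" "\<xi> x \<noteq> \<xi> y" using characters_separate by blast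
    have tp: "trig_poly \<xi>" "trig_poly (\<lambda>z. cnj (\<xi> z))"
      using trig_poly_monomial[OF \<xi>(1), of 1] trig_poly_monomial[OF characters_cnj[OF \<xi>(1)], of 1] by auto
    have c: "trig_poly (\<lambda>x. c * f x)" if "trig_poly f" for c and f :: "'g \<Rightarrow> complex"
      using trig_poly_mult[OF trig_poly_monomial[OF characters_one, of c] that] by simp
    have re_eq: "(\<lambda>z. complex_of_real (Re (\<xi> z))) = (\<lambda>z. 1 / 2 * (\<xi> z + cnj (\<xi> z)))"
      by (simp add: complex_eq_iff fun_eq_iff)
    have "trig_poly (\<lambda>z. complex_of_real (Re (\<xi> z)))" unfolding re_eq by (rule c[OF trig_poly_add[OF tp]])
    then have re: "(\<lambda>z. Re (\<xi> z)) \<in> R"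
      using characterD(1)[OF \<xi>(1)] by (auto simp: R_def intro!: continuous_intros)
    have im_eq: "(\<lambda>z. complex_of_real (Im (\<xi> z))) = (\<lambda>z. - \<i> / 2 * (\<xi> z + (- 1) * cnj (\<xi> z)))"
      by (simp add: complex_eq_iff fun_eq_iff)
    have "trig_poly (\<lambda>z. complex_of_real (Im (\<xi> z)))" unfolding im_eq by (rule c[OF trig_poly_add[OF tp(1) c[OF tp(2)]]])
    then have im: "(\<lambda>z. Im (\<xi> z)) \<in> R"
      using characterD(1)[OF \<xi>(1)] by (auto simp: R_def intro!: continuous_intros)
    show "\<exists>f\<in>R. f x \<noteq> f y"
    proof (cases "Re (\<xi> x) = Re (\<xi> y)")
      case True
      then have "Im (\<xi> x) \<noteq> Im (\<xi> y)" using \<xi>(2) by (auto simp: complex_eq_iff)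
      then show ?thesis by (rule bexI[OF _ im])
    next
      case False
      then show ?thesis by (rule bexI[OF _ re])
    qed
  qed
  from Stone_Weierstrass_basic[OF h e] obtain g where g: "g \<in> R" "\<And>x. \<bar>h x - g x\<bar> < e" by auto
  show thesis
  proof (rule that[of "\<lambda>x. complex_of_real (g x)"])
    show "trig_poly (\<lambda>x. complex_of_real (g x))" using g by (simp add: R_def)
    show "cmod (of_real (h x) - of_real (g x)) < e" for x using g(2)[of x] by (simp flip: of_real_diff)
  qed
qed

lemma haar_regular:
  assumes A: "A \<in> sets borel" and d: "d > 0"
  obtains K U where "compact K" "open U" "K \<subseteq> A" "A \<subseteq> U" "measure \<mu> (U - K) < d"
proof -
  have reg: "emeasure \<mu> A = (SUP K\<in>{K. compact K \<and> K \<subseteq> A}. emeasure \<mu> K)" "emeasure \<mu> A = (INF U\<in>{U. open U \<and> A \<subseteq> U}. emeasure \<mu> U)"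
    using haar A unfolding normalized_haar_measure_def by blast+
  have em: "emeasure \<mu> B = ennreal (measure \<mu> B)" for B by (rule emeasure_eq_measure)
  have "\<exists>K. compact K \<and> K \<subseteq> A \<and> measure \<mu> A - d / 2 < measure \<mu> K"
  proof (cases "measure \<mu> A - d / 2 < 0")
    case True
    then show ?thesis by (intro exI[of _ "{}"]) auto
  next
    case False
    then have "ennreal (measure \<mu> A - d / 2) < emeasure \<mu> A" unfolding em using d by (intro ennreal_lessI) auto
    then obtain K where K: "compact K" "K \<subseteq> A" "ennreal (measure \<mu> A - d / 2) < emeasure \<mu> K"
      unfolding reg(1) less_SUP_iff by auto
    then have "measure \<mu> A - d / 2 < measure \<mu> K" unfolding em using False by (simp add: ennreal_less_iff)
    then show ?thesis using K by blast
  qed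
  then obtain K where K: "compact K" "K \<subseteq> A" "measure \<mu> A - d / 2 < measure \<mu> K" by blast
  have "emeasure \<mu> A < ennreal (measure \<mu> A + d / 2)" unfolding em using d by (intro ennreal_lessI) (auto simp: add_nonneg_pos)
  then obtain U where U: "open U" "A \<subseteq> U" "emeasure \<mu> U < ennreal (measure \<mu> A + d / 2)"
    using reg(2) by (auto simp: INF_less_iff)
  then have mU: "measure \<mu> U < measure \<mu> A + d / 2" unfolding em by (simp add: ennreal_less_iff)
  have "closed K" using K(1) by (rule compact_imp_closed)
  then have "measure \<mu> (U - K) = measure \<mu> U - measure \<mu> K"
    using K U by (intro finite_measure_Diff) auto
  then show thesis using that[of K U] K U mU by simp
qed

lemma indicator_trig_approx:
  assumes A: "A \<in> sets borel" and p: "p \<ge> 1" and e: "e > 0"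
  obtains q where "trig_poly q" "q \<in> Lp \<mu> p" "Lp_norm \<mu> p (\<lambda>x. indicator A x - q x) < e"
proof -
  have p0: "p > 0" using p by simp
  define d where "d = (e / 2) powr p"
  have d: "d > 0" using e by (simp add: d_def)
  obtain K U where KU: "compact K" "open U" "K \<subseteq> A" "A \<subseteq> U" "measure \<mu> (U - K) < d"
    using haar_regular[OF A d] by blast
  have cl: "closed K" "closed (- U)" using KU compact_imp_closed by auto
  obtain h :: "'g \<Rightarrow> real" where h: "continuous_on UNIV h" "\<And>x. 0 \<le> h x \<and> h x \<le> 1" "\<And>x. x \<in> - U \<Longrightarrow> h x = 0" "\<And>x. x \<in> K \<Longrightarrow> h x = 1"
    using urysohn_group[OF cl(2,1)] KU by blast
  have e4: "e / 4 > 0" using e by simp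
  obtain q where q: "trig_poly q" "\<And>x. cmod (of_real (h x) - q x) < e / 4"
    using trig_poly_uniformly_dense[OF h(1) e4] by blast
  obtain F c where F: "finite F" "F \<subseteq> characters" "q = trig F c" using q(1) by (auto simp: trig_poly_def)
  have qL: "q \<in> Lp \<mu> p" unfolding F(3) by (rule trig_Lp(1)[OF F(2) p])
  have [measurable]: "h \<in> borel_measurable \<mu>" using continuous_borel[OF h(1)] by simp
  have [measurable]: "A \<in> sets \<mu>" and UK [measurable]: "U - K \<in> sets \<mu>" using A KU cl by auto
  have hsm: "strongly_measurable \<mu> (\<lambda>x. complex_of_real (h x))" by (rule strongly_measurable_borel) simp
  have hL: "(\<lambda>x. complex_of_real (h x)) \<in> Lp \<mu> p"
    by (rule Lp_bounded(1)[OF prob_space_haar p hsm, of 1]) (use h(2) in auto)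
  have ism: "strongly_measurable \<mu> (indicator A :: 'g \<Rightarrow> complex)" by (rule strongly_measurable_borel) simp
  have iL: "(indicator A :: 'g \<Rightarrow> complex) \<in> Lp \<mu> p"
    by (rule Lp_bounded(1)[OF prob_space_haar p ism, of 1]) (auto simp: indicator_def)
  have ihL: "(\<lambda>x. indicator A x - complex_of_real (h x)) \<in> Lp \<mu> p" by (rule Lp_diff(1)[OF p iL hL])
  have hqL: "(\<lambda>x. complex_of_real (h x) - q x) \<in> Lp \<mu> p" by (rule Lp_diff(1)[OF p hL qL])
  have "Lp_norm \<mu> p (\<lambda>x. indicator A x - complex_of_real (h x)) \<le> e / 2"
  proof (rule Lp_norm_leI[OF p0])
    have "(\<integral>x. norm (indicator A x - complex_of_real (h x)) powr p \<partial>\<mu>) \<le> (\<integral>x. indicator (U - K) x \<partial>\<mu>)"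
    proof (rule integral_mono[OF LpD(2)[OF ihL]])
      show "integrable \<mu> (indicator (U - K) :: 'g \<Rightarrow> real)"
        by (rule integrable_real_indicator[OF UK]) (simp add: emeasure_eq_measure)
      fix x
      show "norm (indicator A x - complex_of_real (h x)) powr p \<le> indicator (U - K) x"
      proof (cases "x \<in> U - K")
        case True
        have "norm (indicator A x - complex_of_real (h x)) = \<bar>indicator A x - h x\<bar>"
          by (metis norm_of_real of_real_diff of_real_indicator)
        also have "\<dots> \<le> 1" using h(2)[of x] by (auto simp: indicator_def)
        finally show ?thesis using True p0 by (simp add: powr_le1)
      next
        case False
        then have "indicator A x = complex_of_real (h x)" using KU h(3,4) by (auto simp: indicator_def)
        then show ?thesis by simp
      qed
    qed
    also have "\<dots> = measure \<mu> (U - K)" by simp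
    finally show "(\<integral>x. norm (indicator A x - complex_of_real (h x)) powr p \<partial>\<mu>) \<le> (e / 2) powr p" using KU(5) by (simp add: d_def)
  qed (use e in simp)
  moreover have "Lp_norm \<mu> p (\<lambda>x. complex_of_real (h x) - q x) \<le> e / 4"
    by (rule Lp_bounded(2)[OF prob_space_haar p LpD(1)[OF hqL]]) (use q(2) e in \<open>auto intro: less_imp_le\<close>)
  moreover have "Lp_norm \<mu> p (\<lambda>x. indicator A x - q x) \<le> Lp_norm \<mu> p (\<lambda>x. indicator A x - complex_of_real (h x)) + Lp_norm \<mu> p (\<lambda>x. complex_of_real (h x) - q x)"
    using Lp_add(2)[OF p ihL hqL] by simp
  ultimately show thesis using that[OF q(1) qL] e by simp
qed

definition trig_approximable :: "real \<Rightarrow> ('g \<Rightarrow> 'x::complex_banach) \<Rightarrow> bool" where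
  "trig_approximable p f \<longleftrightarrow> f \<in> Lp \<mu> p \<and> (\<forall>e>0. \<exists>F v. finite F \<and> F \<subseteq> characters \<and> Lp_norm \<mu> p (\<lambda>x. f x - trig F v x) < e)"

lemma trig_approximable_add:
  assumes p: "p \<ge> 1" and f: "trig_approximable p f" and g: "trig_approximable p g"
  shows "trig_approximable p (\<lambda>x. f x + g x)"
  unfolding trig_approximable_def
proof (intro conjI allI impI)
  have fL: "f \<in> Lp \<mu> p" and gL: "g \<in> Lp \<mu> p" using f g by (auto simp: trig_approximable_def)
  then show "(\<lambda>x. f x + g x) \<in> Lp \<mu> p" by (rule Lp_add(1)[OF p])
  fix e :: real assume "e > 0"
  then have e: "e / 2 > 0" by simp
  obtain F v where F: "finite F" "F \<subseteq> characters" "Lp_norm \<mu> p (\<lambda>x. f x - trig F v x) < e / 2"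
    using f e unfolding trig_approximable_def by blast
  obtain G w where G: "finite G" "G \<subseteq> characters" "Lp_norm \<mu> p (\<lambda>x. g x - trig G w x) < e / 2"
    using g e unfolding trig_approximable_def by blast
  have "Lp_norm \<mu> p (\<lambda>x. (f x - trig F v x) + (g x - trig G w x)) \<le> Lp_norm \<mu> p (\<lambda>x. f x - trig F v x) + Lp_norm \<mu> p (\<lambda>x. g x - trig G w x)"
    by (intro Lp_add(2)[OF p] Lp_diff(1)[OF p] fL gL trig_Lp(1)[OF _ p] F G)
  also have "\<dots> < e" using F(3) G(3) by simp
  also have "(\<lambda>x. (f x - trig F v x) + (g x - trig G w x)) = (\<lambda>x. (f x + g x) - (trig F v x + trig G w x))" by (simp add: algebra_simps)
  finally show "\<exists>F v. finite F \<and> F \<subseteq> characters \<and> Lp_norm \<mu> p (\<lambda>x. f x + g x - trig F v x) < e"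
    unfolding trig_add[OF F(1) G(1)] using F G by (intro exI[of _ "F \<union> G"] exI conjI) auto
qed

lemma trig_approximable_zero: "p \<ge> 1 \<Longrightarrow> trig_approximable p (\<lambda>x. 0)"
  unfolding trig_approximable_def
  by (auto intro!: exI[of _ "{}"] simp: Lp_zero trig_def)

lemma trig_approximable_sum:
  "p \<ge> 1 \<Longrightarrow> (\<And>i. i \<in> I \<Longrightarrow> trig_approximable p (f i)) \<Longrightarrow> trig_approximable p (\<lambda>x. \<Sum>i\<in>I. f i x)"
  by (induction I rule: infinite_finite_induct) (auto intro: trig_approximable_zero trig_approximable_add)

lemma trig_approximable_indicator:
  fixes y :: "'x::complex_banach"
  assumes A: "A \<in> sets borel" and p: "p \<ge> 1"
  shows "trig_approximable p (\<lambda>x. indicator A x *\<^sub>C y)"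
  unfolding trig_approximable_def
proof (intro conjI allI impI)
  have p0: "p > 0" using p by simp
  have sm: "strongly_measurable \<mu> (\<lambda>x. indicator A x *\<^sub>C y)"
    by (intro strongly_measurable_scaleC_vector strongly_measurable_borel) (use A in simp)
  show L: "(\<lambda>x. indicator A x *\<^sub>C y) \<in> Lp \<mu> p"
    by (rule Lp_bounded(1)[OF prob_space_haar p sm, of "norm y"]) (auto simp: indicator_def scaleC_one)
  fix e :: real assume e: "e > 0"
  have n1: "norm y + 1 > 0" by (simp add: add_nonneg_pos)
  then have e': "e / (norm y + 1) > 0" using e by simp
  obtain q where q: "trig_poly q" "q \<in> Lp \<mu> p" "Lp_norm \<mu> p (\<lambda>x. indicator A x - q x) < e / (norm y + 1)"
    using indicator_trig_approx[OF A p e'] by blast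
  obtain F c where F: "finite F" "F \<subseteq> characters" "q = trig F c" using q(1) by (auto simp: trig_poly_def)
  have ism: "strongly_measurable \<mu> (indicator A :: 'g \<Rightarrow> complex)" by (rule strongly_measurable_borel) (use A in simp)
  have iL: "(indicator A :: 'g \<Rightarrow> complex) \<in> Lp \<mu> p"
    by (rule Lp_bounded(1)[OF prob_space_haar p ism, of 1]) (auto simp: indicator_def)
  note dL = Lp_diff(1)[OF p iL q(2)]
  note sc = Lp_scaleC[OF p0 dL, of "of_real (norm y)"]
  have "Lp_norm \<mu> p (\<lambda>x. indicator A x *\<^sub>C y - trig F (\<lambda>\<xi>. c \<xi> *\<^sub>C y) x) \<le> Lp_norm \<mu> p (\<lambda>x. complex_of_real (norm y) *\<^sub>C (indicator A x - q x))"
  proof (rule Lp_norm_mono(1)[OF p0 LpD(2)[OF sc(1)]])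
    show "strongly_measurable \<mu> (\<lambda>x. indicator A x *\<^sub>C y - trig F (\<lambda>\<xi>. c \<xi> *\<^sub>C y) x)"
      by (intro strongly_measurable_diff sm trig_strongly_measurable F)
    show "AE x in \<mu>. norm (indicator A x *\<^sub>C y - trig F (\<lambda>\<xi>. c \<xi> *\<^sub>C y) x) \<le> norm (complex_of_real (norm y) *\<^sub>C (indicator A x - q x))"
      unfolding F(3) trig_scalar_times_vector[symmetric] scaleC_diff_left[symmetric] norm_scaleC by (simp add: mult.commute)
  qed
  also have "\<dots> = norm y * Lp_norm \<mu> p (\<lambda>x. indicator A x - q x)" using sc(2) by simp
  also have "\<dots> \<le> norm y * (e / (norm y + 1))" using q(3) by (intro mult_left_mono) auto
  also have "\<dots> = e * (norm y / (norm y + 1))" by simp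
  also have "\<dots> < e * 1" using e n1 by (intro mult_strict_left_mono) (auto simp: divide_less_eq_1)
  finally show "\<exists>F v. finite F \<and> F \<subseteq> characters \<and> Lp_norm \<mu> p (\<lambda>x. indicator A x *\<^sub>C y - trig F v x) < e"
    using F by auto
qed

text \<open>
  Strongly measurable functions are limits of simple functions, indicators of Borel sets are
  approximated by continuous functions because the measure is regular, and these by trigonometric
  polynomials with the Stone--Weierstrass theorem.
\<close>

theorem trig_dense:
  fixes f :: "'g \<Rightarrow> 'x::complex_banach"
  assumes p: "p \<ge> 1" and f: "f \<in> Lp \<mu> p" and e: "e > 0"
  obtains F v where "finite F" "F \<subseteq> characters" "Lp_norm \<mu> p (\<lambda>x. f x - trig F v x) < e"
proof -
  have e2: "e / 2 > 0" using e by simp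
  obtain s where s: "simple_function \<mu> s" "s \<in> Lp \<mu> p" "Lp_norm \<mu> p (\<lambda>x. f x - s x) < e / 2"
    using Lp_approx_simple[OF prob_space_haar p f e2] by blast
  have fin: "finite (range s)" using simple_functionD(1)[OF s(1)] by simp
  have eq: "(\<lambda>x. \<Sum>y\<in>range s. indicator (s -` {y}) x *\<^sub>C y) = s"
  proof
    fix x
    have "(\<Sum>y\<in>range s. indicator (s -` {y}) x *\<^sub>C y) = (\<Sum>y\<in>range s. if y = s x then s x else 0)"
      by (rule sum.cong) (auto simp: indicator_def scaleC_one)
    also have "\<dots> = s x" using fin by simp
    finally show "(\<Sum>y\<in>range s. indicator (s -` {y}) x *\<^sub>C y) = s x" .
  qed
  have "trig_approximable p (\<lambda>x. \<Sum>y\<in>range s. indicator (s -` {y}) x *\<^sub>C y)"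
  proof (intro trig_approximable_sum[OF p] trig_approximable_indicator[OF _ p])
    fix y show "s -` {y} \<in> sets borel" using simple_functionD(2)[OF s(1), of "{y}"] by simp
  qed
  then have "trig_approximable p s" unfolding eq .
  then have "\<exists>F v. finite F \<and> F \<subseteq> characters \<and> Lp_norm \<mu> p (\<lambda>x. s x - trig F v x) < e / 2"
    using e2 unfolding trig_approximable_def by (elim conjE allE impE)
  then obtain F v where F: "finite F" "F \<subseteq> characters" "Lp_norm \<mu> p (\<lambda>x. s x - trig F v x) < e / 2"
    by (elim exE conjE)
  have "Lp_norm \<mu> p (\<lambda>x. (f x - s x) + (s x - trig F v x)) \<le> Lp_norm \<mu> p (\<lambda>x. f x - s x) + Lp_norm \<mu> p (\<lambda>x. s x - trig F v x)"
    by (intro Lp_add(2)[OF p] Lp_diff(1)[OF p] f s trig_Lp(1)[OF _ p] F)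
  then have "Lp_norm \<mu> p (\<lambda>x. f x - trig F v x) < e" using s(3) F(3) by simp
  then show thesis using that F by blast
qed

end


section \<open>Symbols dominated by the supremum norm\<close>

text \<open>
  The property of the symbol that the contractivity of a multiplier for the supremum norm leaves when
  one evaluates at the neutral element.
\<close>

definition sup_dominated :: "(('g::{topological_ab_group_add, t2_space} \<Rightarrow> complex) \<Rightarrow> complex) \<Rightarrow> bool" where
  "sup_dominated \<phi> \<longleftrightarrow> (\<forall>F a s. finite F \<longrightarrow> F \<subseteq> characters \<longrightarrow>
     (\<forall>y. cmod (\<Sum>\<xi>\<in>F. a \<xi> * \<xi> y) \<le> s) \<longrightarrow> cmod (\<Sum>\<xi>\<in>F. a \<xi> * \<phi> \<xi>) \<le> s)"

text \<open>The transform of the measure with mass \<open>c i\<close> at \<open>y i\<close>.\<close>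

definition discrete_transform :: "nat \<Rightarrow> (nat \<Rightarrow> complex) \<Rightarrow> (nat \<Rightarrow> 'g) \<Rightarrow> ('g \<Rightarrow> complex) \<Rightarrow> complex" where
  "discrete_transform m c y \<xi> = (\<Sum>i<m. c i * \<xi> (y i))"

lemma cmod_diff_squared: "(cmod (a - z))\<^sup>2 = (cmod a)\<^sup>2 - 2 * Re (cnj a * z) + (cmod z)\<^sup>2"
  by (simp only: cmod_power2) (simp add: power2_eq_square algebra_simps)

text \<open>
  A separation argument. On the finite set \<open>F\<close> the transforms of discrete measures of mass one form a
  convex set; let \<open>w\<close> be an almost nearest point of it to \<open>\<phi>\<close> and \<open>a = \<phi> - w\<close>. Moving from \<open>w\<close> a
  little towards a unimodular multiple of the transform of a point mass cannot come much closer, which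
  bounds the trigonometric polynomial with coefficients \<open>cnj a\<close> by its pairing with \<open>w\<close> up to \<open>\<kappa>\<close>.
  Domination carries this over to the pairing with \<open>\<phi>\<close>, and the difference of the two pairings is the
  squared distance.
\<close>

lemma sup_dominated_approx_step:
  fixes \<phi> :: "('g::{topological_ab_group_add, t2_space} \<Rightarrow> complex) \<Rightarrow> complex"
  assumes \<phi>: "sup_dominated \<phi>" and F: "finite F" "F \<subseteq> characters" and e: "e > 0"
  shows "\<exists>m c y. (\<Sum>i<m. cmod (c i)) = 1 \<and> (\<Sum>\<xi>\<in>F. (cmod (\<phi> \<xi> - discrete_transform m c y \<xi>))\<^sup>2) < e"
proof (rule ccontr)
  assume not: "\<not> ?thesis"
  have far: "(\<Sum>\<xi>\<in>F. (cmod (\<phi> \<xi> - discrete_transform m c y \<xi>))\<^sup>2) \<ge> e" if "(\<Sum>i<m. cmod (c i)) = 1" for m c y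
  proof (rule ccontr)
    assume "\<not> ?thesis"
    then have "(\<Sum>i<m. cmod (c i)) = 1 \<and> (\<Sum>\<xi>\<in>F. (cmod (\<phi> \<xi> - discrete_transform m c y \<xi>))\<^sup>2) < e"
      by (intro conjI that) (simp only: not_le)
    note * = this
    show False by (rule notE[OF not], rule exI[of _ m], rule exI[of _ c], rule exI[of _ y], rule *)
  qed
  define Q where "Q = {(\<Sum>\<xi>\<in>F. (cmod (\<phi> \<xi> - discrete_transform m c y \<xi>))\<^sup>2) | m c y. (\<Sum>i<m. cmod (c i)) = 1}"
  have ne: "Q \<noteq> {}"
  proof -
    have "(\<Sum>i<1::nat. cmod ((\<lambda>_. 1) i)) = 1" by simp
    then have "(\<Sum>\<xi>\<in>F. (cmod (\<phi> \<xi> - discrete_transform 1 (\<lambda>_. 1) (\<lambda>_. 0) \<xi>))\<^sup>2) \<in> Q" unfolding Q_def by blast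
    then show ?thesis by blast
  qed
  have bdd: "bdd_below Q" unfolding Q_def by (rule bdd_belowI[of _ e]) (use far in auto)
  define d where "d = Inf Q"
  have d_le: "d \<le> (\<Sum>\<xi>\<in>F. (cmod (\<phi> \<xi> - discrete_transform m c y \<xi>))\<^sup>2)" if "(\<Sum>i<m. cmod (c i)) = 1" for m c y
    unfolding d_def by (rule cInf_lower[OF _ bdd]) (use that in \<open>auto simp: Q_def\<close>)
  define N where "N = real (card F)"
  define t where "t = min 1 (e / (4 * N + 4))"
  have N0: "N \<ge> 0" by (simp add: N_def)
  have t: "0 < t" "t \<le> 1" "4 * N * t \<le> e"
  proof -
    show "0 < t" "t \<le> 1" using e N0 by (auto simp: t_def)
    have "4 * N * t \<le> 4 * N * (e / (4 * N + 4))" using N0 by (intro mult_left_mono) (auto simp: t_def)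
    also have "\<dots> = e * (4 * N / (4 * N + 4))" by simp
    also have "\<dots> \<le> e * 1" using e N0 by (intro mult_left_mono) (auto simp: divide_le_eq_1)
    finally show "4 * N * t \<le> e" by simp
  qed
  define \<eta> where "\<eta> = t * e / 2"
  have "\<exists>q\<in>Q. q < d + \<eta>" using cInf_lessD[OF ne, of "d + \<eta>"] t e by (simp add: d_def \<eta>_def)
  then obtain m c y where c1: "(\<Sum>i<m. cmod (c i)) = 1" and lt: "(\<Sum>\<xi>\<in>F. (cmod (\<phi> \<xi> - discrete_transform m c y \<xi>))\<^sup>2) < d + \<eta>"
    unfolding Q_def by blast
  define w where "w \<xi> = discrete_transform m c y \<xi>" for \<xi>
  define a where "a \<xi> = \<phi> \<xi> - w \<xi>" for \<xi>
  have w_le: "cmod (w \<xi>) \<le> 1" if "\<xi> \<in> F" for \<xi>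
  proof -
    have "cmod (w \<xi>) \<le> (\<Sum>i<m. cmod (c i * \<xi> (y i)))" unfolding w_def discrete_transform_def by (rule norm_sum)
    also have "\<dots> = 1" using characterD(3)[of \<xi>] that F c1 by (auto simp: norm_mult)
    finally show ?thesis .
  qed
  \<comment> \<open>The error of a step of length \<open>t\<close>: \<open>\<eta> / t\<close> because \<open>w\<close> is only almost nearest, and \<open>4 N t\<close> from the quadratic
    term. The choice of \<open>\<eta>\<close> and \<open>t\<close> makes it smaller than the squared distance.\<close>
  define \<kappa> where "\<kappa> = (\<eta> / t + 4 * N * t) / 2"
  have \<kappa>: "\<kappa> < e"
  proof -
    have "\<eta> / t = e / 2" using t by (simp add: \<eta>_def)
    then show ?thesis using t e by (simp add: \<kappa>_def)
  qed
  define B where "B = Re (\<Sum>\<xi>\<in>F. cnj (a \<xi>) * w \<xi>)"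
  have dom: "Re (\<omega> * (\<Sum>\<xi>\<in>F. cnj (a \<xi>) * \<xi> x)) \<le> B + \<kappa>" if \<omega>: "cmod \<omega> = 1" for \<omega> x
  proof -
    define c' where "c' i = (if i < m then of_real (1 - t) * c i else of_real t * \<omega>)" for i
    define y' where "y' i = (if i < m then y i else x)" for i
    have "(\<Sum>i<Suc m. cmod (c' i)) = (\<Sum>i<m. (1 - t) * cmod (c i)) + t"
    proof -
      have "cmod (of_real (1 - t)) = 1 - t" "cmod (of_real t) = t" using t by (simp_all only: norm_of_real)
      then show ?thesis using \<omega> by (simp add: c'_def norm_mult del: of_real_diff)
    qed
    also have "\<dots> = 1" using c1 by (simp flip: sum_distrib_left)
    finally have c'1: "(\<Sum>i<Suc m. cmod (c' i)) = 1" .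
    have tr: "discrete_transform (Suc m) c' y' \<xi> = w \<xi> + of_real t * (\<omega> * \<xi> x - w \<xi>)" for \<xi>
    proof -
      have "(\<Sum>i<m. c' i * \<xi> (y' i)) = of_real (1 - t) * w \<xi>"
        unfolding w_def discrete_transform_def sum_distrib_left by (rule sum.cong) (auto simp: c'_def y'_def)
      then show ?thesis by (simp add: discrete_transform_def c'_def y'_def algebra_simps)
    qed
    have pt: "(cmod (\<phi> \<xi> - discrete_transform (Suc m) c' y' \<xi>))\<^sup>2 \<le> (cmod (a \<xi>))\<^sup>2 - 2 * t * Re (cnj (a \<xi>) * (\<omega> * \<xi> x - w \<xi>)) + t\<^sup>2 * 4"
      if "\<xi> \<in> F" for \<xi>
    proof -
      have "cmod (\<omega> * \<xi> x - w \<xi>) \<le> cmod (\<omega> * \<xi> x) + cmod (w \<xi>)" by (rule norm_triangle_ineq4)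
      also have "\<dots> \<le> 2" using w_le[OF that] \<omega> characterD(3)[of \<xi> x] that F by (auto simp: norm_mult)
      finally have "(cmod (\<omega> * \<xi> x - w \<xi>))\<^sup>2 \<le> 2\<^sup>2" by (intro power_mono) auto
      then have le4: "t\<^sup>2 * (cmod (\<omega> * \<xi> x - w \<xi>))\<^sup>2 \<le> t\<^sup>2 * 4" by (intro mult_left_mono) auto
      have "\<phi> \<xi> - discrete_transform (Suc m) c' y' \<xi> = a \<xi> - of_real t * (\<omega> * \<xi> x - w \<xi>)"
        unfolding tr a_def by simp
      moreover have "Re (cnj (a \<xi>) * (of_real t * (\<omega> * \<xi> x - w \<xi>))) = t * Re (cnj (a \<xi>) * (\<omega> * \<xi> x - w \<xi>))"
        by (simp only: mult.left_commute[of "cnj (a \<xi>)" "of_real t"]) (subst times_complex.simps(1), simp only: Re_complex_of_real Im_complex_of_real mult_zero_left diff_zero)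
      ultimately show ?thesis using le4 by (simp only: cmod_diff_squared norm_mult power_mult_distrib norm_of_real power2_abs)
    qed
    have "d \<le> (\<Sum>\<xi>\<in>F. (cmod (a \<xi>))\<^sup>2 - 2 * t * Re (cnj (a \<xi>) * (\<omega> * \<xi> x - w \<xi>)) + t\<^sup>2 * 4)"
      using d_le[OF c'1] sum_mono[OF pt] by (rule order_trans)
    also have "\<dots> = (\<Sum>\<xi>\<in>F. (cmod (a \<xi>))\<^sup>2) - 2 * t * (\<Sum>\<xi>\<in>F. Re (cnj (a \<xi>) * (\<omega> * \<xi> x - w \<xi>))) + t\<^sup>2 * 4 * N"
      by (simp only: sum.distrib sum_subtractf sum_distrib_left[symmetric] sum_constant N_def mult.commute)
    also have "(\<Sum>\<xi>\<in>F. (cmod (a \<xi>))\<^sup>2) < d + \<eta>" using lt by (simp add: a_def w_def)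
    finally have "2 * t * (\<Sum>\<xi>\<in>F. Re (cnj (a \<xi>) * (\<omega> * \<xi> x - w \<xi>))) < \<eta> + t\<^sup>2 * 4 * N" by simp
    also have "\<eta> + t\<^sup>2 * 4 * N = 2 * t * \<kappa>" using t by (simp add: \<kappa>_def power2_eq_square algebra_simps)
    finally have "(\<Sum>\<xi>\<in>F. Re (cnj (a \<xi>) * (\<omega> * \<xi> x - w \<xi>))) < \<kappa>" using t by simp
    moreover have "(\<Sum>\<xi>\<in>F. Re (cnj (a \<xi>) * (\<omega> * \<xi> x - w \<xi>))) = Re (\<omega> * (\<Sum>\<xi>\<in>F. cnj (a \<xi>) * \<xi> x)) - B"
      unfolding B_def Re_sum[symmetric] minus_complex.simps(1)[symmetric]
      by (rule arg_cong[of _ _ Re]) (simp add: sum_distrib_left sum_subtractf right_diff_distrib mult_ac)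
    ultimately show ?thesis by linarith
  qed
  have sup: "cmod (\<Sum>\<xi>\<in>F. cnj (a \<xi>) * \<xi> x) \<le> B + \<kappa>" for x
  proof -
    define S where "S = (\<Sum>\<xi>\<in>F. cnj (a \<xi>) * \<xi> x)"
    show ?thesis
    proof (cases "S = 0")
      case True
      then show ?thesis using dom[of 1 x] by (simp add: S_def)
    next
      case False
      define \<omega> where "\<omega> = cnj S / of_real (cmod S)"
      have "cmod \<omega> = 1" using False by (simp add: \<omega>_def norm_divide)
      moreover have "\<omega> * S = of_real (cmod S)"
        using False complex_norm_square[of S] by (simp add: \<omega>_def mult.commute power2_eq_square nonzero_divide_eq_eq)
      ultimately show ?thesis using dom[of \<omega> x] by (simp add: S_def[symmetric])
    qed
  qed
  have "cmod (\<Sum>\<xi>\<in>F. cnj (a \<xi>) * \<phi> \<xi>) \<le> B + \<kappa>"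
    by (rule \<phi>[unfolded sup_dominated_def, rule_format, OF F sup])
  then have "Re (\<Sum>\<xi>\<in>F. cnj (a \<xi>) * \<phi> \<xi>) \<le> B + \<kappa>" by (rule order_trans[OF complex_Re_le_cmod])
  moreover have "Re (\<Sum>\<xi>\<in>F. cnj (a \<xi>) * \<phi> \<xi>) - B = (\<Sum>\<xi>\<in>F. (cmod (a \<xi>))\<^sup>2)"
  proof -
    have "Re (cnj (a \<xi>) * \<phi> \<xi>) - Re (cnj (a \<xi>) * w \<xi>) = (cmod (a \<xi>))\<^sup>2" for \<xi>
      by (simp only: a_def cmod_power2) (simp add: power2_eq_square algebra_simps)
    then show ?thesis unfolding B_def Re_sum sum_subtractf[symmetric] by simp
  qed
  ultimately have "(\<Sum>\<xi>\<in>F. (cmod (a \<xi>))\<^sup>2) \<le> \<kappa>" by linarith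
  moreover have "(\<Sum>\<xi>\<in>F. (cmod (a \<xi>))\<^sup>2) \<ge> e" using far[OF c1] by (simp add: a_def w_def)
  ultimately show False using \<kappa> by linarith
qed

lemma sup_dominated_approx:
  fixes \<phi> :: "('g::{topological_ab_group_add, t2_space} \<Rightarrow> complex) \<Rightarrow> complex"
  assumes \<phi>: "sup_dominated \<phi>" and F: "finite F" "F \<subseteq> characters"
  obtains m c y where "\<And>k. (\<Sum>i<m k. cmod (c k i)) = 1"
    "\<And>\<xi>. \<xi> \<in> F \<Longrightarrow> (\<lambda>k. discrete_transform (m k) (c k) (y k) \<xi>) \<longlonglongrightarrow> \<phi> \<xi>"
proof -
  have "\<forall>k. \<exists>m c y. (\<Sum>i<m. cmod (c i)) = 1 \<and> (\<Sum>\<xi>\<in>F. (cmod (\<phi> \<xi> - discrete_transform m c y \<xi>))\<^sup>2) < (1 / real (Suc k))\<^sup>2"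
    by (intro allI sup_dominated_approx_step[OF \<phi> F]) simp
  then obtain m where m: "\<forall>k. \<exists>c y. (\<Sum>i<m k. cmod (c i)) = 1 \<and> (\<Sum>\<xi>\<in>F. (cmod (\<phi> \<xi> - discrete_transform (m k) c y \<xi>))\<^sup>2) < (1 / real (Suc k))\<^sup>2"
    by (rule exE[OF choice])
  obtain c where c: "\<forall>k. \<exists>y. (\<Sum>i<m k. cmod (c k i)) = 1 \<and> (\<Sum>\<xi>\<in>F. (cmod (\<phi> \<xi> - discrete_transform (m k) (c k) y \<xi>))\<^sup>2) < (1 / real (Suc k))\<^sup>2"
    by (rule exE[OF choice[OF m]])
  obtain y where y: "\<forall>k. (\<Sum>i<m k. cmod (c k i)) = 1 \<and> (\<Sum>\<xi>\<in>F. (cmod (\<phi> \<xi> - discrete_transform (m k) (c k) (y k) \<xi>))\<^sup>2) < (1 / real (Suc k))\<^sup>2"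
    by (rule exE[OF choice[OF c]])
  note k = conjunct1[OF spec[OF y]] conjunct2[OF spec[OF y]]
  show thesis
  proof (rule that[OF k(1)])
    fix \<xi> assume g: "\<xi> \<in> F"
    have "cmod (discrete_transform (m k) (c k) (y k) \<xi> - \<phi> \<xi>) \<le> 1 / real (Suc k)" for k
    proof (rule power2_le_imp_le)
      have "(cmod (\<phi> \<xi> - discrete_transform (m k) (c k) (y k) \<xi>))\<^sup>2 \<le> (\<Sum>\<xi>\<in>F. (cmod (\<phi> \<xi> - discrete_transform (m k) (c k) (y k) \<xi>))\<^sup>2)"
        by (rule member_le_sum) (use F g in auto)
      then show "(cmod (discrete_transform (m k) (c k) (y k) \<xi> - \<phi> \<xi>))\<^sup>2 \<le> (1 / real (Suc k))\<^sup>2"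
        using k(2)[of k] by (subst norm_minus_commute) (rule order_trans[OF _ less_imp_le])
    qed simp
    note le = this
    have "(\<lambda>k. 1 / real (Suc k)) \<longlonglongrightarrow> 0" using LIMSEQ_inverse_real_of_nat by (simp add: inverse_eq_divide)
    from Lim_null_comparison[OF always_eventually[OF allI[OF le]] this]
    show "(\<lambda>k. discrete_transform (m k) (c k) (y k) \<xi>) \<longlonglongrightarrow> \<phi> \<xi>" by (rule LIM_zero_cancel)
  qed
qed

context compact_haar_group
begin

abbreviation trig_norm :: "real \<Rightarrow> ('g \<Rightarrow> complex) set \<Rightarrow> (('g \<Rightarrow> complex) \<Rightarrow> 'x::complex_banach) \<Rightarrow> real" where
  "trig_norm p F v \<equiv> Lp_norm \<mu> p (trig F v)"

lemma trig_multiplier_seminorm: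
  assumes p: "p \<ge> 1"
  shows "multiplier_seminorm characters (trig_norm p :: _ \<Rightarrow> (('g \<Rightarrow> complex) \<Rightarrow> 'x::complex_banach) \<Rightarrow> real)"
proof
  fix F :: "('g \<Rightarrow> complex) set" and v w :: "('g \<Rightarrow> complex) \<Rightarrow> 'x" and c :: complex
  show "0 \<le> trig_norm p F v" by (rule Lp_norm_nonneg)
  assume F: "finite F" "F \<subseteq> characters"
  have "trig F (\<lambda>\<xi>. v \<xi> + w \<xi>) = (\<lambda>x. trig F v x + trig F w x)"
    by (auto simp: trig_def scaleC_add_right sum.distrib fun_eq_iff)
  then show "trig_norm p F (\<lambda>\<xi>. v \<xi> + w \<xi>) \<le> trig_norm p F v + trig_norm p F w"
    using Lp_add(2)[OF p trig_Lp(1)[OF F(2) p, of v] trig_Lp(1)[OF F(2) p, of w]] by simp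
  have "trig F (\<lambda>\<xi>. c *\<^sub>C v \<xi>) = (\<lambda>x. c *\<^sub>C trig F v x)" by (simp add: trig_scaleC)
  then show "trig_norm p F (\<lambda>\<xi>. c *\<^sub>C v \<xi>) = cmod c * trig_norm p F v"
    using Lp_scaleC(2)[OF _ trig_Lp(1)[OF F(2) p, of v], of c] p by simp
  show "trig_norm p F v \<le> (\<Sum>\<xi>\<in>F. norm (v \<xi>))" by (rule trig_Lp(2)[OF F(2) p])
qed

lemma trig_norm_translation:
  assumes F: "F \<subseteq> characters"
  shows "trig_norm p F (\<lambda>\<xi>. \<xi> y *\<^sub>C v \<xi>) = trig_norm p F v"
proof -
  have "trig F (\<lambda>\<xi>. \<xi> y *\<^sub>C v \<xi>) x = trig F v (y + x)" for x
    unfolding trig_def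
  proof (rule sum.cong[OF refl])
    fix \<xi> assume "\<xi> \<in> F"
    then have "\<xi> \<in> characters" using F by blast
    from characterD(2)[OF this, of y x] show "\<xi> x *\<^sub>C \<xi> y *\<^sub>C v \<xi> = \<xi> (y + x) *\<^sub>C v \<xi>"
      by (simp add: scaleC_scaleC mult.commute)
  qed
  moreover have "(\<lambda>x. norm (trig F v x) powr p) \<in> borel_measurable borel"
    using borel_measurable_norm_strongly[OF trig_strongly_measurable[OF F, of v]] by measurable
  from integral_translation[OF this, of y]
  have "(\<integral>x. norm (trig F v (y + x)) powr p \<partial>\<mu>) = (\<integral>x. norm (trig F v x) powr p \<partial>\<mu>)" .
  ultimately show ?thesis unfolding Lp_norm_def by simp
qed

end

text \<open>The argument \<open>X\<close> fixes the type of the values of the functions.\<close>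

locale Lp_fourier = compact_haar_group \<mu> for \<mu> :: "'g::{topological_ab_group_add, t2_space} measure" +
  fixes p :: real and X :: "'x::complex_banach itself"
  assumes p: "p \<ge> 1"
begin

sublocale multiplier_seminorm characters "trig_norm p :: _ \<Rightarrow> (('g \<Rightarrow> complex) \<Rightarrow> 'x) \<Rightarrow> real"
  by (rule trig_multiplier_seminorm[OF p])

abbreviation N :: "('g \<Rightarrow> 'x) \<Rightarrow> real" where "N \<equiv> Lp_norm \<mu> p"
abbreviation L :: "('g \<Rightarrow> 'x) set" where "L \<equiv> Lp \<mu> p"

lemma p0: "p > 0" using p by simp

lemma character_multiplier_isometry:
  shows "mb (\<lambda>\<xi>. \<xi> y) 1"
    and "mb (\<lambda>\<xi>. cnj (\<xi> y)) 1"
proof -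
  show *: "mb (\<lambda>\<xi>. \<xi> y) 1" for y by (rule mbI) (simp add: trig_norm_translation)
  show "mb (\<lambda>\<xi>. cnj (\<xi> y)) 1"
    by (rule mb_cong[OF *[of "- y"]]) (rule character_minus)
qed

text \<open>
  On the finitely many frequencies of a polynomial the symbol is a limit of averages of unimodular
  multiples of translations.
\<close>

lemma sup_dominated_multiplier:
  assumes \<phi>: "sup_dominated \<phi>"
  shows "mb \<phi> 1"
proof (rule mbI)
  fix F :: "('g \<Rightarrow> complex) set" and v :: "('g \<Rightarrow> complex) \<Rightarrow> 'x" assume F: "finite F" "F \<subseteq> characters"
  obtain m c y where k: "\<And>k. (\<Sum>i<m k. cmod (c k i)) = 1"
    "\<And>\<xi>. \<xi> \<in> F \<Longrightarrow> (\<lambda>k. discrete_transform (m k) (c k) (y k) \<xi>) \<longlonglongrightarrow> \<phi> \<xi>"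
    by (rule sup_dominated_approx[OF \<phi> F], rule that)
  have "mb (\<lambda>\<xi>. \<Sum>i\<in>{..<m k}. c k i * \<xi> (y k i)) 1" for k
    by (rule isometry_combination[where u = "\<lambda>i \<xi>. \<xi> (y k i)"]) (rule finite_lessThan character_multiplier_isometry(1) eq_refl[OF k(1)] k(1))+
  then have le: "trig_norm p F (\<lambda>\<xi>. discrete_transform (m k) (c k) (y k) \<xi> *\<^sub>C v \<xi>) \<le> 1 * trig_norm p F v" for k
    unfolding discrete_transform_def by (rule mbD[OF _ F])
  have "(\<lambda>k. trig_norm p F (\<lambda>\<xi>. discrete_transform (m k) (c k) (y k) \<xi> *\<^sub>C v \<xi>)) \<longlonglongrightarrow> trig_norm p F (\<lambda>\<xi>. \<phi> \<xi> *\<^sub>C v \<xi>)"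
    by (rule nu_tendsto[OF F], rule bounded_bilinear.tendsto[OF bounded_bilinear_scaleC]) (use k(2) in auto)
  then show "trig_norm p F (\<lambda>\<xi>. \<phi> \<xi> *\<^sub>C v \<xi>) \<le> 1 * trig_norm p F v"
    by (rule LIMSEQ_le_const2) (use le in auto)
qed

text \<open>
  A real symbol satisfies \<open>\<phi>\<^sup>2 = \<phi> \<phi>\<^sup>*\<close>, which is the form that the dilation argument asks for.
\<close>

lemma sup_dominated_difference_multiplier:
  assumes \<phi>: "sup_dominated \<phi>" and real: "\<And>\<xi>. \<xi> \<in> characters \<Longrightarrow> cnj (\<phi> \<xi>) = \<phi> \<xi>"
    and gap: "sign_gap n \<epsilon>"
    and n: "n > 0" and \<epsilon>: "\<epsilon> \<ge> 0"
  shows "mb (\<lambda>\<xi>. (1 - (\<phi> \<xi>)\<^sup>2) ^ n) (2 ^ n - \<epsilon> / 2 ^ n / real n)"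
proof (rule mbI)
  fix F :: "('g \<Rightarrow> complex) set" and v :: "('g \<Rightarrow> complex) \<Rightarrow> 'x" assume F: "finite F" "F \<subseteq> characters"
  obtain m c y where k: "\<And>k. (\<Sum>i<m k. cmod (c k i)) = 1"
    "\<And>\<xi>. \<xi> \<in> F \<Longrightarrow> (\<lambda>k. discrete_transform (m k) (c k) (y k) \<xi>) \<longlonglongrightarrow> \<phi> \<xi>"
    by (rule sup_dominated_approx[OF \<phi> F], rule that)
  let ?w = "\<lambda>k \<xi>. discrete_transform (m k) (c k) (y k) \<xi>"
  let ?C = "2 ^ n - \<epsilon> / 2 ^ n / real n"
  have "mb (\<lambda>\<xi>. (1 - (\<Sum>i\<in>{..<m k}. c k i * \<xi> (y k i)) * cnj (\<Sum>i\<in>{..<m k}. c k i * \<xi> (y k i))) ^ n) ?C" for k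
    by (rule power_of_difference_bound[where u = "\<lambda>i \<xi>. \<xi> (y k i)", OF gap n \<epsilon>])
       (rule finite_lessThan character_multiplier_isometry eq_refl[OF k(1)] k(1) characterD(3) | assumption)+
  then have le: "trig_norm p F (\<lambda>\<xi>. (1 - ?w k \<xi> * cnj (?w k \<xi>)) ^ n *\<^sub>C v \<xi>) \<le> ?C * trig_norm p F v" for k
    unfolding discrete_transform_def by (rule mbD[OF _ F])
  have "(\<lambda>k. trig_norm p F (\<lambda>\<xi>. (1 - ?w k \<xi> * cnj (?w k \<xi>)) ^ n *\<^sub>C v \<xi>)) \<longlonglongrightarrow> trig_norm p F (\<lambda>\<xi>. (1 - \<phi> \<xi> * cnj (\<phi> \<xi>)) ^ n *\<^sub>C v \<xi>)"
    by (rule nu_tendsto[OF F], rule bounded_bilinear.tendsto[OF bounded_bilinear_scaleC])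
       (use k(2) in \<open>auto intro!: tendsto_intros\<close>)
  also have "trig_norm p F (\<lambda>\<xi>. (1 - \<phi> \<xi> * cnj (\<phi> \<xi>)) ^ n *\<^sub>C v \<xi>) = trig_norm p F (\<lambda>\<xi>. (1 - (\<phi> \<xi>)\<^sup>2) ^ n *\<^sub>C v \<xi>)"
    by (rule nu_cong[OF F]) (use F real in \<open>auto simp: power2_eq_square\<close>)
  finally show "trig_norm p F (\<lambda>\<xi>. (1 - (\<phi> \<xi>)\<^sup>2) ^ n *\<^sub>C v \<xi>) \<le> ?C * trig_norm p F v"
    by (rule LIMSEQ_le_const2) (use le in auto)
qed

text \<open>The sign bound of \<open>X\<close>, integrated over \<open>G\<close>.\<close>

lemma K_convex_sign_gap:
  assumes r: "rademacher_sequence \<Omega> \<epsilon>" and K: "K_convex \<Omega> \<epsilon> (UNIV :: 'x::complex_banach set) norm" and p1: "p > 1"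
  obtains n :: nat and \<delta> :: real where "n > 0" "\<delta> > 0" "\<delta> / 2 ^ n / real n \<le> 2 ^ n"
    "sign_gap n \<delta>"
proof -
  obtain n e where ne: "n > 0" "e > 0" "\<And>x :: nat \<Rightarrow> 'x. (\<And>k. k < n \<Longrightarrow> norm (x k) \<le> 1) \<Longrightarrow> \<exists>\<eta>\<in>sign_choices n. norm (\<Sum>k<n. \<eta> k *\<^sub>R x k) < real n - e"
    using K_convex_sign_bound[OF r K] by blast
  obtain d where d: "d > 0" "\<And>x :: nat \<Rightarrow> 'x. (\<Sum>\<eta>\<in>sign_choices n. norm (\<Sum>k<n. \<eta> k *\<^sub>R x k) powr p) \<le> (1 - d) * (2 ^ n * real n powr (p - 1) * (\<Sum>k<n. norm (x k) powr p))"
    using sign_average_powr_bound[OF ne(1,2) p1 ne(3)] by blast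
  define d' where "d' = min d 1"
  have d': "0 < d'" "d' \<le> 1" using d by (auto simp: d'_def)
  have bd: "(\<Sum>\<eta>\<in>sign_choices n. norm (\<Sum>k<n. \<eta> k *\<^sub>R x k) powr p) \<le> (1 - d') * (2 ^ n * real n powr (p - 1) * (\<Sum>k<n. norm (x k) powr p))" for x :: "nat \<Rightarrow> 'x"
  proof (rule order_trans[OF d(2)])
    show "(1 - d) * (2 ^ n * real n powr (p - 1) * (\<Sum>k<n. norm (x k) powr p)) \<le> (1 - d') * (2 ^ n * real n powr (p - 1) * (\<Sum>k<n. norm (x k) powr p))"
      by (intro mult_right_mono mult_nonneg_nonneg sum_nonneg) (auto simp: d'_def)
  qed
  define \<delta> where "\<delta> = d' * (2 ^ n * real n / p)"
  show thesis
  proof (rule that[OF ne(1), of \<delta>])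
    show "\<delta> > 0" using d' ne(1) p1 by (simp add: \<delta>_def)
    have "\<delta> / 2 ^ n / real n = d' / p" using ne(1) by (simp add: \<delta>_def)
    also have "\<dots> \<le> 1" using d' p1 by (simp add: divide_le_eq_1)
    also have "1 \<le> (2::real) ^ n" by simp
    finally show "\<delta> / 2 ^ n / real n \<le> 2 ^ n" .
    show "sign_gap n \<delta>" unfolding sign_gap_def
    proof (intro allI impI)
      fix F :: "('g \<Rightarrow> complex) set" and v :: "nat \<Rightarrow> ('g \<Rightarrow> complex) \<Rightarrow> 'x"
      assume F: "finite F" "F \<subseteq> characters" and v: "\<forall>k<n. trig_norm p F (v k) \<le> 1"
      have eq: "trig F (\<lambda>\<xi>. \<Sum>k<n. \<eta> k *\<^sub>R v k \<xi>) = (\<lambda>x. \<Sum>k<n. \<eta> k *\<^sub>R trig F (v k) x)" for \<eta> :: "nat \<Rightarrow> real"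
      proof
        fix x
        have "trig F (\<lambda>\<xi>. \<Sum>k<n. \<eta> k *\<^sub>R v k \<xi>) x = (\<Sum>\<xi>\<in>F. \<Sum>k<n. \<eta> k *\<^sub>R (\<xi> x *\<^sub>C v k \<xi>))"
          by (simp add: trig_def scaleC_sum_right scaleR_as_scaleC scaleC_scaleC mult.commute)
        also have "\<dots> = (\<Sum>k<n. \<eta> k *\<^sub>R trig F (v k) x)"
          by (subst sum.swap) (simp add: trig_def scaleR_sum_right)
        finally show "trig F (\<lambda>\<xi>. \<Sum>k<n. \<eta> k *\<^sub>R v k \<xi>) x = (\<Sum>k<n. \<eta> k *\<^sub>R trig F (v k) x)" .
      qed
      show "(\<Sum>\<eta>\<in>sign_choices n. trig_norm p F (\<lambda>\<xi>. \<Sum>k<n. \<eta> k *\<^sub>R v k \<xi>)) \<le> 2 ^ n * real n - \<delta>"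
        unfolding eq \<delta>_def
        by (rule Lp_sign_average_bound[OF p1 ne(1) bd d']) (use trig_Lp(1)[OF F(2) p] v in auto)
    qed
  qed
qed

end


section \<open>Extension of multipliers to Bochner spaces\<close>

context compact_haar_group
begin

text \<open>
  The closure, in \<open>L\<^sup>p\<close> times \<open>L\<^sup>p\<close>, of the graph of the multiplier on the trigonometric polynomials.
\<close>

definition extends :: "real \<Rightarrow> (('g \<Rightarrow> complex) \<Rightarrow> complex) \<Rightarrow> ('g \<Rightarrow> 'y::complex_banach) \<Rightarrow> ('g \<Rightarrow> 'y) \<Rightarrow> bool" where
  "extends p \<psi> f g \<longleftrightarrow> f \<in> Lp \<mu> p \<and> g \<in> Lp \<mu> p \<and>
    (\<forall>e>0. \<exists>F v. finite F \<and> F \<subseteq> characters \<and> Lp_norm \<mu> p (\<lambda>x. f x - trig F v x) < e \<and>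
       Lp_norm \<mu> p (\<lambda>x. g x - trig F (\<lambda>\<xi>. \<psi> \<xi> *\<^sub>C v \<xi>) x) < e)"

text \<open>
  Some representative of the value; it is determined up to a null function whenever the multiplier is
  bounded.
\<close>

definition multiplier_op :: "real \<Rightarrow> (('g \<Rightarrow> complex) \<Rightarrow> complex) \<Rightarrow> ('g \<Rightarrow> 'y::complex_banach) \<Rightarrow> ('g \<Rightarrow> 'y)" where
  "multiplier_op p \<psi> f = (SOME g. extends p \<psi> f g)"

lemma extendsD: "extends p \<psi> f g \<Longrightarrow> f \<in> Lp \<mu> p" "extends p \<psi> f g \<Longrightarrow> g \<in> Lp \<mu> p"
  by (auto simp: extends_def)

lemma extends_approx:
  assumes "extends p \<psi> f g" "e > 0"
  obtains F v where "finite F" "F \<subseteq> characters" "Lp_norm \<mu> p (\<lambda>x. f x - trig F v x) < e"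
    "Lp_norm \<mu> p (\<lambda>x. g x - trig F (\<lambda>\<xi>. \<psi> \<xi> *\<^sub>C v \<xi>) x) < e"
  using assms unfolding extends_def by blast

end

lemma Lp_triangle:
  fixes f g h :: "'a \<Rightarrow> 'b::complex_banach"
  assumes "p \<ge> 1" "f \<in> Lp M p" "g \<in> Lp M p" "h \<in> Lp M p"
  shows "Lp_norm M p (\<lambda>x. f x - h x) \<le> Lp_norm M p (\<lambda>x. f x - g x) + Lp_norm M p (\<lambda>x. g x - h x)"
  using Lp_add(2)[OF assms(1) Lp_diff(1)[OF assms(1,2,3)] Lp_diff(1)[OF assms(1,3,4)]] by simp

lemma Lp_combination:
  fixes f g :: "'a \<Rightarrow> 'b::complex_banach"
  assumes p: "p \<ge> 1" and f: "f \<in> Lp M p" and g: "g \<in> Lp M p"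
  shows "(\<lambda>x. c *\<^sub>C f x + d *\<^sub>C g x) \<in> Lp M p"
    "Lp_norm M p (\<lambda>x. c *\<^sub>C f x + d *\<^sub>C g x) \<le> cmod c * Lp_norm M p f + cmod d * Lp_norm M p g"
proof -
  have p0: "p > 0" using p by simp
  note c = Lp_scaleC[OF p0 f, of c] and d = Lp_scaleC[OF p0 g, of d]
  show "(\<lambda>x. c *\<^sub>C f x + d *\<^sub>C g x) \<in> Lp M p"
    "Lp_norm M p (\<lambda>x. c *\<^sub>C f x + d *\<^sub>C g x) \<le> cmod c * Lp_norm M p f + cmod d * Lp_norm M p g"
    using Lp_add[OF p c(1) d(1)] by (simp_all only: c(2) d(2))
qed

lemma Lp_norm_zero_AE:
  fixes f :: "'a \<Rightarrow> 'b::complex_banach"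
  assumes "p > 0" "f \<in> Lp M p" "Lp_norm M p f = 0"
  shows "AE x in M. f x = 0"
proof -
  have "(\<integral>x. norm (f x) powr p \<partial>M) = 0" using Lp_norm_powr[OF assms(1), of M f] assms by simp
  then have "AE x in M. norm (f x) powr p = 0"
    using integral_nonneg_eq_0_iff_AE[OF LpD(2)[OF assms(2)]] by simp
  then show ?thesis by eventually_elim simp
qed

lemma trig_linear:
  assumes "finite F" "finite G"
  shows "c *\<^sub>C trig G w x + d *\<^sub>C trig F v x =
    trig (F \<union> G) (\<lambda>\<xi>. c *\<^sub>C (if \<xi> \<in> G then w \<xi> else 0) + d *\<^sub>C (if \<xi> \<in> F then v \<xi> else 0)) x"
proof -
  have f: "finite (F \<union> G)" using assms by simp
  show ?thesis
    unfolding trig_extend[OF f Un_upper1] trig_extend[OF f Un_upper2] trig_scaleC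
    by (simp add: trig_def scaleC_add_right sum.distrib)
qed

lemma trig_linear_multiplier:
  assumes "finite F" "finite G"
  shows "c *\<^sub>C trig G (\<lambda>\<xi>. \<psi> \<xi> *\<^sub>C w \<xi>) x + d *\<^sub>C trig F (\<lambda>\<xi>. \<psi> \<xi> *\<^sub>C v \<xi>) x =
    trig (F \<union> G) (\<lambda>\<xi>. \<psi> \<xi> *\<^sub>C (c *\<^sub>C (if \<xi> \<in> G then w \<xi> else 0) + d *\<^sub>C (if \<xi> \<in> F then v \<xi> else 0))) x"
  unfolding trig_linear[OF assms]
  unfolding trig_def by (rule sum.cong[OF refl]) (simp add: scaleC_add_right scaleC_scaleC mult_ac)

context Lp_fourier
begin

lemma multiplier_diff:
  fixes v w :: "('g \<Rightarrow> complex) \<Rightarrow> 'x"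
  assumes "mb \<psi> B" and F: "finite F" "F \<subseteq> characters" and G: "finite G" "G \<subseteq> characters"
  shows "N (\<lambda>x. trig G (\<lambda>\<xi>. \<psi> \<xi> *\<^sub>C w \<xi>) x - trig F (\<lambda>\<xi>. \<psi> \<xi> *\<^sub>C v \<xi>) x) \<le> B * N (\<lambda>x. trig G w x - trig F v x)"
proof -
  have eq: "a - b = 1 *\<^sub>C a + (-1) *\<^sub>C b" for a b :: 'x by (simp add: scaleC_one scaleC_minus_left)
  show ?thesis unfolding eq trig_linear_multiplier[OF F(1) G(1)] unfolding trig_linear[OF F(1) G(1)]
    by (rule mbD[OF assms(1)]) (use F G in auto)
qed

text \<open>
  Together with \<open>extendsI\<close> this characterizes the extension by inequalities alone. Combinations and
  compositions of symbols are handled through it.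
\<close>

lemma extends_bound:
  fixes f g :: "'g \<Rightarrow> 'x"
  assumes e: "extends p \<psi> f g" and B: "mb \<psi> B" "B \<ge> 0" and F: "finite F" "F \<subseteq> characters"
  shows "N (\<lambda>x. g x - trig F (\<lambda>\<xi>. \<psi> \<xi> *\<^sub>C v \<xi>) x) \<le> B * N (\<lambda>x. f x - trig F v x)"
proof (rule field_le_epsilon)
  fix d :: real assume d: "d > 0"
  note fL = extendsD(1)[OF e] and gL = extendsD(2)[OF e]
  have "d / (B + 1) > 0" using d B by simp
  then obtain G w where G: "finite G" "G \<subseteq> characters" "N (\<lambda>x. f x - trig G w x) < d / (B + 1)"
    "N (\<lambda>x. g x - trig G (\<lambda>\<xi>. \<psi> \<xi> *\<^sub>C w \<xi>) x) < d / (B + 1)"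
    by (rule extends_approx[OF e])
  note tF = trig_Lp(1)[OF F(2) p] and tG = trig_Lp(1)[OF G(2) p]
  have "N (\<lambda>x. g x - trig F (\<lambda>\<xi>. \<psi> \<xi> *\<^sub>C v \<xi>) x) \<le> N (\<lambda>x. g x - trig G (\<lambda>\<xi>. \<psi> \<xi> *\<^sub>C w \<xi>) x) +
     N (\<lambda>x. trig G (\<lambda>\<xi>. \<psi> \<xi> *\<^sub>C w \<xi>) x - trig F (\<lambda>\<xi>. \<psi> \<xi> *\<^sub>C v \<xi>) x)"
    by (rule Lp_triangle[OF p gL tG tF])
  also have "\<dots> \<le> d / (B + 1) + B * N (\<lambda>x. trig G w x - trig F v x)"
    by (rule add_mono[OF less_imp_le[OF G(4)] multiplier_diff[OF B(1) F G(1,2)]])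
  also have "N (\<lambda>x. trig G w x - trig F v x) \<le> N (\<lambda>x. trig G w x - f x) + N (\<lambda>x. f x - trig F v x)"
    by (rule Lp_triangle[OF p tG fL tF])
  also have "N (\<lambda>x. trig G w x - f x) = N (\<lambda>x. f x - trig G w x)" by (rule Lp_norm_commute)
  also have "\<dots> \<le> d / (B + 1)" using G(3) by simp
  finally have "N (\<lambda>x. g x - trig F (\<lambda>\<xi>. \<psi> \<xi> *\<^sub>C v \<xi>) x) \<le> d / (B + 1) + B * (d / (B + 1) + N (\<lambda>x. f x - trig F v x))"
    using B(2) by (simp add: mult_left_mono)
  also have "\<dots> = (B + 1) * (d / (B + 1)) + B * N (\<lambda>x. f x - trig F v x)" by (simp only: ring_distribs mult_1)
  also have "\<dots> = B * N (\<lambda>x. f x - trig F v x) + d" using B(2) by simp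
  finally show "N (\<lambda>x. g x - trig F (\<lambda>\<xi>. \<psi> \<xi> *\<^sub>C v \<xi>) x) \<le> B * N (\<lambda>x. f x - trig F v x) + d" .
qed

lemma extends_norm:
  fixes f g :: "'g \<Rightarrow> 'x"
  assumes e: "extends p \<psi> f g" and B: "mb \<psi> B" "B \<ge> 0"
  shows "N g \<le> B * N f"
  using extends_bound[OF assms, of "{}"] by (simp add: trig_def)

lemma extendsI:
  fixes f g :: "'g \<Rightarrow> 'x"
  assumes f: "f \<in> L" and g: "g \<in> L"
    and C: "\<And>F v. finite F \<Longrightarrow> F \<subseteq> characters \<Longrightarrow> N (\<lambda>x. g x - trig F (\<lambda>\<xi>. \<psi> \<xi> *\<^sub>C v \<xi>) x) \<le> C * N (\<lambda>x. f x - trig F v x)"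
  shows "extends p \<psi> f g"
  unfolding extends_def
proof (intro conjI allI impI f g)
  fix e :: real assume e: "e > 0"
  then have "e / (\<bar>C\<bar> + 1) > 0" by simp
  then obtain F v where F: "finite F" "F \<subseteq> characters" "N (\<lambda>x. f x - trig F v x) < e / (\<bar>C\<bar> + 1)"
    by (rule trig_dense[OF p f])
  let ?d = "N (\<lambda>x. f x - trig F v x)"
  have d: "(\<bar>C\<bar> + 1) * ?d < e" using F(3) by (simp add: pos_less_divide_eq mult.commute)
  have nn: "?d \<ge> 0" by (rule Lp_norm_nonneg)
  have "\<bar>C\<bar> * ?d \<ge> 0" "C * ?d \<le> \<bar>C\<bar> * ?d" using nn by (auto intro: mult_right_mono)
  then have "?d < e" "C * ?d < e" using d[unfolded distrib_right mult_1] nn by linarith+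
  then show "\<exists>F v. finite F \<and> F \<subseteq> characters \<and> N (\<lambda>x. f x - trig F v x) < e \<and> N (\<lambda>x. g x - trig F (\<lambda>\<xi>. \<psi> \<xi> *\<^sub>C v \<xi>) x) < e"
    by (intro exI[of _ F] exI[of _ v] conjI F(1,2)) (assumption, rule order_le_less_trans[OF C[OF F(1,2)]])
qed

text \<open>
  The images of polynomials that approximate \<open>f\<close> at a geometric rate form a Cauchy sequence.
\<close>

lemma extends_exists:
  fixes f :: "'g \<Rightarrow> 'x"
  assumes B: "mb \<psi> B" "B \<ge> 0" and f: "f \<in> L"
  shows "\<exists>g. extends p \<psi> f g"
proof -
  \<comment> \<open>Small enough for the images of consecutive approximations to meet the hypothesis of \<open>Lp_complete\<close>.\<close>
  define r where "r n = 1 / (8 * (B + 1)) * (1 / 2) ^ n" for n :: nat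
  have r: "r n > 0" "r (Suc n) = r n / 2" for n using B(2) by (auto simp: r_def)
  have "\<forall>n. \<exists>F v. finite F \<and> F \<subseteq> characters \<and> N (\<lambda>x. f x - trig F v x) < r n"
  proof
    fix n
    obtain F v where "finite F" "F \<subseteq> characters" "N (\<lambda>x. f x - trig F v x) < r n"
      by (rule trig_dense[OF p f r(1)])
    then show "\<exists>F v. finite F \<and> F \<subseteq> characters \<and> N (\<lambda>x. f x - trig F v x) < r n" by blast
  qed
  from choice[OF this] obtain F where "\<forall>n. \<exists>v. finite (F n) \<and> F n \<subseteq> characters \<and> N (\<lambda>x. f x - trig (F n) v x) < r n" ..
  from choice[OF this] obtain v where Fv: "\<forall>n. finite (F n) \<and> F n \<subseteq> characters \<and> N (\<lambda>x. f x - trig (F n) (v n) x) < r n" ..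
  have F: "finite (F n)" "F n \<subseteq> characters" "N (\<lambda>x. f x - trig (F n) (v n) x) < r n" for n using Fv by auto
  define h where "h n = trig (F n) (\<lambda>\<xi>. \<psi> \<xi> *\<^sub>C v n \<xi>)" for n
  have hL: "h n \<in> L" for n unfolding h_def by (rule trig_Lp(1)[OF F(2) p])
  have fast: "N (\<lambda>x. h (Suc n) x - h n x) \<le> (1 / 4) * (1 / 2) ^ n" for n
  proof -
    have "N (\<lambda>x. h (Suc n) x - h n x) \<le> B * N (\<lambda>x. trig (F (Suc n)) (v (Suc n)) x - trig (F n) (v n) x)"
      unfolding h_def by (rule multiplier_diff[OF B(1) F(1,2) F(1,2)])
    also have "N (\<lambda>x. trig (F (Suc n)) (v (Suc n)) x - trig (F n) (v n) x) \<le>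
       N (\<lambda>x. trig (F (Suc n)) (v (Suc n)) x - f x) + N (\<lambda>x. f x - trig (F n) (v n) x)"
      by (rule Lp_triangle[OF p trig_Lp(1)[OF F(2) p] f trig_Lp(1)[OF F(2) p]])
    also have "N (\<lambda>x. trig (F (Suc n)) (v (Suc n)) x - f x) = N (\<lambda>x. f x - trig (F (Suc n)) (v (Suc n)) x)"
      by (rule Lp_norm_commute)
    also have "N (\<lambda>x. f x - trig (F (Suc n)) (v (Suc n)) x) + N (\<lambda>x. f x - trig (F n) (v n) x) \<le> 2 * r n"
      using F(3)[of n] F(3)[of "Suc n"] r[of n] by simp
    finally have "N (\<lambda>x. h (Suc n) x - h n x) \<le> B * (2 * r n)" using B(2) by (simp add: mult_left_mono)
    also have "\<dots> \<le> (B + 1) * (2 * r n)" using r(1)[of n] by (intro mult_right_mono) auto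
    also have "\<dots> = ((B + 1) * (1 / (8 * (B + 1)))) * (2 * (1 / 2) ^ n)" by (simp only: r_def mult_ac)
    also have "(B + 1) * (1 / (8 * (B + 1))) = 1 / 8" using B(2) by simp
    also have "1 / 8 * (2 * (1 / 2) ^ n) = (1 / 4) * (1 / (2::real)) ^ n" by simp
    finally show ?thesis .
  qed
  obtain g where g: "g \<in> L" "(\<lambda>n. N (\<lambda>x. g x - h n x)) \<longlonglongrightarrow> 0"
    by (rule Lp_complete[OF prob_space_haar p hL fast])
  have r0: "r \<longlonglongrightarrow> 0" unfolding r_def[abs_def] by (intro tendsto_mult_right_zero LIMSEQ_power_zero) simp
  have "extends p \<psi> f g"
    unfolding extends_def
  proof (intro conjI allI impI f g(1))
    fix e :: real assume e: "e > 0"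
    have "\<forall>\<^sub>F n in sequentially. r n < e \<and> N (\<lambda>x. g x - h n x) < e"
      by (intro eventually_conj order_tendstoD(2)[OF r0 e] order_tendstoD(2)[OF g(2) e])
    then obtain n where n: "r n < e" "N (\<lambda>x. g x - h n x) < e" by (auto dest!: eventually_happens)
    show "\<exists>F v. finite F \<and> F \<subseteq> characters \<and> N (\<lambda>x. f x - trig F v x) < e \<and> N (\<lambda>x. g x - trig F (\<lambda>\<xi>. \<psi> \<xi> *\<^sub>C v \<xi>) x) < e"
      by (intro exI[of _ "F n"] exI[of _ "v n"] conjI F(1,2) n(2)[unfolded h_def] less_trans[OF F(3) n(1)])
  qed
  then show ?thesis by blast
qed

lemma extends_combination:
  fixes f g :: "'g \<Rightarrow> 'x"
  assumes a: "extends p \<psi> f g" and b: "extends p \<psi> f' g'"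
  shows "extends p \<psi> (\<lambda>x. c *\<^sub>C f x + d *\<^sub>C f' x) (\<lambda>x. c *\<^sub>C g x + d *\<^sub>C g' x)"
  unfolding extends_def
proof (intro conjI allI impI Lp_combination(1)[OF p] extendsD[OF a] extendsD[OF b])
  fix e :: real assume e: "e > 0"
  define C where "C = cmod c + cmod d + 1"
  have C: "C > 0" by (simp add: C_def add_nonneg_pos)
  then have "e / C > 0" using e by simp
  note e' = this
  obtain F v where F: "finite F" "F \<subseteq> characters" "N (\<lambda>x. f x - trig F v x) < e / C" "N (\<lambda>x. g x - trig F (\<lambda>\<xi>. \<psi> \<xi> *\<^sub>C v \<xi>) x) < e / C"
    by (rule extends_approx[OF a e'])
  obtain G w where G: "finite G" "G \<subseteq> characters" "N (\<lambda>x. f' x - trig G w x) < e / C" "N (\<lambda>x. g' x - trig G (\<lambda>\<xi>. \<psi> \<xi> *\<^sub>C w \<xi>) x) < e / C"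
    by (rule extends_approx[OF b e'])
  have *: "N (\<lambda>x. (c *\<^sub>C h x + d *\<^sub>C h' x) - (c *\<^sub>C k x + d *\<^sub>C k' x)) < e"
    if L: "h \<in> L" "h' \<in> L" "k \<in> L" "k' \<in> L" and lt: "N (\<lambda>x. h x - k x) < e / C" "N (\<lambda>x. h' x - k' x) < e / C" for h h' k k'
  proof -
    have "N (\<lambda>x. (c *\<^sub>C h x + d *\<^sub>C h' x) - (c *\<^sub>C k x + d *\<^sub>C k' x)) = N (\<lambda>x. c *\<^sub>C (h x - k x) + d *\<^sub>C (h' x - k' x))"
      by (simp add: scaleC_diff_right algebra_simps)
    also have "\<dots> \<le> cmod c * N (\<lambda>x. h x - k x) + cmod d * N (\<lambda>x. h' x - k' x)"
      by (rule Lp_combination(2)[OF p Lp_diff(1)[OF p] Lp_diff(1)[OF p]]) (rule L)+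
    also have "\<dots> \<le> cmod c * (e / C) + cmod d * (e / C)" using lt by (intro add_mono mult_left_mono) auto
    also have "\<dots> < cmod c * (e / C) + cmod d * (e / C) + 1 * (e / C)" using e' by simp
    also have "\<dots> = (cmod c + cmod d + 1) * (e / C)" by (simp only: distrib_right)
    also have "\<dots> = C * (e / C)" unfolding C_def ..
    also have "\<dots> = e" using C by simp
    finally show ?thesis .
  qed
  note tF = trig_Lp(1)[OF F(2) p] and tG = trig_Lp(1)[OF G(2) p]
  show "\<exists>F v. finite F \<and> F \<subseteq> characters \<and> N (\<lambda>x. (c *\<^sub>C f x + d *\<^sub>C f' x) - trig F v x) < e \<and>
     N (\<lambda>x. (c *\<^sub>C g x + d *\<^sub>C g' x) - trig F (\<lambda>\<xi>. \<psi> \<xi> *\<^sub>C v \<xi>) x) < e"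
  proof (intro exI conjI)
    show "finite (G \<union> F)" "G \<union> F \<subseteq> characters" using F G by auto
    let ?u = "\<lambda>\<xi>. c *\<^sub>C (if \<xi> \<in> F then v \<xi> else 0) + d *\<^sub>C (if \<xi> \<in> G then w \<xi> else 0)"
    show "N (\<lambda>x. (c *\<^sub>C f x + d *\<^sub>C f' x) - trig (G \<union> F) ?u x) < e"
      unfolding trig_linear[OF G(1) F(1), symmetric] by (rule *[OF extendsD(1)[OF a] extendsD(1)[OF b] tF tG F(3) G(3)])
    show "N (\<lambda>x. (c *\<^sub>C g x + d *\<^sub>C g' x) - trig (G \<union> F) (\<lambda>\<xi>. \<psi> \<xi> *\<^sub>C ?u \<xi>) x) < e"
      unfolding trig_linear_multiplier[OF G(1) F(1), symmetric] by (rule *[OF extendsD(2)[OF a] extendsD(2)[OF b] tF tG F(4) G(4)])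
  qed
qed

lemma extends_unique:
  fixes f g g' :: "'g \<Rightarrow> 'x"
  assumes a: "extends p \<psi> f g" and b: "extends p \<psi> f g'" and B: "mb \<psi> B" "B \<ge> 0"
  shows "N (\<lambda>x. g x - g' x) = 0"
proof -
  have "extends p \<psi> (\<lambda>x. 1 *\<^sub>C f x + (-1) *\<^sub>C f x) (\<lambda>x. 1 *\<^sub>C g x + (-1) *\<^sub>C g' x)"
    by (rule extends_combination[OF a b])
  then have "extends p \<psi> (\<lambda>x. 0) (\<lambda>x. g x - g' x)" by (simp add: scaleC_one scaleC_minus_left)
  note * = extends_norm[OF this B]
  have "N (\<lambda>x. 0) = 0" by (rule Lp_zero(2)[OF p0])
  with * Lp_norm_nonneg[of \<mu> p "\<lambda>x. g x - g' x"] show ?thesis by simp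
qed

lemma extends_symbol_combination:
  fixes f g g' :: "'g \<Rightarrow> 'x"
  assumes a: "extends p \<psi> f g" "mb \<psi> B" "B \<ge> 0" and b: "extends p \<psi>' f g'" "mb \<psi>' B'" "B' \<ge> 0"
  shows "extends p (\<lambda>\<xi>. c * \<psi> \<xi> + d * \<psi>' \<xi>) f (\<lambda>x. c *\<^sub>C g x + d *\<^sub>C g' x)"
proof (rule extendsI[where C = "cmod c * B + cmod d * B'"])
  show "f \<in> L" "(\<lambda>x. c *\<^sub>C g x + d *\<^sub>C g' x) \<in> L" by (intro extendsD[OF a(1)] extendsD[OF b(1)] Lp_combination(1)[OF p])+
  fix F :: "('g \<Rightarrow> complex) set" and v :: "('g \<Rightarrow> complex) \<Rightarrow> 'x" assume F: "finite F" "F \<subseteq> characters"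
  have t: "trig F (\<lambda>\<xi>. (c * \<psi> \<xi> + d * \<psi>' \<xi>) *\<^sub>C v \<xi>) x = c *\<^sub>C trig F (\<lambda>\<xi>. \<psi> \<xi> *\<^sub>C v \<xi>) x + d *\<^sub>C trig F (\<lambda>\<xi>. \<psi>' \<xi> *\<^sub>C v \<xi>) x" for x
    unfolding trig_scaleC by (simp add: trig_def scaleC_add_left scaleC_add_right scaleC_scaleC sum.distrib)
  note tF = trig_Lp(1)[OF F(2) p]
  have "N (\<lambda>x. (c *\<^sub>C g x + d *\<^sub>C g' x) - trig F (\<lambda>\<xi>. (c * \<psi> \<xi> + d * \<psi>' \<xi>) *\<^sub>C v \<xi>) x) =
    N (\<lambda>x. c *\<^sub>C (g x - trig F (\<lambda>\<xi>. \<psi> \<xi> *\<^sub>C v \<xi>) x) + d *\<^sub>C (g' x - trig F (\<lambda>\<xi>. \<psi>' \<xi> *\<^sub>C v \<xi>) x))"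
    unfolding t by (simp add: scaleC_diff_right algebra_simps)
  also have "\<dots> \<le> cmod c * N (\<lambda>x. g x - trig F (\<lambda>\<xi>. \<psi> \<xi> *\<^sub>C v \<xi>) x) + cmod d * N (\<lambda>x. g' x - trig F (\<lambda>\<xi>. \<psi>' \<xi> *\<^sub>C v \<xi>) x)"
    by (rule Lp_combination(2)[OF p Lp_diff(1)[OF p] Lp_diff(1)[OF p]]) (rule extendsD(2)[OF a(1)] extendsD(2)[OF b(1)] tF)+
  also have "\<dots> \<le> cmod c * (B * N (\<lambda>x. f x - trig F v x)) + cmod d * (B' * N (\<lambda>x. f x - trig F v x))"
    by (intro add_mono mult_left_mono extends_bound[OF a F] extends_bound[OF b F]) auto
  finally show "N (\<lambda>x. (c *\<^sub>C g x + d *\<^sub>C g' x) - trig F (\<lambda>\<xi>. (c * \<psi> \<xi> + d * \<psi>' \<xi>) *\<^sub>C v \<xi>) x) \<le> (cmod c * B + cmod d * B') * N (\<lambda>x. f x - trig F v x)"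
    by (simp add: distrib_right mult.assoc)
qed

lemma extends_compose:
  fixes f g h :: "'g \<Rightarrow> 'x"
  assumes a: "extends p \<psi> f g" "mb \<psi> B" "B \<ge> 0" and b: "extends p \<psi>' g h" "mb \<psi>' B'" "B' \<ge> 0"
  shows "extends p (\<lambda>\<xi>. \<psi>' \<xi> * \<psi> \<xi>) f h"
proof (rule extendsI[where C = "B' * B"])
  show "f \<in> L" "h \<in> L" by (intro extendsD[OF a(1)] extendsD[OF b(1)])+
  fix F :: "('g \<Rightarrow> complex) set" and v :: "('g \<Rightarrow> complex) \<Rightarrow> 'x" assume F: "finite F" "F \<subseteq> characters"
  have "N (\<lambda>x. h x - trig F (\<lambda>\<xi>. (\<psi>' \<xi> * \<psi> \<xi>) *\<^sub>C v \<xi>) x) \<le> B' * N (\<lambda>x. g x - trig F (\<lambda>\<xi>. \<psi> \<xi> *\<^sub>C v \<xi>) x)"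
    using extends_bound[OF b F, of "\<lambda>\<xi>. \<psi> \<xi> *\<^sub>C v \<xi>"] by (simp add: scaleC_scaleC)
  also have "\<dots> \<le> B' * (B * N (\<lambda>x. f x - trig F v x))" by (rule mult_left_mono[OF extends_bound[OF a F] b(3)])
  finally show "N (\<lambda>x. h x - trig F (\<lambda>\<xi>. (\<psi>' \<xi> * \<psi> \<xi>) *\<^sub>C v \<xi>) x) \<le> B' * B * N (\<lambda>x. f x - trig F v x)" by (simp add: mult.assoc)
qed

lemma extends_identity: "f \<in> L \<Longrightarrow> extends p (\<lambda>\<xi>. 1) f f"
  by (rule extendsI[where C = 1]) (auto simp: scaleC_one)

lemma extends_multiplier_op:
  fixes f :: "'g \<Rightarrow> 'x"
  assumes "mb \<psi> B" "B \<ge> 0" "f \<in> L"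
  shows "extends p \<psi> f (multiplier_op p \<psi> f)"
  unfolding multiplier_op_def by (rule someI_ex[OF extends_exists[OF assms]])

lemma multiplier_op_linear:
  assumes B: "mb \<psi> B" "B \<ge> 0"
  shows "linear_op L N (multiplier_op p \<psi>)"
  unfolding linear_op_def
proof (intro conjI ballI allI)
  fix f g :: "'g \<Rightarrow> 'x" and c assume f: "f \<in> L"
  note ef = extends_multiplier_op[OF B f]
  show "multiplier_op p \<psi> f \<in> L" by (rule extendsD(2)[OF ef])
  have s: "extends p \<psi> (c *\<^sub>C f) (c *\<^sub>C multiplier_op p \<psi> f)"
    using extends_combination[OF ef ef, of c 0] by (simp add: scaleC_fun_def)
  have "N (\<lambda>x. multiplier_op p \<psi> (c *\<^sub>C f) x - (c *\<^sub>C multiplier_op p \<psi> f) x) = 0"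
    by (rule extends_unique[OF extends_multiplier_op[OF B extendsD(1)[OF s]] s B])
  then show "N (multiplier_op p \<psi> (c *\<^sub>C f) - c *\<^sub>C multiplier_op p \<psi> f) = 0" by (simp only: fun_diff_def)
  assume g: "g \<in> L"
  note eg = extends_multiplier_op[OF B g]
  have s: "extends p \<psi> (f + g) (multiplier_op p \<psi> f + multiplier_op p \<psi> g)"
    using extends_combination[OF ef eg, of 1 1] by (simp add: scaleC_one plus_fun_def)
  have "N (\<lambda>x. multiplier_op p \<psi> (f + g) x - (multiplier_op p \<psi> f + multiplier_op p \<psi> g) x) = 0"
    by (rule extends_unique[OF extends_multiplier_op[OF B extendsD(1)[OF s]] s B])
  then show "N (multiplier_op p \<psi> (f + g) - (multiplier_op p \<psi> f + multiplier_op p \<psi> g)) = 0" by (simp only: fun_diff_def)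
qed

lemma multiplier_op_norm:
  assumes "mb \<psi> B" "B \<ge> 0" "f \<in> L"
  shows "N (multiplier_op p \<psi> f) \<le> B * N f"
  by (rule extends_norm[OF extends_multiplier_op[OF assms] assms(1,2)])

lemma multiplier_op_bounded:
  assumes "mb \<psi> B" "B \<ge> 0"
  shows "multiplier_op p \<psi> \<in> bounded_ops L N"
  unfolding bounded_ops_def using multiplier_op_linear[OF assms] multiplier_op_norm[OF assms] by blast

lemma multiplier_op_contraction:
  assumes "mb \<psi> 1"
  shows "contraction_op L N (multiplier_op p \<psi>)"
  unfolding contraction_op_def using multiplier_op_linear[OF assms] multiplier_op_norm[OF assms] by simp

lemma bounded_ops_norm_bounds:
  assumes S: "\<And>f. f \<in> L \<Longrightarrow> N (S f) \<le> C * N f" and C: "C \<ge> 0"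
  shows "bounded_ops_norm L N S \<le> C" "bounded_ops_norm L N S \<ge> 0"
proof -
  let ?A = "{N (S f) |f. f \<in> L \<and> N f \<le> 1}"
  have z0: "N (\<lambda>x. 0) \<le> 1" by (simp only: Lp_zero(2)[OF p0])
  have z: "N (S (\<lambda>x. 0)) \<in> ?A" by (intro CollectI exI[of _ "\<lambda>x. 0"] conjI refl Lp_zero(1) z0)
  have le: "a \<le> C" if a: "a \<in> ?A" for a
  proof -
    obtain f where f: "a = N (S f)" "f \<in> L" "N f \<le> 1" using a by blast
    have "a \<le> C * N f" unfolding f(1) by (rule S[OF f(2)])
    also have "\<dots> \<le> C" using mult_left_mono[OF f(3) C] by simp
    finally show ?thesis .
  qed
  have "?A \<noteq> {}" using z by blast
  then show "bounded_ops_norm L N S \<le> C" unfolding bounded_ops_norm_def by (rule cSup_least) (rule le)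
  have "bdd_above ?A" by (rule bdd_aboveI) (rule le)
  from cSup_upper2[OF z Lp_norm_nonneg this] show "bounded_ops_norm L N S \<ge> 0" unfolding bounded_ops_norm_def .
qed

end


section \<open>Selfadjoint Fourier multipliers on bounded functions\<close>

text \<open>
  A zero of \<open>g\<close> would spread to points arbitrarily close to 0, where \<open>g\<close> is 1. The logarithm of \<open>g\<close> is
  additive and monotone, hence linear.
\<close>

lemma continuous_multiplicative_exp:
  fixes g :: "real \<Rightarrow> real"
  assumes g0: "g 0 = 1" and mult: "\<And>s t. s \<ge> 0 \<Longrightarrow> t \<ge> 0 \<Longrightarrow> g (s + t) = g s * g t"
    and cont: "continuous_on {0..} g" and bound: "\<And>t. t \<ge> 0 \<Longrightarrow> g t \<le> 1"
  obtains a where "a \<ge> 0" "\<And>t. t \<ge> 0 \<Longrightarrow> g t = exp (- (t * a))"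
proof -
  have half: "g t = g (t / 2) * g (t / 2)" if "t \<ge> 0" for t using mult[of "t / 2" "t / 2"] that by simp
  have nz: "g t \<noteq> 0" if t: "t \<ge> 0" for t
  proof
    assume z: "g t = 0"
    have zn: "g (t * (1 / 2) ^ n) = 0" for n
    proof (induction n)
      case (Suc n)
      then show ?case using half[of "t * (1 / 2) ^ n"] t by simp
    qed (use z in simp)
    have "(\<lambda>n. t * (1 / 2) ^ n) \<longlonglongrightarrow> 0" by (intro tendsto_mult_right_zero LIMSEQ_power_zero) simp
    from continuous_on_tendsto_compose[OF cont this _ always_eventually]
    have "(\<lambda>n. g (t * (1 / 2) ^ n)) \<longlonglongrightarrow> g 0" using t by simp
    then have "(\<lambda>n. 0) \<longlonglongrightarrow> (1::real)" unfolding zn g0 .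
    then show False by (simp add: LIMSEQ_const_iff)
  qed
  have pos: "g t > 0" if t: "t \<ge> 0" for t using half[OF t] nz[OF t] by (metis less_le zero_le_square)
  define h where "h t = ln (g t)" for t
  have add: "h (s + t) = h s + h t" if "s \<ge> 0" "t \<ge> 0" for s t
    unfolding h_def mult[OF that] by (rule ln_mult_pos) (use pos that in auto)
  have neg: "h t \<le> 0" if "t \<ge> 0" for t using bound[OF that] pos[OF that] by (simp add: h_def)
  have anti: "h t \<le> h s" if "0 \<le> s" "s \<le> t" for s t
    using add[of s "t - s"] neg[of "t - s"] that by simp
  have nat: "h (real n * x) = real n * h x" if "x \<ge> 0" for n x
  proof (induction n)
    case 0 then show ?case by (simp add: h_def g0)
  next
    case (Suc n)
    have "h (real (Suc n) * x) = h (real n * x + x)" by (simp add: distrib_right add.commute)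
    also have "\<dots> = h (real n * x) + h x" by (rule add) (use that in auto)
    finally show ?case using Suc by (simp add: distrib_right)
  qed
  define a where "a = - h 1"
  have a0: "a \<ge> 0" using neg[of 1] by (simp add: a_def)
  have lin: "h t = - (t * a)" if t: "t \<ge> 0" for t
  proof (rule ccontr)
    assume "h t \<noteq> - (t * a)"
    then have d: "\<bar>h t + t * a\<bar> > 0" by simp
    obtain n :: nat where n: "a < real n * \<bar>h t + t * a\<bar>" using reals_Archimedean3[OF d] by blast
    define k where "k = nat \<lfloor>real n * t\<rfloor>"
    have k: "real k \<le> real n * t" "real n * t \<le> real (Suc k)"
      using t by (auto simp: k_def of_nat_nat) linarith+
    have hn: "h (real m) = - (real m * a)" for m using nat[of 1 m] by (simp add: a_def)
    have "h (real (Suc k)) \<le> h (real n * t)" "h (real n * t) \<le> h (real k)" using k t by (intro anti; simp)+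
    then have "real n * h t \<le> - (real k * a)" "- (real (Suc k) * a) \<le> real n * h t" unfolding hn nat[OF t] by auto
    moreover have "real k * a \<le> real n * t * a" "real n * t * a \<le> real (Suc k) * a" using k a0 by (auto intro: mult_right_mono)
    moreover have "real (Suc k) * a = real k * a + a" by (simp add: distrib_right)
    ultimately have "\<bar>real n * h t + real n * t * a\<bar> \<le> a" by linarith
    moreover have "\<bar>real n * (h t + t * a)\<bar> = real n * \<bar>h t + t * a\<bar>" by (simp only: abs_mult abs_of_nat)
    moreover have "real n * (h t + t * a) = real n * h t + real n * t * a" by (simp only: distrib_left mult.assoc)
    ultimately show False using n by linarith
  qed
  show thesis
  proof (rule that[OF a0])
    fix t :: real assume t: "t \<ge> 0"
    have "g t = exp (h t)" using pos[OF t] by (simp add: h_def)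
    then show "g t = exp (- (t * a))" by (simp only: lin[OF t])
  qed
qed

lemma borel_measurable_cnj [measurable (raw)]: "f \<in> borel_measurable M \<Longrightarrow> (\<lambda>x. cnj (f x)) \<in> borel_measurable M"
  by (rule measurable_compose[OF _ borel_measurable_continuous_onI]) (auto intro!: continuous_intros)

lemma Linf_norm_AE:
  assumes "f \<in> Linf M" shows "AE x in M. cmod (f x) \<le> Linf_norm M f"
proof -
  let ?A = "{C. 0 \<le> C \<and> (AE x in M. cmod (f x) \<le> C)}"
  obtain C where C: "AE x in M. cmod (f x) \<le> C" using assms by (auto simp: Linf_def)
  have "AE x in M. cmod (f x) \<le> max C 0" using C by eventually_elim auto
  then have "max C 0 \<in> ?A" by simp
  then have ne: "?A \<noteq> {}" by blast
  have "AE x in M. cmod (f x) \<le> Linf_norm M f + 1 / real (Suc n)" for n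
  proof -
    have "Inf ?A < Linf_norm M f + 1 / real (Suc n)" unfolding Linf_norm_def by simp
    then obtain c where c: "c \<in> ?A" "c < Linf_norm M f + 1 / real (Suc n)" by (rule cInf_lessD[OF ne, THEN bexE])
    from c(1) have "AE x in M. cmod (f x) \<le> c" by simp
    then show ?thesis by eventually_elim (use c(2) in simp)
  qed
  then have "AE x in M. \<forall>n. cmod (f x) \<le> Linf_norm M f + 1 / real (Suc n)" by (simp add: AE_all_countable)
  then show ?thesis
  proof eventually_elim
    case (elim x)
    have "(\<lambda>n. Linf_norm M f + 1 / real (Suc n)) \<longlonglongrightarrow> Linf_norm M f + 0"
      by (intro tendsto_add tendsto_const) (use LIMSEQ_inverse_real_of_nat in \<open>simp add: inverse_eq_divide\<close>)
    from LIMSEQ_le_const[OF this] elim show ?case by auto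
  qed
qed

lemma Linf_norm_le:
  assumes "0 \<le> C" "AE x in M. cmod (f x) \<le> C" shows "Linf_norm M f \<le> C"
  unfolding Linf_norm_def by (rule cInf_lower) (use assms in \<open>auto intro!: bdd_belowI[of _ 0]\<close>)

lemma Linf_norm_zero_AE:
  assumes "f \<in> Linf M" "Linf_norm M f = 0" shows "AE x in M. f x = 0"
  using Linf_norm_AE[OF assms(1)] unfolding assms(2) by eventually_elim simp

lemma Linf_combination:
  assumes "f \<in> Linf M" "g \<in> Linf M"
  shows "(\<lambda>x. c * f x + d * g x) \<in> Linf M"
proof -
  have m: "f \<in> borel_measurable M" "g \<in> borel_measurable M" using assms by (auto simp: Linf_def)
  have "AE x in M. cmod (c * f x + d * g x) \<le> cmod c * Linf_norm M f + cmod d * Linf_norm M g"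
    using Linf_norm_AE[OF assms(1)] Linf_norm_AE[OF assms(2)]
  proof eventually_elim
    case (elim x)
    have "cmod (c * f x + d * g x) \<le> cmod c * cmod (f x) + cmod d * cmod (g x)"
      using norm_triangle_ineq[of "c * f x" "d * g x"] by (simp add: norm_mult)
    also have "\<dots> \<le> cmod c * Linf_norm M f + cmod d * Linf_norm M g" using elim by (intro add_mono mult_left_mono) auto
    finally show ?case .
  qed
  moreover have "(\<lambda>x. c * f x + d * g x) \<in> borel_measurable M" using m by measurable
  ultimately show ?thesis by (auto simp: Linf_def)
qed

locale selfadjoint_multiplier = compact_haar_group \<mu> for \<mu> :: "'g::{topological_ab_group_add, t2_space} measure" +
  fixes S :: "('g \<Rightarrow> complex) \<Rightarrow> ('g \<Rightarrow> complex)" and \<phi> :: "('g \<Rightarrow> complex) \<Rightarrow> complex"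
  assumes contraction: "contraction_op (Linf \<mu>) (Linf_norm \<mu>) S" and sa: "selfadjoint \<mu> S"
    and symbol: "\<And>\<xi>. \<xi> \<in> characters \<Longrightarrow> AE x in \<mu>. S \<xi> x = \<phi> \<xi> * \<xi> x"
begin

lemma S_Linf: "f \<in> Linf \<mu> \<Longrightarrow> S f \<in> Linf \<mu>"
  using contraction by (auto simp: contraction_op_def linear_op_def)

lemma Linf_measurable: "f \<in> Linf \<mu> \<Longrightarrow> f \<in> borel_measurable \<mu>" by (simp only: Linf_def mem_Collect_eq)

lemma S_combination:
  assumes f: "f \<in> Linf \<mu>" and g: "g \<in> Linf \<mu>"
  shows "AE x in \<mu>. S (\<lambda>x. c * f x + d * g x) x = c * S f x + d * S g x"
proof -
  have L: "linear_op (Linf \<mu>) (Linf_norm \<mu>) S" using contraction by (simp add: contraction_op_def)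
  have cf: "c *\<^sub>C h \<in> Linf \<mu>" if "h \<in> Linf \<mu>" for c h
    using Linf_combination[OF that that, of c 0] by (simp add: scaleC_fun_def scaleC_complex_def)
  have sub: "h - k \<in> Linf \<mu>" if "h \<in> Linf \<mu>" "k \<in> Linf \<mu>" for h k
    using Linf_combination[OF that, of 1 "-1"] by (simp add: fun_diff_def)
  have plus: "h + k \<in> Linf \<mu>" if "h \<in> Linf \<mu>" "k \<in> Linf \<mu>" for h k
    using Linf_combination[OF that, of 1 1] by (simp add: plus_fun_def)
  have sc: "AE x in \<mu>. S (c *\<^sub>C h) x = c * S h x" if h: "h \<in> Linf \<mu>" for c h
  proof -
    have "Linf_norm \<mu> (S (c *\<^sub>C h) - c *\<^sub>C S h) = 0" using L h by (auto simp: linear_op_def)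
    from Linf_norm_zero_AE[OF sub[OF S_Linf[OF cf[OF h]] cf[OF S_Linf[OF h]]] this]
    show ?thesis by eventually_elim (simp add: scaleC_fun_def scaleC_complex_def)
  qed
  have "Linf_norm \<mu> (S (c *\<^sub>C f + d *\<^sub>C g) - (S (c *\<^sub>C f) + S (d *\<^sub>C g))) = 0" using L cf[OF f] cf[OF g] by (auto simp: linear_op_def)
  from Linf_norm_zero_AE[OF sub[OF S_Linf[OF plus[OF cf[OF f] cf[OF g]]] plus[OF S_Linf[OF cf[OF f]] S_Linf[OF cf[OF g]]]] this]
  have "AE x in \<mu>. S (c *\<^sub>C f + d *\<^sub>C g) x = c * S f x + d * S g x"
    using sc[OF f, of c] sc[OF g, of d] by eventually_elim simp
  moreover have "c *\<^sub>C f + d *\<^sub>C g = (\<lambda>x. c * f x + d * g x)" by (simp add: fun_eq_iff scaleC_fun_def scaleC_complex_def)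
  ultimately show ?thesis by (simp only:)
qed

lemma S_bound:
  assumes "f \<in> Linf \<mu>" "0 \<le> C" "AE x in \<mu>. cmod (f x) \<le> C"
  shows "AE x in \<mu>. cmod (S f x) \<le> C"
proof -
  have "Linf_norm \<mu> (S f) \<le> Linf_norm \<mu> f" using contraction assms(1) by (auto simp: contraction_op_def)
  also have "\<dots> \<le> C" by (rule Linf_norm_le[OF assms(2,3)])
  finally have le: "Linf_norm \<mu> (S f) \<le> C" .
  from Linf_norm_AE[OF S_Linf[OF assms(1)]] show ?thesis by eventually_elim (rule order_trans[OF _ le])
qed

lemma S_cong:
  assumes f: "f \<in> Linf \<mu>" and g: "g \<in> Linf \<mu>" and eq: "AE x in \<mu>. f x = g x"
  shows "AE x in \<mu>. S f x = S g x"
proof -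
  have "AE x in \<mu>. cmod (1 * f x + (-1) * g x) \<le> 0" using eq by eventually_elim simp
  from S_bound[OF Linf_combination[OF f g] _ this] S_combination[OF f g, of 1 "-1"]
  show ?thesis by (auto elim!: eventually_elim2)
qed

lemma continuous_Linf:
  assumes "continuous_on UNIV f" shows "f \<in> Linf \<mu>"
proof -
  obtain C where "\<And>x. cmod (f x) \<le> C" using continuous_bounded[OF assms] by blast
  then show ?thesis using continuous_borel[OF assms] by (auto simp: Linf_def)
qed

lemma trig_continuous: "F \<subseteq> characters \<Longrightarrow> continuous_on UNIV (trig F (a :: _ \<Rightarrow> complex))"
  unfolding trig_def[abs_def] scaleC_complex_def
  by (intro continuous_intros) (use characterD(1) in blast)

lemma trig_Linf: "F \<subseteq> characters \<Longrightarrow> trig F (a :: _ \<Rightarrow> complex) \<in> Linf \<mu>"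
  by (intro continuous_Linf trig_continuous)

lemma S_trig:
  fixes a :: "('g \<Rightarrow> complex) \<Rightarrow> complex"
  assumes "finite F" "F \<subseteq> characters"
  shows "AE x in \<mu>. S (trig F a) x = trig F (\<lambda>\<xi>. \<phi> \<xi> *\<^sub>C a \<xi>) x"
  using assms
proof (induction F)
  case empty
  have z: "(\<lambda>x. 0) \<in> Linf \<mu>" by (intro continuous_Linf continuous_intros)
  from S_combination[OF z z, of 0 0] show ?case by (simp add: trig_def[abs_def])
next
  case (insert \<xi> F)
  have g: "\<xi> \<in> characters" and F: "F \<subseteq> characters" using insert.prems by auto
  have gL: "\<xi> \<in> Linf \<mu>" by (rule continuous_Linf[OF characterD(1)[OF g]])
  have eq: "trig (insert \<xi> F) a = (\<lambda>x. a \<xi> * \<xi> x + 1 * trig F a x)"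
    using insert.hyps by (simp add: trig_def fun_eq_iff scaleC_complex_def mult.commute)
  from S_combination[OF gL trig_Linf[OF F], of "a \<xi>" 1 a] symbol[OF g] insert.IH[OF F]
  show ?case unfolding eq
  proof eventually_elim
    case (elim x)
    then show ?case using insert.hyps by (simp add: trig_def scaleC_complex_def mult_ac)
  qed
qed

text \<open>
  Trigonometric polynomials are continuous and nonempty open sets have positive measure, so that an
  essential bound holds at the neutral element, too.
\<close>

lemma symbol_sup_dominated: "sup_dominated \<phi>"
  unfolding sup_dominated_def
proof (intro allI impI)
  fix F and a :: "('g \<Rightarrow> complex) \<Rightarrow> complex" and s :: real
  assume F: "finite F" "F \<subseteq> characters" and le: "\<forall>y. cmod (\<Sum>\<xi>\<in>F. a \<xi> * \<xi> y) \<le> s"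
  have s: "s \<ge> 0" using le[rule_format, of 0] norm_ge_zero order_trans by blast
  have "AE x in \<mu>. cmod (trig F a x) \<le> s" using le by (simp add: trig_def scaleC_complex_def mult.commute)
  from S_bound[OF trig_Linf[OF F(2)] s this] S_trig[OF F, of a]
  have ae: "AE x in \<mu>. cmod (trig F (\<lambda>\<xi>. \<phi> \<xi> *\<^sub>C a \<xi>) x) \<le> s" by eventually_elim simp
  have "cmod (trig F (\<lambda>\<xi>. \<phi> \<xi> *\<^sub>C a \<xi>) 0) \<le> s"
  proof (rule ccontr)
    assume n: "\<not> ?thesis"
    define V where "V = {x. s < cmod (trig F (\<lambda>\<xi>. \<phi> \<xi> *\<^sub>C a \<xi>) x)}"
    have o: "open V" unfolding V_def
      by (intro open_Collect_less continuous_intros trig_continuous F(2))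
    have "0 \<in> V" using n by (simp add: V_def)
    then have "V \<noteq> {}" by blast
    then have pos: "emeasure \<mu> V > 0" by (rule open_measure_pos[OF o])
    have "AE x in \<mu>. x \<notin> V" using ae by eventually_elim (simp add: V_def)
    then have "emeasure \<mu> V = 0" using AE_iff_measurable[of V \<mu> "\<lambda>x. x \<notin> V"] o by auto
    with pos show False by simp
  qed
  moreover have "trig F (\<lambda>\<xi>. \<phi> \<xi> *\<^sub>C a \<xi>) 0 = (\<Sum>\<xi>\<in>F. a \<xi> * \<phi> \<xi>)"
    unfolding trig_def by (rule sum.cong[OF refl]) (use character_0 F(2) in \<open>auto simp: scaleC_complex_def\<close>)
  ultimately show "cmod (\<Sum>\<xi>\<in>F. a \<xi> * \<phi> \<xi>) \<le> s" by simp
qed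

lemma cmod_symbol_le: assumes "\<xi> \<in> characters" shows "cmod (\<phi> \<xi>) \<le> 1"
  using symbol_sup_dominated[unfolded sup_dominated_def, rule_format, of "{\<xi>}" "\<lambda>_. 1" 1] assms characterD(3)[OF assms] by simp

lemma symbol_integral:
  assumes g: "\<xi> \<in> characters"
  shows "(\<integral>x. S \<xi> x * cnj (\<xi> x) \<partial>\<mu>) = \<phi> \<xi>"
proof -
  have c: "\<xi> x * cnj (\<xi> x) = 1" for x using characterD(3)[OF g, of x] complex_norm_square[of "\<xi> x"] by simp
  have m: "S \<xi> \<in> borel_measurable \<mu>" "\<xi> \<in> borel_measurable \<mu>"
    using Linf_measurable S_Linf continuous_Linf characterD(1)[OF g] by blast+
  have "(\<integral>x. S \<xi> x * cnj (\<xi> x) \<partial>\<mu>) = (\<integral>x. \<phi> \<xi> \<partial>\<mu>)"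
  proof (rule integral_cong_AE)
    show "AE x in \<mu>. S \<xi> x * cnj (\<xi> x) = \<phi> \<xi>" using symbol[OF g] by eventually_elim (simp add: c mult.assoc)
  qed (use m in measurable)
  then show ?thesis by simp
qed

lemma symbol_real:
  assumes g: "\<xi> \<in> characters"
  shows "cnj (\<phi> \<xi>) = \<phi> \<xi>"
proof -
  have gL: "\<xi> \<in> Linf \<mu>" by (rule continuous_Linf[OF characterD(1)[OF g]])
  have "(\<integral>x. S \<xi> x * cnj (\<xi> x) \<partial>\<mu>) = (\<integral>x. \<xi> x * cnj (S \<xi> x) \<partial>\<mu>)"
    using sa gL unfolding selfadjoint_def by blast
  also have "\<dots> = (\<integral>x. cnj (S \<xi> x * cnj (\<xi> x)) \<partial>\<mu>)" by (simp add: mult.commute)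
  also have "\<dots> = cnj (\<integral>x. S \<xi> x * cnj (\<xi> x) \<partial>\<mu>)" by (rule Bochner_Integration.integral_cnj)
  finally show ?thesis unfolding symbol_integral[OF g] by simp
qed

lemma Linf_integrable: assumes "f \<in> Linf \<mu>" shows "integrable \<mu> f"
proof -
  obtain C where "AE x in \<mu>. norm (f x) \<le> C" using assms by (auto simp: Linf_def)
  then show ?thesis by (rule integrable_const_bound) (rule Linf_measurable[OF assms])
qed

text \<open>
  Duality with \<open>g = sgn (S f)\<close>: \<open>\<integral>\<bar>S f\<bar> = \<integral> S f cnj g = \<integral> f cnj (S g)\<close> and \<open>\<bar>S g\<bar> \<le> 1\<close>.
\<close>

lemma S_L1_contraction:
  assumes f: "f \<in> Linf \<mu>"
  shows "(\<integral>x. cmod (S f x) \<partial>\<mu>) \<le> (\<integral>x. cmod (f x) \<partial>\<mu>)"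
proof -
  define g where "g x = sgn (S f x)" for x
  have mS: "S f \<in> borel_measurable \<mu>" by (rule Linf_measurable[OF S_Linf[OF f]])
  have gm: "g \<in> borel_measurable \<mu>" unfolding g_def[abs_def] sgn_div_norm using mS by measurable
  have g1: "cmod (g x) \<le> 1" for x by (simp add: g_def norm_sgn)
  have gL: "g \<in> Linf \<mu>" using gm g1 by (auto simp: Linf_def)
  have Sg: "AE x in \<mu>. cmod (S g x) \<le> 1" by (rule S_bound[OF gL]) (use g1 in auto)
  have mSg: "S g \<in> borel_measurable \<mu>" by (rule Linf_measurable[OF S_Linf[OF gL]])
  have "S f x * cnj (g x) = of_real (cmod (S f x))" for x
  proof (cases "S f x = 0")
    case False
    then show ?thesis using complex_norm_square[of "S f x"]
      by (simp add: g_def sgn_div_norm scaleR_conv_of_real divide_inverse[symmetric] nonzero_divide_eq_eq mult.assoc[symmetric] mult.commute power2_eq_square)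
  qed (simp add: g_def)
  then have "of_real (\<integral>x. cmod (S f x) \<partial>\<mu>) = (\<integral>x. S f x * cnj (g x) \<partial>\<mu>)"
    by (simp only: integral_complex_of_real)
  also have "\<dots> = (\<integral>x. f x * cnj (S g x) \<partial>\<mu>)" using sa f gL unfolding selfadjoint_def by blast
  finally have eq: "complex_of_real (\<integral>x. cmod (S f x) \<partial>\<mu>) = (\<integral>x. f x * cnj (S g x) \<partial>\<mu>)" .
  have "(\<integral>x. cmod (S f x) \<partial>\<mu>) = cmod (complex_of_real (\<integral>x. cmod (S f x) \<partial>\<mu>))" by simp
  also have "\<dots> \<le> (\<integral>x. cmod (f x * cnj (S g x)) \<partial>\<mu>)" unfolding eq by (rule integral_norm_bound)
  also have "\<dots> \<le> (\<integral>x. cmod (f x) \<partial>\<mu>)"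
  proof (rule integral_mono_AE)
    have le: "AE x in \<mu>. cmod (f x * cnj (S g x)) \<le> cmod (f x)" using Sg
      by eventually_elim (simp add: norm_mult mult_left_le)
    show "AE x in \<mu>. cmod (f x * cnj (S g x)) \<le> cmod (f x)" by (rule le)
    show i: "integrable \<mu> (\<lambda>x. cmod (f x))" using Linf_integrable[OF f] by simp
    have m: "(\<lambda>x. cmod (f x * cnj (S g x))) \<in> borel_measurable \<mu>"
      using Linf_measurable[OF f] mSg by measurable
    show "integrable \<mu> (\<lambda>x. cmod (f x * cnj (S g x)))"
      by (rule Bochner_Integration.integrable_bound[OF i m]) (use le in simp)
  qed
  finally show ?thesis .
qed

text \<open>
  A bounded function need not be a uniform limit of polynomials; the comparison of \<open>S f\<close> with the
  images of polynomials uses that \<open>S\<close> is a contraction for the \<open>L\<^sup>1\<close> norm, which is weaker than the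
  \<open>L\<^sup>p\<close> norm.
\<close>

lemma S_extends:
  fixes f g :: "'g \<Rightarrow> complex"
  assumes p: "p \<ge> 1" and f: "f \<in> Linf \<mu>" and e: "extends p \<phi> f g"
  shows "AE x in \<mu>. S f x = g x"
proof -
  have fL: "f \<in> Lp \<mu> p" and gL: "g \<in> Lp \<mu> p" using extendsD[OF e] .
  have iS: "integrable \<mu> (S f)" by (rule Linf_integrable[OF S_Linf[OF f]])
  have gsm: "g \<in> borel_measurable \<mu>"
  proof -
    obtain s where s: "\<And>n. simple_function \<mu> (s n)" "\<And>x. x \<in> space \<mu> \<Longrightarrow> (\<lambda>n. s n x) \<longlonglongrightarrow> g x"
      using LpD(1)[OF gL] unfolding strongly_measurable_def by blast
    show ?thesis by (rule borel_measurable_LIMSEQ_metric[OF borel_measurable_simple_function[OF s(1)] s(2)])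
  qed
  have ig: "integrable \<mu> g"
    using integral_norm_le_Lp_norm(1)[OF prob_space_haar p gL] gsm by (simp add: integrable_norm_iff)
  have le: "(\<integral>x. cmod (S f x - g x) \<partial>\<mu>) \<le> 0"
  proof (rule field_le_epsilon)
    fix d :: real assume "d > 0"
    then have d2: "d / 2 > 0" by simp
    obtain F v where F: "finite F" "F \<subseteq> characters" and lt: "Lp_norm \<mu> p (\<lambda>x. f x - trig F v x) < d / 2"
      "Lp_norm \<mu> p (\<lambda>x. g x - trig F (\<lambda>\<xi>. \<phi> \<xi> *\<^sub>C v \<xi>) x) < d / 2"
      by (rule extends_approx[OF e d2])
    let ?P = "trig F v" and ?Q = "trig F (\<lambda>\<xi>. \<phi> \<xi> *\<^sub>C v \<xi>)"
    have PL: "?P \<in> Linf \<mu>" "?Q \<in> Linf \<mu>" by (intro trig_Linf F(2))+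
    have D: "(\<lambda>x. 1 * f x + (-1) * ?P x) \<in> Linf \<mu>" by (rule Linf_combination[OF f PL(1)])
    have a1: "(\<integral>x. cmod (S f x - ?Q x) \<partial>\<mu>) < d / 2"
    proof -
      have "(\<integral>x. cmod (S f x - ?Q x) \<partial>\<mu>) = (\<integral>x. cmod (S (\<lambda>x. 1 * f x + (-1) * ?P x) x) \<partial>\<mu>)"
      proof (rule integral_cong_AE)
        show "AE x in \<mu>. cmod (S f x - ?Q x) = cmod (S (\<lambda>x. 1 * f x + (-1) * ?P x) x)"
          using S_combination[OF f PL(1), of 1 "-1"] S_trig[OF F, of v] by eventually_elim simp
        show "(\<lambda>x. cmod (S f x - ?Q x)) \<in> borel_measurable \<mu>"
          using Linf_measurable[OF S_Linf[OF f]] Linf_measurable[OF PL(2)] by measurable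
        show "(\<lambda>x. cmod (S (\<lambda>x. 1 * f x + (-1) * ?P x) x)) \<in> borel_measurable \<mu>"
          using Linf_measurable[OF S_Linf[OF D]] by measurable
      qed
      also have "\<dots> \<le> (\<integral>x. cmod (1 * f x + (-1) * ?P x) \<partial>\<mu>)" by (rule S_L1_contraction[OF D])
      also have "\<dots> = (\<integral>x. cmod (f x - ?P x) \<partial>\<mu>)" by simp
      also have "\<dots> \<le> Lp_norm \<mu> p (\<lambda>x. f x - ?P x)"
        by (rule integral_norm_le_Lp_norm(2)[OF prob_space_haar p Lp_diff(1)[OF p fL trig_Lp(1)[OF F(2) p]]])
      finally show ?thesis using lt(1) by simp
    qed
    have a2: "(\<integral>x. cmod (g x - ?Q x) \<partial>\<mu>) < d / 2"
      by (rule order_le_less_trans[OF integral_norm_le_Lp_norm(2)[OF prob_space_haar p Lp_diff(1)[OF p gL trig_Lp(1)[OF F(2) p]]] lt(2)])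
    have iQ: "integrable \<mu> ?Q" by (rule Linf_integrable[OF PL(2)])
    have "(\<integral>x. cmod (S f x - g x) \<partial>\<mu>) \<le> (\<integral>x. cmod (S f x - ?Q x) + cmod (g x - ?Q x) \<partial>\<mu>)"
    proof (rule integral_mono)
      show "cmod (S f x - g x) \<le> cmod (S f x - ?Q x) + cmod (g x - ?Q x)" for x
        using norm_triangle_ineq4[of "S f x - ?Q x" "g x - ?Q x"] by simp
    qed (use iS ig iQ in auto)
    also have "\<dots> = (\<integral>x. cmod (S f x - ?Q x) \<partial>\<mu>) + (\<integral>x. cmod (g x - ?Q x) \<partial>\<mu>)"
      by (rule Bochner_Integration.integral_add) (use iS ig iQ in auto)
    finally show "(\<integral>x. cmod (S f x - g x) \<partial>\<mu>) \<le> 0 + d" using a1 a2 by linarith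
  qed
  have "(\<integral>x. cmod (S f x - g x) \<partial>\<mu>) = 0" using le by (intro antisym integral_nonneg_AE) auto
  then have "AE x in \<mu>. cmod (S f x - g x) = 0"
    using integral_nonneg_eq_0_iff_AE[of \<mu> "\<lambda>x. cmod (S f x - g x)"] iS ig by simp
  then show ?thesis by eventually_elim simp
qed

end


section \<open>Semigroups of Fourier multipliers\<close>

context compact_haar_group
begin

lemma extends_zero: "p > 0 \<Longrightarrow> extends p \<psi> (\<lambda>x. 0) (\<lambda>x. 0)"
  unfolding extends_def by (auto intro!: exI[of _ "{}"] Lp_zero(1) simp: trig_def Lp_zero(2))

lemma extends_cong:
  assumes e: "extends p \<psi> f g" and eq: "\<And>\<xi>. \<xi> \<in> characters \<Longrightarrow> \<psi> \<xi> = \<psi>' \<xi>"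
  shows "extends p \<psi>' f g"
  unfolding extends_def
proof (intro conjI allI impI extendsD[OF e])
  fix d :: real assume "d > 0"
  then obtain F v where F: "finite F" "F \<subseteq> characters" "Lp_norm \<mu> p (\<lambda>x. f x - trig F v x) < d"
    "Lp_norm \<mu> p (\<lambda>x. g x - trig F (\<lambda>\<xi>. \<psi> \<xi> *\<^sub>C v \<xi>) x) < d" by (rule extends_approx[OF e])
  have "trig F (\<lambda>\<xi>. \<psi> \<xi> *\<^sub>C v \<xi>) = trig F (\<lambda>\<xi>. \<psi>' \<xi> *\<^sub>C v \<xi>)"
    unfolding trig_def using F(2) eq by (intro ext sum.cong refl) (auto simp: subset_iff)
  with F show "\<exists>F v. finite F \<and> F \<subseteq> characters \<and> Lp_norm \<mu> p (\<lambda>x. f x - trig F v x) < d \<and> Lp_norm \<mu> p (\<lambda>x. g x - trig F (\<lambda>\<xi>. \<psi>' \<xi> *\<^sub>C v \<xi>) x) < d"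
    by (intro exI[of _ F] exI[of _ v]) simp
qed

lemma Lp_scaleC_vector:
  fixes f :: "'g \<Rightarrow> complex" and v :: "'y::complex_banach"
  assumes "f \<in> Lp \<mu> p" shows "(\<lambda>x. f x *\<^sub>C v) \<in> Lp \<mu> p"
proof (rule LpI)
  show "strongly_measurable \<mu> (\<lambda>x. f x *\<^sub>C v)" by (rule strongly_measurable_scaleC_vector[OF LpD(1)[OF assms]])
  show "integrable \<mu> (\<lambda>x. norm (f x *\<^sub>C v) powr p)"
    unfolding norm_scaleC using LpD(2)[OF assms] by (simp add: powr_mult)
qed

lemma Lp_norm_scaleC_vector:
  fixes f :: "'g \<Rightarrow> complex" and v :: "'y::complex_banach"
  assumes "p > 0" "f \<in> Lp \<mu> p" shows "Lp_norm \<mu> p (\<lambda>x. f x *\<^sub>C v) = norm v * Lp_norm \<mu> p f"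
proof -
  have "Lp_norm \<mu> p (\<lambda>x. f x *\<^sub>C v) = Lp_norm \<mu> p (\<lambda>x. complex_of_real (norm v) *\<^sub>C f x)"
    unfolding Lp_norm_def by (simp add: norm_scaleC mult.commute)
  also have "\<dots> = norm v * Lp_norm \<mu> p f" by (simp add: Lp_scaleC(2)[OF assms])
  finally show ?thesis .
qed

text \<open>
  Tensoring with \<open>y\<close> takes polynomials to polynomials and multiplies all norms by \<open>norm y\<close>.
\<close>

lemma extends_tensor:
  fixes f g :: "'g \<Rightarrow> complex" and y :: "'y::complex_banach"
  assumes p: "p \<ge> 1" and e: "extends p \<psi> f g"
  shows "extends p \<psi> (\<lambda>x. f x *\<^sub>C y) (\<lambda>x. g x *\<^sub>C y)"
  unfolding extends_def
proof (intro conjI allI impI Lp_scaleC_vector extendsD[OF e])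
  fix d :: real assume d: "d > 0"
  have p0: "p > 0" using p by simp
  have "d / (norm y + 1) > 0" using d by (simp add: add_nonneg_pos)
  then obtain F v where F: "finite F" "F \<subseteq> characters" "Lp_norm \<mu> p (\<lambda>x. f x - trig F v x) < d / (norm y + 1)"
    "Lp_norm \<mu> p (\<lambda>x. g x - trig F (\<lambda>\<xi>. \<psi> \<xi> *\<^sub>C v \<xi>) x) < d / (norm y + 1)" by (rule extends_approx[OF e])
  have *: "Lp_norm \<mu> p (\<lambda>x. h x *\<^sub>C y - trig F (\<lambda>\<xi>. c \<xi> *\<^sub>C y) x) < d"
    if h: "h \<in> Lp \<mu> p" and lt: "Lp_norm \<mu> p (\<lambda>x. h x - trig F c x) < d / (norm y + 1)" for h c
  proof -
    let ?n = "Lp_norm \<mu> p (\<lambda>x. h x - trig F c x)"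
    have "Lp_norm \<mu> p (\<lambda>x. h x *\<^sub>C y - trig F (\<lambda>\<xi>. c \<xi> *\<^sub>C y) x) = Lp_norm \<mu> p (\<lambda>x. (h x - trig F c x) *\<^sub>C y)"
      by (simp only: trig_scalar_times_vector scaleC_diff_left)
    also have "\<dots> = norm y * ?n" by (rule Lp_norm_scaleC_vector[OF p0 Lp_diff(1)[OF p h trig_Lp(1)[OF F(2) p]]])
    also have "\<dots> \<le> (norm y + 1) * ?n" by (intro mult_right_mono Lp_norm_nonneg) simp
    also have "\<dots> < d" using lt by (simp add: pos_less_divide_eq add_nonneg_pos mult.commute)
    finally show ?thesis .
  qed
  have s: "(\<lambda>\<xi>. \<psi> \<xi> *\<^sub>C v \<xi> *\<^sub>C y) = (\<lambda>\<xi>. (\<psi> \<xi> *\<^sub>C v \<xi>) *\<^sub>C y)" by (simp add: scaleC_scaleC scaleC_complex_def)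
  show "\<exists>F v. finite F \<and> F \<subseteq> characters \<and> Lp_norm \<mu> p (\<lambda>x. f x *\<^sub>C y - trig F v x) < d \<and>
      Lp_norm \<mu> p (\<lambda>x. g x *\<^sub>C y - trig F (\<lambda>\<xi>. \<psi> \<xi> *\<^sub>C v \<xi>) x) < d"
    by (intro exI[of _ F] exI[of _ "\<lambda>\<xi>. v \<xi> *\<^sub>C y"] conjI F(1,2) *[OF extendsD(1)[OF e] F(3)], unfold s, rule *[OF extendsD(2)[OF e] F(4)])
qed

end

context Lp_fourier
begin

lemma extends_sum:
  fixes f g :: "nat \<Rightarrow> 'g \<Rightarrow> 'x"
  assumes "\<And>k. k < n \<Longrightarrow> extends p \<psi> (f k) (g k)"
  shows "extends p \<psi> (\<lambda>x. \<Sum>k<n. f k x) (\<lambda>x. \<Sum>k<n. g k x)"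
  using assms
proof (induction n)
  case 0
  show ?case by (simp add: extends_zero[OF p0])
next
  case (Suc n)
  have "extends p \<psi> (\<lambda>x. 1 *\<^sub>C (\<Sum>k<n. f k x) + 1 *\<^sub>C f n x) (\<lambda>x. 1 *\<^sub>C (\<Sum>k<n. g k x) + 1 *\<^sub>C g n x)"
    by (rule extends_combination) (use Suc in auto)
  then show ?case by (simp add: scaleC_one)
qed

lemma extends_AE_unique:
  fixes f g g' :: "'g \<Rightarrow> 'x"
  assumes a: "extends p \<psi> f g" and b: "extends p \<psi> f g'" and B: "mb \<psi> B" "B \<ge> 0"
  shows "AE x in \<mu>. g x = g' x"
proof -
  from Lp_norm_zero_AE[OF p0 Lp_diff(1)[OF p extendsD(2)[OF a] extendsD(2)[OF b]] extends_unique[OF assms]]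
  show ?thesis by eventually_elim simp
qed

text \<open>
  On polynomials the continuity is that of finitely many scalars, and the contractions are
  equicontinuous.
\<close>

lemma multiplier_op_strongly_continuous:
  assumes c: "\<And>t. t \<ge> 0 \<Longrightarrow> mb (\<psi> t) 1" and cont: "\<And>\<xi>. \<xi> \<in> characters \<Longrightarrow> continuous_on {0..} (\<lambda>t::real. \<psi> t \<xi>)"
    and f: "f \<in> L"
  shows "norm_continuous_on N {0..} (\<lambda>t. multiplier_op p (\<psi> t) f)"
  unfolding norm_continuous_on_def
proof
  fix z :: real assume z: "z \<in> {0..}"
  show "((\<lambda>w. N (multiplier_op p (\<psi> w) f - multiplier_op p (\<psi> z) f)) \<longlongrightarrow> 0) (at z within {0..})"
  proof (rule tendstoI)
    fix e :: real assume "e > 0"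
    then have e3: "e / 3 > 0" by simp
    obtain F v where F: "finite F" "F \<subseteq> characters" and lt: "N (\<lambda>x. f x - trig F v x) < e / 3"
      by (rule trig_dense[OF p f e3])
    have b: "N (\<lambda>x. multiplier_op p (\<psi> w) f x - trig F (\<lambda>\<xi>. \<psi> w \<xi> *\<^sub>C v \<xi>) x) < e / 3" if "w \<ge> 0" for w
      using extends_bound[OF extends_multiplier_op[OF c[OF that] zero_le_one f] c[OF that] zero_le_one F, of v] lt by simp
    have "((\<lambda>w. trig_norm p F (\<lambda>\<xi>. (\<psi> w \<xi> - \<psi> z \<xi>) *\<^sub>C v \<xi>)) \<longlongrightarrow> trig_norm p F (\<lambda>\<xi>. 0::'x)) (at z within {0..})"
    proof (rule nu_tendsto[OF F])
      fix \<xi> assume "\<xi> \<in> F"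
      then have "((\<lambda>t. \<psi> t \<xi>) \<longlongrightarrow> \<psi> z \<xi>) (at z within {0..})" using cont F(2) z by (auto simp: continuous_on_def)
      then have "((\<lambda>w. \<psi> w \<xi> - \<psi> z \<xi>) \<longlongrightarrow> 0) (at z within {0..})" by (rule LIM_zero)
      from bounded_bilinear.tendsto[OF bounded_bilinear_scaleC this tendsto_const, of "v \<xi>"]
      show "((\<lambda>w. (\<psi> w \<xi> - \<psi> z \<xi>) *\<^sub>C v \<xi>) \<longlongrightarrow> 0) (at z within {0..})" by simp
    qed
    then have "((\<lambda>w. trig_norm p F (\<lambda>\<xi>. (\<psi> w \<xi> - \<psi> z \<xi>) *\<^sub>C v \<xi>)) \<longlongrightarrow> 0) (at z within {0..})" by (simp only: nu_zero[OF F])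
    from order_tendstoD(2)[OF this e3] have "\<forall>\<^sub>F w in at z within {0..}. trig_norm p F (\<lambda>\<xi>. (\<psi> w \<xi> - \<psi> z \<xi>) *\<^sub>C v \<xi>) < e / 3" .
    moreover have "\<forall>\<^sub>F w in at z within {0..}. w \<in> {0..}" by (simp add: eventually_at_filter)
    ultimately show "\<forall>\<^sub>F w in at z within {0..}. dist (N (multiplier_op p (\<psi> w) f - multiplier_op p (\<psi> z) f)) 0 < e"
    proof eventually_elim
      case (elim w)
      have w: "w \<ge> 0" and z0: "z \<ge> 0" using elim z by auto
      note Lw = extendsD(2)[OF extends_multiplier_op[OF c[OF w] zero_le_one f]]
        and Lz = extendsD(2)[OF extends_multiplier_op[OF c[OF z0] zero_le_one f]]
      let ?P = "\<lambda>w. trig F (\<lambda>\<xi>. \<psi> w \<xi> *\<^sub>C v \<xi>)"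
      note tF = trig_Lp(1)[OF F(2) p]
      have "N (\<lambda>x. multiplier_op p (\<psi> w) f x - multiplier_op p (\<psi> z) f x) \<le>
         N (\<lambda>x. multiplier_op p (\<psi> w) f x - ?P w x) + N (\<lambda>x. ?P w x - multiplier_op p (\<psi> z) f x)"
        by (rule Lp_triangle[OF p Lw tF Lz])
      also have "N (\<lambda>x. ?P w x - multiplier_op p (\<psi> z) f x) \<le> N (\<lambda>x. ?P w x - ?P z x) + N (\<lambda>x. ?P z x - multiplier_op p (\<psi> z) f x)"
        by (rule Lp_triangle[OF p tF tF Lz])
      also have "N (\<lambda>x. ?P z x - multiplier_op p (\<psi> z) f x) = N (\<lambda>x. multiplier_op p (\<psi> z) f x - ?P z x)" by (rule Lp_norm_commute)
      also have "(\<lambda>x. ?P w x - ?P z x) = trig F (\<lambda>\<xi>. (\<psi> w \<xi> - \<psi> z \<xi>) *\<^sub>C v \<xi>)"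
        by (simp add: trig_def fun_eq_iff scaleC_diff_left scaleC_diff_right sum_subtractf)
      finally have "N (\<lambda>x. multiplier_op p (\<psi> w) f x - multiplier_op p (\<psi> z) f x) < e"
        using b[OF w] b[OF z0] elim(1) by linarith
      then show ?case using Lp_norm_nonneg[of \<mu> p "\<lambda>x. multiplier_op p (\<psi> w) f x - multiplier_op p (\<psi> z) f x"]
        by (simp add: fun_diff_def)
    qed
  qed
qed

lemma multiplier_op_semigroup:
  assumes c: "\<And>t. t \<ge> 0 \<Longrightarrow> mb (\<psi> t) 1" and cont: "\<And>\<xi>. \<xi> \<in> characters \<Longrightarrow> continuous_on {0..} (\<lambda>t::real. \<psi> t \<xi>)"
    and one: "\<And>\<xi>. \<xi> \<in> characters \<Longrightarrow> \<psi> 0 \<xi> = 1"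
    and mult: "\<And>s t \<xi>. s \<ge> 0 \<Longrightarrow> t \<ge> 0 \<Longrightarrow> \<xi> \<in> characters \<Longrightarrow> \<psi> (s + t) \<xi> = \<psi> s \<xi> * \<psi> t \<xi>"
  shows "strongly_continuous_semigroup L N (\<lambda>t. multiplier_op p (\<psi> t))"
  unfolding strongly_continuous_semigroup_def operator_semigroup_def
proof (intro conjI allI impI ballI)
  fix t :: real assume t: "t \<ge> 0"
  show "multiplier_op p (\<psi> t) \<in> bounded_ops L N" by (rule multiplier_op_bounded[OF c[OF t] zero_le_one])
next
  fix f assume f: "f \<in> L"
  show "norm_continuous_on N {0..} (\<lambda>t. multiplier_op p (\<psi> t) f)" by (rule multiplier_op_strongly_continuous[OF c cont f])
  have "extends p (\<psi> 0) f f" by (rule extends_cong[OF extends_identity[OF f]]) (simp add: one)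
  from extends_unique[OF extends_multiplier_op[OF c[OF order_refl] zero_le_one f] this c[OF order_refl] zero_le_one]
  show "N (multiplier_op p (\<psi> 0) f - f) = 0" by (simp only: fun_diff_def)
next
  fix s t :: real and f assume st: "s \<ge> 0" "t \<ge> 0" and f: "f \<in> L"
  have st0: "s + t \<ge> 0" using st by simp
  note et = extends_multiplier_op[OF c[OF st(2)] zero_le_one f]
  note es = extends_multiplier_op[OF c[OF st(1)] zero_le_one extendsD(2)[OF et]]
  have "extends p (\<psi> (s + t)) f (multiplier_op p (\<psi> s) (multiplier_op p (\<psi> t) f))"
    by (rule extends_cong[OF extends_compose[OF et c[OF st(2)] zero_le_one es c[OF st(1)] zero_le_one]]) (simp add: mult[OF st])
  from extends_unique[OF extends_multiplier_op[OF c[OF st0] zero_le_one f] this c[OF st0] zero_le_one]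
  show "N (multiplier_op p (\<psi> (s + t)) f - multiplier_op p (\<psi> s) (multiplier_op p (\<psi> t) f)) = 0" by (simp only: fun_diff_def)
qed

text \<open>
  The difference quotient minus the candidate for the derivative is itself a multiplier, so a bound on
  its symbol is a bound on the operator norm.
\<close>

lemma multiplier_op_holomorphic:
  assumes b: "\<And>z. z \<in> A \<Longrightarrow> \<exists>B. mb (\<psi> z) B" and b': "\<And>z. z \<in> A \<Longrightarrow> \<exists>B. mb (\<psi>' z) B"
    and d: "\<And>z. z \<in> A \<Longrightarrow> \<exists>\<delta>>0. \<exists>B. \<forall>w. w \<noteq> z \<longrightarrow> cmod (w - z) < \<delta> \<longrightarrow>
       mb (\<lambda>\<xi>. inverse (w - z) * (\<psi> w \<xi> - \<psi> z \<xi>) - \<psi>' z \<xi>) (B * cmod (w - z))"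
  shows "norm_holomorphic_on (bounded_ops L N) (bounded_ops_norm L N) A (\<lambda>z. multiplier_op p (\<psi> z))"
proof -
  have pos: "\<exists>B\<ge>0. mb h B" if "\<exists>B. mb h B" for h using that mb_mono[of h _ "max 0 _"] by (metis max.cobounded1 max.cobounded2)
  show ?thesis
    unfolding norm_holomorphic_on_def
  proof (intro conjI ballI)
    fix z assume z: "z \<in> A"
    obtain B where B: "B \<ge> 0" "mb (\<psi> z) B" using pos[OF b[OF z]] by blast
    show "multiplier_op p (\<psi> z) \<in> bounded_ops L N" by (rule multiplier_op_bounded[OF B(2,1)])
    obtain B' where B': "B' \<ge> 0" "mb (\<psi>' z) B'" using pos[OF b'[OF z]] by blast
    obtain \<delta> C where \<delta>: "\<delta> > 0" and C: "\<And>w. w \<noteq> z \<Longrightarrow> cmod (w - z) < \<delta> \<Longrightarrow>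
       mb (\<lambda>\<xi>. inverse (w - z) * (\<psi> w \<xi> - \<psi> z \<xi>) - \<psi>' z \<xi>) (C * cmod (w - z))" using d[OF z] by blast
    let ?Q = "\<lambda>w. inverse (w - z) *\<^sub>C (multiplier_op p (\<psi> w) - multiplier_op p (\<psi> z)) - multiplier_op p (\<psi>' z)"
    have est: "\<bar>bounded_ops_norm L N (?Q w)\<bar> \<le> \<bar>C\<bar> * cmod (w - z)" if w: "w \<in> A" "w \<noteq> z" "cmod (w - z) < \<delta>" for w
    proof -
      obtain Bw where Bw: "Bw \<ge> 0" "mb (\<psi> w) Bw" using pos[OF b[OF w(1)]] by blast
      have nn: "\<bar>C\<bar> * cmod (w - z) \<ge> 0" by simp
      have m: "mb (\<lambda>\<xi>. inverse (w - z) * (\<psi> w \<xi> - \<psi> z \<xi>) - \<psi>' z \<xi>) (\<bar>C\<bar> * cmod (w - z))"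
        by (rule mb_mono[OF C[OF w(2,3)]]) (simp add: mult_right_mono)
      have "N (?Q w f) \<le> \<bar>C\<bar> * cmod (w - z) * N f" if f: "f \<in> L" for f
      proof -
        note ew = extends_multiplier_op[OF Bw(2,1) f] and ez = extends_multiplier_op[OF B(2,1) f] and ed = extends_multiplier_op[OF B'(2,1) f]
        let ?i = "inverse (w - z)"
        note e1 = extends_symbol_combination[OF ew Bw(2,1) ez B(2,1), of ?i "- ?i"]
        have m1: "mb (\<lambda>\<xi>. ?i * \<psi> w \<xi> + - ?i * \<psi> z \<xi>) (cmod ?i * Bw + cmod (- ?i) * B)"
          by (rule mb_add[OF mb_cmult[OF Bw(2)] mb_cmult[OF B(2)]])
        have n1: "cmod ?i * Bw + cmod (- ?i) * B \<ge> 0" using Bw(1) B(1) by simp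
        note e2 = extends_symbol_combination[OF e1 m1 n1 ed B'(2,1), of 1 "-1"]
        have e3: "extends p (\<lambda>\<xi>. ?i * (\<psi> w \<xi> - \<psi> z \<xi>) - \<psi>' z \<xi>) f
          (\<lambda>x. 1 *\<^sub>C (?i *\<^sub>C multiplier_op p (\<psi> w) f x + - ?i *\<^sub>C multiplier_op p (\<psi> z) f x) + - 1 *\<^sub>C multiplier_op p (\<psi>' z) f x)"
          by (rule extends_cong[OF e2]) (simp add: right_diff_distrib)
        have "?Q w f = (\<lambda>x. 1 *\<^sub>C (?i *\<^sub>C multiplier_op p (\<psi> w) f x + - ?i *\<^sub>C multiplier_op p (\<psi> z) f x) + - 1 *\<^sub>C multiplier_op p (\<psi>' z) f x)"
          by (simp only: fun_eq_iff fun_diff_def scaleC_fun_def scaleC_minus_left scaleC_one scaleC_diff_right) simp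
        then show ?thesis using extends_norm[OF e3 m nn] by (simp only:)
      qed
      from bounded_ops_norm_bounds[where S = "?Q w", OF this nn] show ?thesis by (simp only: abs_of_nonneg)
    qed
    show "\<exists>D\<in>bounded_ops L N. ((\<lambda>w. bounded_ops_norm L N (inverse (w - z) *\<^sub>C (multiplier_op p (\<psi> w) - multiplier_op p (\<psi> z)) - D)) \<longlongrightarrow> 0) (at z within A)"
    proof (rule bexI[OF _ multiplier_op_bounded[OF B'(2,1)]])
      have ev: "\<forall>\<^sub>F w in at z within A. norm (bounded_ops_norm L N (?Q w)) \<le> \<bar>C\<bar> * cmod (w - z)"
        unfolding eventually_at by (rule exI[of _ \<delta>]) (use \<delta> est in \<open>auto simp: dist_norm\<close>)
      have "((\<lambda>w. \<bar>C\<bar> * cmod (w - z)) \<longlongrightarrow> \<bar>C\<bar> * cmod (z - z)) (at z within A)" by (intro tendsto_intros)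
      then have "((\<lambda>w. \<bar>C\<bar> * cmod (w - z)) \<longlongrightarrow> 0) (at z within A)" by simp
      from Lim_null_comparison[OF ev this] show "((\<lambda>w. bounded_ops_norm L N (?Q w)) \<longlongrightarrow> 0) (at z within A)" .
    qed
  qed
qed

end

text \<open>
  The symbol at \<open>\<xi>\<close> is \<open>\<integral> T\<^sub>t \<xi> cnj \<xi>\<close>, a weak\<open>*\<close> continuous function of \<open>t\<close> that is real, bounded by
  1 and multiplicative in \<open>t\<close>.
\<close>

lemma (in compact_haar_group) semigroup_symbol:
  assumes ws: "weak_star_semigroup \<mu> T" and fm: "\<And>t. 0 \<le> t \<Longrightarrow> fourier_multiplier \<mu> (T t)"
    and con: "\<And>t. 0 \<le> t \<Longrightarrow> contraction_op (Linf \<mu>) (Linf_norm \<mu>) (T t)" and sa: "\<And>t. 0 \<le> t \<Longrightarrow> selfadjoint \<mu> (T t)"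
  obtains a where "\<And>\<xi>. \<xi> \<in> characters \<Longrightarrow> a \<xi> \<ge> 0"
    "\<And>t. t \<ge> 0 \<Longrightarrow> selfadjoint_multiplier \<mu> (T t) (\<lambda>\<xi>. exp (- complex_of_real (t * a \<xi>)))"
proof -
  have "\<forall>t. \<exists>\<phi>. 0 \<le> t \<longrightarrow> (\<forall>\<xi>\<in>characters. AE x in \<mu>. T t \<xi> x = \<phi> \<xi> * \<xi> x)"
    using fm unfolding fourier_multiplier_def by blast
  from choice[OF this] obtain \<phi> where \<phi>: "\<forall>t. 0 \<le> t \<longrightarrow> (\<forall>\<xi>\<in>characters. AE x in \<mu>. T t \<xi> x = \<phi> t \<xi> * \<xi> x)" ..
  have sm: "selfadjoint_multiplier \<mu> (T t) (\<phi> t)" if "t \<ge> 0" for t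
    by (intro selfadjoint_multiplier.intro selfadjoint_multiplier_axioms.intro compact_haar_group_axioms con sa that) (use \<phi> that in blast)
  have "\<exists>a\<ge>0. \<forall>t\<ge>0. \<phi> t \<xi> = exp (- complex_of_real (t * a))" if g: "\<xi> \<in> characters" for \<xi> :: "'g \<Rightarrow> complex"
  proof -
    have gne: "\<xi> x \<noteq> 0" for x using characterD(3)[OF g, of x] by auto
    have gL: "\<xi> \<in> Linf \<mu>" by (rule selfadjoint_multiplier.continuous_Linf[OF sm[OF order_refl] characterD(1)[OF g]])
    have re: "\<phi> t \<xi> = of_real (Re (\<phi> t \<xi>))" if "t \<ge> 0" for t
      using selfadjoint_multiplier.symbol_real[OF sm[OF that] g] by (simp add: complex_eq_iff)
    have minus: "(\<lambda>x. h x - k x) \<in> Linf \<mu>" if "h \<in> Linf \<mu>" "k \<in> Linf \<mu>" for h k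
      using Linf_combination[OF that, of 1 "-1"] by simp
    have T_Linf: "T t f \<in> Linf \<mu>" if "t \<ge> 0" "f \<in> Linf \<mu>" for t f
      by (rule selfadjoint_multiplier.S_Linf[OF sm[OF that(1)] that(2)])
    have os: "operator_semigroup (Linf \<mu>) (Linf_norm \<mu>) T" using ws by (simp add: weak_star_semigroup_def)
    have one: "\<phi> 0 \<xi> = 1"
    proof -
      have "Linf_norm \<mu> (T 0 \<xi> - \<xi>) = 0" using os gL by (simp add: operator_semigroup_def)
      from Linf_norm_zero_AE[OF minus[OF T_Linf[OF order_refl gL] gL] this[unfolded fun_diff_def]]
      have "AE x in \<mu>. T 0 \<xi> x = \<xi> x" by eventually_elim simp
      moreover have "AE x in \<mu>. T 0 \<xi> x = \<phi> 0 \<xi> * \<xi> x" using \<phi> g by blast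
      ultimately have "AE x in \<mu>. \<phi> 0 \<xi> = 1" by eventually_elim (use gne in simp)
      then show ?thesis by simp
    qed
    have mult: "\<phi> (s + t) \<xi> = \<phi> s \<xi> * \<phi> t \<xi>" if st: "s \<ge> 0" "t \<ge> 0" for s t
    proof -
      have st0: "s + t \<ge> 0" using st by simp
      note TtL = T_Linf[OF st(2) gL]
      have "Linf_norm \<mu> (T (s + t) \<xi> - T s (T t \<xi>)) = 0" using os gL st by (simp add: operator_semigroup_def)
      from Linf_norm_zero_AE[OF minus[OF T_Linf[OF st0 gL] T_Linf[OF st(1) TtL]] this[unfolded fun_diff_def]]
      have 1: "AE x in \<mu>. T (s + t) \<xi> x = T s (T t \<xi>) x" by eventually_elim simp
      have cL: "(\<lambda>x. \<phi> t \<xi> * \<xi> x + 0 * \<xi> x) \<in> Linf \<mu>" by (rule Linf_combination[OF gL gL])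
      have 0: "AE x in \<mu>. T t \<xi> x = \<phi> t \<xi> * \<xi> x" "AE x in \<mu>. T s \<xi> x = \<phi> s \<xi> * \<xi> x" "AE x in \<mu>. T (s + t) \<xi> x = \<phi> (s + t) \<xi> * \<xi> x"
        using \<phi> g st st0 by blast+
      have eq: "AE x in \<mu>. T t \<xi> x = \<phi> t \<xi> * \<xi> x + 0 * \<xi> x" using 0(1) by simp
      note 2 = selfadjoint_multiplier.S_cong[OF sm[OF st(1)] TtL cL eq]
      note 3 = selfadjoint_multiplier.S_combination[OF sm[OF st(1)] gL gL, of "\<phi> t \<xi>" 0]
      from 1 2 3 0(2,3) have "AE x in \<mu>. \<phi> (s + t) \<xi> = \<phi> s \<xi> * \<phi> t \<xi>"
      proof eventually_elim
        case (elim x)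
        have "\<phi> (s + t) \<xi> * \<xi> x = (\<phi> s \<xi> * \<phi> t \<xi>) * \<xi> x"
          using elim(5)[symmetric] unfolding elim(1) elim(2) elim(3) elim(4) by (simp only: mult_ac) simp
        then show ?case using gne by simp
      qed
      then show ?thesis by simp
    qed
    have cont: "continuous_on {0..} (\<lambda>t. \<phi> t \<xi>)"
      unfolding continuous_map_iff_continuous[symmetric] continuous_map_def
    proof (intro conjI allI impI)
      fix U :: "complex set" assume U: "openin euclidean U"
      have i: "integrable \<mu> (\<lambda>x. cnj (\<xi> x))" by (rule continuous_integrable[OF characterD(1)[OF characters_cnj[OF g]]])
      have o: "openin (weak_star \<mu>) {f \<in> Linf \<mu>. (\<integral>x. f x * cnj (\<xi> x) \<partial>\<mu>) \<in> U}" (is "openin _ ?W")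
        unfolding weak_star_def openin_topology_generated_by_iff
        by (intro generate_topology_on.Basis CollectI exI[of _ "\<lambda>x. cnj (\<xi> x)"] exI[of _ U] conjI refl i) (use U in simp)
      have "continuous_map (top_of_set {0..}) (weak_star \<mu>) (\<lambda>t. T t \<xi>)" using ws gL by (simp add: weak_star_semigroup_def)
      from openin_continuous_map_preimage[OF this o]
      have "openin (top_of_set {0..}) {t \<in> topspace (top_of_set {0..}). T t \<xi> \<in> ?W}" .
      also have "{t \<in> topspace (top_of_set {0..}). T t \<xi> \<in> ?W} = {t \<in> topspace (top_of_set {0..}). \<phi> t \<xi> \<in> U}"
        using T_Linf[OF _ gL] selfadjoint_multiplier.symbol_integral[OF sm g] by auto
      finally show "openin (top_of_set {0..}) {t \<in> topspace (top_of_set {0..}). \<phi> t \<xi> \<in> U}" .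
    qed simp
    obtain a where a: "a \<ge> 0" "\<And>t. t \<ge> 0 \<Longrightarrow> Re (\<phi> t \<xi>) = exp (- (t * a))"
    proof (rule continuous_multiplicative_exp[of "\<lambda>t. Re (\<phi> t \<xi>)"])
      show "Re (\<phi> 0 \<xi>) = 1" by (simp add: one)
      fix s t :: real assume st: "s \<ge> 0" "t \<ge> 0"
      show "Re (\<phi> (s + t) \<xi>) = Re (\<phi> s \<xi>) * Re (\<phi> t \<xi>)"
        unfolding mult[OF st] by (subst re[OF st(1)], subst re[OF st(2)]) simp
    next
      show "continuous_on {0..} (\<lambda>t. Re (\<phi> t \<xi>))" by (intro continuous_intros cont)
      fix t :: real assume "t \<ge> 0"
      from selfadjoint_multiplier.cmod_symbol_le[OF sm[OF this] g] show "Re (\<phi> t \<xi>) \<le> 1" using complex_Re_le_cmod order_trans by blast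
    qed blast
    show ?thesis
    proof (intro exI[of _ a] conjI allI impI a(1))
      fix t :: real assume t: "t \<ge> 0"
      show "\<phi> t \<xi> = exp (- complex_of_real (t * a))" by (subst re[OF t]) (simp only: a(2)[OF t] exp_of_real of_real_minus[symmetric])
    qed
  qed
  then have "\<forall>\<xi>. \<exists>a. \<xi> \<in> characters \<longrightarrow> a \<ge> 0 \<and> (\<forall>t\<ge>0. \<phi> t \<xi> = exp (- complex_of_real (t * a)))" by blast
  from choice[OF this] obtain a where a: "\<forall>\<xi>. \<xi> \<in> characters \<longrightarrow> a \<xi> \<ge> 0 \<and> (\<forall>t\<ge>0. \<phi> t \<xi> = exp (- complex_of_real (t * a \<xi>)))" ..
  show thesis
  proof (rule that[of a])
    show "a \<xi> \<ge> 0" if "\<xi> \<in> characters" for \<xi> using a that by blast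
    fix t :: real assume t: "t \<ge> 0"
    show "selfadjoint_multiplier \<mu> (T t) (\<lambda>\<xi>. exp (- complex_of_real (t * a \<xi>)))"
    proof (intro selfadjoint_multiplier.intro selfadjoint_multiplier_axioms.intro compact_haar_group_axioms con sa t)
      fix \<xi> :: "'g \<Rightarrow> complex" assume g: "\<xi> \<in> characters"
      then have "\<phi> t \<xi> = exp (- complex_of_real (t * a \<xi>))" using a t by blast
      with \<phi> t g show "AE x in \<mu>. T t \<xi> x = exp (- complex_of_real (t * a \<xi>)) * \<xi> x" by metis
    qed
  qed
qed

theorem theorem1p1:
  fixes \<mu> :: "'g::{topological_ab_group_add, t2_space} measure"
    and T :: "real \<Rightarrow> ('g \<Rightarrow> complex) \<Rightarrow> ('g \<Rightarrow> complex)"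
    and \<Omega> :: "'w measure"
    and \<epsilon> :: "nat \<Rightarrow> 'w \<Rightarrow> real"
    and u :: "'x::complex_banach \<Rightarrow> 'e::complex_banach"
    and N :: "'e matrix_norms"
    and p :: real
  assumes "compact (UNIV :: 'g set)"
    and "normalized_haar_measure \<mu>"
    and "weak_star_semigroup \<mu> T"
    and "\<And>t. 0 \<le> t \<Longrightarrow> fourier_multiplier \<mu> (T t)"
    and "\<And>t. 0 \<le> t \<Longrightarrow> contraction_op (Linf \<mu>) (Linf_norm \<mu>) (T t)"
    and "\<And>t. 0 \<le> t \<Longrightarrow> selfadjoint \<mu> (T t)"
    and "rademacher_sequence \<Omega> \<epsilon>"
    and "K_convex \<Omega> \<epsilon> (UNIV :: 'x set) norm"
    and "complex_isomorphism u"
    and "operator_space_structure N"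
    and "OK_convex \<Omega> \<epsilon> N"
    and "1 < p"
  shows "\<exists>S :: real \<Rightarrow> ('g \<Rightarrow> 'x) \<Rightarrow> ('g \<Rightarrow> 'x).
    (\<forall>t\<ge>0. induced_operator \<mu> p (T t) (S t)) \<and>
    strongly_continuous_semigroup (Lp \<mu> p) (Lp_norm \<mu> p) S \<and>
    (\<forall>t\<ge>0. contraction_op (Lp \<mu> p) (Lp_norm \<mu> p) (S t)) \<and>
    bounded_analytic (Lp \<mu> p) (Lp_norm \<mu> p) S"
proof -
  interpret compact_haar_group \<mu> by (rule compact_haar_group.intro[OF assms(1,2)])
  have p1: "p \<ge> 1" using assms(12) by simp
  interpret Lp_fourier \<mu> p "TYPE('x)" by (rule Lp_fourier.intro[OF compact_haar_group_axioms]) (rule Lp_fourier_axioms.intro[OF p1])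
  interpret scalar: Lp_fourier \<mu> p "TYPE(complex)" by (rule Lp_fourier.intro[OF compact_haar_group_axioms]) (rule Lp_fourier_axioms.intro[OF p1])
  obtain a where a: "\<And>\<xi>. \<xi> \<in> characters \<Longrightarrow> a \<xi> \<ge> 0"
    "\<And>t. t \<ge> 0 \<Longrightarrow> selfadjoint_multiplier \<mu> (T t) (\<lambda>\<xi>. exp (- complex_of_real (t * a \<xi>)))"
    by (rule semigroup_symbol[OF assms(3-6)]) (assumption | rule that)+
  define \<psi> where "\<psi> t \<xi> = exp (- complex_of_real (t * a \<xi>))" for t \<xi>
  note sm = a(2)[folded \<psi>_def]
  have con: "mb (\<psi> t) 1" if "t \<ge> 0" for t
    by (rule sup_dominated_multiplier[OF selfadjoint_multiplier.symbol_sup_dominated[OF sm[OF that]]])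
  have scon: "scalar.mb (\<psi> t) 1" if "t \<ge> 0" for t
    by (rule scalar.sup_dominated_multiplier[OF selfadjoint_multiplier.symbol_sup_dominated[OF sm[OF that]]])
  obtain n :: nat and \<delta> :: real where n: "n > 0" "\<delta> > 0" "\<delta> / 2 ^ n / real n \<le> 2 ^ n" "sign_gap n \<delta>"
    by (rule K_convex_sign_gap[OF assms(7,8,12)])
  define \<rho> where "\<rho> = 2 ^ n - \<delta> / 2 ^ n / real n"
  interpret beurling_semigroup characters "trig_norm p :: _ \<Rightarrow> (('g \<Rightarrow> complex) \<Rightarrow> 'x) \<Rightarrow> real" a n \<rho>
  proof
    show "0 < n" "0 \<le> \<rho>" "\<rho> < 2 ^ n" using n by (auto simp: \<rho>_def)
    show "a \<xi> \<ge> 0" if "\<xi> \<in> characters" for \<xi> by (rule a(1)[OF that])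
    show "mb (\<lambda>\<xi>. exp (- complex_of_real (s * a \<xi>))) 1" if "s \<ge> 0" for s using con[OF that] by (simp only: \<psi>_def[abs_def])
    fix s :: real assume "s \<ge> 0"
    then have s2: "s / 2 \<ge> 0" by simp
    \<comment> \<open>The square root \<open>T\<^sub>s\<^sub>/\<^sub>2\<close> is the operator that is dilated.\<close>
    have "mb (\<lambda>\<xi>. (1 - (\<psi> (s / 2) \<xi>)\<^sup>2) ^ n) \<rho>"
      unfolding \<rho>_def
      by (rule sup_dominated_difference_multiplier[OF selfadjoint_multiplier.symbol_sup_dominated[OF sm[OF s2]]
            selfadjoint_multiplier.symbol_real[OF sm[OF s2]] n(4,1) less_imp_le[OF n(2)]])
    moreover have "(\<psi> (s / 2) \<xi>)\<^sup>2 = exp (- complex_of_real (s * a \<xi>))" for \<xi>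
      by (simp add: \<psi>_def power2_eq_square exp_add[symmetric] flip: of_real_add)
    ultimately show "mb (\<lambda>\<xi>. (1 - exp (- complex_of_real (s * a \<xi>))) ^ n) \<rho>" by (simp only:)
  qed
  define S :: "real \<Rightarrow> ('g \<Rightarrow> 'x) \<Rightarrow> ('g \<Rightarrow> 'x)" where "S t = multiplier_op p (\<psi> t)" for t
  show ?thesis
  proof (intro exI[of _ S] conjI allI impI)
    show "strongly_continuous_semigroup (Lp \<mu> p) (Lp_norm \<mu> p) S"
      unfolding S_def[abs_def]
    proof (rule multiplier_op_semigroup[OF con])
      fix \<xi> :: "'g \<Rightarrow> complex"
      show "continuous_on {0..} (\<lambda>t. \<psi> t \<xi>)" unfolding \<psi>_def by (intro continuous_intros)
      show "\<psi> 0 \<xi> = 1" by (simp add: \<psi>_def)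
      show "\<psi> (s + t) \<xi> = \<psi> s \<xi> * \<psi> t \<xi>" for s t by (simp add: \<psi>_def distrib_right exp_add[symmetric])
    qed
    show "contraction_op (Lp \<mu> p) (Lp_norm \<mu> p) (S t)" if "t \<ge> 0" for t
      unfolding S_def by (rule multiplier_op_contraction[OF con[OF that]])
    show "induced_operator \<mu> p (T t) (S t)" if t: "t \<ge> 0" for t
      unfolding induced_operator_def
    proof (intro conjI exI[of _ "multiplier_op p (\<psi> t)"] allI impI)
      show "S t \<in> bounded_ops (Lp \<mu> p) (Lp_norm \<mu> p)" unfolding S_def by (rule multiplier_op_bounded[OF con[OF t] zero_le_one])
      show "Lp_extension \<mu> p (T t) (multiplier_op p (\<psi> t))"
        unfolding Lp_extension_def
      proof (intro conjI ballI scalar.multiplier_op_contraction scon t)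
        fix f assume f: "f \<in> Linf \<mu>"
        obtain C where C: "AE x in \<mu>. cmod (f x) \<le> C" using f by (auto simp: Linf_def)
        have "AE x in \<mu>. cmod (f x) \<le> max C 0" using C by eventually_elim simp
        then have "f \<in> Lp \<mu> p"
          by (rule Lp_bounded(1)[OF prob_space_haar p1 strongly_measurable_borel[OF selfadjoint_multiplier.Linf_measurable[OF sm[OF t] f]]]) simp
        from selfadjoint_multiplier.S_extends[OF sm[OF t] p1 f scalar.extends_multiplier_op[OF scon[OF t] zero_le_one this]]
        show "AE x in \<mu>. multiplier_op p (\<psi> t) f x = T t f x" by eventually_elim simp
      qed
      fix m :: nat and f :: "nat \<Rightarrow> 'g \<Rightarrow> complex" and v :: "nat \<Rightarrow> 'x" assume f: "\<forall>k<m. f k \<in> Lp \<mu> p"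
      have "extends p (\<psi> t) (\<lambda>y. \<Sum>k<m. f k y *\<^sub>C v k) (\<lambda>y. \<Sum>k<m. multiplier_op p (\<psi> t) (f k) y *\<^sub>C v k)"
      proof (rule extends_sum)
        fix k assume "k < m"
        then have "f k \<in> Lp \<mu> p" using f by blast
        from extends_tensor[OF p1 scalar.extends_multiplier_op[OF scon[OF t] zero_le_one this]]
        show "extends p (\<psi> t) (\<lambda>y. f k y *\<^sub>C v k) (\<lambda>y. multiplier_op p (\<psi> t) (f k) y *\<^sub>C v k)" .
      qed
      note e = this
      show "AE x in \<mu>. S t (\<lambda>y. \<Sum>k<m. f k y *\<^sub>C v k) x = (\<Sum>k<m. multiplier_op p (\<psi> t) (f k) x *\<^sub>C v k)"
        unfolding S_def
        by (rule extends_AE_unique[OF extends_multiplier_op[OF con[OF t] zero_le_one extendsD(1)[OF e]] e con[OF t] zero_le_one])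
    qed
    show "bounded_analytic (Lp \<mu> p) (Lp_norm \<mu> p) S"
    proof -
      obtain \<theta> where \<theta>: "0 < \<theta>" "\<theta> < pi / 2"
        and b: "\<And>z. z \<in> sector \<theta> \<Longrightarrow> mb (\<lambda>\<xi>. exp (- z * of_real (a \<xi>))) 2"
        and b': "\<And>z. z \<in> sector \<theta> \<Longrightarrow> \<exists>B. mb (\<lambda>\<xi>. - of_real (a \<xi>) * exp (- z * of_real (a \<xi>))) B"
        and d: "\<And>z. z \<in> sector \<theta> \<Longrightarrow> \<exists>\<delta>>0. \<exists>B. \<forall>w. w \<noteq> z \<longrightarrow> cmod (w - z) < \<delta> \<longrightarrow>
           mb (\<lambda>\<xi>. inverse (w - z) * (exp (- w * of_real (a \<xi>)) - exp (- z * of_real (a \<xi>))) - (- of_real (a \<xi>) * exp (- z * of_real (a \<xi>)))) (B * cmod (w - z))"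
        by (rule analytic_multipliers, rule that)
      define R :: "complex \<Rightarrow> ('g \<Rightarrow> 'x) \<Rightarrow> ('g \<Rightarrow> 'x)" where "R z = multiplier_op p (\<lambda>\<xi>. exp (- z * of_real (a \<xi>)))" for z
      show ?thesis unfolding bounded_analytic_def
      proof (rule exI[of _ \<theta>], rule exI[of _ R], intro exI[of _ 2] conjI \<theta> ballI allI impI)
        show "norm_holomorphic_on (bounded_ops (Lp \<mu> p) (Lp_norm \<mu> p)) (bounded_ops_norm (Lp \<mu> p) (Lp_norm \<mu> p)) (sector \<theta>) R"
          unfolding R_def[abs_def]
        proof (rule multiplier_op_holomorphic[where \<psi>' = "\<lambda>z \<xi>. - of_real (a \<xi>) * exp (- z * of_real (a \<xi>))"])
          fix z assume z: "z \<in> sector \<theta>"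
          show "\<exists>B. mb (\<lambda>\<xi>. exp (- z * of_real (a \<xi>))) B" by (rule exI, rule b[OF z])
        qed (rule b' d, assumption)+
        show "bounded_ops_norm (Lp \<mu> p) (Lp_norm \<mu> p) (R z) \<le> 2" if "z \<in> sector \<theta>" for z
          unfolding R_def by (rule bounded_ops_norm_bounds(1)[OF multiplier_op_norm[OF b[OF that]]]) simp_all
        fix t :: real and f :: "'g \<Rightarrow> 'x"
        have "R (complex_of_real t) f = S t f" by (simp add: R_def S_def \<psi>_def[abs_def])
        then have "R (complex_of_real t) f - S t f = (\<lambda>x. 0)" by (simp add: zero_fun_def)
        then show "Lp_norm \<mu> p (R (complex_of_real t) f - S t f) = 0" by (simp only: Lp_zero(2)[OF p0])
      qed
    qed
  qed
qed

end
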